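(* Consider the linear model $Y=X\beta_0+\epsilon$ where $\epsilon\sim\mathcal N(0,I)$ in $\mathbb R^n$, and $X$ is a random $n\times p$ matrix independent of $\epsilon$ with independent rows $X^{(i)}\sim\mathcal N(0,\Sigma_0)$, where $\Theta_0:=\Sigma_0^{-1}$ exists, $1/\Lambda_{\min}(\Sigma_0)=\mathcal O(1)$ and $\|\Sigma_0\|_\infty=\mathcal O(1)$. Suppose $\beta_0\in\mathcal B(d_n)$ with $d_n=o(\sqrt n/\log p)$ and $\max_{j}s_j\le d_n$, where $s_j:=\|\Theta_j^0\|_0$ and $\Theta^0_j$ is the $j$-th column of $\Theta_0$. Let $\xi\in\mathbb R^p$ be a known vector with $\|\xi\|_1=\mathcal O(1)$. Let $\hat b_\xi=\xi^T\hat b$ be the de-sparsified Lasso estimator of $\xi^T\beta$ with tuning parameters of the Lasso and of the nodewise regressions satisfying $\lambda\asymp\lambda_j\asymp\sqrt{\log p/n}$ uniformly in $j=1,\dots,p$. Then $\hat b_\xi$ is a strongly asymptotically unbiased estimator of $\xi^T\beta$ at $\beta_0$. Furthermore, let $T$ be any strongly asymptotically unbiased estimator of $\xi^T\beta$ at $\beta_0$ and assume that $\beta_0+\Theta_0\xi/(\xi^T\Theta_0\xi\, n)^{1/2}\in B(\beta_0,c/\sqrt n)$. Then $$\mathrm{var}_{\beta_0}(T)\ \ge\ \frac{\xi^T\Theta_0\xi+o(1)}{n},\qquad \mathrm{var}_{\beta_0}(\hat b_\xi)=\frac{\xi^T\Theta_0\xi+o(1)}{n}.$$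
   Context: Asymptotic regime: $n\to\infty$, $p=p_n$ may depend on $n$ (possibly $p\gg n$), and all parameters ($\beta_0,\Sigma_0,\xi,d_n,\lambda,\lambda_j,\dots$) are sequences that may depend on $n$, the index being suppressed; $\mathcal O(\cdot)$, $o(\cdot)$, $\asymp$ refer to $n\to\infty$. $\|A\|_\infty:=\max_{i,j}|A_{ij}|$ for a matrix $A$; $\Lambda_{\min}$ is the smallest eigenvalue; $\|x\|_0$ is the number of non-zero entries of $x$; $\|x\|_n^2:=\|x\|_2^2/n$ for $x\in\mathbb R^n$. Parameter set: $\mathcal B\subset\mathbb R^p$ is a parameter space, $C,c>0$ are universal constants (independent of $n,p$), and $$\mathcal B(d_n):=\{\beta\in\mathcal B:\|\beta\|_0\le d_n,\ \|\beta\|_2\le C\},\qquad B(\beta,\varepsilon):=\{\tilde\beta\in\mathcal B(d_n):\|\tilde\beta-\beta\|_2\le\varepsilon\}.$$ $\mathbb E_\beta,\mathrm{var}_\beta$ denote expectation and variance when the data $(X,Y)$ are generated with regression vector $\beta$; an estimator is a measurable function of $(X,Y)$. Strong asymptotic unbiasedness: $T_n$ is a strongly asymptotically unbiased estimator of $g(\beta)$ at $\beta_0$ (in a neighbourhood of size $c$) with rate $m_n$, where $n=o(m_n)$, if $\mathrm{var}_{\beta_0}(T_n)=\mathcal O(1/n)$ and for every (sequence) $\beta\in B(\beta_0,c/\sqrt{m_n})$, $\lim_{n\to\infty}\sqrt{m_n}(\mathbb E_\beta T_n-g(\beta))=0$. When no rate is mentioned, this is meant for some sequence $m_n$ with $n=o(m_n)$.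 De-sparsified Lasso: the Lasso is $\hat\beta:=\arg\min_{\beta\in\mathbb R^p}\|Y-X\beta\|_n^2+2\lambda\|\beta\|_1$. Let $X_j$ be the $j$-th column of $X$ and $X_{-j}$ the $n\times(p-1)$ matrix obtained by removing it. Nodewise regression: for $j=1,\dots,p$, $$\hat\gamma_j:=\arg\min_{\gamma\in\mathbb R^{p-1}}\|X_j-X_{-j}\gamma\|_n^2+2\lambda_j\|\gamma\|_1,\qquad \hat\tau_j^2:=\|X_j-X_{-j}\hat\gamma_j\|_n^2+\lambda_j\|\hat\gamma_j\|_1,$$ $$\hat\Theta_j:=(-\hat\gamma_{j,1},\dots,-\hat\gamma_{j,j-1},1,-\hat\gamma_{j,j+1},\dots,-\hat\gamma_{j,p})^T/\hat\tau_j^2$$ (entries of $\hat\gamma_j$ indexed by $\{1,\dots,p\}\setminus\{j\}$), and $\hat\Theta:=(\hat\Theta_1,\dots,\hat\Theta_p)$ is the matrix with these columns. Then $\hat b:=\hat\beta+\hat\Theta^TX^T(Y-X\hat\beta)/n$ and $\hat b_\xi:=\xi^T\hat b=\xi^T\hat\beta+\xi^T\hat\Theta^TX^T(Y-X\hat\beta)/n$.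
   Formalization: The tuning parameters have order √(log p/n) with a sufficiently large constant of proportionality, and the lower bound also assumes, for large n, β0+Θ0ξ/(ξᵀΘ0ξ m_n)^{1/2} ∈ B(β0,c/√m_n), with m_n the rate of T; without these the claim is false. *)

theory Defs
  imports
    "HOL-Probability.Probability"
    "HOL-Library.Landau_Symbols"
    "Jordan_Normal_Form.Spectral_Radius"
    "Jordan_Normal_Form.Gauss_Jordan_Elimination"
begin

unbundle no vec_syntax
hide_type (open) Finite_Cartesian_Product.vec
hide_const (open) Finite_Cartesian_Product.vec Finite_Cartesian_Product.mat
  Finite_Cartesian_Product.row Finite_Cartesian_Product.column Determinants.det

subsection \<open>Norms and matrix quantities\<close>

definition l0norm :: "real vec \<Rightarrow> nat" where
  "l0norm v = card {i. i < dim_vec v \<and> v $ i \<noteq> 0}"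

definition l1norm :: "real vec \<Rightarrow> real" where
  "l1norm v = (\<Sum>i<dim_vec v. \<bar>v $ i\<bar>)"

definition l2norm :: "real vec \<Rightarrow> real" where
  "l2norm v = sqrt (v \<bullet> v)"

definition nnorm :: "real vec \<Rightarrow> real" where
  "nnorm v = l2norm v / sqrt (real (dim_vec v))"

definition max_entry :: "real mat \<Rightarrow> real" where
  "max_entry A = Max {\<bar>A $$ (i, j)\<bar> | i j. i < dim_row A \<and> j < dim_col A}"

definition min_eigenvalue :: "real mat \<Rightarrow> real" where
  "min_eigenvalue A = Min (spectrum A)"

abbreviation inverse_mat :: "real mat \<Rightarrow> real mat" where
  "inverse_mat A \<equiv> the (mat_inverse A)"

definition covariance_matrix :: "nat \<Rightarrow> real mat \<Rightarrow> bool" where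
  "covariance_matrix p S \<longleftrightarrow> S \<in> carrier_mat p p \<and> transpose_mat S = S \<and>
     (\<forall>v \<in> carrier_vec p. 0 \<le> v \<bullet> (S *\<^sub>v v))"

subsection \<open>The Gaussian linear model\<close>

text \<open>
  The normal law with mean zero and invertible covariance matrix \<open>S\<close>, given by its Lebesgue density.
  A random vector of length \<open>p\<close> is a function on \<open>{..<p}\<close> in the product space, so that the
  library's product measures apply; it is turned into a \<open>vec\<close> or \<open>mat\<close> when the data are formed.
\<close>
definition normal_law :: "nat \<Rightarrow> real mat \<Rightarrow> (nat \<Rightarrow> real) measure" where
  "normal_law p S = density (\<Pi>\<^sub>M j\<in>{..<p}. lborel)
     (\<lambda>x. ennreal (exp (- (vec p x \<bullet> (inverse_mat S *\<^sub>v vec p x)) / 2) / sqrt ((2 * pi) ^ p * det S)))"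

text \<open>Joint law of design and noise: independent rows, and noise independent of the design.\<close>
definition design_noise_law ::
  "nat \<Rightarrow> nat \<Rightarrow> real mat \<Rightarrow> ((nat \<Rightarrow> nat \<Rightarrow> real) \<times> (nat \<Rightarrow> real)) measure" where
  "design_noise_law n p S =
     (\<Pi>\<^sub>M i\<in>{..<n}. normal_law p S) \<Otimes>\<^sub>M normal_law n (1\<^sub>m n)"

definition design :: "nat \<Rightarrow> nat \<Rightarrow> (nat \<Rightarrow> nat \<Rightarrow> real) \<Rightarrow> real mat" where
  "design n p x = mat n p (\<lambda>(i, j). x i j)"

text \<open>
  A statistic is a function of the data \<open>(X, Y)\<close>. Below it is composed with \<open>Y = X \<beta> + \<epsilon>\<close>, which
  gives its distribution when the regression vector is \<open>\<beta>\<close>.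
\<close>
type_synonym statistic = "real mat \<Rightarrow> real vec \<Rightarrow> real"

definition under ::
  "nat \<Rightarrow> nat \<Rightarrow> real vec \<Rightarrow> statistic \<Rightarrow> (nat \<Rightarrow> nat \<Rightarrow> real) \<times> (nat \<Rightarrow> real) \<Rightarrow> real" where
  "under n p b T = (\<lambda>(x, e). T (design n p x) (design n p x *\<^sub>v b + vec n e))"

definition expect :: "nat \<Rightarrow> nat \<Rightarrow> real mat \<Rightarrow> real vec \<Rightarrow> statistic \<Rightarrow> real" where
  "expect n p S b T = (LINT w|design_noise_law n p S. under n p b T w)"

definition var :: "nat \<Rightarrow> nat \<Rightarrow> real mat \<Rightarrow> real vec \<Rightarrow> statistic \<Rightarrow> real" where
  "var n p S b T = (LINT w|design_noise_law n p S. (under n p b T w - expect n p S b T)\<^sup>2)"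

definition estimator :: "nat \<Rightarrow> nat \<Rightarrow> statistic \<Rightarrow> bool" where
  "estimator n p T \<longleftrightarrow> (\<lambda>(x, y). T (design n p x) (vec n y)) \<in>
     borel_measurable ((\<Pi>\<^sub>M i\<in>{..<n}. \<Pi>\<^sub>M j\<in>{..<p}. borel) \<Otimes>\<^sub>M (\<Pi>\<^sub>M i\<in>{..<n}. borel))"

text \<open>
  The Bochner integral of a non-integrable function is 0, so finiteness of means and variances has
  to be required explicitly where the statement refers to them.
\<close>
definition finite_mean :: "nat \<Rightarrow> nat \<Rightarrow> real mat \<Rightarrow> real vec \<Rightarrow> statistic \<Rightarrow> bool" where
  "finite_mean n p S b T \<longleftrightarrow> integrable (design_noise_law n p S) (under n p b T)"

definition finite_var :: "nat \<Rightarrow> nat \<Rightarrow> real mat \<Rightarrow> real vec \<Rightarrow> statistic \<Rightarrow> bool" where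
  "finite_var n p S b T \<longleftrightarrow> finite_mean n p S b T \<and>
     integrable (design_noise_law n p S) (\<lambda>w. (under n p b T w)\<^sup>2)"

subsection \<open>Strong asymptotic unbiasedness\<close>

definition sparse_params :: "real vec set \<Rightarrow> real \<Rightarrow> real \<Rightarrow> real vec set" where
  "sparse_params P C d = {b \<in> P. real (l0norm b) \<le> d \<and> l2norm b \<le> C}"

definition nbhd :: "real vec set \<Rightarrow> real \<Rightarrow> real \<Rightarrow> real vec \<Rightarrow> real \<Rightarrow> real vec set" where
  "nbhd P C d b r = {b' \<in> sparse_params P C d. l2norm (b' - b) \<le> r}"

text \<open>
  The argument \<open>p\<close> and all later ones are sequences indexed by the sample size. Positivity of the rate
  \<open>m\<close> keeps every neighbourhood non-empty.
\<close>
definition strongly_unbiased_rate ::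
  "real \<Rightarrow> real \<Rightarrow> (nat \<Rightarrow> nat) \<Rightarrow> (nat \<Rightarrow> real mat) \<Rightarrow> (nat \<Rightarrow> real vec set) \<Rightarrow> (nat \<Rightarrow> real) \<Rightarrow>
   (nat \<Rightarrow> real vec) \<Rightarrow> (nat \<Rightarrow> real vec \<Rightarrow> real) \<Rightarrow> (nat \<Rightarrow> real) \<Rightarrow> (nat \<Rightarrow> statistic) \<Rightarrow> bool" where
  "strongly_unbiased_rate C c p S P d b0 g m T \<longleftrightarrow>
     (\<forall>n. 0 < m n) \<and> (\<lambda>n. real n) \<in> o(m) \<and>
     (\<forall>n. estimator n (p n) (T n)) \<and>
     (\<forall>\<^sub>F n in sequentially. finite_var n (p n) (S n) (b0 n) (T n)) \<and>
     (\<lambda>n. var n (p n) (S n) (b0 n) (T n)) \<in> O(\<lambda>n. 1 / real n) \<and>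
     (\<forall>b. (\<forall>n. b n \<in> nbhd (P n) C (d n) (b0 n) (c / sqrt (m n))) \<longrightarrow>
        (\<forall>\<^sub>F n in sequentially. finite_mean n (p n) (S n) (b n) (T n)) \<and>
        (\<lambda>n. sqrt (m n) * (expect n (p n) (S n) (b n) (T n) - g n (b n))) \<longlonglongrightarrow> 0)"

subsection \<open>The de-sparsified Lasso\<close>

definition lasso_objective :: "real \<Rightarrow> real mat \<Rightarrow> real vec \<Rightarrow> real vec \<Rightarrow> real" where
  "lasso_objective lam X Y b = (nnorm (Y - X *\<^sub>v b))\<^sup>2 + 2 * lam * l1norm b"

definition is_lasso :: "real \<Rightarrow> real mat \<Rightarrow> real vec \<Rightarrow> real vec \<Rightarrow> bool" where
  "is_lasso lam X Y b \<longleftrightarrow>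
     is_arg_min (lasso_objective lam X Y) (\<lambda>b. b \<in> carrier_vec (dim_col X)) b"

text \<open>
  Vectors in \<open>R^(p-1)\<close> indexed by the coordinates other than \<open>j\<close> are vectors of dimension \<open>p - 1\<close>,
  with \<open>insert_index j\<close> and \<open>delete_index j\<close> translating between the two index sets.
\<close>
definition remove_col :: "real mat \<Rightarrow> nat \<Rightarrow> real mat" where
  "remove_col X j = mat (dim_row X) (dim_col X - 1) (\<lambda>(i, k). X $$ (i, insert_index j k))"

definition is_nodewise_lasso :: "real \<Rightarrow> real mat \<Rightarrow> nat \<Rightarrow> real vec \<Rightarrow> bool" where
  "is_nodewise_lasso lam X j g \<longleftrightarrow> is_lasso lam (remove_col X j) (col X j) g"

definition tau_sq :: "real \<Rightarrow> real mat \<Rightarrow> nat \<Rightarrow> real vec \<Rightarrow> real" where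
  "tau_sq lam X j g = (nnorm (col X j - remove_col X j *\<^sub>v g))\<^sup>2 + lam * l1norm g"

definition theta_hat :: "(nat \<Rightarrow> real) \<Rightarrow> real mat \<Rightarrow> (nat \<Rightarrow> real vec) \<Rightarrow> real mat" where
  "theta_hat lams X g = mat (dim_col X) (dim_col X)
     (\<lambda>(k, j). (if k = j then 1 else - (g j $ delete_index j k)) / tau_sq (lams j) X j (g j))"

definition debiased :: "(nat \<Rightarrow> real) \<Rightarrow> real mat \<Rightarrow> real vec \<Rightarrow> real vec \<Rightarrow> (nat \<Rightarrow> real vec) \<Rightarrow> real vec" where
  "debiased lams X Y b g = b + (1 / real (dim_row X)) \<cdot>\<^sub>v
     (transpose_mat (theta_hat lams X g) *\<^sub>v (transpose_mat X *\<^sub>v (Y - X *\<^sub>v b)))"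

text \<open>
  Measurable versions of the Lasso and of the nodewise Lassos, as functions of the data. The
  minimisers need not be unique, and any measurable selection is allowed.
\<close>
definition lasso_version ::
  "nat \<Rightarrow> nat \<Rightarrow> real \<Rightarrow> (real mat \<Rightarrow> real vec \<Rightarrow> real vec) \<Rightarrow> bool" where
  "lasso_version n p lam bhat \<longleftrightarrow>
     (\<forall>X \<in> carrier_mat n p. \<forall>Y \<in> carrier_vec n. is_lasso lam X Y (bhat X Y)) \<and>
     (\<forall>k<p. estimator n p (\<lambda>X Y. bhat X Y $ k))"

definition nodewise_version ::
  "nat \<Rightarrow> nat \<Rightarrow> (nat \<Rightarrow> real) \<Rightarrow> (real mat \<Rightarrow> nat \<Rightarrow> real vec) \<Rightarrow> bool" where
  "nodewise_version n p lams ghat \<longleftrightarrow>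
     (\<forall>j<p. (\<forall>X \<in> carrier_mat n p. is_nodewise_lasso (lams j) X j (ghat X j)) \<and>
        (\<forall>k<p - 1. estimator n p (\<lambda>X Y. ghat X j $ k)))"

definition debiased_stat ::
  "real vec \<Rightarrow> (nat \<Rightarrow> real) \<Rightarrow> (real mat \<Rightarrow> real vec \<Rightarrow> real vec) \<Rightarrow> (real mat \<Rightarrow> nat \<Rightarrow> real vec) \<Rightarrow>
   statistic" where
  "debiased_stat xi lams bhat ghat X Y = xi \<bullet> debiased lams X Y (bhat X Y) (ghat X)"

text \<open>
  All tuning parameters are of the exact order \<open>sqrt (log p / n)\<close>, uniformly in \<open>j\<close>, where \<open>L\<close>
  bounds the constants of proportionality from below.
\<close>
definition tuning_order ::
  "real \<Rightarrow> (nat \<Rightarrow> nat) \<Rightarrow> (nat \<Rightarrow> real) \<Rightarrow> (nat \<Rightarrow> nat \<Rightarrow> real) \<Rightarrow> bool" where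
  "tuning_order L p lam lams \<longleftrightarrow> 0 < L \<and> (\<exists>U. \<forall>\<^sub>F n in sequentially.
     lam n \<in> {L * sqrt (ln (real (p n)) / real n) .. U * sqrt (ln (real (p n)) / real n)} \<and>
     (\<forall>j<p n. lams n j \<in> {L * sqrt (ln (real (p n)) / real n) .. U * sqrt (ln (real (p n)) / real n)}))"

end

theory Submission
  imports Defs "HOL-Real_Asymp.Real_Asymp"
begin

text \<open>
  By the Karush--Kuhn--Tucker conditions of all Lassos, the de-sparsified Lasso is \<open>\<xi>\<^sup>T \<beta>\<close> plus a noise
  term, centred Gaussian given the design, plus a bias of size at most
  \<open>|\<xi>|\<^sub>1 max\<^sub>j (\<lambda>\<^sub>j / \<tau>\<^sub>j\<^sup>2) |b - \<beta>|\<^sub>1\<close>, where \<open>b\<close> is the Lasso. On an event of probability polynomially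
  close to one the bias is \<open>O(s log p / n) = o(1 / sqrt n)\<close>, and the conditional variance of the noise term
  is close to \<open>\<xi>\<^sup>T \<Theta> \<xi> / n\<close>. All quantities have fourth moments bounded by powers of \<open>n\<close> and \<open>p\<close>, so that
  the complement of the event is negligible for mean and variance, uniformly in \<open>\<beta>\<close>; this leaves room for
  a rate \<open>m\<close> with \<open>n = o(m)\<close>.

  The lower bound is the Chapman--Robbins inequality for the shift \<open>h = \<Theta> \<xi> / sqrt (\<xi>\<^sup>T \<Theta> \<xi> m)\<close>: the mean
  of \<open>T\<close> changes by \<open>\<xi>\<^sup>T h + o(1 / sqrt m)\<close>, while the chi-square divergence of the laws is asymptotic to
  \<open>n h\<^sup>T \<Sigma> h = n / m\<close>.
\<close>

subsection \<open>Linear functionals of Gaussian vectors\<close>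

text \<open>Two obstacles shape the proof. In the lower bound, unbiasedness is granted only within c
  / sqrt m of \<open>beta0\<close>, so the alternative has to be that close. This also keeps the
  constant sharp: exp x - 1 is equivalent to x only for x = n / m tending to zero, whereas a shift
  of order 1 / sqrt n would cost a factor exp 1 - 1. For the estimator, means and variances are
  asked for, not probabilities, and off the good event a nodewise scale can be arbitrarily close to
  zero. Its inverse is therefore bounded by column norms and inverse column norms, whose moments are
  finite but grow with powers of n p. The bad event must then be small in powers of n p, which asks
  for a large lower constant in \<open>tuning_order\<close>. Even so, a power of p does not beat
  powers of n when p grows slowly; in that regime the whole index set serves as support and the
  noise level is a fixed power of n. Tails and moments of the Gaussian data are all read off from
  one scalar linear functional per row, that is, from integrals over
  \<open>std_normal\<close>.\<close>

definition std_normal :: "real measure" where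
  "std_normal = density lborel (\<lambda>x. ennreal (std_normal_density x))"

lemma sets_std_normal [simp, measurable_cong]: "sets std_normal = sets borel"
  by (simp add: std_normal_def)

lemma space_std_normal [simp]: "space std_normal = UNIV"
  by (simp add: std_normal_def)

lemma prob_space_std_normal: "prob_space std_normal"
  unfolding std_normal_def by (rule prob_space_normal_density) simp

interpretation std_normal: prob_space std_normal
  by (rule prob_space_std_normal)

lemma distributed_scaled_std_normal:
  assumes "s \<noteq> 0"
  shows "distributed std_normal lborel (\<lambda>z. m + s * z) (normal_density m \<bar>s\<bar>)"
proof -
  have "distributed std_normal lborel (\<lambda>z. z) std_normal_density"
    unfolding distributed_def std_normal_def by (auto simp: distr_id2)
  from std_normal.normal_density_affine[OF this, of s m] assms show ?thesis by simp
qed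

lemma nn_integral_normal_density:
  assumes "s \<noteq> 0" and [measurable]: "f \<in> borel_measurable borel"
  shows "(\<integral>\<^sup>+y. ennreal (normal_density m \<bar>s\<bar> y) * f y \<partial>lborel) = (\<integral>\<^sup>+z. f (m + s * z) \<partial>std_normal)"
  using distributed_nn_integral[OF distributed_scaled_std_normal[OF assms(1)], of f m] by simp

text \<open>This is the symmetry of the law, later the reason why the noise term is centred. A zero
  scale has no density and is treated apart.\<close>

lemma nn_integral_std_normal_abs:
  assumes [measurable]: "f \<in> borel_measurable borel"
  shows "(\<integral>\<^sup>+z. f (\<bar>s\<bar> * z) \<partial>std_normal) = (\<integral>\<^sup>+z. f (s * z) \<partial>std_normal)"
proof (cases "s = 0")
  case False
  then show ?thesis
    using nn_integral_normal_density[of s f 0] nn_integral_normal_density[of "\<bar>s\<bar>" f 0] by simp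
qed simp

text \<open>Stability of the normal law under independent sums: for two nonzero scales the
  convolution of the densities is again normal, and a zero scale leaves only one summand. For
  nonnegative functions no integrability has to be carried through the induction on the
  dimension.\<close>

lemma nn_integral_std_normal_add:
  assumes [measurable]: "f \<in> borel_measurable borel"
  shows "(\<integral>\<^sup>+a. \<integral>\<^sup>+b. f (s * a + t * b) \<partial>std_normal \<partial>std_normal) =
    (\<integral>\<^sup>+z. f (sqrt (s\<^sup>2 + t\<^sup>2) * z) \<partial>std_normal)"
proof (cases "s = 0 \<or> t = 0")
  case True
  have 1: "(\<integral>\<^sup>+z. f (sqrt (s\<^sup>2) * z) \<partial>std_normal) = (\<integral>\<^sup>+z. f (s * z) \<partial>std_normal)" for s
    using nn_integral_std_normal_abs[of f s] by simp
  show ?thesis using True 1[of s] 1[of t] by (auto simp: std_normal.emeasure_space_1[simplified])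
next
  case False
  then have s: "s \<noteq> 0" and t: "t \<noteq> 0" by auto
  have "(\<integral>\<^sup>+a. \<integral>\<^sup>+b. f (s * a + t * b) \<partial>std_normal \<partial>std_normal) =
      (\<integral>\<^sup>+a. \<integral>\<^sup>+y. ennreal (normal_density (s * a) \<bar>t\<bar> y) * f y \<partial>lborel \<partial>std_normal)"
    by (simp add: nn_integral_normal_density[OF t])
  also have "\<dots> = (\<integral>\<^sup>+x. ennreal (normal_density 0 \<bar>s\<bar> x) *
      (\<integral>\<^sup>+y. ennreal (normal_density x \<bar>t\<bar> y) * f y \<partial>lborel) \<partial>lborel)"
    using nn_integral_normal_density[OF s, of "\<lambda>x. \<integral>\<^sup>+y. ennreal (normal_density x \<bar>t\<bar> y) * f y \<partial>lborel" 0]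
    by (simp add: normal_density_def)
  also have "\<dots> = (\<integral>\<^sup>+x. \<integral>\<^sup>+y. ennreal (normal_density 0 \<bar>t\<bar> (y - x) * normal_density 0 \<bar>s\<bar> x) * f y \<partial>lborel \<partial>lborel)"
    by (subst nn_integral_cmult[symmetric])
      (auto intro!: nn_integral_cong simp: normal_density_def ennreal_mult'[symmetric] ac_simps)
  also have "\<dots> = (\<integral>\<^sup>+y. \<integral>\<^sup>+x. ennreal (normal_density 0 \<bar>t\<bar> (y - x) * normal_density 0 \<bar>s\<bar> x) * f y \<partial>lborel \<partial>lborel)"
    by (rule lborel_pair.Fubini') simp
  also have "\<dots> = (\<integral>\<^sup>+y. (\<integral>\<^sup>+x. ennreal (normal_density 0 \<bar>t\<bar> (y - x) * normal_density 0 \<bar>s\<bar> x) \<partial>lborel) * f y \<partial>lborel)"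
    by (subst nn_integral_multc) auto
  also have "\<dots> = (\<integral>\<^sup>+y. ennreal (normal_density 0 (sqrt (t\<^sup>2 + s\<^sup>2)) y) * f y \<partial>lborel)"
    using conv_normal_density_zero_mean[of "\<bar>t\<bar>" "\<bar>s\<bar>"] s t by (simp add: fun_eq_iff)
  also have "\<dots> = (\<integral>\<^sup>+z. f (sqrt (s\<^sup>2 + t\<^sup>2) * z) \<partial>std_normal)"
    using nn_integral_normal_density[of "sqrt (s\<^sup>2 + t\<^sup>2)" f 0] s t by (simp add: add.commute)
  finally show ?thesis .
qed

section \<open>Bilinear forms and the induction on the dimension of a Gaussian law\<close>

definition bform :: "nat \<Rightarrow> (nat \<Rightarrow> nat \<Rightarrow> real) \<Rightarrow> (nat \<Rightarrow> real) \<Rightarrow> (nat \<Rightarrow> real) \<Rightarrow> real" where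
  "bform p S u w = (\<Sum>i<p. \<Sum>j<p. S i j * u i * w j)"

lemma bform_mult_vec: "bform p S u w = (\<Sum>i<p. u i * (\<Sum>j<p. S i j * w j))"
  by (simp add: bform_def sum_distrib_left mult_ac)

lemma bform_cong:
  "(\<And>i. i < p \<Longrightarrow> u i = u' i) \<Longrightarrow> (\<And>i. i < p \<Longrightarrow> w i = w' i) \<Longrightarrow> bform p S u w = bform p S u' w'"
  by (simp add: bform_def)

lemma bform_commute:
  assumes "\<And>i j. i < p \<Longrightarrow> j < p \<Longrightarrow> S i j = S j i"
  shows "bform p S u w = bform p S w u"
  unfolding bform_def by (subst sum.swap) (auto intro!: sum.cong simp: assms)

lemma bform_diff_right: "bform p S u (\<lambda>i. a i - b i) = bform p S u a - bform p S u b"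
  by (simp add: bform_def algebra_simps sum_subtractf)

lemma bform_diff_left: "bform p S (\<lambda>i. a i - b i) u = bform p S a u - bform p S b u"
  by (simp add: bform_def algebra_simps sum_subtractf)

lemma bform_add_right: "bform p S u (\<lambda>i. a i + b i) = bform p S u a + bform p S u b"
  by (simp add: bform_def algebra_simps sum.distrib)

lemma bform_add_left: "bform p S (\<lambda>i. a i + b i) u = bform p S a u + bform p S b u"
  by (simp add: bform_def algebra_simps sum.distrib)

lemma bform_scale_right: "bform p S u (\<lambda>i. t * a i) = t * bform p S u a"
  by (simp add: bform_def sum_distrib_left mult_ac)

lemma bform_scale_left: "bform p S (\<lambda>i. t * a i) u = t * bform p S a u"
  by (simp add: bform_def sum_distrib_left mult_ac)

lemmas bform_linear = bform_diff_right bform_diff_left bform_add_right bform_add_left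
  bform_scale_right bform_scale_left

text \<open>The adjugate is the determinant times the inverse, and its last diagonal entry is the
  cofactor of the leading block. The identity carries the normalising constant from one dimension to
  the next.\<close>

lemma det_principal_minor:
  fixes S Q :: "nat \<Rightarrow> nat \<Rightarrow> real"
  assumes inv: "\<And>i j. i < Suc p \<Longrightarrow> j < Suc p \<Longrightarrow> (\<Sum>k<Suc p. S i k * Q k j) = (if i = j then 1 else 0)"
  shows "det (mat p p (\<lambda>(i, j). S i j)) = det (mat (Suc p) (Suc p) (\<lambda>(i, j). S i j)) * Q p p"
proof -
  let ?A = "mat (Suc p) (Suc p) (\<lambda>(i, j). S i j)" and ?B = "mat (Suc p) (Suc p) (\<lambda>(i, j). Q i j)"
  have A: "?A \<in> carrier_mat (Suc p) (Suc p)" and B: "?B \<in> carrier_mat (Suc p) (Suc p)" by auto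
  have AB: "?A * ?B = 1\<^sub>m (Suc p)"
    using inv by (intro eq_matI) (auto simp: scalar_prod_def atLeast0LessThan)
  note adj = adj_mat[OF A]
  have "adj_mat ?A = adj_mat ?A * (?A * ?B)"
    unfolding AB using adj(1) by simp
  also have "\<dots> = (adj_mat ?A * ?A) * ?B"
    by (rule assoc_mult_mat[symmetric, OF adj(1) A B])
  also have "\<dots> = det ?A \<cdot>\<^sub>m ?B"
    unfolding adj(3) using B by (simp add: mult_smult_assoc_mat[of _ "Suc p" "Suc p" _ "Suc p"])
  finally have "adj_mat ?A $$ (p, p) = det ?A * Q p p" by simp
  moreover have "adj_mat ?A $$ (p, p) = cofactor ?A p p"
    by (simp add: adj_mat_def)
  moreover have "mat_delete ?A p p = mat p p (\<lambda>(i, j). S i j)"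
    by (rule eq_matI) (auto simp: mat_delete_def)
  ultimately show ?thesis by (simp add: cofactor_def)
qed

text \<open>Induction on the dimension: completing the square in the last coordinate splits the
  density into a conditional normal density of that coordinate and a density of the same kind in one
  dimension less; stability of the normal law then merges the two scales. Positivity of the
  determinant travels along because the normalising constants have to be split under the square
  root.\<close>

theorem gaussian_linear_functional:
  fixes S Q :: "nat \<Rightarrow> nat \<Rightarrow> real"
  assumes "\<And>i j. i < p \<Longrightarrow> j < p \<Longrightarrow> S i j = S j i"
    and "\<And>i j. i < p \<Longrightarrow> j < p \<Longrightarrow> Q i j = Q j i"
    and "\<And>i j. i < p \<Longrightarrow> j < p \<Longrightarrow> (\<Sum>k<p. S i k * Q k j) = (if i = j then 1 else 0)"
    and "\<And>u. \<exists>i<p. u i \<noteq> 0 \<Longrightarrow> 0 < bform p S u u"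
  shows "0 < det (mat p p (\<lambda>(i, j). S i j)) \<and> (\<forall>u. \<forall>f \<in> borel_measurable borel.
    (\<integral>\<^sup>+x. ennreal (exp (- bform p Q x x / 2) / sqrt ((2 * pi) ^ p * det (mat p p (\<lambda>(i, j). S i j)))) *
       f (\<Sum>j<p. u j * x j) \<partial>(\<Pi>\<^sub>M j\<in>{..<p}. lborel)) =
    (\<integral>\<^sup>+z. f (sqrt (bform p S u u) * z) \<partial>std_normal))"
  using assms
proof (induction p arbitrary: Q)
  case 0
  have "emeasure std_normal UNIV = 1" using std_normal.emeasure_space_1 by simp
  then show ?case by (simp add: bform_def PiM_empty det_dim_zero nn_integral_count_space_finite)
next
  case (Suc p)
  note sym = Suc.prems(1) and symQ = Suc.prems(2) and inv = Suc.prems(3) and pd = Suc.prems(4)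
  define \<kappa> where "\<kappa> = Q p p"
  \<comment> \<open>In the form \<open>S\<close> the last column of the inverse represents
    evaluation at \<open>p\<close>. Hence \<open>\<kappa>\<close> is the value of the form at
    \<open>q\<close> and positive; it is the inverse of the conditional variance of the last
    coordinate.\<close>
  define q where "q = (\<lambda>i. Q i p)"
  have Sq: "(\<Sum>j<Suc p. S i j * q j) = (if i = p then 1 else 0)" if "i < Suc p" for i
    using inv[OF that, of p] by (simp add: q_def)
  have Sq_right: "bform (Suc p) S u q = u p" for u
    unfolding bform_mult_vec using Sq by (simp add: if_distrib[of "(*) _"] cong: if_cong)
  have Sq_left: "bform (Suc p) S q u = u p" for u
    using bform_commute[of "Suc p" S q u] sym Sq_right by simp
  have "\<exists>i<Suc p. q i \<noteq> 0"
  proof (rule ccontr)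
    assume "\<not> ?thesis"
    then show False using Sq[of p] by simp
  qed
  have qp: "q p = \<kappa>" by (simp add: q_def \<kappa>_def)
  from pd[OF \<open>\<exists>i<Suc p. q i \<noteq> 0\<close>] have \<kappa>: "0 < \<kappa>" by (simp add: Sq_right qp)
  \<comment> \<open>The Schur complement of \<open>\<kappa>\<close> in \<open>Q\<close>, which is
    the inverse of the leading block of \<open>S\<close>.\<close>
  define R where "R = (\<lambda>i j. Q i j - Q i p * Q j p / \<kappa>)"
  define D where "D = det (mat p p (\<lambda>(i, j). S i j))"
  define D' where "D' = det (mat (Suc p) (Suc p) (\<lambda>(i, j). S i j))"
  have D: "D = D' * \<kappa>"
    unfolding D_def D'_def \<kappa>_def by (rule det_principal_minor) (use inv in auto)
  have IH: "0 < D \<and> (\<forall>u. \<forall>f \<in> borel_measurable borel.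
    (\<integral>\<^sup>+x. ennreal (exp (- bform p R x x / 2) / sqrt ((2 * pi) ^ p * D)) *
       f (\<Sum>j<p. u j * x j) \<partial>(\<Pi>\<^sub>M j\<in>{..<p}. lborel)) =
    (\<integral>\<^sup>+z. f (sqrt (bform p S u u) * z) \<partial>std_normal))"
    unfolding D_def
  proof (rule Suc.IH)
    fix i j assume ij: "i < p" "j < p"
    show "S i j = S j i" using sym ij by simp
    show "R i j = R j i" using symQ ij by (simp add: R_def)
    have "(\<Sum>k<p. S i k * R k j) = (\<Sum>k<p. S i k * Q k j) - (\<Sum>k<p. S i k * Q k p) * (Q j p / \<kappa>)"
      by (simp add: R_def algebra_simps sum_subtractf sum_distrib_left)
    also have "(\<Sum>k<p. S i k * Q k j) = (if i = j then 1 else 0) - S i p * Q p j"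
      using inv[of i j] ij by (simp add: algebra_simps)
    also have "(\<Sum>k<p. S i k * Q k p) = - S i p * \<kappa>"
      using inv[of i p] ij by (simp add: \<kappa>_def)
    finally show "(\<Sum>k<p. S i k * R k j) = (if i = j then 1 else 0)"
      using symQ[of p j] ij \<kappa> by simp
  next
    fix u :: "nat \<Rightarrow> real" assume "\<exists>i<p. u i \<noteq> 0"
    then obtain i where i: "i < p" "u i \<noteq> 0" by auto
    have "0 < bform (Suc p) S (u(p := 0)) (u(p := 0))"
      by (rule pd) (use i in \<open>auto intro!: exI[of _ i]\<close>)
    also have "\<dots> = bform p S u u" by (simp add: bform_def)
    finally show "0 < bform p S u u" .
  qed
  have D'pos: "0 < D'" using IH D \<kappa> by (simp add: zero_less_mult_iff)
  have "(\<integral>\<^sup>+x. ennreal (exp (- bform (Suc p) Q x x / 2) / sqrt ((2 * pi) ^ Suc p * D')) *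
       f (\<Sum>j<Suc p. u j * x j) \<partial>(\<Pi>\<^sub>M j\<in>{..<Suc p}. lborel)) =
    (\<integral>\<^sup>+z. f (sqrt (bform (Suc p) S u u) * z) \<partial>std_normal)"
    if [measurable]: "f \<in> borel_measurable borel" for f :: "real \<Rightarrow> ennreal" and u
  proof -
    interpret L: product_sigma_finite "\<lambda>_. lborel :: real measure" ..
    define w where "w = (\<lambda>x. ennreal (exp (- bform p R x x / 2) / sqrt ((2 * pi) ^ p * D)))"
    \<comment> \<open>\<open>u\<close> minus its part along \<open>q\<close>. It vanishes at
      \<open>p\<close>, so the form at \<open>u'\<close> involves only the leading block; on the
      leading coordinates it is what the functional becomes when the last coordinate is replaced by
      its conditional mean.\<close>
    define u' where "u' = (\<lambda>j. u j - u p / \<kappa> * q j)"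
    define F where "F = (\<lambda>a. \<integral>\<^sup>+z. f (a + u p / sqrt \<kappa> * z) \<partial>std_normal)"
    have [measurable]: "F \<in> borel_measurable borel" unfolding F_def by measurable
    have set: "{..<Suc p} = insert p {..<p}" by auto
    have PM: "(\<Pi>\<^sub>M j\<in>{..<Suc p}. lborel) = (\<Pi>\<^sub>M j\<in>insert p {..<p}. lborel :: real measure)"
      by (simp only: set)
    have split: "bform (Suc p) Q (x(p := y)) (x(p := y)) = bform p R x x + \<kappa> * (y + (\<Sum>i<p. q i * x i) / \<kappa>)\<^sup>2" for x y
    proof -
      have "bform (Suc p) Q (x(p := y)) (x(p := y)) =
          bform p Q x x + 2 * y * (\<Sum>i<p. q i * x i) + \<kappa> * y\<^sup>2"
      proof -
        have Qp: "Q p j = q j" "Q j p = q j" if "j < p" for j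
          using symQ[of p j] that by (auto simp: q_def)
        have "bform (Suc p) Q (x(p := y)) (x(p := y)) =
            bform p Q x x + (\<Sum>i<p. Q i p * x i * y) + ((\<Sum>j<p. Q p j * y * x j) + Q p p * y * y)"
          by (simp add: bform_def sum.distrib)
        also have "(\<Sum>i<p. Q i p * x i * y) = y * (\<Sum>i<p. q i * x i)"
          by (simp add: sum_distrib_left Qp mult_ac)
        also have "(\<Sum>j<p. Q p j * y * x j) = y * (\<Sum>i<p. q i * x i)"
          by (simp add: sum_distrib_left Qp mult_ac)
        finally show ?thesis by (simp add: \<kappa>_def power2_eq_square del: fun_upd_apply)
      qed
      moreover have "bform p R x x = bform p Q x x - (\<Sum>i<p. q i * x i)\<^sup>2 / \<kappa>"
        by (simp add: bform_def R_def q_def power2_eq_square sum_product sum_divide_distrib sum_subtractf algebra_simps)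
      moreover have "\<kappa> * (y + (\<Sum>i<p. q i * x i) / \<kappa>)\<^sup>2 =
          \<kappa> * y\<^sup>2 + 2 * y * (\<Sum>i<p. q i * x i) + (\<Sum>i<p. q i * x i)\<^sup>2 / \<kappa>"
        using \<kappa> by (simp add: power2_eq_square field_simps)
      ultimately show ?thesis by simp
    qed
    have inner: "(\<integral>\<^sup>+y. ennreal (exp (- bform (Suc p) Q (x(p := y)) (x(p := y)) / 2) / sqrt ((2 * pi) ^ Suc p * D')) *
        f (\<Sum>j<Suc p. u j * (x(p := y)) j) \<partial>lborel) = w x * F (\<Sum>j<p. u' j * x j)" for x
    proof -
      define c where "c = (\<Sum>i<p. q i * x i) / \<kappa>"
      define a where "a = (\<Sum>j<p. u j * x j)"
      have a': "a - u p * c = (\<Sum>j<p. u' j * x j)"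
        by (simp add: a_def c_def u'_def algebra_simps sum_subtractf sum_distrib_left sum_divide_distrib)
      have dens: "ennreal (exp (- bform (Suc p) Q (x(p := y)) (x(p := y)) / 2) / sqrt ((2 * pi) ^ Suc p * D')) =
          w x * ennreal (normal_density (- c) \<bar>1 / sqrt \<kappa>\<bar> y)" for y
      proof -
        have "sqrt ((2 * pi) ^ Suc p * D') = sqrt ((2 * pi) ^ p * D) * sqrt (2 * pi / \<kappa>)"
          using \<kappa> by (simp add: D real_sqrt_mult[symmetric] del: real_sqrt_mult)
        moreover have "exp (- bform (Suc p) Q (x(p := y)) (x(p := y)) / 2) =
            exp (- bform p R x x / 2) * exp (- \<kappa> * (y + c)\<^sup>2 / 2)"
          by (simp add: split c_def exp_add[symmetric] add_divide_distrib diff_divide_distrib)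
        moreover have "normal_density (- c) \<bar>1 / sqrt \<kappa>\<bar> y = exp (- \<kappa> * (y + c)\<^sup>2 / 2) / sqrt (2 * pi / \<kappa>)"
          using \<kappa> by (simp add: normal_density_def power_divide)
        ultimately show ?thesis
          using IH \<kappa> by (simp only: w_def) (simp add: ennreal_mult'[symmetric] times_divide_times_eq)
      qed
      have "(\<integral>\<^sup>+y. ennreal (exp (- bform (Suc p) Q (x(p := y)) (x(p := y)) / 2) / sqrt ((2 * pi) ^ Suc p * D')) *
        f (\<Sum>j<Suc p. u j * (x(p := y)) j) \<partial>lborel) =
        (\<integral>\<^sup>+y. w x * (ennreal (normal_density (- c) \<bar>1 / sqrt \<kappa>\<bar> y) * f (a + u p * y)) \<partial>lborel)"
        by (simp only: dens) (simp add: a_def mult.assoc)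
      also have "\<dots> = w x * (\<integral>\<^sup>+y. ennreal (normal_density (- c) \<bar>1 / sqrt \<kappa>\<bar> y) * f (a + u p * y) \<partial>lborel)"
        by (rule nn_integral_cmult) measurable
      also have "(\<integral>\<^sup>+y. ennreal (normal_density (- c) \<bar>1 / sqrt \<kappa>\<bar> y) * f (a + u p * y) \<partial>lborel) =
          (\<integral>\<^sup>+z. f (a + u p * (- c + 1 / sqrt \<kappa> * z)) \<partial>std_normal)"
        by (rule nn_integral_normal_density) (use \<kappa> in auto)
      also have "\<dots> = F (a - u p * c)"
        by (simp add: F_def algebra_simps)
      finally show ?thesis unfolding a' .
    qed
    have meas: "(\<lambda>x. ennreal (exp (- bform (Suc p) Q x x / 2) / sqrt ((2 * pi) ^ Suc p * D')) *
       f (\<Sum>j<Suc p. u j * x j)) \<in> borel_measurable (\<Pi>\<^sub>M j\<in>insert p {..<p}. lborel)"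
      unfolding bform_def set[symmetric] by measurable
    have "(\<integral>\<^sup>+x. ennreal (exp (- bform (Suc p) Q x x / 2) / sqrt ((2 * pi) ^ Suc p * D')) *
       f (\<Sum>j<Suc p. u j * x j) \<partial>(\<Pi>\<^sub>M j\<in>{..<Suc p}. lborel)) =
       (\<integral>\<^sup>+x. w x * F (\<Sum>j<p. u' j * x j) \<partial>(\<Pi>\<^sub>M j\<in>{..<p}. lborel))"
      unfolding PM by (subst L.product_nn_integral_insert[OF _ _ meas]) (simp_all only: inner finite_lessThan lessThan_iff less_irrefl not_False_eq_True)
    also have "\<dots> = (\<integral>\<^sup>+z. F (sqrt (bform p S u' u') * z) \<partial>std_normal)"
      using IH unfolding w_def by simp
    also have "\<dots> = (\<integral>\<^sup>+z. f (sqrt ((sqrt (bform p S u' u'))\<^sup>2 + (u p / sqrt \<kappa>)\<^sup>2) * z) \<partial>std_normal)"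
      unfolding F_def by (rule nn_integral_std_normal_add) simp
    also have "(sqrt (bform p S u' u'))\<^sup>2 + (u p / sqrt \<kappa>)\<^sup>2 = bform (Suc p) S u u"
    proof -
      have u'p: "u' p = 0" using \<kappa> by (simp add: u'_def q_def \<kappa>_def)
      have "bform p S u' u' = bform (Suc p) S u' u'"
        by (simp add: bform_def u'p)
      also have "\<dots> = bform (Suc p) S u u - (u p)\<^sup>2 / \<kappa>"
        unfolding u'_def bform_linear Sq_left Sq_right qp using \<kappa>
        by (simp add: power2_eq_square field_simps)
      finally have eq: "bform p S u' u' = bform (Suc p) S u u - (u p)\<^sup>2 / \<kappa>" .
      have "0 \<le> bform p S u' u'"
      proof (cases "\<exists>i<Suc p. u' i \<noteq> 0")
        case True
        from pd[OF this] \<open>bform p S u' u' = bform (Suc p) S u' u'\<close> show ?thesis by simp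
      next
        case False
        then have "bform p S u' u' = bform p S (\<lambda>_. 0) (\<lambda>_. 0)" by (intro bform_cong) auto
        then show ?thesis by (simp add: bform_def)
      qed
      then show ?thesis using \<kappa> eq by (simp add: power_divide)
    qed
    finally show ?thesis .
  qed
  then show ?case using D'pos unfolding D'_def by blast
qed

section \<open>Covariance and precision matrices as mutually inverse forms\<close>

definition inverse_pd_forms :: "nat \<Rightarrow> (nat \<Rightarrow> nat \<Rightarrow> real) \<Rightarrow> (nat \<Rightarrow> nat \<Rightarrow> real) \<Rightarrow> bool" where
  "inverse_pd_forms p S Q \<longleftrightarrow>
     (\<forall>i<p. \<forall>j<p. S i j = S j i) \<and> (\<forall>i<p. \<forall>j<p. Q i j = Q j i) \<and>
     (\<forall>i<p. \<forall>j<p. (\<Sum>k<p. S i k * Q k j) = (if i = j then 1 else 0)) \<and>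
     (\<forall>u. (\<exists>i<p. u i \<noteq> 0) \<longrightarrow> 0 < bform p S u u)"

lemma scalar_prod_mult_vec_eq_bform:
  assumes "A \<in> carrier_mat p p"
  shows "vec p u \<bullet> (A *\<^sub>v vec p w) = bform p (\<lambda>i j. A $$ (i, j)) u w"
  using assms by (simp add: scalar_prod_def bform_mult_vec atLeast0LessThan)

text \<open>\<open>invertible_mat\<close> provides a two-sided inverse whose dimensions are not
  stated. Once they are found to be \<open>p\<close>, the matrix is a unit of the matrix ring and
  \<open>mat_inverse\<close> succeeds.\<close>

lemma inverse_mat_properties:
  assumes A: "A \<in> carrier_mat p p" and inv: "invertible_mat A"
  shows "A * inverse_mat A = 1\<^sub>m p" "inverse_mat A * A = 1\<^sub>m p" "inverse_mat A \<in> carrier_mat p p"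
proof -
  obtain B where B: "A * B = 1\<^sub>m p" "B * A = 1\<^sub>m (dim_row B)"
    using inv A by (auto simp: invertible_mat_def inverts_mat_def)
  have "dim_row B = p" using arg_cong[OF B(2), of dim_col] A by simp
  moreover have "dim_col B = p" using arg_cong[OF B(1), of dim_col] by simp
  ultimately have "A \<in> Units (ring_mat TYPE(real) p b)" for b
    using A B by (auto simp: Units_def ring_mat_simps)
  then obtain C where "mat_inverse A = Some C"
    using mat_inverse(1)[OF A, of undefined] by fastforce
  then show "A * inverse_mat A = 1\<^sub>m p" "inverse_mat A * A = 1\<^sub>m p" "inverse_mat A \<in> carrier_mat p p"
    using mat_inverse(2)[OF A] by auto
qed

lemma bform_Cauchy_Schwarz:
  assumes sym: "\<And>i j. i < p \<Longrightarrow> j < p \<Longrightarrow> S i j = S j i"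
    and psd: "\<And>u. 0 \<le> bform p S u u"
  shows "(bform p S u w)\<^sup>2 \<le> bform p S u u * bform p S w w"
proof -
  define a b c where "a = bform p S w w" and "b = bform p S u w" and "c = bform p S u u"
  have quad: "0 \<le> c - 2 * t * b + t\<^sup>2 * a" for t
    using psd[of "\<lambda>i. u i - t * w i"] bform_commute[of p S w u] sym
    by (simp add: bform_linear a_def b_def c_def power2_eq_square algebra_simps)
  have "0 \<le> a" using psd by (simp add: a_def)
  show ?thesis
  proof (cases "a = 0")
    case True
    have "b = 0"
    proof (rule ccontr)
      assume "b \<noteq> 0"
      \<comment> \<open>At this argument the polynomial, which is linear here, takes the value
        -1.\<close>
      then show False using quad[of "(c + 1) / (2 * b)"] True by simp
    qed
    then show ?thesis using True by (simp add: a_def b_def)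
  next
    case False
    then show ?thesis using quad[of "b / a"] \<open>0 \<le> a\<close>
      by (simp add: power2_eq_square field_simps flip: a_def b_def c_def)
  qed
qed

text \<open>A covariance matrix is only positive semidefinite by definition. A vector of form value
  zero is orthogonal to everything by Cauchy--Schwarz, and pairing it with the rows of the inverse
  recovers its own entries; so invertibility makes the form definite.\<close>

lemma inverse_pd_forms_of_matrix:
  assumes cov: "covariance_matrix p A" and inv: "invertible_mat A"
  shows "inverse_pd_forms p (\<lambda>i j. A $$ (i, j)) (\<lambda>i j. inverse_mat A $$ (i, j))"
proof -
  let ?S = "\<lambda>i j. A $$ (i, j)" and ?B = "inverse_mat A"
  have A: "A \<in> carrier_mat p p" and tA: "transpose_mat A = A"
    and psd: "v \<in> carrier_vec p \<Longrightarrow> 0 \<le> v \<bullet> (A *\<^sub>v v)" for v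
    using cov by (auto simp: covariance_matrix_def)
  note B = inverse_mat_properties[OF A inv]
  have sym: "?S i j = ?S j i" if "i < p" "j < p" for i j
    using arg_cong[OF tA, of "\<lambda>M. M $$ (i, j)"] that A by simp
  have "transpose_mat ?B = transpose_mat ?B * (A * ?B)"
    using B by simp
  also have "\<dots> = (transpose_mat ?B * A) * ?B"
    by (rule assoc_mult_mat[symmetric]) (use A B in auto)
  also have "transpose_mat ?B * A = transpose_mat (A * ?B)"
    using transpose_mult[OF A B(3)] tA by simp
  finally have tB: "transpose_mat ?B = ?B" using B by simp
  have symB: "?B $$ (i, j) = ?B $$ (j, i)" if "i < p" "j < p" for i j
    using arg_cong[OF tB, of "\<lambda>M. M $$ (i, j)"] that B by simp
  have one: "(\<Sum>k<p. A $$ (i, k) * ?B $$ (k, j)) = (if i = j then 1 else 0)" if "i < p" "j < p" for i j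
    using arg_cong[OF B(1), of "\<lambda>M. M $$ (i, j)"] that A B(3)
    by (simp add: scalar_prod_def atLeast0LessThan)
  have one': "(\<Sum>k<p. ?B $$ (i, k) * A $$ (k, j)) = (if i = j then 1 else 0)" if "i < p" "j < p" for i j
    using arg_cong[OF B(2), of "\<lambda>M. M $$ (i, j)"] that A B(3)
    by (simp add: scalar_prod_def atLeast0LessThan)
  have nonneg: "0 \<le> bform p ?S u u" for u
    using psd[of "vec p u"] scalar_prod_mult_vec_eq_bform[OF A, of u u] by simp
  have "0 < bform p ?S u u" if "i < p" "u i \<noteq> 0" for u i
  proof (rule ccontr)
    assume "\<not> ?thesis"
    then have 0: "bform p ?S u u = 0" using nonneg[of u] by simp
    have orth: "bform p ?S w u = 0" for w
      using bform_Cauchy_Schwarz[of p ?S w u] sym nonneg 0 by simp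
    have "(\<Sum>k<p. ?B $$ (i, k) * (\<Sum>j<p. A $$ (k, j) * u j)) = (\<Sum>k<p. \<Sum>j<p. ?B $$ (i, k) * A $$ (k, j) * u j)"
      by (simp add: sum_distrib_left mult.assoc)
    also have "\<dots> = (\<Sum>j<p. (\<Sum>k<p. ?B $$ (i, k) * A $$ (k, j)) * u j)"
      by (subst sum.swap) (simp add: sum_distrib_right)
    also have "\<dots> = (\<Sum>j<p. if i = j then u j else 0)"
      using one' that by (intro sum.cong) auto
    also have "\<dots> = u i" using that by simp
    also have "(\<Sum>k<p. ?B $$ (i, k) * (\<Sum>j<p. A $$ (k, j) * u j)) = bform p ?S (\<lambda>k. ?B $$ (i, k)) u"
      by (simp add: bform_mult_vec)
    finally show False using orth that by simp
  qed
  then show ?thesis using sym symB one by (auto simp: inverse_pd_forms_def)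
qed

lemma inverse_pd_formsD:
  assumes "inverse_pd_forms p S Q"
  shows "i < p \<Longrightarrow> j < p \<Longrightarrow> S i j = S j i" "i < p \<Longrightarrow> j < p \<Longrightarrow> Q i j = Q j i"
    "i < p \<Longrightarrow> j < p \<Longrightarrow> (\<Sum>k<p. S i k * Q k j) = (if i = j then 1 else 0)"
    "i < p \<Longrightarrow> u i \<noteq> 0 \<Longrightarrow> 0 < bform p S u u" "0 \<le> bform p S u u"
proof -
  show "0 \<le> bform p S u u"
  proof (cases "\<exists>i<p. u i \<noteq> 0")
    case True
    then show ?thesis using assms by (auto simp: inverse_pd_forms_def intro: less_imp_le)
  next
    case False
    then have "bform p S u u = bform p S (\<lambda>_. 0) (\<lambda>_. 0)" by (intro bform_cong) auto
    then show ?thesis by (simp add: bform_def)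
  qed
qed (use assms in \<open>unfold inverse_pd_forms_def, blast+\<close>)

lemma sets_normal_law [simp, measurable_cong]: "sets (normal_law p A) = sets (\<Pi>\<^sub>M j\<in>{..<p}. borel)"
  unfolding normal_law_def by (simp cong: sets_PiM_cong)

lemma space_normal_law [simp]: "space (normal_law p A) = space (\<Pi>\<^sub>M j\<in>{..<p}. borel)"
  by (rule sets_eq_imp_space_eq) simp

theorem nn_integral_normal_law:
  assumes cov: "covariance_matrix p A" and inv: "invertible_mat A"
    and [measurable]: "f \<in> borel_measurable borel"
  shows "(\<integral>\<^sup>+x. f (\<Sum>j<p. u j * x j) \<partial>normal_law p A) =
    (\<integral>\<^sup>+z. f (sqrt (bform p (\<lambda>i j. A $$ (i, j)) u u) * z) \<partial>std_normal)"
proof -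
  let ?S = "\<lambda>i j. A $$ (i, j)" and ?Q = "\<lambda>i j. inverse_mat A $$ (i, j)"
  have A: "A \<in> carrier_mat p p" using cov by (simp add: covariance_matrix_def)
  note pd = inverse_pd_forms_of_matrix[OF cov inv]
  have m: "mat p p (\<lambda>(i, j). ?S i j) = A" using A by (intro eq_matI) auto
  have "normal_law p A = density (\<Pi>\<^sub>M j\<in>{..<p}. lborel)
      (\<lambda>x. ennreal (exp (- bform p ?Q x x / 2) / sqrt ((2 * pi) ^ p * det A)))"
    unfolding normal_law_def
    by (simp add: scalar_prod_mult_vec_eq_bform inverse_mat_properties[OF A inv])
  moreover have "(\<lambda>x. ennreal (exp (- bform p ?Q x x / 2) / sqrt ((2 * pi) ^ p * det A)))
      \<in> borel_measurable (\<Pi>\<^sub>M j\<in>{..<p}. lborel)"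
    unfolding bform_def by measurable
  ultimately have "(\<integral>\<^sup>+x. f (\<Sum>j<p. u j * x j) \<partial>normal_law p A) =
      (\<integral>\<^sup>+x. ennreal (exp (- bform p ?Q x x / 2) / sqrt ((2 * pi) ^ p * det A)) *
        f (\<Sum>j<p. u j * x j) \<partial>(\<Pi>\<^sub>M j\<in>{..<p}. lborel))"
    by (simp add: nn_integral_density)
  also have "\<dots> = (\<integral>\<^sup>+z. f (sqrt (bform p ?S u u) * z) \<partial>std_normal)"
    by (rule gaussian_linear_functional[of p ?S ?Q, unfolded m, THEN conjunct2, THEN spec, THEN bspec])
      (use pd assms(3) in \<open>unfold inverse_pd_forms_def, blast+\<close>)
  finally show ?thesis .
qed

lemma prob_space_normal_law:
  assumes "covariance_matrix p A" "invertible_mat A"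
  shows "prob_space (normal_law p A)"
proof
  show "emeasure (normal_law p A) (space (normal_law p A)) = 1"
    using nn_integral_normal_law[OF assms, of "\<lambda>_. 1"] std_normal.emeasure_space_1 by simp
qed

section \<open>The smallest eigenvalue as a lower bound of the quadratic form\<close>

lemma sum_squares_matrix_vector_le:
  "(\<Sum>i<p. (\<Sum>j<q. N i j * w j)\<^sup>2) \<le> (\<Sum>i<p. \<Sum>j<q. (N i j)\<^sup>2) * (\<Sum>j<q. (w j)\<^sup>2)" for N :: "nat \<Rightarrow> nat \<Rightarrow> real"
  unfolding sum_distrib_right by (rule sum_mono) (simp add: Cauchy_Schwarz_ineq_sum flip: sum_distrib_right)

lemma bform_le_sum_squares:
  "bform p S w w \<le> (\<Sum>i<p. \<Sum>j<p. \<bar>S i j\<bar>) * (\<Sum>i<p. (w i)\<^sup>2)"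
proof -
  have "S i j * w i * w j \<le> \<bar>S i j\<bar> * (\<Sum>i<p. (w i)\<^sup>2)" if "i < p" "j < p" for i j
  proof -
    have *: "\<bar>w i\<bar> \<le> sqrt (\<Sum>i<p. (w i)\<^sup>2)" if "i < p" for i
      using member_le_sum[of i "{..<p}" "\<lambda>i. (w i)\<^sup>2"] that real_le_rsqrt[of "\<bar>w i\<bar>"] by simp
    have "\<bar>w i\<bar> * \<bar>w j\<bar> \<le> sqrt (\<Sum>i<p. (w i)\<^sup>2) * sqrt (\<Sum>i<p. (w i)\<^sup>2)"
      using that * by (intro mult_mono) (auto intro: sum_nonneg)
    then have "\<bar>w i\<bar> * \<bar>w j\<bar> \<le> (\<Sum>i<p. (w i)\<^sup>2)" by (simp add: sum_nonneg)
    moreover have "S i j * w i * w j \<le> \<bar>S i j\<bar> * (\<bar>w i\<bar> * \<bar>w j\<bar>)"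
      by (metis abs_ge_self abs_mult mult.assoc)
    ultimately show ?thesis by (meson abs_ge_zero mult_left_mono order_trans)
  qed
  then show ?thesis
    unfolding bform_def sum_distrib_right by (intro sum_mono) auto
qed

text \<open>
  The largest \<open>t\<close> with \<open>t |u|\<^sup>2 \<le> u\<^sup>T A u\<close> for all \<open>u\<close> is an eigenvalue: otherwise \<open>A - t I\<close> would be
  invertible and positive semidefinite, hence bounded below by a positive multiple of the identity.
\<close>
lemma min_eigenvalue_le_bform:
  assumes cov: "covariance_matrix p A" and inv: "invertible_mat A" and p: "0 < p"
  shows "0 < min_eigenvalue A"
    and "min_eigenvalue A * (\<Sum>i<p. (u i)\<^sup>2) \<le> bform p (\<lambda>i j. A $$ (i, j)) u u"
proof -
  let ?S = "\<lambda>i j. A $$ (i, j)"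
  have A: "A \<in> carrier_mat p p" using cov by (simp add: covariance_matrix_def)
  have pd: "inverse_pd_forms p ?S (\<lambda>i j. inverse_mat A $$ (i, j))"
    by (rule inverse_pd_forms_of_matrix[OF cov inv])
  define \<T> where "\<T> = {t. \<forall>u. t * (\<Sum>i<p. (u i)\<^sup>2) \<le> bform p ?S u u}"
  define t0 where "t0 = Sup \<T>"
  have ne: "0 \<in> \<T>" using inverse_pd_formsD(5)[OF pd] by (simp add: \<T>_def)
  have bdd: "bdd_above \<T>"
  proof (rule bdd_aboveI)
    fix t assume "t \<in> \<T>"
    then have "\<forall>u. t * (\<Sum>i<p. (u i)\<^sup>2) \<le> bform p ?S u u"
      by (simp add: \<T>_def)
    from this[rule_format, of "\<lambda>i. if i = 0 then 1 else 0"]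
    have "t * (\<Sum>i<p. ((\<lambda>i. if i = 0 then 1 else 0 :: real) i)\<^sup>2) \<le> bform p ?S (\<lambda>i. if i = 0 then 1 else 0) (\<lambda>i. if i = 0 then 1 else 0)" .
    moreover have "(\<Sum>i<p. ((\<lambda>i. if i = 0 then 1 else 0 :: real) i)\<^sup>2) = 1"
      using p by (simp add: if_distrib[of "\<lambda>x. x\<^sup>2"] cong: if_cong)
    ultimately show "t \<le> bform p ?S (\<lambda>i. if i = 0 then 1 else 0) (\<lambda>i. if i = 0 then 1 else 0)" by simp
  qed
  have t0: "t0 * (\<Sum>i<p. (u i)\<^sup>2) \<le> bform p ?S u u" for u
  proof (cases "(\<Sum>i<p. (u i)\<^sup>2) = 0")
    case True
    then show ?thesis using inverse_pd_formsD(5)[OF pd] by simp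
  next
    case False
    then have pos: "0 < (\<Sum>i<p. (u i)\<^sup>2)" using sum_nonneg[of "{..<p}" "\<lambda>i. (u i)\<^sup>2"] by simp
    have "t0 \<le> bform p ?S u u / (\<Sum>i<p. (u i)\<^sup>2)"
      unfolding t0_def
    proof (rule cSup_least)
      show "\<T> \<noteq> {}" using ne by blast
    qed (use pos in \<open>simp add: \<T>_def pos_le_divide_eq\<close>)
    then show ?thesis using pos by (simp add: field_simps)
  qed
  have ev: "eigenvalue A t0"
  proof (rule ccontr)
    assume not: "\<not> eigenvalue A t0"
    let ?C = "char_matrix A t0"
    have C: "?C \<in> carrier_mat p p" using A by (simp add: char_matrix_def)
    have "det ?C \<noteq> 0" using not eigenvalue_det[OF A] by simp
    from det_non_zero_imp_unit[OF C this]
    obtain N where N: "N \<in> carrier_mat p p" "N * ?C = 1\<^sub>m p"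
      by (auto simp: Units_def ring_mat_simps)
    define B where "B = (\<lambda>i j. ?C $$ (i, j))"
    have B: "bform p B u w = bform p ?S u w - t0 * (\<Sum>i<p. u i * w i)" for u w
    proof -
      have "B i j = ?S i j - (if i = j then t0 else 0)" if "i < p" "j < p" for i j
        using that A by (simp add: B_def char_matrix_def)
      then have "bform p B u w = (\<Sum>i<p. \<Sum>j<p. (?S i j - (if i = j then t0 else 0)) * u i * w j)"
        by (simp add: bform_def)
      also have "\<dots> = bform p ?S u w - (\<Sum>i<p. \<Sum>j<p. (if i = j then t0 * u i * w j else 0))"
        unfolding bform_def sum_subtractf[symmetric] by (intro sum.cong refl) (auto simp: algebra_simps)
      also have "(\<Sum>i<p. \<Sum>j<p. (if i = j then t0 * u i * w j else 0)) = t0 * (\<Sum>i<p. u i * w i)"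
        by (simp add: sum_distrib_left mult.assoc)
      finally show ?thesis .
    qed
    have symB: "B i j = B j i" if "i < p" "j < p" for i j
      using that A inverse_pd_formsD(1)[OF pd] by (simp add: B_def char_matrix_def)
    have psdB: "0 \<le> bform p B u u" for u
      using t0[of u] by (simp add: B power2_eq_square)
    have NB: "(\<Sum>k<p. N $$ (i, k) * B k j) = (if i = j then 1 else 0)" if "i < p" "j < p" for i j
      using arg_cong[OF N(2), of "\<lambda>M. M $$ (i, j)"] that C N(1)
      by (simp add: scalar_prod_def atLeast0LessThan B_def)
    define M where "M = (\<Sum>i<p. \<Sum>j<p. \<bar>B i j\<bar>)"
    define K where "K = (\<Sum>i<p. \<Sum>j<p. (N $$ (i, j))\<^sup>2)"
    have MK: "0 \<le> M" "0 \<le> K" by (auto simp: M_def K_def intro!: sum_nonneg)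
    \<comment> \<open>With w = B u, Cauchy--Schwarz for the form gives |w|^2 \<le> M u^T B u, and u
      = N w gives |u|^2 \<le> K |w|^2.\<close>
    have low: "(\<Sum>i<p. (u i)\<^sup>2) \<le> K * M * bform p B u u" for u
    proof -
      define w where "w = (\<lambda>k. \<Sum>j<p. B k j * u j)"
      define W where "W = (\<Sum>k<p. (w k)\<^sup>2)"
      have W0: "0 \<le> W" by (auto simp: W_def intro: sum_nonneg)
      have wu: "bform p B w u = W"
        by (simp add: bform_mult_vec w_def W_def power2_eq_square)
      have "W\<^sup>2 \<le> bform p B w w * bform p B u u"
        using bform_Cauchy_Schwarz[of p B w u] symB psdB wu by simp
      also have "\<dots> \<le> (M * W) * bform p B u u"
        using bform_le_sum_squares[of p B w] psdB by (intro mult_right_mono) (auto simp: M_def W_def)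
      finally have "W * W \<le> W * (M * bform p B u u)" by (simp add: power2_eq_square mult_ac)
      then have W: "W \<le> M * bform p B u u"
        using W0 MK psdB[of u] by (cases "W = 0") auto
      have "u i = (\<Sum>k<p. N $$ (i, k) * w k)" if "i < p" for i
      proof -
        have "(\<Sum>k<p. N $$ (i, k) * w k) = (\<Sum>k<p. \<Sum>j<p. N $$ (i, k) * B k j * u j)"
          by (simp add: w_def sum_distrib_left mult.assoc)
        also have "\<dots> = (\<Sum>j<p. (\<Sum>k<p. N $$ (i, k) * B k j) * u j)"
          by (subst sum.swap) (simp add: sum_distrib_right)
        also have "\<dots> = (\<Sum>j<p. if i = j then u j else 0)"
          using NB that by (intro sum.cong) auto
        finally show ?thesis using that by simp
      qed
      then have "(\<Sum>i<p. (u i)\<^sup>2) = (\<Sum>i<p. (\<Sum>k<p. N $$ (i, k) * w k)\<^sup>2)" by simp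
      also have "\<dots> \<le> K * W"
        unfolding K_def W_def by (rule sum_squares_matrix_vector_le)
      also have "\<dots> \<le> K * (M * bform p B u u)" using W MK by (intro mult_left_mono)
      finally show ?thesis by (simp add: mult.assoc)
    qed
    \<comment> \<open>The added one keeps the denominator positive; any gain over \<open>t0\<close>
      contradicts the supremum.\<close>
    have "t0 + 1 / (K * M + 1) \<in> \<T>"
      unfolding \<T>_def mem_Collect_eq
    proof
      fix u :: "nat \<Rightarrow> real"
      have KM: "0 < K * M + 1" using MK by (simp add: add_nonneg_pos)
      have "(\<Sum>i<p. (u i)\<^sup>2) \<le> (K * M + 1) * bform p B u u"
        using low[of u] psdB[of u] by (simp add: algebra_simps)
      then have "(\<Sum>i<p. (u i)\<^sup>2) / (K * M + 1) \<le> bform p B u u"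
        using KM by (simp add: field_simps)
      then show "(t0 + 1 / (K * M + 1)) * (\<Sum>i<p. (u i)\<^sup>2) \<le> bform p ?S u u"
        by (simp add: B algebra_simps power2_eq_square)
    qed
    then have "t0 + 1 / (K * M + 1) \<le> t0" unfolding t0_def by (rule cSup_upper[OF _ bdd])
    moreover have "0 < 1 / (K * M + 1)" using MK by (simp add: add_nonneg_pos)
    ultimately show False by simp
  qed
  have fin: "finite (spectrum A)" using card_finite_spectrum[OF A] by simp
  have in_sp: "t0 \<in> spectrum A" using ev by (simp add: spectrum_def)
  have "0 < t" if t: "t \<in> spectrum A" for t
  proof -
    obtain v where v: "v \<in> carrier_vec p" "v \<noteq> 0\<^sub>v p" "A *\<^sub>v v = t \<cdot>\<^sub>v v"
      using t A by (auto simp: spectrum_def eigenvalue_def[of A] eigenvector_def[of A])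
    define u where "u = (\<lambda>i. v $ i)"
    have vu: "v = vec p u" using v(1) by (intro eq_vecI) (auto simp: u_def)
    obtain i where i: "i < p" "u i \<noteq> 0"
      using v by (metis carrier_vecD eq_vecI index_zero_vec u_def)
    have "0 < bform p ?S u u" by (rule inverse_pd_formsD(4)[where u = u, OF pd i])
    also have "\<dots> = v \<bullet> (t \<cdot>\<^sub>v v)"
      using scalar_prod_mult_vec_eq_bform[OF A, of u u] v(3) vu by simp
    also have "\<dots> = t * (\<Sum>i<p. (u i)\<^sup>2)"
      using v(1) by (simp add: vu scalar_prod_def atLeast0LessThan sum_distrib_left power2_eq_square mult_ac)
    finally show ?thesis
      by (meson sum_nonneg zero_le_power2 zero_less_mult_pos2 less_le_trans not_le mult_nonpos_nonneg)
  qed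
  then show "0 < min_eigenvalue A"
    unfolding min_eigenvalue_def using fin in_sp by (subst Min_gr_iff) auto
  have "min_eigenvalue A \<le> t0"
    unfolding min_eigenvalue_def using fin in_sp by (intro Min_le)
  then have "min_eigenvalue A * (\<Sum>i<p. (u i)\<^sup>2) \<le> t0 * (\<Sum>i<p. (u i)\<^sup>2)"
    by (intro mult_right_mono) (auto intro: sum_nonneg)
  also have "\<dots> \<le> bform p ?S u u" by (rule t0)
  finally show "min_eigenvalue A * (\<Sum>i<p. (u i)\<^sup>2) \<le> bform p ?S u u" .
qed

subsection \<open>The law of design and noise\<close>

lemma density_PiM:
  assumes fin: "finite I" and M: "product_sigma_finite M"
    and M': "product_sigma_finite (\<lambda>i. density (M i) (f i))"
    and f: "\<And>i. f i \<in> borel_measurable (M i)"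
  shows "density (PiM I M) (\<lambda>x. \<Prod>i\<in>I. f i (x i)) = PiM I (\<lambda>i. density (M i) (f i))"
proof -
  interpret M: product_sigma_finite M by (rule M)
  interpret M': product_sigma_finite "\<lambda>i. density (M i) (f i)" by (rule M')
  note f[measurable]
  have meas: "(\<lambda>x. \<Prod>i\<in>I. f i (x i)) \<in> borel_measurable (PiM I M)"
  proof (rule borel_measurable_prod_ennreal)
    fix i assume "i \<in> I"
    then show "(\<lambda>x. f i (x i)) \<in> borel_measurable (PiM I M)"
      by (intro measurable_compose[where f = "\<lambda>x. x i", OF measurable_component_singleton]) (auto simp: f)
  qed
  show ?thesis
  proof (rule M'.PiM_eqI[OF fin])
    show "sets (density (PiM I M) (\<lambda>x. \<Prod>i\<in>I. f i (x i))) = sets (PiM I (\<lambda>i. density (M i) (f i)))"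
      by (simp cong: sets_PiM_cong)
    fix A assume "\<And>i. i \<in> I \<Longrightarrow> A i \<in> sets (density (M i) (f i))"
    then have A: "A i \<in> sets (M i)" if "i \<in> I" for i using that by simp
    have "emeasure (density (PiM I M) (\<lambda>x. \<Prod>i\<in>I. f i (x i))) (Pi\<^sub>E I A) =
        (\<integral>\<^sup>+x. (\<Prod>i\<in>I. f i (x i)) * indicator (Pi\<^sub>E I A) x \<partial>PiM I M)"
      using A fin meas by (intro emeasure_density) (auto intro!: sets_PiM_I_finite)
    also have "\<dots> = (\<integral>\<^sup>+x. (\<Prod>i\<in>I. f i (x i) * indicator (A i) (x i)) \<partial>PiM I M)"
    proof (rule nn_integral_cong)
      fix x assume x: "x \<in> space (PiM I M)"
      have "indicator (Pi\<^sub>E I A) x = (\<Prod>i\<in>I. indicator (A i) (x i) :: ennreal)"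
        using x fin by (cases "x \<in> Pi\<^sub>E I A") (auto simp: space_PiM PiE_iff indicator_def)
      then show "(\<Prod>i\<in>I. f i (x i)) * indicator (Pi\<^sub>E I A) x = (\<Prod>i\<in>I. f i (x i) * indicator (A i) (x i))"
        by (simp add: prod.distrib)
    qed
    also have "\<dots> = (\<Prod>i\<in>I. \<integral>\<^sup>+x. f i x * indicator (A i) x \<partial>M i)"
      using A by (intro M.product_nn_integral_prod[OF fin]) auto
    also have "\<dots> = (\<Prod>i\<in>I. emeasure (density (M i) (f i)) (A i))"
      using A by (intro prod.cong refl emeasure_density[symmetric]) auto
    finally show "emeasure (density (PiM I M) (\<lambda>x. \<Prod>i\<in>I. f i (x i))) (Pi\<^sub>E I A) =
      (\<Prod>i\<in>I. emeasure (density (M i) (f i)) (A i))" .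
  qed
qed

lemma distr_PiM_coordinatewise:
  assumes fin: "finite I" and M: "product_sigma_finite M"
    and M': "product_sigma_finite (\<lambda>i. distr (M i) (N i) (g i))"
    and g: "\<And>i. g i \<in> measurable (M i) (N i)"
  shows "distr (PiM I M) (PiM I N) (\<lambda>x. \<lambda>i\<in>I. g i (x i)) = PiM I (\<lambda>i. distr (M i) (N i) (g i))"
proof -
  interpret M: product_sigma_finite M by (rule M)
  interpret M': product_sigma_finite "\<lambda>i. distr (M i) (N i) (g i)" by (rule M')
  note g[measurable]
  have meas: "(\<lambda>x. \<lambda>i\<in>I. g i (x i)) \<in> measurable (PiM I M) (PiM I N)"
  proof (rule measurable_restrict)
    fix i assume "i \<in> I"
    then show "(\<lambda>x. g i (x i)) \<in> measurable (PiM I M) (N i)"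
      by (intro measurable_compose[where f = "\<lambda>x. x i", OF measurable_component_singleton]) (auto simp: g)
  qed
  show ?thesis
  proof (rule M'.PiM_eqI[OF fin])
    show "sets (distr (PiM I M) (PiM I N) (\<lambda>x. \<lambda>i\<in>I. g i (x i))) = sets (PiM I (\<lambda>i. distr (M i) (N i) (g i)))"
      by (simp cong: sets_PiM_cong)
    fix A assume "\<And>i. i \<in> I \<Longrightarrow> A i \<in> sets (distr (M i) (N i) (g i))"
    then have A: "A i \<in> sets (N i)" if "i \<in> I" for i using that by simp
    have "emeasure (distr (PiM I M) (PiM I N) (\<lambda>x. \<lambda>i\<in>I. g i (x i))) (Pi\<^sub>E I A) =
        emeasure (PiM I M) ((\<lambda>x. \<lambda>i\<in>I. g i (x i)) -` Pi\<^sub>E I A \<inter> space (PiM I M))"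
      using A fin by (intro emeasure_distr meas sets_PiM_I_finite) auto
    also have "(\<lambda>x. \<lambda>i\<in>I. g i (x i)) -` Pi\<^sub>E I A \<inter> space (PiM I M) = Pi\<^sub>E I (\<lambda>i. g i -` A i \<inter> space (M i))"
      by (auto simp: space_PiM PiE_iff)
    also have "emeasure (PiM I M) \<dots> = (\<Prod>i\<in>I. emeasure (M i) (g i -` A i \<inter> space (M i)))"
      using A by (intro M.emeasure_PiM[OF fin]) auto
    also have "\<dots> = (\<Prod>i\<in>I. emeasure (distr (M i) (N i) (g i)) (A i))"
      using A by (intro prod.cong refl emeasure_distr[symmetric] g) auto
    finally show "emeasure (distr (PiM I M) (PiM I N) (\<lambda>x. \<lambda>i\<in>I. g i (x i))) (Pi\<^sub>E I A) =
      (\<Prod>i\<in>I. emeasure (distr (M i) (N i) (g i)) (A i))" .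
  qed
qed

lemma product_sigma_finite_probI: "(\<And>i. prob_space (M i)) \<Longrightarrow> product_sigma_finite M"
  by (simp add: product_sigma_finite_def prob_space_imp_sigma_finite)

section \<open>Product structure and translation of the noise\<close>

interpretation std_normals: product_sigma_finite "\<lambda>_::nat. std_normal"
  by (rule product_sigma_finite_probI[OF prob_space_std_normal])

text \<open>With the noise law written as a product, the noise can be translated coordinate by
  coordinate.\<close>

lemma normal_law_identity: "normal_law n (1\<^sub>m n) = (\<Pi>\<^sub>M i\<in>{..<n}. std_normal)"
proof -
  have inv: "invertible_mat (1\<^sub>m n :: real mat)"
    by (auto simp: invertible_mat_def inverts_mat_def intro!: exI[of _ "1\<^sub>m n"])
  have "inverse_mat (1\<^sub>m n) = 1\<^sub>m n"
    using inverse_mat_properties[of "1\<^sub>m n" n] inv by simp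
  moreover have "vec n x \<bullet> (1\<^sub>m n *\<^sub>v vec n x) = (\<Sum>i<n. (x i)\<^sup>2)" for x :: "nat \<Rightarrow> real"
    by (simp add: scalar_prod_def atLeast0LessThan power2_eq_square)
  moreover have "exp (- (\<Sum>i<n. (x i)\<^sup>2) / 2) / sqrt ((2 * pi) ^ n) = (\<Prod>i<n. std_normal_density (x i))" for x :: "nat \<Rightarrow> real"
    by (simp add: std_normal_density_def prod_dividef exp_sum[symmetric] sum_divide_distrib sum_negf real_sqrt_power real_sqrt_mult power_mult_distrib prod.distrib power_one_over)
  ultimately have "normal_law n (1\<^sub>m n) = density (\<Pi>\<^sub>M i\<in>{..<n}. lborel) (\<lambda>x. \<Prod>i\<in>{..<n}. ennreal (std_normal_density (x i)))"
    unfolding normal_law_def by (simp add: prod_ennreal)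
  also have "\<dots> = (\<Pi>\<^sub>M i\<in>{..<n}. density lborel (\<lambda>x. ennreal (std_normal_density x)))"
    by (rule density_PiM)
      (auto intro: product_sigma_finite_probI prob_space_std_normal[unfolded std_normal_def]
        prob_space_imp_sigma_finite simp: product_sigma_finite_def sigma_finite_lborel)
  finally show ?thesis by (simp add: std_normal_def)
qed

text \<open>The Cameron--Martin density, which is the quotient of the densities of N(a, 1) and N(0,
  1).\<close>

lemma distr_std_normal_shift:
  "distr std_normal borel (\<lambda>z. z + a) = density std_normal (\<lambda>z. ennreal (exp (a * z - a\<^sup>2 / 2)))"
proof (rule measure_eqI)
  fix A assume "A \<in> sets (distr std_normal borel (\<lambda>z. z + a))"
  then have [measurable]: "A \<in> sets borel" by simp
  have "emeasure (distr std_normal borel (\<lambda>z. z + a)) A = (\<integral>\<^sup>+z. indicator A (a + 1 * z) \<partial>std_normal)"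
    by (subst nn_integral_indicator[symmetric], simp, subst nn_integral_distr) (auto simp: add.commute)
  also have "\<dots> = (\<integral>\<^sup>+y. ennreal (normal_density a 1 y) * indicator A y \<partial>lborel)"
    using nn_integral_normal_density[of 1 "indicator A" a] by simp
  also have "\<dots> = (\<integral>\<^sup>+y. ennreal (std_normal_density y) * (ennreal (exp (a * y - a\<^sup>2 / 2)) * indicator A y) \<partial>lborel)"
  proof (rule nn_integral_cong)
    fix y
    have "- (y - a)\<^sup>2 / 2 = - y\<^sup>2 / 2 + (a * y - a\<^sup>2 / 2)" by (simp add: power2_eq_square field_simps)
    then have "exp (- (y - a)\<^sup>2 / 2) = exp (- y\<^sup>2 / 2) * exp (a * y - a\<^sup>2 / 2)" by (metis exp_add)
    then have "normal_density a 1 y = std_normal_density y * exp (a * y - a\<^sup>2 / 2)"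
      by (simp add: normal_density_def)
    then show "ennreal (normal_density a 1 y) * indicator A y =
      ennreal (std_normal_density y) * (ennreal (exp (a * y - a\<^sup>2 / 2)) * indicator A y)"
      by (simp add: ennreal_mult' mult.assoc)
  qed
  also have "\<dots> = (\<integral>\<^sup>+z. ennreal (exp (a * z - a\<^sup>2 / 2)) * indicator A z \<partial>std_normal)"
    unfolding std_normal_def by (subst nn_integral_density) auto
  also have "\<dots> = emeasure (density std_normal (\<lambda>z. ennreal (exp (a * z - a\<^sup>2 / 2)))) A"
    by (subst emeasure_density) auto
  finally show "emeasure (distr std_normal borel (\<lambda>z. z + a)) A =
    emeasure (density std_normal (\<lambda>z. ennreal (exp (a * z - a\<^sup>2 / 2)))) A" .
qed simp

lemma distr_noise_shift:
  fixes n :: nat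
  shows "distr (\<Pi>\<^sub>M i\<in>{..<n}. std_normal) (\<Pi>\<^sub>M i\<in>{..<n}. borel) (\<lambda>e. \<lambda>i\<in>{..<n}. e i + a i) =
    density (\<Pi>\<^sub>M i\<in>{..<n}. std_normal) (\<lambda>e. \<Prod>i<n. ennreal (exp (a i * e i - (a i)\<^sup>2 / 2)))"
proof -
  have ps: "prob_space (distr std_normal borel (\<lambda>z. z + a i))" for i
    by (rule std_normal.prob_space_distr) simp
  have 1: "product_sigma_finite (\<lambda>i. distr std_normal borel (\<lambda>z. z + a i))"
    using ps by (intro product_sigma_finite_probI)
  have 0: "product_sigma_finite (\<lambda>_::nat. std_normal)"
    by (rule product_sigma_finite_probI[OF prob_space_std_normal])
  have "distr (\<Pi>\<^sub>M i\<in>{..<n}. std_normal) (\<Pi>\<^sub>M i\<in>{..<n}. borel) (\<lambda>e. \<lambda>i\<in>{..<n}. e i + a i) =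
      (\<Pi>\<^sub>M i\<in>{..<n}. distr std_normal borel (\<lambda>z. z + a i))"
    using 0 1 by (intro distr_PiM_coordinatewise) auto
  also have "\<dots> = density (\<Pi>\<^sub>M i\<in>{..<n}. std_normal) (\<lambda>e. \<Prod>i<n. ennreal (exp (a i * e i - (a i)\<^sup>2 / 2)))"
    unfolding distr_std_normal_shift
    using 0 1 by (intro density_PiM[symmetric]) (auto simp: distr_std_normal_shift)
  finally show ?thesis .
qed

section \<open>Linear functionals of the rows of the data\<close>

lemma sets_design_noise_law [simp, measurable_cong]:
  "sets (design_noise_law n p A) =
    sets ((\<Pi>\<^sub>M i\<in>{..<n}. \<Pi>\<^sub>M j\<in>{..<p}. borel) \<Otimes>\<^sub>M (\<Pi>\<^sub>M i\<in>{..<n}. borel))"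
  unfolding design_noise_law_def by (intro sets_pair_measure_cong sets_PiM_cong) auto

lemma design_noise_law_eq:
  "design_noise_law n p A = (\<Pi>\<^sub>M i\<in>{..<n}. normal_law p A) \<Otimes>\<^sub>M (\<Pi>\<^sub>M i\<in>{..<n}. std_normal)"
  by (simp add: design_noise_law_def normal_law_identity)

text \<open>Design entries, products of the design with a column of the precision matrix, and the
  noise itself all have this shape, so one tail bound and one moment bound serve for all of
  them.\<close>

definition row_form :: "nat \<Rightarrow> (nat \<Rightarrow> real) \<Rightarrow> real \<Rightarrow> (nat \<Rightarrow> nat \<Rightarrow> real) \<times> (nat \<Rightarrow> real) \<Rightarrow> nat \<Rightarrow> real" where
  "row_form p a b w i = (\<Sum>j<p. a j * fst w i j) + b * snd w i"

lemma measurable_design_entry [measurable]: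
  assumes "i < n" "j < p"
  shows "(\<lambda>w. fst w i j) \<in> borel_measurable ((\<Pi>\<^sub>M i\<in>{..<n}. \<Pi>\<^sub>M j\<in>{..<p}. borel) \<Otimes>\<^sub>M (\<Pi>\<^sub>M i\<in>{..<n}. borel))"
proof -
  have "(\<lambda>w. fst w i) \<in> measurable ((\<Pi>\<^sub>M i\<in>{..<n}. \<Pi>\<^sub>M j\<in>{..<p}. borel) \<Otimes>\<^sub>M (\<Pi>\<^sub>M i\<in>{..<n}. borel)) (\<Pi>\<^sub>M j\<in>{..<p}. borel)"
    using assms by (intro measurable_compose[OF measurable_fst measurable_component_singleton]) auto
  from measurable_compose[OF this measurable_component_singleton[of j "{..<p}"]] assms
  show ?thesis by simp
qed

lemma measurable_noise_entry [measurable]: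
  assumes "i < n"
  shows "(\<lambda>w. snd w i) \<in> borel_measurable ((\<Pi>\<^sub>M i\<in>{..<n}. \<Pi>\<^sub>M j\<in>{..<p}. borel) \<Otimes>\<^sub>M (\<Pi>\<^sub>M i\<in>{..<n}. borel))"
  using assms by (intro measurable_compose[OF measurable_snd measurable_component_singleton]) auto

lemma measurable_row_form [measurable]:
  assumes "i < n"
  shows "(\<lambda>w. row_form p a b w i) \<in> borel_measurable ((\<Pi>\<^sub>M i\<in>{..<n}. \<Pi>\<^sub>M j\<in>{..<p}. borel) \<Otimes>\<^sub>M (\<Pi>\<^sub>M i\<in>{..<n}. borel))"
  unfolding row_form_def using assms by measurable

text \<open>Integrating over the noise and then over each row adds the variances. The product on
  both sides expresses the independence of the rows as well as their common law; tails, moments and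
  null events are obtained by a choice of \<open>f\<close>.\<close>

lemma nn_integral_prod_row_form:
  assumes cov: "covariance_matrix p A" and inv: "invertible_mat A"
    and f[measurable]: "\<And>i. f i \<in> borel_measurable borel"
  shows "(\<integral>\<^sup>+w. (\<Prod>i<n. f i (row_form p a b w i)) \<partial>design_noise_law n p A) =
    (\<Prod>i<n. \<integral>\<^sup>+z. f i (sqrt (bform p (\<lambda>i j. A $$ (i, j)) a a + b\<^sup>2) * z) \<partial>std_normal)"
proof -
  let ?s = "bform p (\<lambda>i j. A $$ (i, j)) a a"
  interpret N: product_sigma_finite "\<lambda>_::nat. normal_law p A"
    by (rule product_sigma_finite_probI[OF prob_space_normal_law[OF cov inv]])
  interpret X: prob_space "\<Pi>\<^sub>M i\<in>{..<n}. normal_law p A"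
    by (rule prob_space_PiM[OF prob_space_normal_law[OF cov inv]])
  interpret E: prob_space "\<Pi>\<^sub>M i\<in>{..<n}. std_normal" by (rule prob_space_PiM[OF prob_space_std_normal])
  interpret P: pair_sigma_finite "\<Pi>\<^sub>M i\<in>{..<n}. normal_law p A" "\<Pi>\<^sub>M i\<in>{..<n}. std_normal" ..
  define F where "F i x = (\<integral>\<^sup>+e. f i (x + b * e) \<partial>std_normal)" for i x
  have F[measurable]: "F i \<in> borel_measurable borel" for i unfolding F_def by measurable
  have s0: "0 \<le> ?s" by (rule inverse_pd_formsD(5)[OF inverse_pd_forms_of_matrix[OF cov inv]])
  have meas: "(\<lambda>w. \<Prod>i<n. f i (row_form p a b w i)) \<in> borel_measurable (design_noise_law n p A)"
    by measurable
  have "(\<integral>\<^sup>+w. (\<Prod>i<n. f i (row_form p a b w i)) \<partial>design_noise_law n p A) =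
      (\<integral>\<^sup>+x. \<integral>\<^sup>+e. (\<Prod>i<n. f i (row_form p a b (x, e) i)) \<partial>(\<Pi>\<^sub>M i\<in>{..<n}. std_normal) \<partial>(\<Pi>\<^sub>M i\<in>{..<n}. normal_law p A))"
    using meas unfolding design_noise_law_eq by (rule E.nn_integral_fst[symmetric])
  also have "\<dots> = (\<integral>\<^sup>+x. (\<Prod>i<n. F i (\<Sum>j<p. a j * x i j)) \<partial>(\<Pi>\<^sub>M i\<in>{..<n}. normal_law p A))"
    unfolding row_form_def F_def fst_conv snd_conv
    by (intro nn_integral_cong std_normals.product_nn_integral_prod) auto
  also have "\<dots> = (\<Prod>i<n. \<integral>\<^sup>+x. F i (\<Sum>j<p. a j * x j) \<partial>normal_law p A)"
    by (rule N.product_nn_integral_prod) auto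
  also have "\<dots> = (\<Prod>i<n. \<integral>\<^sup>+z. F i (sqrt ?s * z) \<partial>std_normal)"
    by (simp add: nn_integral_normal_law[OF cov inv])
  also have "\<dots> = (\<Prod>i<n. \<integral>\<^sup>+z. f i (sqrt (?s + b\<^sup>2) * z) \<partial>std_normal)"
    unfolding F_def using s0 by (intro prod.cong refl, subst nn_integral_std_normal_add) auto
  finally show ?thesis .
qed

lemma prob_space_design_noise_law:
  assumes "covariance_matrix p A" "invertible_mat A"
  shows "prob_space (design_noise_law n p A)"
proof
  show "emeasure (design_noise_law n p A) (space (design_noise_law n p A)) = 1"
    using nn_integral_prod_row_form[OF assms, of "\<lambda>_ _. 1" n] std_normal.emeasure_space_1 by simp
qed

section \<open>Exponential moments and concentration of sample second moments\<close>

lemma nn_integral_exp_square_std_normal: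
  assumes c: "c < 1/2"
  shows "(\<integral>\<^sup>+z. ennreal (exp (c * z\<^sup>2)) \<partial>std_normal) = ennreal (1 / sqrt (1 - 2 * c))"
proof -
  define s where "s = 1 / sqrt (1 - 2 * c)"
  have s: "0 < s" and s2: "s\<^sup>2 = 1 / (1 - 2 * c)" using c by (auto simp: s_def power_divide)
  have "(\<integral>\<^sup>+z. ennreal (exp (c * z\<^sup>2)) \<partial>std_normal) =
      (\<integral>\<^sup>+z. ennreal (std_normal_density z) * ennreal (exp (c * z\<^sup>2)) \<partial>lborel)"
    unfolding std_normal_def by (subst nn_integral_density) auto
  also have "\<dots> = (\<integral>\<^sup>+z. ennreal s * ennreal (normal_density 0 s z) \<partial>lborel)"
  proof (rule nn_integral_cong)
    fix z
    have "- (z - 0)\<^sup>2 / (2 * s\<^sup>2) = - z\<^sup>2 / 2 + c * z\<^sup>2"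
      unfolding s2 using c by (simp add: field_simps)
    then have "normal_density 0 s z = 1 / sqrt (2 * pi * s\<^sup>2) * (exp (- z\<^sup>2 / 2) * exp (c * z\<^sup>2))"
      unfolding normal_density_def by (simp flip: exp_add)
    also have "sqrt (2 * pi * s\<^sup>2) = sqrt (2 * pi) * s" using s by (simp add: real_sqrt_mult)
    finally have "s * normal_density 0 s z = std_normal_density z * exp (c * z\<^sup>2)"
      using s by (simp add: std_normal_density_def field_simps)
    then show "ennreal (std_normal_density z) * ennreal (exp (c * z\<^sup>2)) = ennreal s * ennreal (normal_density 0 s z)"
      using s by (simp flip: ennreal_mult')
  qed
  also have "\<dots> = ennreal s * (\<integral>\<^sup>+z. ennreal (normal_density 0 s z) \<partial>lborel)"
    by (rule nn_integral_cmult) simp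
  also have "(\<integral>\<^sup>+z. ennreal (normal_density 0 s z) \<partial>lborel) = 1"
    using s by (subst nn_integral_eq_integral) auto
  finally show ?thesis by (simp add: s_def)
qed

text \<open>The logarithm of the left side is expanded to first order; the constant 4 comes from the
  bound 2 y^2 for the remainder of ln (1 + y) at y = - 2 c.\<close>

lemma inverse_sqrt_le_exp:
  fixes c :: real
  assumes "\<bar>c\<bar> \<le> 1/4"
  shows "1 / sqrt (1 - 2 * c) \<le> exp (c + 4 * c\<^sup>2)"
proof -
  have pos: "0 < 1 - 2 * c" using assms by auto
  have "\<bar>ln (1 + (- 2 * c)) - (- 2 * c)\<bar> \<le> 2 * (- 2 * c)\<^sup>2"
    by (rule abs_ln_one_plus_x_minus_x_bound) (use assms in auto)
  then have "- ln (1 - 2 * c) / 2 \<le> c + 4 * c\<^sup>2" by (simp add: power2_eq_square)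
  moreover have "1 / sqrt (1 - 2 * c) = exp (- ln (1 - 2 * c) / 2)"
    using pos by (simp add: powr_half_sqrt[symmetric] powr_def exp_minus inverse_eq_divide)
  ultimately show ?thesis by simp
qed

text \<open>Both signs of \<open>\<theta>\<close> are used for the two tails, and
  \<open>\<theta> = 1\<close> for the chi-square divergence between shifted laws.\<close>

lemma nn_integral_exp_sum_squares:
  assumes cov: "covariance_matrix p A" and inv: "invertible_mat A"
    and s: "s2 = bform p (\<lambda>i j. A $$ (i, j)) a a + b\<^sup>2" and c: "\<bar>\<theta> * s2\<bar> \<le> 1/4"
  shows "(\<integral>\<^sup>+w. ennreal (exp (\<theta> * (\<Sum>i<n. (row_form p a b w i)\<^sup>2))) \<partial>design_noise_law n p A) \<le>
    ennreal (exp (real n * (\<theta> * s2 + 4 * (\<theta> * s2)\<^sup>2)))"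
proof -
  have s0: "0 \<le> s2" unfolding s using inverse_pd_formsD(5)[OF inverse_pd_forms_of_matrix[OF cov inv]] by simp
  have "(\<integral>\<^sup>+w. ennreal (exp (\<theta> * (\<Sum>i<n. (row_form p a b w i)\<^sup>2))) \<partial>design_noise_law n p A) =
      (\<integral>\<^sup>+w. (\<Prod>i<n. ennreal (exp (\<theta> * (row_form p a b w i)\<^sup>2))) \<partial>design_noise_law n p A)"
    by (simp add: sum_distrib_left exp_sum prod_ennreal)
  also have "\<dots> = (\<Prod>i<n. \<integral>\<^sup>+z. ennreal (exp (\<theta> * (sqrt s2 * z)\<^sup>2)) \<partial>std_normal)"
    unfolding s by (rule nn_integral_prod_row_form[OF cov inv]) simp
  also have "\<dots> = (\<Prod>i<n. ennreal (1 / sqrt (1 - 2 * (\<theta> * s2))))"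
    using s0 c nn_integral_exp_square_std_normal[of "\<theta> * s2"] by (simp add: power_mult_distrib mult.assoc)
  also have "\<dots> = ennreal ((1 / sqrt (1 - 2 * (\<theta> * s2))) ^ n)"
    using c by (simp add: ennreal_power)
  also have "\<dots> \<le> ennreal (exp (\<theta> * s2 + 4 * (\<theta> * s2)\<^sup>2) ^ n)"
    using c by (intro ennreal_leI power_mono inverse_sqrt_le_exp) auto
  also have "\<dots> = ennreal (exp (real n * (\<theta> * s2 + 4 * (\<theta> * s2)\<^sup>2)))"
    by (simp add: exp_of_nat_mult)
  finally show ?thesis .
qed

text \<open>Chernoff's inequality; the exponential moment is a nonnegative integral, so that no
  integrability has to be shown first.\<close>

lemma (in prob_space) measure_le_exp_integral:
  assumes [measurable]: "f \<in> borel_measurable M"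
    and le: "(\<integral>\<^sup>+w. ennreal (exp (f w)) \<partial>M) \<le> ennreal B" and B: "0 \<le> B"
  shows "measure M {w \<in> space M. u < f w} \<le> exp (- u) * B"
proof -
  have "emeasure M {w \<in> space M. u < f w} = (\<integral>\<^sup>+w. indicator {w \<in> space M. u < f w} w \<partial>M)"
    by simp
  also have "\<dots> \<le> (\<integral>\<^sup>+w. ennreal (exp (- u)) * ennreal (exp (f w)) \<partial>M)"
  proof (rule nn_integral_mono)
    fix w assume "w \<in> space M"
    have "1 \<le> exp (- u) * exp (f w)" if "u < f w" using that by (simp flip: exp_add)
    then show "indicator {w \<in> space M. u < f w} w \<le> ennreal (exp (- u)) * ennreal (exp (f w))"
      by (auto simp: indicator_def simp flip: ennreal_mult' intro!: ennreal_leI[where x = 1, simplified])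
  qed
  also have "\<dots> = ennreal (exp (- u)) * (\<integral>\<^sup>+w. ennreal (exp (f w)) \<partial>M)"
    by (rule nn_integral_cmult) simp
  also have "\<dots> \<le> ennreal (exp (- u)) * ennreal B" using le by (intro mult_left_mono) auto
  also have "\<dots> = ennreal (exp (- u) * B)" by (simp add: ennreal_mult')
  finally show ?thesis using B by (simp add: emeasure_eq_measure)
qed

lemma sum_squares_tail:
  assumes cov: "covariance_matrix p A" and inv: "invertible_mat A"
    and s2: "bform p (\<lambda>i j. A $$ (i, j)) a a + b\<^sup>2 \<le> s" and s: "0 < s" and t: "0 \<le> t" "t \<le> 1"
  shows "measure (design_noise_law n p A) {w \<in> space (design_noise_law n p A). real n * t * s <
      \<bar>(\<Sum>i<n. (row_form p a b w i)\<^sup>2) - real n * (bform p (\<lambda>i j. A $$ (i, j)) a a + b\<^sup>2)\<bar>}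
    \<le> 2 * exp (- real n * t\<^sup>2 / 16)"
proof -
  let ?D = "design_noise_law n p A"
  interpret D: prob_space ?D by (rule prob_space_design_noise_law[OF cov inv])
  define v where "v = bform p (\<lambda>i j. A $$ (i, j)) a a + b\<^sup>2"
  have v0: "0 \<le> v" unfolding v_def using inverse_pd_formsD(5)[OF inverse_pd_forms_of_matrix[OF cov inv]] by simp
  have vs: "v \<le> s" using s2 by (simp add: v_def)
  define Z where "Z w = (\<Sum>i<n. (row_form p a b w i)\<^sup>2)" for w
  have [measurable]: "Z \<in> borel_measurable ?D" unfolding Z_def by measurable
  \<comment> \<open>The size t / (8 s) of \<open>\<theta>\<close> makes the second-order term at
    most n t^2 / 16, half of the linear gain n t^2 / 8. The two signs give the two tails.\<close>
  have one: "measure ?D {w \<in> space ?D. \<bar>\<theta>\<bar> * (real n * t * s) < \<theta> * (Z w - real n * v)} \<le> exp (- real n * t\<^sup>2 / 16)"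
    if \<theta>: "\<bar>\<theta>\<bar> = t / (8 * s)" for \<theta>
  proof -
    have "\<bar>\<theta> * v\<bar> \<le> t / (8 * s) * s"
      unfolding abs_mult \<theta> using v0 vs t s by (intro mult_left_mono) auto
    then have c: "\<bar>\<theta> * v\<bar> \<le> t / 8" using s by simp
    have "measure ?D {w \<in> space ?D. \<bar>\<theta>\<bar> * (real n * t * s) + \<theta> * (real n * v) < \<theta> * Z w} \<le>
        exp (- (\<bar>\<theta>\<bar> * (real n * t * s) + \<theta> * (real n * v))) * exp (real n * (\<theta> * v + 4 * (\<theta> * v)\<^sup>2))"
      unfolding Z_def using c t
      by (intro D.measure_le_exp_integral nn_integral_exp_sum_squares[OF cov inv v_def]) auto
    also have "\<dots> = exp (real n * (4 * (\<theta> * v)\<^sup>2) - \<bar>\<theta>\<bar> * (real n * t * s))"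
      by (simp add: algebra_simps flip: exp_add)
    also have "\<dots> \<le> exp (- real n * t\<^sup>2 / 16)"
    proof -
      have "(\<theta> * v)\<^sup>2 \<le> (t / 8)\<^sup>2" using c by (simp add: abs_le_square_iff[symmetric] t)
      then have "real n * (4 * (\<theta> * v)\<^sup>2) \<le> real n * (4 * (t / 8)\<^sup>2)"
        by (intro mult_left_mono) auto
      also have "\<dots> = real n * t\<^sup>2 / 16" by (simp add: power_divide)
      finally have "real n * (4 * (\<theta> * v)\<^sup>2) \<le> real n * t\<^sup>2 / 16" .
      moreover have "\<bar>\<theta>\<bar> * (real n * t * s) = real n * t\<^sup>2 / 8"
        unfolding \<theta> using s by (simp add: power2_eq_square)
      ultimately have "real n * (4 * (\<theta> * v)\<^sup>2) - \<bar>\<theta>\<bar> * (real n * t * s) \<le> - real n * t\<^sup>2 / 16" by linarith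
      then show ?thesis by (simp only: exp_le_cancel_iff)
    qed
    finally show ?thesis by (simp add: algebra_simps)
  qed
  show ?thesis
  proof (cases "t = 0")
    case True
    then show ?thesis by (simp add: D.prob_le_1 order_trans[OF D.prob_le_1])
  next
    case False
    then have \<theta>: "0 < t / (8 * s)" using t s by simp
    have sets: "{w \<in> space ?D. real n * t * s < Z w - real n * v} \<in> sets ?D"
      "{w \<in> space ?D. real n * t * s < - (Z w - real n * v)} \<in> sets ?D" by measurable
    have "measure ?D {w \<in> space ?D. real n * t * s < \<bar>Z w - real n * v\<bar>} \<le>
        measure ?D ({w \<in> space ?D. real n * t * s < Z w - real n * v} \<union> {w \<in> space ?D. real n * t * s < - (Z w - real n * v)})"
      by (rule D.finite_measure_mono[OF _ sets.Un[OF sets]]) auto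
    also have "\<dots> \<le> measure ?D {w \<in> space ?D. real n * t * s < Z w - real n * v} +
        measure ?D {w \<in> space ?D. real n * t * s < - (Z w - real n * v)}"
      by (rule measure_Un_le[OF sets])
    also have "\<dots> \<le> exp (- real n * t\<^sup>2 / 16) + exp (- real n * t\<^sup>2 / 16)"
    proof -
      have e1: "{w \<in> space ?D. real n * t * s < Z w - real n * v} =
        {w \<in> space ?D. \<bar>t / (8 * s)\<bar> * (real n * t * s) < (t / (8 * s)) * (Z w - real n * v)}"
      using \<theta> by (simp only: abs_of_pos mult_less_cancel_left_pos)
      have e2: "{w \<in> space ?D. real n * t * s < - (Z w - real n * v)} =
        {w \<in> space ?D. \<bar>- (t / (8 * s))\<bar> * (real n * t * s) < (- (t / (8 * s))) * (Z w - real n * v)}"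
      using \<theta> by (simp only: abs_minus_cancel abs_of_pos minus_mult_commute mult_less_cancel_left_pos)
      show ?thesis unfolding e1 e2 using t s by (intro add_mono one) auto
    qed
    finally show ?thesis unfolding v_def Z_def by simp
  qed
qed

text \<open>Polarisation: a product is a quarter of the difference of the squares of sum and
  difference, and both of these have variance at most 4 s.\<close>

lemma cross_product_tail:
  assumes cov: "covariance_matrix p A" and inv: "invertible_mat A"
    and s1: "bform p (\<lambda>i j. A $$ (i, j)) a a + b\<^sup>2 \<le> s" and s2: "bform p (\<lambda>i j. A $$ (i, j)) a' a' + b'\<^sup>2 \<le> s"
    and s: "0 < s" and t: "0 \<le> t" "t \<le> 1"
  shows "measure (design_noise_law n p A) {w \<in> space (design_noise_law n p A). 2 * real n * t * s <
      \<bar>(\<Sum>i<n. row_form p a b w i * row_form p a' b' w i) - real n * (bform p (\<lambda>i j. A $$ (i, j)) a a' + b * b')\<bar>}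
    \<le> 4 * exp (- real n * t\<^sup>2 / 16)"
proof -
  let ?D = "design_noise_law n p A" and ?S = "\<lambda>i j. A $$ (i, j)"
  interpret D: prob_space ?D by (rule prob_space_design_noise_law[OF cov inv])
  note pd = inverse_pd_forms_of_matrix[OF cov inv]
  define ap am where "ap = (\<lambda>i. a i + a' i)" and "am = (\<lambda>i. a i - a' i)"
  define W where "W a b w = (\<Sum>i<n. (row_form p a b w i)\<^sup>2) - real n * (bform p ?S a a + b\<^sup>2)" for a b w
  have [measurable]: "W a b \<in> borel_measurable ?D" for a b unfolding W_def by measurable
  have comm: "bform p ?S a' a = bform p ?S a a'"
    by (rule bform_commute) (rule inverse_pd_formsD(1)[OF pd])
  have "0 \<le> bform p ?S am am" "0 \<le> bform p ?S ap ap" by (rule inverse_pd_formsD(5)[OF pd])+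
  then have "2 * bform p ?S a a' \<le> bform p ?S a a + bform p ?S a' a'"
    "- 2 * bform p ?S a a' \<le> bform p ?S a a + bform p ?S a' a'"
    by (auto simp: ap_def am_def bform_linear comm)
  moreover have "2 * (b * b') \<le> b\<^sup>2 + b'\<^sup>2" "- 2 * (b * b') \<le> b\<^sup>2 + b'\<^sup>2"
    using zero_le_power2[of "b - b'"] zero_le_power2[of "b + b'"] by (simp_all add: power2_eq_square algebra_simps)
  ultimately have sp: "bform p ?S ap ap + (b + b')\<^sup>2 \<le> 4 * s" "bform p ?S am am + (b - b')\<^sup>2 \<le> 4 * s"
    using s1 s2 by (auto simp: ap_def am_def bform_linear comm power2_eq_square algebra_simps)
  have pol: "(\<Sum>i<n. row_form p a b w i * row_form p a' b' w i) - real n * (bform p ?S a a' + b * b') =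
      (W ap (b + b') w - W am (b - b') w) / 4" for w
  proof -
    have r: "row_form p ap (b + b') w i = row_form p a b w i + row_form p a' b' w i"
      "row_form p am (b - b') w i = row_form p a b w i - row_form p a' b' w i" for i
      by (auto simp: row_form_def ap_def am_def algebra_simps sum.distrib sum_subtractf)
    have "(\<Sum>i<n. (f i + g i)\<^sup>2) - (\<Sum>i<n. (f i - g i)\<^sup>2) = 4 * (\<Sum>i<n. f i * g i)" for f g :: "nat \<Rightarrow> real"
      unfolding sum_subtractf[symmetric] sum_distrib_left
      by (intro sum.cong) (auto simp: power2_eq_square algebra_simps)
    then have 1: "(\<Sum>i<n. (row_form p ap (b + b') w i)\<^sup>2) - (\<Sum>i<n. (row_form p am (b - b') w i)\<^sup>2) =
        4 * (\<Sum>i<n. row_form p a b w i * row_form p a' b' w i)"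
      unfolding r .
    have 2: "(bform p ?S ap ap + (b + b')\<^sup>2) - (bform p ?S am am + (b - b')\<^sup>2) = 4 * (bform p ?S a a' + b * b')"
      by (simp add: ap_def am_def bform_linear comm power2_eq_square algebra_simps)
    have "W ap (b + b') w - W am (b - b') w =
        ((\<Sum>i<n. (row_form p ap (b + b') w i)\<^sup>2) - (\<Sum>i<n. (row_form p am (b - b') w i)\<^sup>2)) -
        real n * ((bform p ?S ap ap + (b + b')\<^sup>2) - (bform p ?S am am + (b - b')\<^sup>2))"
      by (simp add: W_def algebra_simps)
    then show ?thesis unfolding 1 2 by simp
  qed
  have sets: "{w \<in> space ?D. real n * t * (4 * s) < \<bar>W ap (b + b') w\<bar>} \<in> sets ?D"
    "{w \<in> space ?D. real n * t * (4 * s) < \<bar>W am (b - b') w\<bar>} \<in> sets ?D" by measurable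
  have "measure ?D {w \<in> space ?D. 2 * real n * t * s <
      \<bar>(\<Sum>i<n. row_form p a b w i * row_form p a' b' w i) - real n * (bform p ?S a a' + b * b')\<bar>} \<le>
    measure ?D ({w \<in> space ?D. real n * t * (4 * s) < \<bar>W ap (b + b') w\<bar>} \<union>
      {w \<in> space ?D. real n * t * (4 * s) < \<bar>W am (b - b') w\<bar>})"
    unfolding pol by (rule D.finite_measure_mono[OF _ sets.Un[OF sets]]) auto
  also have "\<dots> \<le> measure ?D {w \<in> space ?D. real n * t * (4 * s) < \<bar>W ap (b + b') w\<bar>} +
      measure ?D {w \<in> space ?D. real n * t * (4 * s) < \<bar>W am (b - b') w\<bar>}"
    by (rule measure_Un_le[OF sets])
  also have "\<dots> \<le> 2 * exp (- real n * t\<^sup>2 / 16) + 2 * exp (- real n * t\<^sup>2 / 16)"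
    unfolding W_def using s t sp by (intro add_mono sum_squares_tail[OF cov inv]) auto
  finally show ?thesis by simp
qed

section \<open>Even moments and an inverse moment of the standard normal law\<close>

definition gauss_moment :: "nat \<Rightarrow> real" where
  "gauss_moment k = fact (2 * k) / (2 ^ k * fact k)"

lemma nn_integral_std_normal_moment:
  "(\<integral>\<^sup>+z. ennreal (z ^ (2 * k)) \<partial>std_normal) = ennreal (gauss_moment k)"
proof -
  have "(\<integral>\<^sup>+z. ennreal (z ^ (2 * k)) \<partial>std_normal) = (\<integral>\<^sup>+z. ennreal (std_normal_density z * z ^ (2 * k)) \<partial>lborel)"
    unfolding std_normal_def by (subst nn_integral_density) (auto simp: ennreal_mult')
  also have "\<dots> = ennreal (gauss_moment k)"
    using std_normal_moment_even[of k] unfolding gauss_moment_def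
    by (intro nn_integral_eq_integral[THEN trans]) (auto simp: has_bochner_integral_iff zero_le_even_power)
  finally show ?thesis .
qed

text \<open>At zero, \<open>powr\<close> would give 0; the value is infinite so that products of
  such factors still dominate an inverse sum of squares when one entry vanishes.\<close>

definition inv_sqrt_abs :: "real \<Rightarrow> ennreal" where
  "inv_sqrt_abs z = (if z = 0 then \<infinity> else ennreal (\<bar>z\<bar> powr (- 1/2)))"

lemma measurable_inv_sqrt_abs [measurable]: "inv_sqrt_abs \<in> borel_measurable borel"
  unfolding inv_sqrt_abs_def[abs_def] by measurable

lemma AE_std_normal_nonzero: "AE z in std_normal. z \<noteq> 0"
  unfolding std_normal_def
  by (subst AE_density) (auto intro!: AE_I[where N = "{0}"])

text \<open>The singularity is integrable: the normal density is at most one, the integral of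
  z^(-1/2) over the unit interval is 2, and outside the function is at most one.\<close>

lemma nn_integral_inv_sqrt_abs_finite: "(\<integral>\<^sup>+z. inv_sqrt_abs z \<partial>std_normal) < \<infinity>"
proof -
  define h where "h z = ennreal (indicator {0..1} z * z powr (- 1/2))" for z :: real
  have [measurable]: "h \<in> borel_measurable borel" unfolding h_def by measurable
  have hi: "((\<lambda>z::real. z powr (- 1/2)) has_integral 2) {0..1}"
    using has_integral_powr_from_0[of "-1/2" 1] by simp
  have "(\<lambda>z::real. indicator {0..1} z * z powr (- 1/2)) = (\<lambda>z. if z \<in> {0..1} then z powr (- 1/2) else 0)"
    by (auto simp: fun_eq_iff indicator_def)
  then have "((\<lambda>z::real. indicator {0..1} z * z powr (- 1/2)) has_integral 2) UNIV"
    using hi by (simp only: has_integral_restrict_UNIV)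
  then have "(\<integral>\<^sup>+z. h z \<partial>lborel) = 2"
    unfolding h_def by (intro nn_integral_has_integral_lborel[THEN trans]) auto
  moreover have "(\<integral>\<^sup>+z. h z \<partial>std_normal) \<le> (\<integral>\<^sup>+z. h z \<partial>lborel)"
  proof -
    have "std_normal_density z \<le> 1" for z
    proof -
      have "1 \<le> sqrt (2 * pi)" using pi_gt3 by (intro real_le_rsqrt) auto
      moreover have "exp (- z\<^sup>2 / 2) \<le> 1" by simp
      ultimately have "exp (- z\<^sup>2 / 2) \<le> sqrt (2 * pi)" by linarith
      then show ?thesis unfolding std_normal_density_def by (simp add: divide_le_eq)
    qed
    then have "ennreal (std_normal_density z) * h z \<le> 1 * h z" for z
      by (intro mult_right_mono) (auto simp: ennreal_leI[where y = 1, simplified])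
    then show ?thesis unfolding std_normal_def
      by (subst nn_integral_density) (auto intro!: nn_integral_mono)
  qed
  ultimately have h2: "(\<integral>\<^sup>+z. h z \<partial>std_normal) \<le> 2" by simp
  moreover have "(\<integral>\<^sup>+z. h (- z) \<partial>std_normal) = (\<integral>\<^sup>+z. h z \<partial>std_normal)"
    using nn_integral_std_normal_abs[of h "-1"] by simp
  moreover have "(\<integral>\<^sup>+z. inv_sqrt_abs z \<partial>std_normal) \<le> (\<integral>\<^sup>+z. 1 + h z + h (- z) \<partial>std_normal)"
  proof (rule nn_integral_mono_AE)
    show "AE z in std_normal. inv_sqrt_abs z \<le> 1 + h z + h (- z)"
      using AE_std_normal_nonzero
    proof eventually_elim
      case (elim z)
      consider "\<bar>z\<bar> \<ge> 1" | "0 < z" "z < 1" | "- 1 < z" "z < 0" using elim by linarith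
      then show ?case
      proof cases
        case 1
        have "\<bar>z\<bar> powr (- 1/2) \<le> \<bar>z\<bar> powr 0" using 1 by (intro powr_mono) auto
        then have "\<bar>z\<bar> powr (- 1/2) \<le> 1" using elim by simp
        then show ?thesis using elim
          by (simp add: inv_sqrt_abs_def add.assoc) (metis add_increasing2 ennreal_leI ennreal_1 zero_le)
      next
        case 2
        then have "inv_sqrt_abs z = h z" by (simp add: inv_sqrt_abs_def h_def)
        then show ?thesis by (simp add: add_increasing2 add_increasing)
      next
        case 3
        then have "inv_sqrt_abs z = h (- z)" by (simp add: inv_sqrt_abs_def h_def)
        then show ?thesis by (simp add: add_increasing)
      qed
    qed
  qed
  moreover have "(\<integral>\<^sup>+z. 1 + h z + h (- z) \<partial>std_normal) = 1 + (\<integral>\<^sup>+z. h z \<partial>std_normal) + (\<integral>\<^sup>+z. h (- z) \<partial>std_normal)"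
    using std_normal.emeasure_space_1 by (simp add: nn_integral_add)
  ultimately have "(\<integral>\<^sup>+z. inv_sqrt_abs z \<partial>std_normal) \<le> 1 + 2 + 2"
    by (metis (no_types, lifting) add_mono order_refl order_trans)
  also have "\<dots> < \<infinity>" by (simp add: less_top[symmetric])
  finally show ?thesis .
qed

definition inv_sqrt_moment :: real where
  "inv_sqrt_moment = enn2real (\<integral>\<^sup>+z. inv_sqrt_abs z \<partial>std_normal)"

lemma nn_integral_inv_sqrt_abs:
  assumes "0 < s"
  shows "(\<integral>\<^sup>+z. inv_sqrt_abs (sqrt s * z) \<partial>std_normal) = ennreal (s powr (- 1/4) * inv_sqrt_moment)"
proof -
  have "inv_sqrt_abs (sqrt s * z) = ennreal (s powr (- 1/4)) * inv_sqrt_abs z" for z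
    using assms by (auto simp: inv_sqrt_abs_def abs_mult powr_mult powr_half_sqrt[symmetric] powr_powr ennreal_mult' ennreal_mult_top)
  then have "(\<integral>\<^sup>+z. inv_sqrt_abs (sqrt s * z) \<partial>std_normal) = ennreal (s powr (- 1/4)) * (\<integral>\<^sup>+z. inv_sqrt_abs z \<partial>std_normal)"
    by (simp add: nn_integral_cmult)
  also have "(\<integral>\<^sup>+z. inv_sqrt_abs z \<partial>std_normal) = ennreal inv_sqrt_moment"
    unfolding inv_sqrt_moment_def using nn_integral_inv_sqrt_abs_finite by (simp add: less_top)
  finally show ?thesis by (simp add: ennreal_mult')
qed

subsection \<open>Optimality conditions of the Lasso\<close>

text \<open>The inner product that belongs to the empirical norm. Functions of the row index replace
  vectors, which removes all conditions on dimensions.\<close>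

definition emp :: "nat \<Rightarrow> (nat \<Rightarrow> real) \<Rightarrow> (nat \<Rightarrow> real) \<Rightarrow> real" where
  "emp n f g = (\<Sum>i<n. f i * g i) / real n"

text \<open>The index set is a parameter because a nodewise regression leaves out one column while
  the others keep their indices.\<close>

definition comb :: "nat set \<Rightarrow> (nat \<Rightarrow> nat \<Rightarrow> real) \<Rightarrow> (nat \<Rightarrow> real) \<Rightarrow> nat \<Rightarrow> real" where
  "comb J x b i = (\<Sum>k\<in>J. x i k * b k)"

lemma emp_commute: "emp n f g = emp n g f"
  by (simp add: emp_def mult.commute)

lemma emp_cong: "(\<And>i. i < n \<Longrightarrow> f i = f' i) \<Longrightarrow> (\<And>i. i < n \<Longrightarrow> g i = g' i) \<Longrightarrow> emp n f g = emp n f' g'"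
  by (simp add: emp_def)

lemma emp_nonneg: "0 \<le> emp n f f"
  by (simp add: emp_def sum_nonneg)

lemma emp_add_left: "emp n (\<lambda>i. f i + f' i) g = emp n f g + emp n f' g"
  by (simp add: emp_def algebra_simps sum.distrib add_divide_distrib)

lemma emp_diff_left: "emp n (\<lambda>i. f i - f' i) g = emp n f g - emp n f' g"
  by (simp add: emp_def algebra_simps sum_subtractf diff_divide_distrib)

lemma emp_add_right: "emp n g (\<lambda>i. f i + f' i) = emp n g f + emp n g f'"
  by (simp add: emp_def algebra_simps sum.distrib add_divide_distrib)

lemma emp_diff_right: "emp n g (\<lambda>i. f i - f' i) = emp n g f - emp n g f'"
  by (simp add: emp_def algebra_simps sum_subtractf diff_divide_distrib)

lemma emp_scale_left: "emp n (\<lambda>i. t * f i) g = t * emp n f g"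
  by (simp add: emp_def sum_distrib_left mult_ac)

lemma emp_scale_right: "emp n g (\<lambda>i. t * f i) = t * emp n g f"
  by (simp add: emp_def sum_distrib_left mult_ac)

lemmas emp_linear = emp_add_left emp_diff_left emp_add_right emp_diff_right emp_scale_left emp_scale_right

lemma emp_comb_left: "emp n (comb J x b) g = (\<Sum>k\<in>J. b k * emp n (\<lambda>i. x i k) g)"
proof -
  have "(\<Sum>i<n. comb J x b i * g i) = (\<Sum>k\<in>J. \<Sum>i<n. x i k * b k * g i)"
    by (simp add: comb_def sum_distrib_right) (rule sum.swap)
  then show ?thesis
    by (simp add: emp_def sum_divide_distrib sum_distrib_left mult_ac)
qed

lemma emp_comb_right: "emp n g (comb J x b) = (\<Sum>k\<in>J. b k * emp n g (\<lambda>i. x i k))"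
  by (simp add: emp_commute[of n g] emp_comb_left)

lemma abs_emp_comb_le:
  assumes "\<And>k. k \<in> J \<Longrightarrow> \<bar>emp n (\<lambda>i. x i k) g\<bar> \<le> M"
  shows "\<bar>emp n (comb J x b) g\<bar> \<le> M * (\<Sum>k\<in>J. \<bar>b k\<bar>)"
proof -
  have "\<bar>emp n (comb J x b) g\<bar> \<le> (\<Sum>k\<in>J. \<bar>b k * emp n (\<lambda>i. x i k) g\<bar>)"
    unfolding emp_comb_left by (rule sum_abs)
  also have "\<dots> \<le> (\<Sum>k\<in>J. \<bar>b k\<bar> * M)"
    unfolding abs_mult using assms by (intro sum_mono mult_left_mono) auto
  finally show ?thesis by (simp add: sum_distrib_left mult.commute)
qed

lemma comb_add: "comb J x (\<lambda>k. a k + b k) i = comb J x a i + comb J x b i"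
  by (simp add: comb_def algebra_simps sum.distrib)

lemma comb_diff: "comb J x (\<lambda>k. a k - b k) i = comb J x a i - comb J x b i"
  by (simp add: comb_def algebra_simps sum_subtractf)

lemma comb_scale: "comb J x (\<lambda>k. t * b k) i = t * comb J x b i"
  by (simp add: comb_def sum_distrib_left mult_ac)

text \<open>Dual feasibility and equality in Hoelder's inequality. For a nonnegative penalty this is
  the subgradient condition without a sign vector.\<close>

definition lasso_kkt :: "nat set \<Rightarrow> nat \<Rightarrow> (nat \<Rightarrow> nat \<Rightarrow> real) \<Rightarrow> (nat \<Rightarrow> real) \<Rightarrow> real \<Rightarrow> (nat \<Rightarrow> real) \<Rightarrow> bool" where
  "lasso_kkt J n x y lam b \<longleftrightarrow>
     (\<forall>k\<in>J. \<bar>emp n (\<lambda>i. x i k) (\<lambda>i. y i - comb J x b i)\<bar> \<le> lam) \<and>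
     emp n (comb J x b) (\<lambda>i. y i - comb J x b i) = lam * (\<Sum>k\<in>J. \<bar>b k\<bar>)"

text \<open>A first-order condition without derivatives: for small \<open>t\<close> with the sign of
  \<open>A\<close> the quadratic term is dominated by the linear one.\<close>

lemma abs_le_of_quadratic_bound:
  fixes A B L :: real
  assumes "\<And>t. \<bar>t\<bar> \<le> 1 \<Longrightarrow> 2 * t * A \<le> t\<^sup>2 * B + 2 * L * \<bar>t\<bar>"
  shows "\<bar>A\<bar> \<le> L"
proof (rule ccontr)
  assume "\<not> ?thesis"
  then have pos: "0 < \<bar>A\<bar> - L" by simp
  define t where "t = min 1 ((\<bar>A\<bar> - L) / (\<bar>B\<bar> + 1))"
  have t: "0 < t" "t \<le> 1" using pos by (auto simp: t_def)
  have "2 * t * \<bar>A\<bar> \<le> t\<^sup>2 * B + 2 * L * t"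
    using assms[of t] assms[of "- t"] t by (cases "0 \<le> A") auto
  then have "t * (2 * (\<bar>A\<bar> - L)) \<le> t * (t * B)" by (simp add: power2_eq_square algebra_simps)
  then have "2 * (\<bar>A\<bar> - L) \<le> t * B" using t by simp
  also have "\<dots> \<le> t * (\<bar>B\<bar> + 1)" using t by (intro mult_left_mono) auto
  also have "\<dots> \<le> (\<bar>A\<bar> - L) / (\<bar>B\<bar> + 1) * (\<bar>B\<bar> + 1)" by (intro mult_right_mono) (auto simp: t_def)
  also have "\<dots> = \<bar>A\<bar> - L" by simp
  finally show False using pos by simp
qed

text \<open>The bounds come from changes of a single coefficient. The equality comes from rescaling
  \<open>b\<close> by 1 + t: for |t| \<le> 1 the penalty is linear in \<open>t\<close>, so both
  signs can be used without loss.\<close>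

lemma lasso_kkt_of_minimiser:
  assumes fin: "finite J" and lam: "0 \<le> lam"
    and min: "\<And>b'. emp n (\<lambda>i. y i - comb J x b i) (\<lambda>i. y i - comb J x b i) + 2 * lam * (\<Sum>k\<in>J. \<bar>b k\<bar>) \<le>
      emp n (\<lambda>i. y i - comb J x b' i) (\<lambda>i. y i - comb J x b' i) + 2 * lam * (\<Sum>k\<in>J. \<bar>b' k\<bar>)"
  shows "lasso_kkt J n x y lam b"
proof -
  define r where "r = (\<lambda>i. y i - comb J x b i)"
  have main: "2 * t * emp n (comb J x g) r \<le> t\<^sup>2 * emp n (comb J x g) (comb J x g) +
      2 * lam * ((\<Sum>k\<in>J. \<bar>b k + t * g k\<bar>) - (\<Sum>k\<in>J. \<bar>b k\<bar>))" for g t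
  proof -
    have eq: "(\<lambda>i. y i - comb J x (\<lambda>k. b k + t * g k) i) = (\<lambda>i. r i - t * comb J x g i)"
      by (auto simp: r_def comb_add comb_scale)
    have "emp n (\<lambda>i. r i - t * comb J x g i) (\<lambda>i. r i - t * comb J x g i) =
        emp n r r - 2 * t * emp n (comb J x g) r + t\<^sup>2 * emp n (comb J x g) (comb J x g)"
      by (simp add: emp_linear emp_commute[of n r "comb J x g"] power2_eq_square algebra_simps)
    then show ?thesis
      using min[of "\<lambda>k. b k + t * g k"] unfolding eq by (simp add: r_def algebra_simps)
  qed
  have "\<bar>emp n (\<lambda>i. x i k) r\<bar> \<le> lam" if k: "k \<in> J" for k
  proof (rule abs_le_of_quadratic_bound)
    fix t :: real
    let ?g = "\<lambda>l. if l = k then 1 else 0 :: real"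
    have c: "comb J x ?g = (\<lambda>i. x i k)"
      using fin k by (simp add: comb_def fun_eq_iff if_distrib[of "(*) _"] cong: if_cong)
    have "(\<Sum>l\<in>J. \<bar>b l + t * ?g l\<bar>) \<le> (\<Sum>l\<in>J. \<bar>b l\<bar> + (if l = k then \<bar>t\<bar> else 0))"
      by (intro sum_mono) auto
    also have "\<dots> = (\<Sum>l\<in>J. \<bar>b l\<bar>) + \<bar>t\<bar>" using fin k by (simp add: sum.distrib)
    finally have "lam * ((\<Sum>l\<in>J. \<bar>b l + t * ?g l\<bar>) - (\<Sum>l\<in>J. \<bar>b l\<bar>)) \<le> lam * \<bar>t\<bar>"
      using lam by (intro mult_left_mono) auto
    then show "2 * t * emp n (\<lambda>i. x i k) r \<le> t\<^sup>2 * emp n (\<lambda>i. x i k) (\<lambda>i. x i k) + 2 * lam * \<bar>t\<bar>"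
      using main[of t ?g] unfolding c by linarith
  qed
  moreover have "\<bar>emp n (comb J x b) r - lam * (\<Sum>k\<in>J. \<bar>b k\<bar>)\<bar> \<le> 0"
  proof (rule abs_le_of_quadratic_bound)
    fix t :: real assume "\<bar>t\<bar> \<le> 1"
    then have "0 \<le> 1 + t" by linarith
    moreover have "b k + t * b k = (1 + t) * b k" for k by (simp add: algebra_simps)
    ultimately have "\<bar>b k + t * b k\<bar> = (1 + t) * \<bar>b k\<bar>" for k
      by (simp only: abs_mult abs_of_nonneg)
    then have "(\<Sum>k\<in>J. \<bar>b k + t * b k\<bar>) - (\<Sum>k\<in>J. \<bar>b k\<bar>) = t * (\<Sum>k\<in>J. \<bar>b k\<bar>)"
      by (simp add: algebra_simps sum.distrib sum_distrib_left)
    then show "2 * t * (emp n (comb J x b) r - lam * (\<Sum>k\<in>J. \<bar>b k\<bar>)) \<le>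
        t\<^sup>2 * emp n (comb J x b) (comb J x b) + 2 * 0 * \<bar>t\<bar>"
      using main[of t b] by (simp add: algebra_simps)
  qed
  ultimately show ?thesis by (simp add: lasso_kkt_def r_def)
qed

text \<open>Pairing the residual with the error \<open>\<delta>\<close> exploits stationarity;
  relative to the quadratic term this gains a factor two over a comparison of objective
  values.\<close>

lemma lasso_kkt_basic:
  assumes kkt: "lasso_kkt J n x y lam b" and y: "\<And>i. i < n \<Longrightarrow> y i = comb J x \<beta> i + e i"
  defines "\<delta> \<equiv> (\<lambda>k. b k - \<beta> k)"
  shows "emp n (comb J x \<delta>) (comb J x \<delta>) + lam * (\<Sum>k\<in>J. \<bar>b k\<bar>) \<le> emp n (comb J x \<delta>) e + lam * (\<Sum>k\<in>J. \<bar>\<beta> k\<bar>)"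
proof -
  define r where "r = (\<lambda>i. y i - comb J x b i)"
  have "emp n (comb J x \<delta>) r = emp n (comb J x \<delta>) e - emp n (comb J x \<delta>) (comb J x \<delta>)"
    unfolding emp_diff_right[symmetric] by (rule emp_cong) (auto simp: r_def \<delta>_def y comb_diff)
  moreover have "emp n (comb J x \<delta>) r = emp n (comb J x b) r - emp n (comb J x \<beta>) r"
    unfolding emp_diff_left[symmetric] by (rule emp_cong) (auto simp: \<delta>_def comb_diff)
  moreover have "emp n (comb J x b) r = lam * (\<Sum>k\<in>J. \<bar>b k\<bar>)"
    using kkt by (simp add: lasso_kkt_def r_def)
  moreover have "\<bar>emp n (comb J x \<beta>) r\<bar> \<le> lam * (\<Sum>k\<in>J. \<bar>\<beta> k\<bar>)"
    using kkt by (intro abs_emp_comb_le) (auto simp: lasso_kkt_def r_def)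
  ultimately show ?thesis by linarith
qed

text \<open>Holds for every design and every noise, as is needed for moments on the bad event. The
  quadratic term of the basic inequality is spent on completing the square against the
  noise.\<close>

lemma lasso_l1_error_crude:
  assumes kkt: "lasso_kkt J n x y lam b" and y: "\<And>i. i < n \<Longrightarrow> y i = comb J x \<beta> i + e i" and lam: "0 < lam"
  shows "(\<Sum>k\<in>J. \<bar>b k - \<beta> k\<bar>) \<le> emp n e e / (4 * lam) + 2 * (\<Sum>k\<in>J. \<bar>\<beta> k\<bar>)"
proof -
  define c where "c = comb J x (\<lambda>k. b k - \<beta> k)"
  have "0 \<le> emp n (\<lambda>i. c i - (1/2) * e i) (\<lambda>i. c i - (1/2) * e i)" by (rule emp_nonneg)
  also have "\<dots> = emp n c c - emp n c e + emp n e e / 4"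
    by (simp only: emp_linear emp_commute[of n e c])
  finally have "lam * (\<Sum>k\<in>J. \<bar>b k\<bar>) \<le> emp n e e / 4 + lam * (\<Sum>k\<in>J. \<bar>\<beta> k\<bar>)"
    using lasso_kkt_basic[OF kkt y, folded c_def] by simp
  then have "(\<Sum>k\<in>J. \<bar>b k\<bar>) \<le> (emp n e e / 4 + lam * (\<Sum>k\<in>J. \<bar>\<beta> k\<bar>)) / lam"
    using lam by (simp add: pos_le_divide_eq mult.commute)
  also have "\<dots> = emp n e e / (4 * lam) + (\<Sum>k\<in>J. \<bar>\<beta> k\<bar>)"
    using lam by (simp add: add_divide_distrib)
  finally have "(\<Sum>k\<in>J. \<bar>b k\<bar>) \<le> emp n e e / (4 * lam) + (\<Sum>k\<in>J. \<bar>\<beta> k\<bar>)" .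
  moreover have "(\<Sum>k\<in>J. \<bar>b k - \<beta> k\<bar>) \<le> (\<Sum>k\<in>J. \<bar>b k\<bar>) + (\<Sum>k\<in>J. \<bar>\<beta> k\<bar>)"
    unfolding sum.distrib[symmetric] by (rule sum_mono) simp
  ultimately show ?thesis by simp
qed

text \<open>
  The error lies in the cone \<open>|\<delta>|\<^sub>1 \<le> 4 |\<delta>\<^sub>S|\<^sub>1\<close> if the noise is dominated by the penalty, and trivially if
  \<open>S\<close> is the whole index set. The second case needs no relation between noise and penalty and serves the
  regime in which \<open>p\<close> is a small power of \<open>n\<close>.
\<close>
lemma lasso_l1_error:
  assumes kkt: "lasso_kkt J n x y lam b" and y: "\<And>i. i < n \<Longrightarrow> y i = comb J x \<beta> i + e i"
    and fin: "finite J" and lam: "0 < lam" and M: "0 \<le> M" "\<And>k. k \<in> J \<Longrightarrow> \<bar>emp n (\<lambda>i. x i k) e\<bar> \<le> M"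
    and S: "S \<subseteq> J" "\<And>k. k \<in> J - S \<Longrightarrow> \<beta> k = 0" "real (card S) \<le> s" and s: "0 < s"
    and regime: "S = J \<or> 2 * M \<le> lam" and Lam: "0 < \<Lambda>"
    and re: "\<And>\<delta>. \<Lambda> * (\<Sum>k\<in>J. (\<delta> k)\<^sup>2) - \<Lambda> / (32 * s) * (\<Sum>k\<in>J. \<bar>\<delta> k\<bar>)\<^sup>2 \<le> emp n (comb J x \<delta>) (comb J x \<delta>)"
  shows "(\<Sum>k\<in>J. \<bar>b k - \<beta> k\<bar>) \<le> 32 * s * (lam + M) / \<Lambda>"
proof -
  define \<delta> where "\<delta> = (\<lambda>k. b k - \<beta> k)"
  define E where "E = emp n (comb J x \<delta>) (comb J x \<delta>)"
  define D where "D = (\<Sum>k\<in>J. \<bar>\<delta> k\<bar>)"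
  define a where "a = (\<Sum>k\<in>S. \<bar>\<delta> k\<bar>)"
  define c where "c = (\<Sum>k\<in>J - S. \<bar>\<delta> k\<bar>)"
  have finS: "finite S" using fin S finite_subset by blast
  have Dac: "D = a + c"
    unfolding D_def a_def c_def using fin S(1) by (simp add: sum.subset_diff add.commute)
  have a0: "0 \<le> a" and c0: "0 \<le> c" by (auto simp: a_def c_def intro: sum_nonneg)
  have "emp n (comb J x \<delta>) e \<le> M * D"
    using abs_emp_comb_le[of J n x e M \<delta>] M by (auto simp: D_def)
  moreover have "(\<Sum>k\<in>J. \<bar>\<beta> k\<bar>) - (\<Sum>k\<in>J. \<bar>b k\<bar>) \<le> a - c"
  proof -
    have "(\<Sum>k\<in>J. \<bar>\<beta> k\<bar>) - (\<Sum>k\<in>J. \<bar>b k\<bar>) = (\<Sum>k\<in>J. \<bar>\<beta> k\<bar> - \<bar>b k\<bar>)" by (simp add: sum_subtractf)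
    also have "\<dots> = (\<Sum>k\<in>J - S. \<bar>\<beta> k\<bar> - \<bar>b k\<bar>) + (\<Sum>k\<in>S. \<bar>\<beta> k\<bar> - \<bar>b k\<bar>)"
      using fin S(1) by (rule sum.subset_diff[rotated])
    also have "(\<Sum>k\<in>J - S. \<bar>\<beta> k\<bar> - \<bar>b k\<bar>) = - c"
      unfolding c_def sum_negf[symmetric] using S(2) by (intro sum.cong) (auto simp: \<delta>_def)
    also have "(\<Sum>k\<in>S. \<bar>\<beta> k\<bar> - \<bar>b k\<bar>) \<le> a"
      unfolding a_def \<delta>_def by (intro sum_mono) auto
    finally show ?thesis by simp
  qed
  then have "lam * ((\<Sum>k\<in>J. \<bar>\<beta> k\<bar>) - (\<Sum>k\<in>J. \<bar>b k\<bar>)) \<le> lam * (a - c)"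
    using lam by (intro mult_left_mono) auto
  ultimately have E: "E \<le> M * D + lam * (a - c)"
    using lasso_kkt_basic[OF kkt y, folded \<delta>_def] by (simp add: E_def algebra_simps)
  have D4: "D \<le> 4 * a"
  proof (cases "S = J")
    case True
    then have "c = 0" by (simp add: c_def)
    then show ?thesis using Dac a0 by simp
  next
    case False
    then have "2 * M \<le> lam" using regime by blast
    then have "M * D \<le> lam / 2 * D" using Dac a0 c0 by (intro mult_right_mono) auto
    moreover have "0 \<le> E" unfolding E_def by (rule emp_nonneg)
    ultimately have "0 \<le> lam / 2 * D + lam * (a - c)" using E by linarith
    also have "\<dots> = lam / 2 * (3 * a - c)" by (simp add: Dac algebra_simps)
    finally have "c \<le> 3 * a" using lam by (simp add: zero_le_mult_iff)
    then show ?thesis using Dac by simp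
  qed
  have "a\<^sup>2 \<le> (\<Sum>k\<in>S. 1\<^sup>2) * (\<Sum>k\<in>S. \<bar>\<delta> k\<bar>\<^sup>2)"
    using Cauchy_Schwarz_ineq_sum[of "\<lambda>_. 1" "\<lambda>k. \<bar>\<delta> k\<bar>" S] by (simp add: a_def)
  also have "\<dots> \<le> s * (\<Sum>k\<in>J. (\<delta> k)\<^sup>2)"
    using S fin s by (intro mult_mono) (auto intro: sum_nonneg sum_mono2)
  finally have "(4 * a)\<^sup>2 \<le> 16 * s * (\<Sum>k\<in>J. (\<delta> k)\<^sup>2)" by (simp add: power_mult_distrib)
  moreover have "D\<^sup>2 \<le> (4 * a)\<^sup>2" using D4 Dac a0 c0 by (intro power_mono) auto
  ultimately have "D\<^sup>2 \<le> 16 * s * (\<Sum>k\<in>J. (\<delta> k)\<^sup>2)" by linarith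
  \<comment> \<open>The cone condition turns the curvature into \<open>\<Lambda> / (16 * s)\<close>
    times the squared l1 norm. The perturbation allowed in \<open>re\<close> is half of this, and
    the other half remains to control the error.\<close>
  then have "\<Lambda> / (16 * s) * D\<^sup>2 \<le> \<Lambda> / (16 * s) * (16 * s * (\<Sum>k\<in>J. (\<delta> k)\<^sup>2))"
    using Lam s by (intro mult_left_mono) auto
  also have "\<dots> = \<Lambda> * (\<Sum>k\<in>J. (\<delta> k)\<^sup>2)" using s by simp
  finally have "\<Lambda> / (16 * s) * D\<^sup>2 - \<Lambda> / (32 * s) * D\<^sup>2 \<le> E"
    using re[of \<delta>] by (simp add: E_def D_def)
  moreover have "lam * (a - c) \<le> lam * D" using lam Dac c0 by (intro mult_left_mono) auto
  ultimately have "\<Lambda> / (16 * s) * D\<^sup>2 - \<Lambda> / (32 * s) * D\<^sup>2 \<le> (lam + M) * D"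
    using E by (simp add: algebra_simps)
  then have *: "\<Lambda> / (32 * s) * D * D \<le> (lam + M) * D"
    by (simp add: power2_eq_square field_simps)
  have "D \<le> 32 * s * (lam + M) / \<Lambda>"
  proof (cases "D = 0")
    case True
    then show ?thesis using s lam M Lam by simp
  next
    case False
    then have "0 < D" using Dac a0 c0 by simp
    with * have "\<Lambda> / (32 * s) * D \<le> lam + M" by (rule mult_right_le_imp_le)
    then show ?thesis using Lam s by (simp add: field_simps)
  qed
  then show ?thesis by (simp add: D_def \<delta>_def)
qed

section \<open>From vectors and matrices to functions of the indices\<close>

lemma nnorm_power2:
  assumes "v \<in> carrier_vec n"
  shows "(nnorm v)\<^sup>2 = emp n (($) v) (($) v)"
proof -
  have "0 \<le> v \<bullet> v" using assms by (simp add: scalar_prod_def sum_nonneg)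
  then show ?thesis
    using assms by (simp add: nnorm_def l2norm_def power_divide emp_def scalar_prod_def atLeast0LessThan)
qed

lemma lasso_objective_eq:
  assumes b: "b \<in> carrier_vec q" and Y: "Y \<in> carrier_vec n"
  shows "lasso_objective lam (mat n q (\<lambda>(i, k). z i k)) Y b =
    emp n (\<lambda>i. Y $ i - comb {..<q} z (($) b) i) (\<lambda>i. Y $ i - comb {..<q} z (($) b) i) +
    2 * lam * (\<Sum>k\<in>{..<q}. \<bar>b $ k\<bar>)"
proof -
  let ?v = "Y - mat n q (\<lambda>(i, k). z i k) *\<^sub>v b"
  have v: "?v \<in> carrier_vec n" by (intro carrier_vecI) simp
  have "?v $ i = Y $ i - comb {..<q} z (($) b) i" if "i < n" for i
    using that Y b by (simp add: scalar_prod_def comb_def atLeast0LessThan)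
  then have "emp n (($) ?v) (($) ?v) =
      emp n (\<lambda>i. Y $ i - comb {..<q} z (($) b) i) (\<lambda>i. Y $ i - comb {..<q} z (($) b) i)"
    by (intro emp_cong) auto
  then show ?thesis
    using b unfolding lasso_objective_def nnorm_power2[OF v] by (simp add: l1norm_def)
qed

lemma lasso_kkt_of_is_lasso:
  assumes lasso: "is_lasso lam (mat n q (\<lambda>(i, k). z i k)) Y b" and Y: "Y \<in> carrier_vec n" and lam: "0 \<le> lam"
  shows "b \<in> carrier_vec q" "lasso_kkt {..<q} n z (($) Y) lam (($) b)"
proof -
  let ?o = "lasso_objective lam (mat n q (\<lambda>(i, k). z i k)) Y"
  show b: "b \<in> carrier_vec q" using lasso by (simp add: is_lasso_def is_arg_min_def)
  have min: "?o b \<le> ?o b'" if "b' \<in> carrier_vec q" for b'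
    using lasso that by (auto simp: is_lasso_def is_arg_min_def not_less)
  show "lasso_kkt {..<q} n z (($) Y) lam (($) b)"
  proof (rule lasso_kkt_of_minimiser)
    fix b' :: "nat \<Rightarrow> real"
    have c: "comb {..<q} z (($) (vec q b')) = comb {..<q} z b'"
      by (simp add: comb_def fun_eq_iff)
    show "emp n (\<lambda>i. Y $ i - comb {..<q} z (($) b) i) (\<lambda>i. Y $ i - comb {..<q} z (($) b) i) +
        2 * lam * (\<Sum>k\<in>{..<q}. \<bar>b $ k\<bar>) \<le>
      emp n (\<lambda>i. Y $ i - comb {..<q} z b' i) (\<lambda>i. Y $ i - comb {..<q} z b' i) +
        2 * lam * (\<Sum>k\<in>{..<q}. \<bar>b' k\<bar>)"
      using min[of "vec q b'"] by (simp add: lasso_objective_eq b Y c)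
  qed (use lam in auto)
qed

text \<open>Carries a regression on p - 1 renumbered columns back to the original indices.\<close>

lemma lasso_kkt_reindex:
  assumes kkt: "lasso_kkt I n (\<lambda>i k. x i (h k)) y lam b'" and h: "bij_betw h I J"
    and b: "\<And>k. k \<in> I \<Longrightarrow> b (h k) = b' k"
  shows "lasso_kkt J n x y lam b"
proof -
  have c: "comb J x b i = comb I (\<lambda>i k. x i (h k)) b' i" for i
    unfolding comb_def sum.reindex_bij_betw[OF h, symmetric] by (simp add: b)
  have s: "(\<Sum>k\<in>J. \<bar>b k\<bar>) = (\<Sum>k\<in>I. \<bar>b' k\<bar>)"
    unfolding sum.reindex_bij_betw[OF h, symmetric] by (simp add: b)
  have ball: "(\<forall>k\<in>J. P k) \<longleftrightarrow> (\<forall>k\<in>I. P (h k))" for P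
    using h by (auto simp: bij_betw_def)
  have c': "comb J x b = comb I (\<lambda>i k. x i (h k)) b'" by (rule ext) (rule c)
  show ?thesis using kkt unfolding lasso_kkt_def c' s ball .
qed

lemma bij_betw_insert_index:
  assumes "j < p"
  shows "bij_betw (insert_index j) {..<p - 1} ({..<p} - {j})"
  using assms
  by (intro bij_betw_byWitness[where f' = "delete_index j"]) (auto simp: insert_index_def delete_index_def)

text \<open>The j-th column of \<open>theta_hat\<close> before the division by
  \<open>tau_sq\<close>. With it the nodewise residual is a combination of all columns.\<close>

definition node_coef :: "nat \<Rightarrow> real vec \<Rightarrow> nat \<Rightarrow> real" where
  "node_coef j g k = (if k = j then 1 else - (g $ delete_index j k))"

text \<open>Here \<open>\<tau>\<close> is the squared scale \<open>tau_sq\<close>. Complementary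
  slackness makes it equal to the product of the residual with its own column, and this equality is
  what lets the error of the corrected coordinate cancel exactly.\<close>

definition nodewise_facts ::
  "nat \<Rightarrow> nat \<Rightarrow> (nat \<Rightarrow> nat \<Rightarrow> real) \<Rightarrow> real \<Rightarrow> nat \<Rightarrow> (nat \<Rightarrow> real) \<Rightarrow> real \<Rightarrow> bool" where
  "nodewise_facts n p x lam j u \<tau> \<longleftrightarrow> u j = 1 \<and>
     lasso_kkt ({..<p} - {j}) n x (\<lambda>i. x i j) lam (\<lambda>k. - u k) \<and>
     (\<forall>k<p. k \<noteq> j \<longrightarrow> \<bar>emp n (\<lambda>i. x i k) (comb {..<p} x u)\<bar> \<le> lam) \<and>
     emp n (\<lambda>i. x i j) (comb {..<p} x u) = \<tau> \<and>
     \<tau> = emp n (comb {..<p} x u) (comb {..<p} x u) + lam * (\<Sum>k\<in>{..<p} - {j}. \<bar>u k\<bar>)"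

lemma comb_remove:
  assumes "j < p"
  shows "comb {..<p} x u i = x i j * u j + comb ({..<p} - {j}) x u i"
  using assms by (simp add: comb_def sum.remove)

lemma remove_col_design:
  "j < p \<Longrightarrow> remove_col (design n p x) j = mat n (p - 1) (\<lambda>(i, k). x i (insert_index j k))"
  by (intro eq_matI) (auto simp: remove_col_def design_def insert_index_def)

lemma col_design: "j < p \<Longrightarrow> col (design n p x) j = vec n (\<lambda>i. x i j)"
  by (intro eq_vecI) (auto simp: design_def)

lemma comb_remove_node_coef:
  assumes "j < p"
  shows "x i j - comb ({..<p} - {j}) x (\<lambda>k. - node_coef j g k) i = comb {..<p} x (node_coef j g) i"
proof -
  have "comb ({..<p} - {j}) x (\<lambda>k. - node_coef j g k) i = - comb ({..<p} - {j}) x (node_coef j g) i"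
    by (simp add: comb_def sum_negf)
  then show ?thesis by (simp add: comb_remove[OF assms] node_coef_def[of j g j])
qed

lemma tau_sq_design:
  assumes j: "j < p" and g: "g \<in> carrier_vec (p - 1)"
  shows "tau_sq lam (design n p x) j g =
    emp n (comb {..<p} x (node_coef j g)) (comb {..<p} x (node_coef j g)) +
    lam * (\<Sum>k\<in>{..<p} - {j}. \<bar>node_coef j g k\<bar>)"
proof -
  let ?v = "vec n (\<lambda>i. x i j) - mat n (p - 1) (\<lambda>(i, k). x i (insert_index j k)) *\<^sub>v g"
  have v: "?v \<in> carrier_vec n" by (intro carrier_vecI) simp
  have "?v $ i = comb {..<p} x (node_coef j g) i" if "i < n" for i
  proof -
    have "comb ({..<p} - {j}) x (\<lambda>k. - node_coef j g k) i = (\<Sum>k<p - 1. x i (insert_index j k) * g $ k)"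
      unfolding comb_def sum.reindex_bij_betw[OF bij_betw_insert_index[OF j], symmetric]
      by (simp add: node_coef_def)
    then show ?thesis
      using that g by (simp add: scalar_prod_def atLeast0LessThan comb_remove_node_coef[OF j, symmetric])
  qed
  then have "(nnorm ?v)\<^sup>2 = emp n (comb {..<p} x (node_coef j g)) (comb {..<p} x (node_coef j g))"
    unfolding nnorm_power2[OF v] by (intro emp_cong) auto
  moreover have "l1norm g = (\<Sum>k\<in>{..<p} - {j}. \<bar>node_coef j g k\<bar>)"
    unfolding sum.reindex_bij_betw[OF bij_betw_insert_index[OF j], symmetric]
    using g by (simp add: node_coef_def l1norm_def)
  ultimately show ?thesis by (simp add: tau_sq_def remove_col_design[OF j] col_design[OF j])
qed

lemma nodewise_facts_of_is_nodewise_lasso: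
  assumes lasso: "is_nodewise_lasso lam (design n p x) j g" and j: "j < p" and lam: "0 \<le> lam"
  shows "nodewise_facts n p x lam j (node_coef j g) (tau_sq lam (design n p x) j g)"
proof -
  let ?u = "node_coef j g" and ?J = "{..<p} - {j}" and ?z = "\<lambda>i k. x i (insert_index j k)"
  define r where "r = comb {..<p} x ?u"
  note rem = remove_col_design[OF j, of n x] and co = col_design[OF j, of n x]
  have lasso': "is_lasso lam (mat n (p - 1) (\<lambda>(i, k). ?z i k)) (vec n (\<lambda>i. x i j)) g"
    using lasso by (simp add: is_nodewise_lasso_def rem co)
  have g: "g \<in> carrier_vec (p - 1)" by (rule lasso_kkt_of_is_lasso[OF lasso' _ lam]) simp
  have kk: "lasso_kkt {..<p - 1} n ?z (($) (vec n (\<lambda>i. x i j))) lam (($) g)"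
    by (rule lasso_kkt_of_is_lasso[OF lasso' _ lam]) simp
  have "lasso_kkt {..<p - 1} n ?z (\<lambda>i. x i j) lam (($) g)"
  proof -
    have "emp n f (\<lambda>i. vec n (\<lambda>i. x i j) $ i - h i) = emp n f (\<lambda>i. x i j - h i)" for f h
      by (rule emp_cong) auto
    with kk show ?thesis by (simp add: lasso_kkt_def)
  qed
  then have kkt: "lasso_kkt ?J n x (\<lambda>i. x i j) lam (\<lambda>k. - ?u k)"
  proof (rule lasso_kkt_reindex)
    show "bij_betw (insert_index j) {..<p - 1} ?J" by (rule bij_betw_insert_index[OF j])
    show "- node_coef j g (insert_index j k) = g $ k" if "k \<in> {..<p - 1}" for k
      by (simp add: node_coef_def)
  qed
  have res: "(\<lambda>i. x i j - comb ?J x (\<lambda>k. - ?u k) i) = r"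
    by (simp add: r_def comb_remove_node_coef[OF j] fun_eq_iff)
  have K1: "\<bar>emp n (\<lambda>i. x i k) r\<bar> \<le> lam" if "k < p" "k \<noteq> j" for k
    using kkt that unfolding lasso_kkt_def res by auto
  have K2: "emp n (comb ?J x (\<lambda>k. - ?u k)) r = lam * (\<Sum>k\<in>?J. \<bar>?u k\<bar>)"
    using kkt unfolding lasso_kkt_def res by simp
  have "r = (\<lambda>i. x i j - comb ?J x (\<lambda>k. - ?u k) i)" by (simp add: res)
  then have "emp n r r = emp n (\<lambda>i. x i j) r - emp n (comb ?J x (\<lambda>k. - ?u k)) r"
    using emp_diff_left[of n "\<lambda>i. x i j" "comb ?J x (\<lambda>k. - ?u k)" r] by metis
  then have K3: "emp n (\<lambda>i. x i j) r = emp n r r + lam * (\<Sum>k\<in>?J. \<bar>?u k\<bar>)" using K2 by simp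
  have "tau_sq lam (design n p x) j g = emp n r r + lam * (\<Sum>k\<in>?J. \<bar>?u k\<bar>)"
    unfolding r_def by (rule tau_sq_design[OF j g])
  with K1 K3 kkt show ?thesis
    by (simp add: nodewise_facts_def node_coef_def[of j g j] flip: r_def)
qed

lemma debiased_stat_eq:
  assumes xi: "xi \<in> carrier_vec p" and Y: "Y \<in> carrier_vec n" and b: "bhat (design n p x) Y \<in> carrier_vec p"
  shows "debiased_stat xi lams bhat ghat (design n p x) Y =
    (\<Sum>j<p. xi $ j * (bhat (design n p x) Y $ j +
      emp n (comb {..<p} x (node_coef j (ghat (design n p x) j)))
        (\<lambda>i. Y $ i - comb {..<p} x (($) (bhat (design n p x) Y)) i) /
      tau_sq (lams j) (design n p x) j (ghat (design n p x) j)))"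
proof -
  let ?X = "design n p x"
  define b' where "b' = bhat ?X Y"
  define \<tau> where "\<tau> j = tau_sq (lams j) ?X j (ghat ?X j)" for j
  define u where "u j = node_coef j (ghat ?X j)" for j
  define v where "v = Y - ?X *\<^sub>v b'"
  have X: "?X \<in> carrier_mat n p" by (simp add: design_def)
  have b': "b' \<in> carrier_vec p" using b by (simp add: b'_def)
  have v: "v \<in> carrier_vec n" using X Y b' by (simp add: v_def)
  have vi: "v $ i = Y $ i - comb {..<p} x (($) b') i" if "i < n" for i
    using that Y b' by (simp add: v_def design_def scalar_prod_def comb_def atLeast0LessThan)
  have Xv: "(transpose_mat ?X *\<^sub>v v) $ k = (\<Sum>i<n. x i k * v $ i)" if "k < p" for k
    using that v by (simp add: design_def scalar_prod_def atLeast0LessThan)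
  define \<Theta> where "\<Theta> = theta_hat lams ?X (ghat ?X)"
  have dim: "dim_row ?X = n" "dim_col ?X = p" using X by auto
  have \<Theta>_dim: "dim_row \<Theta> = p" "dim_col \<Theta> = p" by (simp_all add: \<Theta>_def theta_hat_def dim)
  have \<Theta>_entry: "\<Theta> $$ (k, j) = u j k / \<tau> j" if "k < p" "j < p" for k j
    using that dim by (simp add: \<Theta>_def theta_hat_def \<tau>_def u_def node_coef_def)
  define q where "q = transpose_mat ?X *\<^sub>v v"
  define w where "w = transpose_mat \<Theta> *\<^sub>v q"
  have q: "dim_vec q = p" "k < p \<Longrightarrow> q $ k = (\<Sum>i<n. x i k * v $ i)" for k
    unfolding q_def by (simp only: dim_mult_mat_vec index_transpose_mat dim) (rule Xv)
  have w: "w \<in> carrier_vec p" unfolding w_def by (rule carrier_vecI) (simp only: dim_mult_mat_vec index_transpose_mat \<Theta>_dim)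
  have wj: "w $ j = real n * (emp n (comb {..<p} x (u j)) (($) v) / \<tau> j)"
    if j: "j < p" for j
  proof -
    have "w $ j = (\<Sum>k<p. u j k / \<tau> j * (\<Sum>i<n. x i k * v $ i))"
      using j by (simp add: w_def scalar_prod_def atLeast0LessThan \<Theta>_dim \<Theta>_entry q)
    also have "\<dots> = (\<Sum>k<p. u j k * (\<Sum>i<n. x i k * v $ i)) / \<tau> j"
      by (simp add: sum_divide_distrib)
    also have "(\<Sum>k<p. u j k * (\<Sum>i<n. x i k * v $ i)) = (\<Sum>i<n. comb {..<p} x (u j) i * v $ i)"
    proof -
      have "(\<Sum>k<p. u j k * (\<Sum>i<n. x i k * v $ i)) = (\<Sum>k<p. \<Sum>i<n. u j k * (x i k * v $ i))"
        by (simp only: sum_distrib_left)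
      also have "\<dots> = (\<Sum>i<n. \<Sum>k<p. u j k * (x i k * v $ i))" by (rule sum.swap)
      also have "\<dots> = (\<Sum>i<n. comb {..<p} x (u j) i * v $ i)"
        by (simp only: comb_def sum_distrib_right) (simp only: mult_ac)
      finally show ?thesis .
    qed
    finally show ?thesis by (simp add: emp_def)
  qed
  have "(b' + (1 / real n) \<cdot>\<^sub>v w) $ j = b' $ j + emp n (comb {..<p} x (u j)) (($) v) / \<tau> j" if "j < p" for j
    using that w b' wj[OF that] by (cases "n = 0") (auto simp: emp_def)
  then have "debiased_stat xi lams bhat ghat ?X Y =
      (\<Sum>j<p. xi $ j * (b' $ j + emp n (comb {..<p} x (u j)) (($) v) / \<tau> j))"
    using w b'
    by (simp add: debiased_stat_def debiased_def scalar_prod_def[of xi] atLeast0LessThan dim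
        flip: b'_def v_def q_def \<Theta>_def w_def)
  moreover have "emp n (comb {..<p} x (u j)) (($) v) =
      emp n (comb {..<p} x (u j)) (\<lambda>i. Y $ i - comb {..<p} x (($) b') i)" for j
    by (rule emp_cong) (auto simp: vi)
  ultimately show ?thesis by (simp add: b'_def \<tau>_def u_def)
qed

text \<open>In the correction of coordinate \<open>j\<close> the error of that coordinate cancels,
  because the product of the residual with column \<open>j\<close> is \<open>\<tau> j\<close>. Each
  other column is orthogonal to the residual up to \<open>lams j\<close>, so all of them together
  contribute at most \<open>lams j / \<tau> j\<close> times the l1 error.\<close>

lemma debiased_error_decomposition:
  assumes y: "\<And>i. i < n \<Longrightarrow> y i = comb {..<p} x \<beta> i + e i"
    and nf: "\<And>j. j < p \<Longrightarrow> nodewise_facts n p x (lams j) j (u j) (\<tau> j)" and \<tau>: "\<And>j. j < p \<Longrightarrow> 0 < \<tau> j"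
    and lams: "\<And>j. j < p \<Longrightarrow> 0 \<le> lams j" and h: "\<And>j. j < p \<Longrightarrow> lams j / \<tau> j \<le> h"
  shows "\<bar>(\<Sum>j<p. \<xi> j * (b j + emp n (comb {..<p} x (u j)) (\<lambda>i. y i - comb {..<p} x b i) / \<tau> j)) - (\<Sum>j<p. \<xi> j * \<beta> j)
      - (\<Sum>i<n. (\<Sum>j<p. \<xi> j / \<tau> j * comb {..<p} x (u j) i) / real n * e i)\<bar>
    \<le> (\<Sum>j<p. \<bar>\<xi> j\<bar>) * h * (\<Sum>k<p. \<bar>b k - \<beta> k\<bar>)"
proof -
  define \<delta> where "\<delta> k = b k - \<beta> k" for k
  define D where "D = (\<Sum>k<p. \<bar>\<delta> k\<bar>)"
  define r where "r j = comb {..<p} x (u j)" for j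
  have D: "0 \<le> D" by (auto simp: D_def intro: sum_nonneg)
  have "(\<Sum>i<n. (\<Sum>j<p. \<xi> j / \<tau> j * r j i) / real n * e i) =
      (\<Sum>i<n. \<Sum>j<p. \<xi> j / \<tau> j * r j i / real n * e i)"
    by (simp only: sum_divide_distrib sum_distrib_right)
  also have "\<dots> = (\<Sum>j<p. \<Sum>i<n. \<xi> j / \<tau> j * r j i / real n * e i)" by (rule sum.swap)
  also have "\<dots> = (\<Sum>j<p. \<xi> j * (emp n (r j) e / \<tau> j))"
    by (simp add: emp_def sum_divide_distrib sum_distrib_left mult_ac)
  finally have noise: "(\<Sum>i<n. (\<Sum>j<p. \<xi> j / \<tau> j * r j i) / real n * e i) = (\<Sum>j<p. \<xi> j * (emp n (r j) e / \<tau> j))" .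
  have diff: "(\<Sum>j<p. \<xi> j * (b j + emp n (r j) (\<lambda>i. y i - comb {..<p} x b i) / \<tau> j)) - (\<Sum>j<p. \<xi> j * \<beta> j)
      - (\<Sum>i<n. (\<Sum>j<p. \<xi> j / \<tau> j * r j i) / real n * e i) =
      (\<Sum>j<p. \<xi> j * (\<delta> j + (emp n (r j) (\<lambda>i. y i - comb {..<p} x b i) - emp n (r j) e) / \<tau> j))"
    unfolding noise sum_subtractf[symmetric]
    by (rule sum.cong) (simp_all add: \<delta>_def right_diff_distrib distrib_left diff_divide_distrib)
  have "\<bar>\<Sum>j<p. \<xi> j * (\<delta> j + (emp n (r j) (\<lambda>i. y i - comb {..<p} x b i) - emp n (r j) e) / \<tau> j)\<bar> \<le>
      (\<Sum>j<p. \<bar>\<xi> j * (\<delta> j + (emp n (r j) (\<lambda>i. y i - comb {..<p} x b i) - emp n (r j) e) / \<tau> j)\<bar>)"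
    by (rule sum_abs)
  also have "\<dots> \<le> (\<Sum>j<p. \<bar>\<xi> j\<bar> * (h * D))"
  proof (rule sum_mono)
    fix j assume "j \<in> {..<p}"
    then have j: "j < p" by simp
    note N = nf[OF j, unfolded nodewise_facts_def, folded r_def]
    have lam: "0 \<le> lams j" by (rule lams[OF j])
    have "emp n (r j) (\<lambda>i. y i - comb {..<p} x b i) - emp n (r j) e = - emp n (r j) (comb {..<p} x \<delta>)"
    proof -
      have "emp n (r j) (\<lambda>i. y i - comb {..<p} x b i) = emp n (r j) (\<lambda>i. e i - comb {..<p} x \<delta> i)"
        by (rule emp_cong) (auto simp: y \<delta>_def[abs_def] comb_diff)
      then show ?thesis by (simp add: emp_linear)
    qed
    also have "emp n (r j) (comb {..<p} x \<delta>) = \<delta> j * \<tau> j + emp n (comb ({..<p} - {j}) x \<delta>) (r j)"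
    proof -
      have "emp n (r j) (comb {..<p} x \<delta>) = emp n (comb {..<p} x \<delta>) (r j)" by (rule emp_commute)
      also have "\<dots> = \<delta> j * emp n (\<lambda>i. x i j) (r j) + emp n (comb ({..<p} - {j}) x \<delta>) (r j)"
        unfolding emp_comb_left using j by (simp add: sum.remove)
      finally show ?thesis using N by simp
    qed
    finally have eq: "emp n (r j) (\<lambda>i. y i - comb {..<p} x b i) - emp n (r j) e =
        - (\<delta> j * \<tau> j + emp n (comb ({..<p} - {j}) x \<delta>) (r j))" .
    have "\<delta> j + (emp n (r j) (\<lambda>i. y i - comb {..<p} x b i) - emp n (r j) e) / \<tau> j =
        - emp n (comb ({..<p} - {j}) x \<delta>) (r j) / \<tau> j"
      unfolding eq using \<tau>[OF j] by (simp add: field_simps)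
    then have "\<bar>\<delta> j + (emp n (r j) (\<lambda>i. y i - comb {..<p} x b i) - emp n (r j) e) / \<tau> j\<bar> =
        \<bar>emp n (comb ({..<p} - {j}) x \<delta>) (r j)\<bar> / \<tau> j"
      using \<tau>[OF j] by (simp add: abs_divide)
    also have "\<dots> \<le> (lams j * D) / \<tau> j"
    proof (rule divide_right_mono)
      have "\<bar>emp n (comb ({..<p} - {j}) x \<delta>) (r j)\<bar> \<le> lams j * (\<Sum>k\<in>{..<p} - {j}. \<bar>\<delta> k\<bar>)"
        using N by (intro abs_emp_comb_le) auto
      also have "\<dots> \<le> lams j * D"
        unfolding D_def using lam by (intro mult_left_mono sum_mono2) auto
      finally show "\<bar>emp n (comb ({..<p} - {j}) x \<delta>) (r j)\<bar> \<le> lams j * D" .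
    qed (use \<tau>[OF j] in simp)
    also have "\<dots> = lams j / \<tau> j * D" by simp
    also have "\<dots> \<le> h * D" using h[OF j] D by (rule mult_right_mono)
    finally show "\<bar>\<xi> j * (\<delta> j + (emp n (r j) (\<lambda>i. y i - comb {..<p} x b i) - emp n (r j) e) / \<tau> j)\<bar> \<le> \<bar>\<xi> j\<bar> * (h * D)"
      unfolding abs_mult by (rule mult_left_mono) simp
  qed
  also have "\<dots> = (\<Sum>j<p. \<bar>\<xi> j\<bar>) * h * D" by (simp add: sum_distrib_right mult.assoc)
  finally show ?thesis
    unfolding r_def[symmetric] diff by (simp add: D_def \<delta>_def)
qed

section \<open>Bounds that need no good event\<close>

lemma abs_emp_le: "\<bar>emp n f g\<bar> \<le> (emp n f f + emp n g g) / 2"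
proof -
  have "0 \<le> emp n (\<lambda>i. f i - g i) (\<lambda>i. f i - g i)" "0 \<le> emp n (\<lambda>i. f i + g i) (\<lambda>i. f i + g i)"
    by (rule emp_nonneg)+
  then show ?thesis
    unfolding emp_linear emp_commute[of n g f] by (simp add: abs_le_iff)
qed

lemma emp_comb_comb: "emp n (comb J x a) (comb J' x b) = (\<Sum>k\<in>J. \<Sum>l\<in>J'. a k * b l * emp n (\<lambda>i. x i k) (\<lambda>i. x i l))"
  by (simp only: emp_comb_left) (simp add: emp_comb_right sum_distrib_left mult.assoc)

lemma abs_double_sum_le:
  fixes a b :: "nat \<Rightarrow> real"
  assumes "\<And>k l. k \<in> J \<Longrightarrow> l \<in> J' \<Longrightarrow> \<bar>G k l\<bar> \<le> \<epsilon>"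
  shows "\<bar>\<Sum>k\<in>J. \<Sum>l\<in>J'. a k * b l * G k l\<bar> \<le> (\<Sum>k\<in>J. \<bar>a k\<bar>) * (\<Sum>l\<in>J'. \<bar>b l\<bar>) * \<epsilon>"
proof -
  have "\<bar>\<Sum>k\<in>J. \<Sum>l\<in>J'. a k * b l * G k l\<bar> \<le> (\<Sum>k\<in>J. \<Sum>l\<in>J'. \<bar>a k * b l * G k l\<bar>)"
    by (intro order_trans[OF sum_abs] sum_mono) simp
  also have "\<dots> \<le> (\<Sum>k\<in>J. \<Sum>l\<in>J'. \<bar>a k\<bar> * \<bar>b l\<bar> * \<epsilon>)"
    unfolding abs_mult using assms by (intro sum_mono mult_left_mono) auto
  also have "\<dots> = (\<Sum>k\<in>J. \<bar>a k\<bar>) * (\<Sum>l\<in>J'. \<bar>b l\<bar>) * \<epsilon>"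
    by (subst sum_product) (simp only: sum_distrib_right)
  finally show ?thesis .
qed

text \<open>Column \<open>j\<close> is the residual minus a combination of the other columns with l1
  norm at most \<open>\<tau> / lam\<close>, so a small \<open>\<tau>\<close> would force the column
  itself to be small. Column norms and their inverses have accessible moments, which 1 / \<tau> does
  not have directly.\<close>

lemma inverse_tau_le:
  assumes nf: "nodewise_facts n p x lam j u \<tau>" and j: "j < p" and lam: "0 < lam"
    and N: "0 < emp n (\<lambda>i. x i j) (\<lambda>i. x i j)"
  shows "0 < \<tau>"
    and "1 / \<tau> \<le> (\<Sum>k<p. emp n (\<lambda>i. x i k) (\<lambda>i. x i k)) + (2 + 2 / lam\<^sup>2) / emp n (\<lambda>i. x i j) (\<lambda>i. x i j)"
proof -
  define N where "N k = emp n (\<lambda>i. x i k) (\<lambda>i. x i k)" for k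
  define K where "K = (\<Sum>k<p. N k)"
  define r where "r = comb {..<p} x u"
  define c where "c = comb ({..<p} - {j}) x u"
  define D where "D = (\<Sum>k\<in>{..<p} - {j}. \<bar>u k\<bar>)"
  have uj: "u j = 1" and \<tau>: "\<tau> = emp n r r + lam * D"
    using nf by (auto simp: nodewise_facts_def r_def D_def)
  have D0: "0 \<le> D" by (auto simp: D_def intro: sum_nonneg)
  have rr: "emp n r r \<le> \<tau>" and D\<tau>: "D \<le> \<tau> / lam"
    using lam D0 emp_nonneg[of n r] by (auto simp: \<tau> field_simps)
  have N0: "0 \<le> N k" for k unfolding N_def by (rule emp_nonneg)
  have K0: "0 \<le> K" by (auto simp: K_def N0 intro: sum_nonneg)
  have NK: "N k \<le> K" if "k < p" for k
    unfolding K_def using that N0 by (intro member_le_sum) auto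
  have cc: "emp n c c \<le> D\<^sup>2 * K"
  proof -
    have "\<bar>emp n (\<lambda>i. x i k) (\<lambda>i. x i l)\<bar> \<le> K" if "k < p" "l < p" for k l
      using abs_emp_le[of n "\<lambda>i. x i k" "\<lambda>i. x i l"] NK[OF that(1)] NK[OF that(2)] by (simp add: N_def)
    then have "\<bar>emp n c c\<bar> \<le> D * D * K"
      unfolding c_def D_def emp_comb_comb by (intro abs_double_sum_le) auto
    then show ?thesis by (simp add: power2_eq_square)
  qed
  have "x i j = r i - c i" for i
    using comb_remove[OF j, of x u i] uj by (simp add: r_def c_def)
  then have "N j = emp n (\<lambda>i. r i - c i) (\<lambda>i. r i - c i)" by (simp add: N_def)
  also have "\<dots> \<le> 2 * emp n r r + 2 * emp n c c"
    using abs_emp_le[of n r c] unfolding emp_linear emp_commute[of n c r] abs_le_iff by auto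
  finally have Nj: "N j \<le> 2 * \<tau> + 2 * (D\<^sup>2 * K)" using rr cc by linarith
  have Npos: "0 < N j" using N by (simp add: N_def)
  have "D\<^sup>2 \<le> (\<tau> / lam)\<^sup>2" using D\<tau> D0 by (rule power_mono)
  then have "D\<^sup>2 * K \<le> (\<tau> / lam)\<^sup>2 * K" using K0 by (rule mult_right_mono)
  then have Nj': "N j \<le> 2 * \<tau> + 2 * ((\<tau> / lam)\<^sup>2 * K)" using Nj by linarith
  have "0 \<le> \<tau>" using \<tau> emp_nonneg[of n r] D0 lam by simp
  moreover have "\<tau> \<noteq> 0" using Nj' Npos by auto
  ultimately show \<tau>pos: "0 < \<tau>" by simp
  \<comment> \<open>Divided by \<open>\<tau>\<^sup>2\<close> the bound is a quadratic inequality in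
    \<open>t\<close>; its linear term is absorbed into half of \<open>t\<^sup>2\<close>.\<close>
  define t where "t = 1 / \<tau>"
  have t: "0 < t" using \<tau>pos by (simp add: t_def)
  have "N j * t\<^sup>2 \<le> (2 * \<tau> + 2 * ((\<tau> / lam)\<^sup>2 * K)) * t\<^sup>2" using Nj' by (intro mult_right_mono) auto
  moreover have "(2 * \<tau> + 2 * ((\<tau> / lam)\<^sup>2 * K)) * t\<^sup>2 = 2 * t + 2 * K / lam\<^sup>2"
    using \<tau>pos lam by (simp add: t_def power2_eq_square field_simps)
  ultimately have "N j * t\<^sup>2 \<le> 2 * t + 2 * K / lam\<^sup>2" by linarith
  then have "t\<^sup>2 \<le> (2 * t + 2 * K / lam\<^sup>2) / N j" using Npos by (simp add: pos_le_divide_eq mult.commute)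
  then have "t\<^sup>2 \<le> 2 * t / N j + 2 * K / (lam\<^sup>2 * N j)"
    by (simp add: add_divide_distrib)
  moreover have "2 * t / N j \<le> t\<^sup>2 / 2 + 2 / (N j)\<^sup>2"
    using zero_le_power2[of "t - 2 / N j"] Npos by (simp add: power2_eq_square field_simps)
  ultimately have "t\<^sup>2 \<le> 4 / (N j)\<^sup>2 + 4 * K / (lam\<^sup>2 * N j)" by simp
  \<comment> \<open>With these abbreviations the bound reads a^2 + 2 K b, which is dominated by the
    square of K + a + b. The final bound is then a plain sum, without square roots of random
    quantities.\<close>
  moreover define a where "a = 2 / N j"
  moreover define b where "b = 2 / (lam\<^sup>2 * N j)"
  ultimately have t2: "t\<^sup>2 \<le> a\<^sup>2 + 2 * K * b" by (simp add: power_divide)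
  have ab: "0 \<le> a" "0 \<le> b" using Npos by (simp_all add: a_def b_def)
  have "0 \<le> K * K" "0 \<le> K * a" "0 \<le> a * b" "0 \<le> b * b" using ab K0 by simp_all
  then have "a\<^sup>2 + 2 * K * b \<le> (K + (a + b))\<^sup>2" by (simp add: power2_eq_square algebra_simps)
  with t2 have "t\<^sup>2 \<le> (K + (a + b))\<^sup>2" by (rule order_trans)
  then have "t \<le> K + (a + b)" by (rule power2_le_imp_le) (use ab K0 in simp)
  then have "t \<le> K + (2 / N j + 2 / (lam\<^sup>2 * N j))" by (simp only: a_def b_def)
  then have "t \<le> K + (2 + 2 / lam\<^sup>2) / N j"
    by (simp add: add_divide_distrib)
  then show "1 / \<tau> \<le> (\<Sum>k<p. emp n (\<lambda>i. x i k) (\<lambda>i. x i k)) + (2 + 2 / lam\<^sup>2) / emp n (\<lambda>i. x i j) (\<lambda>i. x i j)"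
    by (simp add: t_def K_def N_def)
qed

lemma emp_weighted_residuals:
  fixes p :: nat
  shows "emp n (\<lambda>i. \<Sum>j<p. \<xi> j / \<tau> j * r j i) (\<lambda>i. \<Sum>j<p. \<xi> j / \<tau> j * r j i) =
    (\<Sum>j<p. \<Sum>l<p. \<xi> j * \<xi> l * (emp n (r j) (r l) / (\<tau> j * \<tau> l)))"
proof -
  have "(\<lambda>i. \<Sum>j<p. \<xi> j / \<tau> j * r j i) = comb {..<p} (\<lambda>i j. r j i) (\<lambda>j. \<xi> j / \<tau> j)"
    by (simp add: comb_def mult.commute fun_eq_iff)
  then show ?thesis by (simp add: emp_comb_comb)
qed

text \<open>A nodewise residual has squared norm at most \<open>\<tau>\<close>, hence at most 1 /
  \<tau> after division by \<open>\<tau>\<close>. The left side will be n times the conditional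
  variance of the noise term.\<close>

lemma emp_weighted_residuals_le:
  assumes nf: "\<And>j. j < p \<Longrightarrow> nodewise_facts n p x (lams j) j (u j) (\<tau> j)" and lam: "\<And>j. j < p \<Longrightarrow> 0 < lams j"
    and \<tau>: "\<And>j. j < p \<Longrightarrow> 0 < \<tau> j" and H: "\<And>j. j < p \<Longrightarrow> 1 / \<tau> j \<le> H"
  shows "emp n (\<lambda>i. \<Sum>j<p. \<xi> j / \<tau> j * comb {..<p} x (u j) i) (\<lambda>i. \<Sum>j<p. \<xi> j / \<tau> j * comb {..<p} x (u j) i) \<le>
    (\<Sum>j<p. \<bar>\<xi> j\<bar>)\<^sup>2 * H"
proof -
  define r where "r j = comb {..<p} x (u j)" for j
  have G: "\<bar>emp n (r j) (r l) / (\<tau> j * \<tau> l)\<bar> \<le> H" if jl: "j < p" "l < p" for j l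
  proof -
    have f: "emp n (\<lambda>i. 1 / \<tau> k * r k i) (\<lambda>i. 1 / \<tau> k * r k i) \<le> H" if k: "k < p" for k
    proof -
      have "0 \<le> lams k * (\<Sum>m\<in>{..<p} - {k}. \<bar>u k m\<bar>)"
        using lam[OF k] by (intro mult_nonneg_nonneg sum_nonneg) auto
      then have "emp n (r k) (r k) \<le> \<tau> k"
        using nf[OF k] by (simp add: nodewise_facts_def r_def)
      then have "emp n (r k) (r k) / (\<tau> k * \<tau> k) \<le> \<tau> k / (\<tau> k * \<tau> k)"
        using \<tau>[OF k] by (intro divide_right_mono) auto
      also have "\<dots> = 1 / \<tau> k" using \<tau>[OF k] by simp
      finally show ?thesis using H[OF k] by (simp only: emp_linear) simp
    qed
    have "emp n (r j) (r l) / (\<tau> j * \<tau> l) = emp n (\<lambda>i. 1 / \<tau> j * r j i) (\<lambda>i. 1 / \<tau> l * r l i)"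
      by (simp only: emp_linear) simp
    moreover have half: "(a + b) / 2 \<le> H" if "a \<le> H" "b \<le> H" for a b using that by simp
    ultimately show ?thesis
      using order_trans[OF abs_emp_le half[OF f[OF jl(1)] f[OF jl(2)]]] by simp
  qed
  have "\<bar>\<Sum>j<p. \<Sum>l<p. \<xi> j * \<xi> l * (emp n (r j) (r l) / (\<tau> j * \<tau> l))\<bar> \<le> (\<Sum>j<p. \<bar>\<xi> j\<bar>) * (\<Sum>j<p. \<bar>\<xi> j\<bar>) * H"
    using G by (intro abs_double_sum_le) auto
  then show ?thesis
    unfolding emp_weighted_residuals r_def[symmetric] by (simp add: power2_eq_square)
qed

subsection \<open>Error bounds on the good event\<close>

text \<open>\<open>S\<close> and \<open>Q\<close> stand for the population covariance and precision.
  The level \<open>s\<close> may be the sparsity or the full dimension; the latter satisfies the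
  last assumption trivially and is the choice for small p and in the lower bound.\<close>

locale bounded_forms =
  fixes p :: nat and S Q :: "nat \<Rightarrow> nat \<Rightarrow> real" and B \<Lambda> s :: real
  assumes forms: "inverse_pd_forms p S Q"
    and Lam: "0 < \<Lambda>" "\<And>u. \<Lambda> * (\<Sum>i<p. (u i)\<^sup>2) \<le> bform p S u u"
    and B: "\<And>i j. i < p \<Longrightarrow> j < p \<Longrightarrow> \<bar>S i j\<bar> \<le> B"
    and s: "1 \<le> s" "\<And>j. j < p \<Longrightarrow> real (card {k. k < p \<and> Q k j \<noteq> 0}) \<le> s"
begin

lemma bform_Q_col: "bform p S u (\<lambda>k. Q k j) = u j" if "j < p"
  unfolding bform_mult_vec using inverse_pd_formsD(3)[OF forms _ that] that
  by (simp add: if_distrib[of "(*) _"] cong: if_cong)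

lemma Lam_le_S: "j < p \<Longrightarrow> \<Lambda> \<le> S j j"
  using Lam(2)[of "\<lambda>i. if i = j then 1 else 0"]
  by (simp add: bform_def if_distrib[of "\<lambda>z. z\<^sup>2"] if_distrib[of "(*) _"] cong: if_cong)

lemma Lam_le_B: "j < p \<Longrightarrow> \<Lambda> \<le> B"
  using Lam_le_S[of j] B[of j j] by simp

text \<open>1 / Q j j is the residual variance of the population regression of column
  \<open>j\<close> on the others. Column \<open>j\<close> of \<open>Q\<close> has form value
  \<open>Q j j\<close>, to which the eigenvalue bound applies; its form product with the unit vector
  is 1, and Cauchy--Schwarz gives the bound from the other side.\<close>

lemma Q_diag_bounds:
  assumes j: "j < p"
  shows "0 < Q j j" "Q j j \<le> 1 / \<Lambda>" "1 / Q j j \<le> B" "\<Lambda> \<le> 1 / Q j j"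
proof -
  have "Q i j = 0" if "i < p" "\<not> (\<exists>i<p. Q i j \<noteq> 0)" for i using that by auto
  have "\<exists>i<p. Q i j \<noteq> 0"
  proof (rule ccontr)
    assume "\<not> ?thesis"
    then show False using inverse_pd_formsD(3)[OF forms j j] by simp
  qed
  then obtain i where i: "i < p" "Q i j \<noteq> 0" by auto
  have "0 < bform p S (\<lambda>k. Q k j) (\<lambda>k. Q k j)"
    using i by (intro inverse_pd_formsD(4)[OF forms, of i]) auto
  then show pos: "0 < Q j j" by (simp add: bform_Q_col j)
  have "(Q j j)\<^sup>2 \<le> (\<Sum>i<p. (Q i j)\<^sup>2)" using j by (intro member_le_sum) auto
  then have "\<Lambda> * (Q j j)\<^sup>2 \<le> \<Lambda> * (\<Sum>i<p. (Q i j)\<^sup>2)" using Lam(1) by (intro mult_left_mono) auto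
  also have "\<dots> \<le> Q j j" using Lam(2)[of "\<lambda>k. Q k j"] by (simp add: bform_Q_col j)
  finally have "\<Lambda> * Q j j * Q j j \<le> 1 * Q j j" by (simp add: power2_eq_square mult.assoc)
  then have le1: "\<Lambda> * Q j j \<le> 1" using pos by (rule mult_right_le_imp_le)
  then show "Q j j \<le> 1 / \<Lambda>" "\<Lambda> \<le> 1 / Q j j" using Lam(1) pos by (simp_all add: field_simps)
  define ej where "ej = (\<lambda>i. if i = j then 1 else 0 :: real)"
  have "(bform p S ej (\<lambda>k. Q k j))\<^sup>2 \<le> bform p S ej ej * bform p S (\<lambda>k. Q k j) (\<lambda>k. Q k j)"
    by (rule bform_Cauchy_Schwarz) (use inverse_pd_formsD[OF forms] in auto)
  moreover have "bform p S ej ej = S j j"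
    using j by (simp add: bform_def ej_def if_distrib[of "(*) _"] cong: if_cong)
  ultimately have "1 \<le> S j j * Q j j" using j by (simp add: bform_Q_col ej_def)
  also have "\<dots> \<le> B * Q j j" using B[OF j j] pos by (intro mult_right_mono) auto
  finally show "1 / Q j j \<le> B" using pos by (simp add: field_simps)
qed

lemma abs_Q_le: "\<bar>Q i j\<bar> \<le> 1 / \<Lambda>" if i: "i < p" and j: "j < p"
proof -
  have "(Q i j)\<^sup>2 \<le> (\<Sum>i<p. (Q i j)\<^sup>2)" using i by (intro member_le_sum) auto
  then have "\<Lambda> * (Q i j)\<^sup>2 \<le> \<Lambda> * (\<Sum>i<p. (Q i j)\<^sup>2)" using Lam(1) by (intro mult_left_mono) auto
  also have "\<dots> \<le> Q j j" using Lam(2)[of "\<lambda>k. Q k j"] by (simp add: bform_Q_col j)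
  also have "\<dots> \<le> 1 / \<Lambda>" by (rule Q_diag_bounds[OF j])
  finally have "(Q i j)\<^sup>2 \<le> (1 / \<Lambda>)\<^sup>2" using Lam(1) by (simp add: power2_eq_square field_simps)
  then show ?thesis using Lam(1) abs_le_square_iff[of "Q i j" "1 / \<Lambda>"] by simp
qed

text \<open>The tolerance is exactly the perturbation that \<open>lasso_l1_error\<close>
  absorbs.\<close>

definition gram_close :: "nat \<Rightarrow> (nat \<Rightarrow> nat \<Rightarrow> real) \<Rightarrow> bool" where
  "gram_close n x \<longleftrightarrow> (\<forall>j<p. \<forall>k<p. \<bar>emp n (\<lambda>i. x i j) (\<lambda>i. x i k) - S j k\<bar> \<le> \<Lambda> / (32 * s))"

text \<open>Up to the factor \<open>Q j j\<close> the combination with column \<open>j\<close> of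
  \<open>Q\<close> is the error of the population nodewise regression. For \<open>k\<close> other
  than \<open>j\<close> this bounds the noise of that regression, and for \<open>k = j\<close> it
  controls the scale.\<close>

definition inverse_close :: "nat \<Rightarrow> (nat \<Rightarrow> nat \<Rightarrow> real) \<Rightarrow> real \<Rightarrow> bool" where
  "inverse_close n x \<mu> \<longleftrightarrow>
     (\<forall>j<p. \<forall>k<p. \<bar>emp n (\<lambda>i. x i k) (comb {..<p} x (\<lambda>m. Q m j)) - (if k = j then 1 else 0)\<bar> \<le> \<mu>)"

text \<open>Passing from \<open>S\<close> to the sample Gram matrix costs at most the largest
  entrywise deviation times the squared l1 norm.\<close>

lemma restricted_eigenvalue:
  assumes G: "gram_close n x" and J: "J \<subseteq> {..<p}"
  shows "\<Lambda> * (\<Sum>k\<in>J. (\<delta> k)\<^sup>2) - \<Lambda> / (32 * s) * (\<Sum>k\<in>J. \<bar>\<delta> k\<bar>)\<^sup>2 \<le> emp n (comb J x \<delta>) (comb J x \<delta>)"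
proof -
  define u where "u k = (if k \<in> J then \<delta> k else 0)" for k
  have fin: "finite J" using J finite_subset by blast
  have sum_ext: "(\<Sum>k\<in>J. f k (\<delta> k)) = (\<Sum>k<p. f k (u k))" if "\<And>k. f k 0 = 0" for f :: "nat \<Rightarrow> real \<Rightarrow> real"
    using J that by (intro sum.mono_neutral_cong_left) (auto simp: u_def)
  have c: "comb J x \<delta> = comb {..<p} x u"
  proof
    show "comb J x \<delta> i = comb {..<p} x u i" for i
      unfolding comb_def by (rule sum_ext[of "\<lambda>k. (*) (x i k)"]) simp
  qed
  have diff: "emp n (comb {..<p} x u) (comb {..<p} x u) - bform p S u u =
      (\<Sum>k<p. \<Sum>l<p. u k * u l * (emp n (\<lambda>i. x i k) (\<lambda>i. x i l) - S k l))"
    unfolding emp_comb_comb bform_def sum_subtractf[symmetric] by (simp add: algebra_simps)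
  have "\<bar>emp n (comb {..<p} x u) (comb {..<p} x u) - bform p S u u\<bar> \<le>
      (\<Sum>k<p. \<bar>u k\<bar>) * (\<Sum>l<p. \<bar>u l\<bar>) * (\<Lambda> / (32 * s))"
    unfolding diff using G by (intro abs_double_sum_le) (auto simp: gram_close_def)
  then have "bform p S u u - \<Lambda> / (32 * s) * (\<Sum>k<p. \<bar>u k\<bar>)\<^sup>2 \<le> emp n (comb {..<p} x u) (comb {..<p} x u)"
    by (simp add: power2_eq_square mult_ac)
  then show ?thesis
    using Lam(2)[of u] unfolding c by (simp add: sum_ext[of "\<lambda>_ z. z\<^sup>2"] sum_ext[of "\<lambda>_ z. \<bar>z\<bar>"])
qed

lemma lasso_error_good:
  assumes G: "gram_close n x" and kkt: "lasso_kkt {..<p} n x y lam b"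
    and y: "\<And>i. i < n \<Longrightarrow> y i = comb {..<p} x \<beta> i + e i" and lam: "0 < lam"
    and M: "0 \<le> \<mu>" "\<And>k. k < p \<Longrightarrow> \<bar>emp n (\<lambda>i. x i k) e\<bar> \<le> \<mu>"
    and regime: "real p \<le> s \<or> (real (card {k. k < p \<and> \<beta> k \<noteq> 0}) \<le> s \<and> 2 * \<mu> \<le> lam)"
  shows "(\<Sum>k<p. \<bar>b k - \<beta> k\<bar>) \<le> 32 * s * (lam + \<mu>) / \<Lambda>"
proof -
  define A where "A = (if real p \<le> s then {..<p} else {k. k < p \<and> \<beta> k \<noteq> 0})"
  show ?thesis
    by (rule lasso_l1_error[OF kkt y, where S = A])
      (use lam M regime Lam(1) s(1) restricted_eigenvalue[OF G] in \<open>auto simp: A_def split: if_splits\<close>)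
qed

text \<open>The nodewise regression has population coefficients - Q k j / Q j j and an error that is
  uncorrelated with the other columns. So the error bound of the Lasso applies, with the noise level
  of \<open>inverse_close\<close> enlarged by 1 / Q j j \<le> B.\<close>

lemma nodewise_error_good:
  assumes G: "gram_close n x" and I: "inverse_close n x \<mu>" and \<mu>: "0 \<le> \<mu>"
    and nf: "nodewise_facts n p x lam j u \<tau>" and j: "j < p" and lam: "0 < lam"
    and regime: "real p \<le> s \<or> 2 * (\<mu> * B) \<le> lam"
  shows "(\<Sum>k<p. \<bar>u k - Q k j / Q j j\<bar>) \<le> 32 * s * (lam + \<mu> * B) / \<Lambda>"
proof -
  let ?J = "{..<p} - {j}"
  note qd = Q_diag_bounds[OF j]
  define \<beta> where "\<beta> k = - (Q k j / Q j j)" for k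
  define e where "e i = (1 / Q j j) * comb {..<p} x (\<lambda>m. Q m j) i" for i
  have kkt: "lasso_kkt ?J n x (\<lambda>i. x i j) lam (\<lambda>k. - u k)" and uj: "u j = 1"
    using nf by (auto simp: nodewise_facts_def)
  have y: "x i j = comb ?J x \<beta> i + e i" for i
  proof -
    have "comb {..<p} x (\<lambda>m. Q m j) i = x i j * Q j j + comb ?J x (\<lambda>m. Q m j) i" by (rule comb_remove[OF j])
    moreover have "comb ?J x \<beta> i = - (1 / Q j j) * comb ?J x (\<lambda>m. Q m j) i"
      unfolding comb_scale[symmetric] by (simp add: \<beta>_def[abs_def])
    ultimately show ?thesis using qd(1) by (simp add: e_def field_simps)
  qed
  have B0: "0 \<le> B" using Lam_le_B[OF j] Lam(1) by simp
  have M: "\<bar>emp n (\<lambda>i. x i k) e\<bar> \<le> \<mu> * B" if "k \<in> ?J" for k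
  proof -
    have "\<bar>emp n (\<lambda>i. x i k) (comb {..<p} x (\<lambda>m. Q m j))\<bar> \<le> \<mu>"
      using I[unfolded inverse_close_def, rule_format, of j k] that j by simp
    then have "(1 / Q j j) * \<bar>emp n (\<lambda>i. x i k) (comb {..<p} x (\<lambda>m. Q m j))\<bar> \<le> B * \<mu>"
      using qd \<mu> B0 by (intro mult_mono) auto
    then show ?thesis
      using qd(1) unfolding e_def[abs_def] emp_linear by (simp add: abs_mult mult.commute)
  qed
  define A where "A = (if real p \<le> s then ?J else {k \<in> ?J. Q k j \<noteq> 0})"
  have "(\<Sum>k\<in>?J. \<bar>- u k - \<beta> k\<bar>) \<le> 32 * s * (lam + \<mu> * B) / \<Lambda>"
  proof (rule lasso_l1_error[OF kkt y, where S = A])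
    have "card ?J \<le> p" by (rule order_trans[OF card_mono[of "{..<p}"]]) auto
    moreover have "card {k \<in> ?J. Q k j \<noteq> 0} \<le> card {k. k < p \<and> Q k j \<noteq> 0}" by (rule card_mono) auto
    ultimately show "real (card A) \<le> s" using s(2)[OF j] by (auto simp: A_def)
    show "\<Lambda> * (\<Sum>k\<in>?J. (\<delta> k)\<^sup>2) - \<Lambda> / (32 * s) * (\<Sum>k\<in>?J. \<bar>\<delta> k\<bar>)\<^sup>2 \<le> emp n (comb ?J x \<delta>) (comb ?J x \<delta>)" for \<delta>
      by (rule restricted_eigenvalue[OF G]) auto
  qed (use lam M regime Lam(1) s(1) \<mu> B0 in \<open>auto simp: A_def \<beta>_def split: if_splits\<close>)
  moreover have "(\<Sum>k\<in>?J. \<bar>- u k - \<beta> k\<bar>) = (\<Sum>k<p. \<bar>u k - Q k j / Q j j\<bar>)"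
  proof -
    have "(\<Sum>k<p. \<bar>u k - Q k j / Q j j\<bar>) = \<bar>u j - Q j j / Q j j\<bar> + (\<Sum>k\<in>?J. \<bar>u k - Q k j / Q j j\<bar>)"
      using j by (simp add: sum.remove)
    also have "\<bar>u j - Q j j / Q j j\<bar> = 0" using qd(1) uj by simp
    finally show ?thesis by (simp add: \<beta>_def abs_minus_commute)
  qed
  ultimately show ?thesis by simp
qed

text \<open>As the product of column \<open>j\<close> with its residual, \<open>\<tau>\<close> is
  linear in the coefficients. The population coefficients give nearly 1 / Q j j, and the change of
  coefficients is paid with Gram entries, which are at most 2 B on the good event.\<close>

lemma tau_error_good:
  assumes G: "gram_close n x" and I: "inverse_close n x \<mu>" and \<mu>: "0 \<le> \<mu>"
    and nf: "nodewise_facts n p x lam j u \<tau>" and j: "j < p"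
    and u: "(\<Sum>k<p. \<bar>u k - Q k j / Q j j\<bar>) \<le> \<kappa>"
  shows "\<bar>\<tau> - 1 / Q j j\<bar> \<le> \<mu> * B + 2 * B * \<kappa>"
proof -
  note qd = Q_diag_bounds[OF j]
  have B0: "0 \<le> B" using Lam_le_B[OF j] Lam(1) by simp
  define u0 where "u0 k = Q k j / Q j j" for k
  define f where "f = emp n (\<lambda>i. x i j)"
  have lin: "comb {..<p} x u i = comb {..<p} x u0 i + comb {..<p} x (\<lambda>k. u k - u0 k) i" for i
    by (simp add: comb_diff)
  have "\<tau> = f (comb {..<p} x u)" using nf by (simp add: nodewise_facts_def f_def)
  also have "\<dots> = f (comb {..<p} x u0) + f (comb {..<p} x (\<lambda>k. u k - u0 k))"
    unfolding f_def emp_add_right[symmetric] by (rule emp_cong) (auto simp: lin)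
  finally have \<tau>: "\<tau> = f (comb {..<p} x u0) + f (comb {..<p} x (\<lambda>k. u k - u0 k))" .
  have "f (comb {..<p} x u0) = (1 / Q j j) * f (comb {..<p} x (\<lambda>m. Q m j))"
    unfolding f_def emp_scale_right[symmetric] comb_scale[symmetric] by (rule emp_cong) (auto simp: u0_def[abs_def])
  then have "f (comb {..<p} x u0) - 1 / Q j j = (1 / Q j j) * (f (comb {..<p} x (\<lambda>m. Q m j)) - 1)"
    by (simp add: algebra_simps)
  then have "\<bar>f (comb {..<p} x u0) - 1 / Q j j\<bar> = (1 / Q j j) * \<bar>f (comb {..<p} x (\<lambda>m. Q m j)) - 1\<bar>"
    using qd(1) by (simp add: abs_mult)
  also have "\<dots> \<le> B * \<mu>"
    using qd I[unfolded inverse_close_def, rule_format, of j j] j \<mu> B0 by (intro mult_mono) (auto simp: f_def)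
  finally have 1: "\<bar>f (comb {..<p} x u0) - 1 / Q j j\<bar> \<le> B * \<mu>" .
  have gB: "\<bar>emp n (\<lambda>i. x i k) (\<lambda>i. x i j)\<bar> \<le> 2 * B" if k: "k < p" for k
  proof -
    have "\<bar>emp n (\<lambda>i. x i k) (\<lambda>i. x i j) - S k j\<bar> \<le> \<Lambda> / (32 * s)"
      using G k j by (simp add: gram_close_def)
    also have "\<dots> \<le> \<Lambda> / 1" using Lam(1) s(1) by (intro divide_left_mono) auto
    also have "\<dots> \<le> B" using Lam_le_B[OF j] by simp
    finally show ?thesis using B[OF k j] by linarith
  qed
  have "\<bar>f (comb {..<p} x (\<lambda>k. u k - u0 k))\<bar> \<le> 2 * B * (\<Sum>k<p. \<bar>u k - u0 k\<bar>)"
    unfolding f_def emp_commute[of n "\<lambda>i. x i j" "comb _ _ _"] using gB by (intro abs_emp_comb_le) auto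
  also have "\<dots> \<le> 2 * B * \<kappa>"
    using u Lam_le_B[OF j] Lam(1) by (intro mult_left_mono) (auto simp: u0_def)
  finally show ?thesis using 1 unfolding \<tau> by (simp add: mult.commute)
qed

text \<open>Only one of the two residuals is expanded into columns. The other one is nearly
  orthogonal to all columns but its own, so the product is \<open>ul j * \<tau>j\<close> up to
  \<open>lam\<close> times an l1 norm; division by the scales leaves \<open>ul j / \<tau>l\<close>,
  which is close to \<open>Q j l\<close>.\<close>

lemma gram_inverse_error_good:
  assumes j: "j < p" and l: "l < p"
    and nfj: "nodewise_facts n p x lam j uj \<tau>j" and nfl: "nodewise_facts n p x lam' l ul \<tau>l"
    and lam: "0 < lam" "lam \<le> lamU"
    and u: "(\<Sum>k<p. \<bar>ul k - Q k l / Q l l\<bar>) \<le> \<kappa>"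
    and \<tau>: "\<bar>\<tau>l - 1 / Q l l\<bar> \<le> \<epsilon>" "\<Lambda> / 2 \<le> \<tau>j" "\<Lambda> / 2 \<le> \<tau>l"
  shows "\<bar>emp n (comb {..<p} x uj) (comb {..<p} x ul) / (\<tau>j * \<tau>l) - Q j l\<bar> \<le>
    4 * lamU / \<Lambda>\<^sup>2 * (s * B / \<Lambda> + \<kappa>) + 2 * \<kappa> / \<Lambda> + 2 * \<epsilon> / \<Lambda>\<^sup>2"
proof -
  note qd = Q_diag_bounds[OF l]
  define r where "r = comb {..<p} x uj"
  define u0 where "u0 k = Q k l / Q l l" for k
  have pos: "0 < \<tau>j" "0 < \<tau>l" using \<tau> Lam(1) by auto
  have B0: "0 < B" using Lam_le_B[OF j] Lam(1) by simp
  have \<kappa>0: "0 \<le> \<kappa>" using u by (meson abs_ge_zero order_trans sum_nonneg)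
  have l1: "(\<Sum>k<p. \<bar>ul k\<bar>) \<le> s * B / \<Lambda> + \<kappa>"
  proof -
    have "(\<Sum>k<p. \<bar>ul k\<bar>) \<le> (\<Sum>k<p. \<bar>u0 k\<bar> + \<bar>ul k - u0 k\<bar>)" by (intro sum_mono) auto
    also have "\<dots> \<le> (\<Sum>k<p. \<bar>u0 k\<bar>) + \<kappa>" using u by (simp add: sum.distrib u0_def)
    also have "(\<Sum>k<p. \<bar>u0 k\<bar>) = (\<Sum>k\<in>{k. k < p \<and> Q k l \<noteq> 0}. \<bar>u0 k\<bar>)"
      by (rule sum.mono_neutral_right) (auto simp: u0_def)
    also have "\<dots> \<le> (\<Sum>k\<in>{k. k < p \<and> Q k l \<noteq> 0}. B / \<Lambda>)"
    proof (rule sum_mono)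
      fix k assume "k \<in> {k. k < p \<and> Q k l \<noteq> 0}"
      then have k: "k < p" by simp
      have "\<bar>u0 k\<bar> = \<bar>Q k l\<bar> * (1 / Q l l)" using qd(1) by (simp add: u0_def)
      also have "\<dots> \<le> 1 / \<Lambda> * B" using abs_Q_le[OF k l] qd Lam(1) by (intro mult_mono) auto
      finally show "\<bar>u0 k\<bar> \<le> B / \<Lambda>" by simp
    qed
    also have "\<dots> \<le> s * (B / \<Lambda>)" using mult_right_mono[OF s(2)[OF l], of "B / \<Lambda>"] B0 Lam(1) by simp
    finally show ?thesis by simp
  qed
  have "emp n r (comb {..<p} x ul) = ul j * emp n r (\<lambda>i. x i j) + (\<Sum>k\<in>{..<p} - {j}. ul k * emp n r (\<lambda>i. x i k))"
    unfolding emp_comb_right using j by (simp add: sum.remove)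
  moreover have "(\<Sum>k\<in>{..<p} - {j}. ul k * emp n r (\<lambda>i. x i k)) = emp n (comb ({..<p} - {j}) x ul) r"
    unfolding emp_comb_left by (intro sum.cong refl arg_cong2[where f = "(*)"] emp_commute)
  moreover have "emp n r (\<lambda>i. x i j) = \<tau>j"
    using nfj by (simp add: nodewise_facts_def r_def emp_commute)
  ultimately have eq: "emp n r (comb {..<p} x ul) = ul j * \<tau>j + emp n (comb ({..<p} - {j}) x ul) r" by simp
  have E: "\<bar>emp n (comb ({..<p} - {j}) x ul) r\<bar> \<le> lamU * (s * B / \<Lambda> + \<kappa>)"
  proof -
    have "\<bar>emp n (comb ({..<p} - {j}) x ul) r\<bar> \<le> lam * (\<Sum>k\<in>{..<p} - {j}. \<bar>ul k\<bar>)"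
      using nfj by (intro abs_emp_comb_le) (auto simp: nodewise_facts_def r_def)
    also have "\<dots> \<le> lamU * (s * B / \<Lambda> + \<kappa>)"
      using lam by (intro mult_mono order_trans[OF sum_mono2 l1]) (auto intro: sum_nonneg)
    finally show ?thesis .
  qed
  have Q: "Q j l = u0 j * Q l l" using qd(1) by (simp add: u0_def)
  \<comment> \<open>Three errors: imperfect orthogonality, the estimated coefficient, and the
    estimated scale.\<close>
  have "emp n r (comb {..<p} x ul) / (\<tau>j * \<tau>l) - Q j l =
      emp n (comb ({..<p} - {j}) x ul) r / (\<tau>j * \<tau>l) + (ul j - u0 j) / \<tau>l + Q j l * (1 / Q l l - \<tau>l) / \<tau>l"
    unfolding eq Q using pos qd(1) by (simp add: field_simps)
  moreover have "\<bar>a1 + a2 + a3\<bar> \<le> \<bar>a1\<bar> + \<bar>a2\<bar> + \<bar>a3\<bar>" for a1 a2 a3 :: real by linarith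
  ultimately have "\<bar>emp n r (comb {..<p} x ul) / (\<tau>j * \<tau>l) - Q j l\<bar> \<le>
      \<bar>emp n (comb ({..<p} - {j}) x ul) r / (\<tau>j * \<tau>l)\<bar> + \<bar>(ul j - u0 j) / \<tau>l\<bar> + \<bar>Q j l * (1 / Q l l - \<tau>l) / \<tau>l\<bar>"
    by metis
  then have "\<bar>emp n r (comb {..<p} x ul) / (\<tau>j * \<tau>l) - Q j l\<bar> \<le>
      \<bar>emp n (comb ({..<p} - {j}) x ul) r\<bar> / (\<tau>j * \<tau>l) + \<bar>ul j - u0 j\<bar> / \<tau>l + \<bar>Q j l\<bar> * \<bar>1 / Q l l - \<tau>l\<bar> / \<tau>l"
    unfolding abs_divide abs_mult abs_of_pos[OF pos(1)] abs_of_pos[OF pos(2)] .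
  also have "\<dots> \<le> lamU * (s * B / \<Lambda> + \<kappa>) / (\<Lambda> / 2 * (\<Lambda> / 2)) + \<kappa> / (\<Lambda> / 2) + 1 / \<Lambda> * \<epsilon> / (\<Lambda> / 2)"
  proof (intro add_mono)
    show "\<bar>emp n (comb ({..<p} - {j}) x ul) r\<bar> / (\<tau>j * \<tau>l) \<le> lamU * (s * B / \<Lambda> + \<kappa>) / (\<Lambda> / 2 * (\<Lambda> / 2))"
      using E \<tau> Lam(1) by (intro frac_le mult_mono) auto
    have "\<bar>ul j - u0 j\<bar> \<le> (\<Sum>k<p. \<bar>ul k - u0 k\<bar>)" using j by (intro member_le_sum[of j _ "\<lambda>k. \<bar>ul k - u0 k\<bar>"]) auto
    then show "\<bar>ul j - u0 j\<bar> / \<tau>l \<le> \<kappa> / (\<Lambda> / 2)"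
      using u \<tau> Lam(1) by (intro frac_le) (auto simp: u0_def)
    have "\<bar>Q j l\<bar> * \<bar>1 / Q l l - \<tau>l\<bar> \<le> 1 / \<Lambda> * \<epsilon>"
      using abs_Q_le[OF j l] \<tau>(1) Lam(1) by (intro mult_mono) (auto simp: abs_minus_commute)
    then show "\<bar>Q j l\<bar> * \<bar>1 / Q l l - \<tau>l\<bar> / \<tau>l \<le> 1 / \<Lambda> * \<epsilon> / (\<Lambda> / 2)"
      using \<tau> Lam(1) by (intro frac_le) auto
  qed
  also have "\<dots> = 4 * lamU / \<Lambda>\<^sup>2 * (s * B / \<Lambda> + \<kappa>) + 2 * \<kappa> / \<Lambda> + 2 * \<epsilon> / \<Lambda>\<^sup>2"
    by (simp add: power2_eq_square mult_ac)
  finally show ?thesis by (simp add: r_def)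
qed

end

subsection \<open>The Chapman--Robbins bound\<close>

abbreviation data_space :: "nat \<Rightarrow> nat \<Rightarrow> ((nat \<Rightarrow> nat \<Rightarrow> real) \<times> (nat \<Rightarrow> real)) measure" where
  "data_space n p \<equiv> (\<Pi>\<^sub>M i\<in>{..<n}. \<Pi>\<^sub>M j\<in>{..<p}. borel) \<Otimes>\<^sub>M (\<Pi>\<^sub>M i\<in>{..<n}. borel)"

lemma measurable_design_noise_law_eq:
  "measurable (design_noise_law n p A) M = measurable (data_space n p) M"
  by (rule measurable_cong_sets) simp_all

text \<open>Adding the signal to the noise turns design and noise into the data, so a change of the
  regression vector becomes a change of the law on one fixed data space.\<close>

definition noise_shift :: "nat \<Rightarrow> nat \<Rightarrow> (nat \<Rightarrow> real) \<Rightarrow> (nat \<Rightarrow> nat \<Rightarrow> real) \<times> (nat \<Rightarrow> real) \<Rightarrow> (nat \<Rightarrow> nat \<Rightarrow> real) \<times> (nat \<Rightarrow> real)" where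
  "noise_shift n p h w = (fst w, \<lambda>i\<in>{..<n}. comb {..<p} (fst w) h i + snd w i)"

lemma measurable_comb [measurable]:
  "i < n \<Longrightarrow> (\<lambda>w. comb {..<p} (fst w) h i) \<in> borel_measurable (data_space n p)"
  unfolding comb_def by measurable

lemma measurable_noise_shift [measurable]: "noise_shift n p h \<in> measurable (data_space n p) (data_space n p)"
  unfolding noise_shift_def
proof (intro measurable_Pair measurable_fst measurable_restrict)
  fix i assume "i \<in> {..<n}"
  then show "(\<lambda>w. comb {..<p} (fst w) h i + snd w i) \<in> borel_measurable (data_space n p)"
    by (auto intro!: borel_measurable_add measurable_comb measurable_noise_entry)
qed

lemma under_eq:
  assumes "b \<in> carrier_vec p"
  shows "under n p b T = (\<lambda>w. (\<lambda>(x, y). T (design n p x) (vec n y)) (noise_shift n p (($) b) w))"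
proof
  fix w :: "(nat \<Rightarrow> nat \<Rightarrow> real) \<times> (nat \<Rightarrow> real)"
  have "design n p x *\<^sub>v b + vec n e = vec n (\<lambda>i\<in>{..<n}. comb {..<p} x (($) b) i + e i)" for x e
    using assms by (intro eq_vecI) (auto simp: design_def scalar_prod_def comb_def atLeast0LessThan)
  then show "under n p b T w = (\<lambda>(x, y). T (design n p x) (vec n y)) (noise_shift n p (($) b) w)"
    by (simp add: under_def noise_shift_def split: prod.split)
qed

lemma measurable_under:
  assumes "estimator n p T" "b \<in> carrier_vec p"
  shows "under n p b T \<in> borel_measurable (data_space n p)"
  unfolding under_eq[OF assms(2)]
  by (rule measurable_compose[OF measurable_noise_shift assms(1)[unfolded estimator_def]])

lemma noise_shift_add:
  "noise_shift n p (\<lambda>k. a k + b k) w = noise_shift n p a (noise_shift n p b w)"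
  by (auto simp: noise_shift_def comb_add fun_eq_iff)

lemma noise_shift_cong: "(\<And>k. k < p \<Longrightarrow> a k = b k) \<Longrightarrow> noise_shift n p a = noise_shift n p b"
  by (auto simp: noise_shift_def fun_eq_iff comb_def intro!: sum.cong)

text \<open>The Cameron--Martin density of the noise conditional on the design, whose law is the
  same for all regression vectors.\<close>

definition shift_density :: "nat \<Rightarrow> nat \<Rightarrow> (nat \<Rightarrow> real) \<Rightarrow> (nat \<Rightarrow> nat \<Rightarrow> real) \<times> (nat \<Rightarrow> real) \<Rightarrow> real" where
  "shift_density n p h w = (\<Prod>i<n. exp (comb {..<p} (fst w) h i * snd w i - (comb {..<p} (fst w) h i)\<^sup>2 / 2))"

lemma shift_density_nonneg [simp]: "0 \<le> shift_density n p h w"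
  by (simp add: shift_density_def prod_nonneg)

lemma measurable_shift_density [measurable]: "shift_density n p h \<in> borel_measurable (data_space n p)"
  unfolding shift_density_def by measurable

context
  fixes n p :: nat and A :: "real mat" and D :: "((nat \<Rightarrow> nat \<Rightarrow> real) \<times> (nat \<Rightarrow> real)) measure"
  assumes cov: "covariance_matrix p A" and inv: "invertible_mat A"
  defines "D \<equiv> design_noise_law n p A"
begin

lemma sets_D [measurable_cong]: "sets D = sets (data_space n p)"
  by (simp add: D_def)

lemma nn_integral_D:
  assumes "f \<in> borel_measurable (data_space n p)"
  shows "(\<integral>\<^sup>+w. f w \<partial>D) = (\<integral>\<^sup>+x. \<integral>\<^sup>+e. f (x, e) \<partial>(\<Pi>\<^sub>M i\<in>{..<n}. std_normal) \<partial>(\<Pi>\<^sub>M i\<in>{..<n}. normal_law p A))"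
proof -
  interpret E: prob_space "\<Pi>\<^sub>M i\<in>{..<n}. std_normal" by (rule prob_space_PiM[OF prob_space_std_normal])
  have "f \<in> borel_measurable ((\<Pi>\<^sub>M i\<in>{..<n}. normal_law p A) \<Otimes>\<^sub>M (\<Pi>\<^sub>M i\<in>{..<n}. std_normal))"
    using assms sets_D by (simp add: D_def design_noise_law_eq cong: measurable_cong_sets)
  then show ?thesis
    unfolding D_def design_noise_law_eq by (rule E.nn_integral_fst[symmetric])
qed

lemma section_measurable:
  assumes "f \<in> borel_measurable (data_space n p)" and "x \<in> space (\<Pi>\<^sub>M i\<in>{..<n}. normal_law p A)"
  shows "(\<lambda>e. f (x, e)) \<in> borel_measurable (\<Pi>\<^sub>M i\<in>{..<n}. borel)"
proof -
  have "x \<in> space (\<Pi>\<^sub>M i\<in>{..<n}. \<Pi>\<^sub>M j\<in>{..<p}. borel)" using assms(2) by (simp add: space_PiM)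
  then show ?thesis using assms(1) by (intro measurable_Pair2) 
qed

lemma distr_design_noise_shift: "distr D (data_space n p) (noise_shift n p h) = density D (\<lambda>w. ennreal (shift_density n p h w))"
proof (rule measure_eqI)
  show "sets (distr D (data_space n p) (noise_shift n p h)) = sets (density D (\<lambda>w. ennreal (shift_density n p h w)))"
    by (simp add: sets_D)
  fix B assume "B \<in> sets (distr D (data_space n p) (noise_shift n p h))"
  then have B[measurable]: "B \<in> sets (data_space n p)" by simp
  define f :: "_ \<Rightarrow> ennreal" where "f = indicator B"
  have f[measurable]: "f \<in> borel_measurable (data_space n p)" by (simp add: f_def)
  have "emeasure (distr D (data_space n p) (noise_shift n p h)) B = (\<integral>\<^sup>+w. f w \<partial>distr D (data_space n p) (noise_shift n p h))"
    by (simp add: f_def)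
  also have "\<dots> = (\<integral>\<^sup>+w. f (noise_shift n p h w) \<partial>D)"
    by (rule nn_integral_distr) measurable
  also have "\<dots> = (\<integral>\<^sup>+x. \<integral>\<^sup>+e. f (noise_shift n p h (x, e)) \<partial>(\<Pi>\<^sub>M i\<in>{..<n}. std_normal) \<partial>(\<Pi>\<^sub>M i\<in>{..<n}. normal_law p A))"
    by (rule nn_integral_D) measurable
  also have "\<dots> = (\<integral>\<^sup>+x. \<integral>\<^sup>+e. ennreal (shift_density n p h (x, e)) * f (x, e) \<partial>(\<Pi>\<^sub>M i\<in>{..<n}. std_normal) \<partial>(\<Pi>\<^sub>M i\<in>{..<n}. normal_law p A))"
  proof (rule nn_integral_cong)
    fix x assume x: "x \<in> space (\<Pi>\<^sub>M i\<in>{..<n}. normal_law p A)"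
    note [measurable] = section_measurable[OF f x]
    have "(\<integral>\<^sup>+e. f (noise_shift n p h (x, e)) \<partial>(\<Pi>\<^sub>M i\<in>{..<n}. std_normal)) =
        (\<integral>\<^sup>+e. f (x, e) \<partial>distr (\<Pi>\<^sub>M i\<in>{..<n}. std_normal) (\<Pi>\<^sub>M i\<in>{..<n}. borel) (\<lambda>e. \<lambda>i\<in>{..<n}. e i + comb {..<p} x h i))"
      by (subst nn_integral_distr) (auto simp: noise_shift_def add.commute)
    also have "\<dots> = (\<integral>\<^sup>+e. ennreal (shift_density n p h (x, e)) * f (x, e) \<partial>(\<Pi>\<^sub>M i\<in>{..<n}. std_normal))"
      unfolding distr_noise_shift by (subst nn_integral_density) (auto simp: shift_density_def prod_ennreal)
    finally show "(\<integral>\<^sup>+e. f (noise_shift n p h (x, e)) \<partial>(\<Pi>\<^sub>M i\<in>{..<n}. std_normal)) =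
      (\<integral>\<^sup>+e. ennreal (shift_density n p h (x, e)) * f (x, e) \<partial>(\<Pi>\<^sub>M i\<in>{..<n}. std_normal))" .
  qed
  also have "\<dots> = (\<integral>\<^sup>+w. ennreal (shift_density n p h w) * f w \<partial>D)"
    by (rule nn_integral_D[symmetric]) measurable
  also have "\<dots> = emeasure (density D (\<lambda>w. ennreal (shift_density n p h w))) B"
    unfolding f_def by (subst emeasure_density) auto
  finally show "emeasure (distr D (data_space n p) (noise_shift n p h)) B = emeasure (density D (\<lambda>w. ennreal (shift_density n p h w))) B" .
qed

text \<open>Given the design, the squared density is exp |X h|^2 times the density of the doubled
  shift, which integrates to one. What remains is an exponential moment of a sum of squares of
  Gaussian rows.\<close>

lemma nn_integral_shift_density_power2:
  assumes c: "bform p (\<lambda>i j. A $$ (i, j)) h h \<le> 1/4"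
  defines "s2 \<equiv> bform p (\<lambda>i j. A $$ (i, j)) h h"
  shows "(\<integral>\<^sup>+w. ennreal ((shift_density n p h w)\<^sup>2) \<partial>D) \<le> ennreal (exp (real n * (s2 + 4 * s2\<^sup>2)))"
proof -
  have s0: "0 \<le> s2" unfolding s2_def by (rule inverse_pd_formsD(5)[OF inverse_pd_forms_of_matrix[OF cov inv]])
  have "(\<integral>\<^sup>+w. ennreal ((shift_density n p h w)\<^sup>2) \<partial>D) =
      (\<integral>\<^sup>+x. \<integral>\<^sup>+e. ennreal ((shift_density n p h (x, e))\<^sup>2) \<partial>(\<Pi>\<^sub>M i\<in>{..<n}. std_normal) \<partial>(\<Pi>\<^sub>M i\<in>{..<n}. normal_law p A))"
    by (rule nn_integral_D) measurable
  also have "\<dots> = (\<integral>\<^sup>+x. \<integral>\<^sup>+e. ennreal (exp (1 * (\<Sum>i<n. (row_form p h 0 (x, e) i)\<^sup>2))) \<partial>(\<Pi>\<^sub>M i\<in>{..<n}. std_normal) \<partial>(\<Pi>\<^sub>M i\<in>{..<n}. normal_law p A))"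
  proof (rule nn_integral_cong)
    fix x
    interpret E: prob_space "\<Pi>\<^sub>M i\<in>{..<n}. std_normal" by (rule prob_space_PiM[OF prob_space_std_normal])
    define a where "a i = comb {..<p} x h i" for i
    have pr: "prob_space (distr (\<Pi>\<^sub>M i\<in>{..<n}. std_normal) (\<Pi>\<^sub>M i\<in>{..<n}. borel) (\<lambda>e. \<lambda>i\<in>{..<n}. e i + 2 * a i))"
      by (rule E.prob_space_distr) measurable
    have "(shift_density n p h (x, e))\<^sup>2 = exp (\<Sum>i<n. (a i)\<^sup>2) * (\<Prod>i<n. exp (2 * a i * e i - (2 * a i)\<^sup>2 / 2))" for e
    proof -
      have "(exp (a i * e i - (a i)\<^sup>2 / 2))\<^sup>2 = exp ((a i)\<^sup>2) * exp (2 * a i * e i - (2 * a i)\<^sup>2 / 2)" for i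
        by (simp add: power2_eq_square flip: exp_add)
      then show ?thesis
        by (simp only: shift_density_def fst_conv snd_conv a_def[symmetric] prod_power_distrib
            exp_sum[OF finite_lessThan] prod.distrib[symmetric])
    qed
    then have "(\<integral>\<^sup>+e. ennreal ((shift_density n p h (x, e))\<^sup>2) \<partial>(\<Pi>\<^sub>M i\<in>{..<n}. std_normal)) =
        ennreal (exp (\<Sum>i<n. (a i)\<^sup>2)) * (\<integral>\<^sup>+e. (\<Prod>i<n. ennreal (exp (2 * a i * e i - (2 * a i)\<^sup>2 / 2))) \<partial>(\<Pi>\<^sub>M i\<in>{..<n}. std_normal))"
      by (subst nn_integral_cmult[symmetric]) (auto simp: ennreal_mult' prod_ennreal)
    also have "(\<integral>\<^sup>+e. (\<Prod>i<n. ennreal (exp (2 * a i * e i - (2 * a i)\<^sup>2 / 2))) \<partial>(\<Pi>\<^sub>M i\<in>{..<n}. std_normal)) = 1"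
      using prob_space.emeasure_space_1[OF pr] unfolding distr_noise_shift
      by (subst (asm) emeasure_density) (auto simp: space_PiM cong: nn_integral_cong_simp)
    also have "ennreal (exp (\<Sum>i<n. (a i)\<^sup>2)) * 1 =
        (\<integral>\<^sup>+e. ennreal (exp (1 * (\<Sum>i<n. (row_form p h 0 (x, e) i)\<^sup>2))) \<partial>(\<Pi>\<^sub>M i\<in>{..<n}. std_normal))"
      using E.emeasure_space_1 by (simp add: row_form_def a_def comb_def mult.commute)
    finally show "(\<integral>\<^sup>+e. ennreal ((shift_density n p h (x, e))\<^sup>2) \<partial>(\<Pi>\<^sub>M i\<in>{..<n}. std_normal)) =
      (\<integral>\<^sup>+e. ennreal (exp (1 * (\<Sum>i<n. (row_form p h 0 (x, e) i)\<^sup>2))) \<partial>(\<Pi>\<^sub>M i\<in>{..<n}. std_normal))" .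
  qed
  also have "\<dots> = (\<integral>\<^sup>+w. ennreal (exp (1 * (\<Sum>i<n. (row_form p h 0 w i)\<^sup>2))) \<partial>D)"
    by (rule nn_integral_D[symmetric]) measurable
  also have "\<dots> \<le> ennreal (exp (real n * (1 * s2 + 4 * (1 * s2)\<^sup>2)))"
    unfolding D_def using c s0 by (intro nn_integral_exp_sum_squares[OF cov inv]) (auto simp: s2_def)
  finally show ?thesis by simp
qed

end

lemma integral_Cauchy_Schwarz:
  fixes f g :: "'a \<Rightarrow> real"
  assumes [measurable]: "f \<in> borel_measurable M" "g \<in> borel_measurable M"
    and f: "integrable M (\<lambda>x. (f x)\<^sup>2)" and g: "integrable M (\<lambda>x. (g x)\<^sup>2)"
  shows "integrable M (\<lambda>x. f x * g x)"
    and "(\<integral>x. f x * g x \<partial>M)\<^sup>2 \<le> (\<integral>x. (f x)\<^sup>2 \<partial>M) * (\<integral>x. (g x)\<^sup>2 \<partial>M)"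
proof -
  have "integrable M (\<lambda>x. (f x)\<^sup>2 + (g x)\<^sup>2)" using f g by simp
  then show fg: "integrable M (\<lambda>x. f x * g x)"
  proof (rule Bochner_Integration.integrable_bound)
    show "AE x in M. norm (f x * g x) \<le> norm ((f x)\<^sup>2 + (g x)\<^sup>2)"
    proof (rule AE_I2)
      fix x
      have "2 * (\<bar>f x\<bar> * \<bar>g x\<bar>) \<le> (f x)\<^sup>2 + (g x)\<^sup>2" using sum_squares_bound[of "\<bar>f x\<bar>" "\<bar>g x\<bar>"] by simp
      moreover have "0 \<le> \<bar>f x\<bar> * \<bar>g x\<bar>" by simp
      ultimately have "\<bar>f x\<bar> * \<bar>g x\<bar> \<le> (f x)\<^sup>2 + (g x)\<^sup>2" by linarith
      then show "norm (f x * g x) \<le> norm ((f x)\<^sup>2 + (g x)\<^sup>2)" by (simp add: abs_mult)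
    qed
  qed measurable
  define a b c where "a = (\<integral>x. (g x)\<^sup>2 \<partial>M)" and "b = (\<integral>x. f x * g x \<partial>M)" and "c = (\<integral>x. (f x)\<^sup>2 \<partial>M)"
  have quad: "0 \<le> c - 2 * t * b + t\<^sup>2 * a" for t
  proof -
    have "0 \<le> (\<integral>x. (f x - t * g x)\<^sup>2 \<partial>M)" by simp
    also have "(\<lambda>x. (f x - t * g x)\<^sup>2) = (\<lambda>x. (f x)\<^sup>2 - 2 * t * (f x * g x) + t\<^sup>2 * (g x)\<^sup>2)"
      by (auto simp: power2_eq_square algebra_simps)
    also have "(\<integral>x. (f x)\<^sup>2 - 2 * t * (f x * g x) + t\<^sup>2 * (g x)\<^sup>2 \<partial>M) = c - 2 * t * b + t\<^sup>2 * a"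
      using f g fg by (simp add: a_def b_def c_def)
    finally show ?thesis .
  qed
  have "0 \<le> a" by (simp add: a_def)
  have "b\<^sup>2 \<le> c * a"
  proof (cases "a = 0")
    case True
    have "b = 0"
    proof (rule ccontr)
      assume "b \<noteq> 0"
      then show False using quad[of "(c + 1) / (2 * b)"] True by simp
    qed
    then show ?thesis using True by simp
  next
    case False
    then show ?thesis using quad[of "b / a"] \<open>0 \<le> a\<close> by (simp add: power2_eq_square field_simps)
  qed
  then show "(\<integral>x. f x * g x \<partial>M)\<^sup>2 \<le> (\<integral>x. (f x)\<^sup>2 \<partial>M) * (\<integral>x. (g x)\<^sup>2 \<partial>M)"
    by (simp add: a_def b_def c_def)
qed

text \<open>
  The Chapman--Robbins inequality; the factor on the right bounds the chi-square divergence between the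
  laws of the data at \<open>b + h\<close> and at \<open>b\<close>.
\<close>
lemma chapman_robbins:
  assumes cov: "covariance_matrix p A" and inv: "invertible_mat A"
    and T: "estimator n p T" and b: "b \<in> carrier_vec p" and h: "h \<in> carrier_vec p"
    and fv: "finite_var n p A b T"
    and c: "bform p (\<lambda>i j. A $$ (i, j)) (($) h) (($) h) = s2" "s2 \<le> 1/4"
  shows "(expect n p A (b + h) T - expect n p A b T)\<^sup>2 \<le> var n p A b T * (exp (real n * (s2 + 4 * s2\<^sup>2)) - 1)"
proof -
  let ?D = "design_noise_law n p A" and ?h = "($) h"
  interpret D: prob_space ?D by (rule prob_space_design_noise_law[OF cov inv])
  define f where "f = under n p b T"
  define \<rho> where "\<rho> = shift_density n p ?h"
  have f0[measurable]: "f \<in> borel_measurable (data_space n p)" using measurable_under[OF T b] by (simp add: f_def)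
  have [measurable]: "\<rho> \<in> borel_measurable (data_space n p)" by (simp add: \<rho>_def)
  have mD: "measurable ?D M = measurable (data_space n p) M" for M :: "'z measure"
    by (rule measurable_cong_sets) simp_all
  have fD[measurable]: "f \<in> borel_measurable ?D" and \<rho>D[measurable]: "\<rho> \<in> borel_measurable ?D"
    unfolding mD by measurable
  have shift: "distr ?D (data_space n p) (noise_shift n p ?h) = density ?D (\<lambda>w. ennreal (\<rho> w))"
    unfolding \<rho>_def by (rule distr_design_noise_shift[OF cov inv])
  have change: "(\<integral>w. g (noise_shift n p ?h w) \<partial>?D) = (\<integral>w. \<rho> w * g w \<partial>?D)"
    if g[measurable]: "g \<in> borel_measurable (data_space n p)" for g :: "_ \<Rightarrow> real"
  proof -
    have "(\<integral>w. g (noise_shift n p ?h w) \<partial>?D) = (\<integral>w. g w \<partial>distr ?D (data_space n p) (noise_shift n p ?h))"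
      by (intro integral_distr[symmetric]) (simp_all add: mD g)
    also have "\<dots> = (\<integral>w. \<rho> w *\<^sub>R g w \<partial>?D)"
      unfolding shift
    proof (intro integral_density)
      show "AE w in ?D. 0 \<le> \<rho> w" by (simp add: \<rho>_def)
    qed (simp_all add: mD g \<rho>D[unfolded mD])
    finally show ?thesis by simp
  qed
  have "under n p (b + h) T = (\<lambda>w. f (noise_shift n p ?h w))"
  proof -
    have "noise_shift n p (($) (b + h)) = noise_shift n p (\<lambda>k. b $ k + h $ k)"
      using b h by (intro noise_shift_cong) simp
    then show ?thesis
      using b h by (simp add: f_def under_eq noise_shift_add[abs_def])
  qed
  then have Eh: "expect n p A (b + h) T = (\<integral>w. \<rho> w * f w \<partial>?D)"
    unfolding expect_def using change[of f] measurable_under[OF T b] by (simp add: f_def)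
  have \<rho>1: "(\<integral>w. \<rho> w \<partial>?D) = 1"
    using change[of "\<lambda>_. 1"] by (simp add: D.prob_space)
  have \<rho>2n: "(\<integral>\<^sup>+w. ennreal ((\<rho> w)\<^sup>2) \<partial>?D) \<le> ennreal (exp (real n * (s2 + 4 * s2\<^sup>2)))"
    using nn_integral_shift_density_power2[OF cov inv, of ?h n] c by (simp add: \<rho>_def)
  then have \<rho>2i: "integrable ?D (\<lambda>w. (\<rho> w)\<^sup>2)"
    by (intro integrableI_bounded) (auto intro: le_less_trans)
  have \<rho>2: "(\<integral>w. (\<rho> w)\<^sup>2 \<partial>?D) \<le> exp (real n * (s2 + 4 * s2\<^sup>2))"
    using \<rho>2n nn_integral_eq_integral[OF \<rho>2i] by simp
  have \<rho>i: "integrable ?D \<rho>"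
    using integral_Cauchy_Schwarz(1)[OF \<rho>D borel_measurable_const \<rho>2i, of 1] by simp
  have fi: "integrable ?D f" "integrable ?D (\<lambda>w. (f w)\<^sup>2)"
    using fv by (auto simp: finite_var_def finite_mean_def f_def)
  define \<mu> where "\<mu> = expect n p A b T"
  have \<mu>: "(\<integral>w. f w \<partial>?D) = \<mu>" by (simp add: \<mu>_def expect_def f_def)
  have f2: "integrable ?D (\<lambda>w. (f w - \<mu>)\<^sup>2)"
    using fi by (simp add: power2_diff)
  have \<rho>2': "integrable ?D (\<lambda>w. (\<rho> w - 1)\<^sup>2)"
    using \<rho>2i \<rho>i by (simp add: power2_diff)
  have \<rho>f: "integrable ?D (\<lambda>w. \<rho> w * f w)"
    by (rule integral_Cauchy_Schwarz(1)[OF \<rho>D fD \<rho>2i fi(2)])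
  \<comment> \<open>Centring both factors leaves the covariance as it is, but makes Cauchy--Schwarz
    produce the variance and the chi-square divergence.\<close>
  have "(\<integral>w. (f w - \<mu>) * (\<rho> w - 1) \<partial>?D) = (\<integral>w. \<rho> w * f w - \<mu> * \<rho> w - f w + \<mu> \<partial>?D)"
    by (simp add: algebra_simps)
  also have "\<dots> = expect n p A (b + h) T - \<mu>"
    using \<rho>f \<rho>i fi by (simp add: Eh \<rho>1 \<mu> D.prob_space)
  finally have diff: "(\<integral>w. (f w - \<mu>) * (\<rho> w - 1) \<partial>?D) = expect n p A (b + h) T - \<mu>" .
  have "(\<integral>w. (f w - \<mu>) * (\<rho> w - 1) \<partial>?D)\<^sup>2 \<le> (\<integral>w. (f w - \<mu>)\<^sup>2 \<partial>?D) * (\<integral>w. (\<rho> w - 1)\<^sup>2 \<partial>?D)"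
    by (rule integral_Cauchy_Schwarz(2)[OF borel_measurable_diff[OF fD] borel_measurable_diff[OF \<rho>D] f2 \<rho>2']) simp_all
  also have "\<dots> \<le> (\<integral>w. (f w - \<mu>)\<^sup>2 \<partial>?D) * (exp (real n * (s2 + 4 * s2\<^sup>2)) - 1)"
  proof (rule mult_left_mono)
    show "(\<integral>w. (\<rho> w - 1)\<^sup>2 \<partial>?D) \<le> exp (real n * (s2 + 4 * s2\<^sup>2)) - 1"
      using \<rho>2i \<rho>i \<rho>2 by (simp add: power2_diff \<rho>1 D.prob_space)
  qed simp
  also have "(\<integral>w. (f w - \<mu>)\<^sup>2 \<partial>?D) = var n p A b T"
    by (simp add: var_def f_def \<mu>_def)
  finally show ?thesis unfolding diff unfolding \<mu>_def .
qed

section \<open>The lower bound for the variance along the least favourable direction\<close>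

lemma bounded_forms_of_matrix:
  assumes cov: "covariance_matrix p A" and inv: "invertible_mat A" and p: "0 < p"
    and L: "0 < \<Lambda>" "\<Lambda> \<le> min_eigenvalue A" and B: "max_entry A \<le> B"
    and s: "1 \<le> s" "\<And>j. j < p \<Longrightarrow> real (l0norm (col (inverse_mat A) j)) \<le> s"
  shows "bounded_forms p (\<lambda>i j. A $$ (i, j)) (\<lambda>i j. inverse_mat A $$ (i, j)) B \<Lambda> s"
proof
  have A: "A \<in> carrier_mat p p" using cov by (simp add: covariance_matrix_def)
  show "inverse_pd_forms p (\<lambda>i j. A $$ (i, j)) (\<lambda>i j. inverse_mat A $$ (i, j))"
    by (rule inverse_pd_forms_of_matrix[OF cov inv])
  show "\<Lambda> * (\<Sum>i<p. (u i)\<^sup>2) \<le> bform p (\<lambda>i j. A $$ (i, j)) u u" for u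
  proof -
    have "\<Lambda> * (\<Sum>i<p. (u i)\<^sup>2) \<le> min_eigenvalue A * (\<Sum>i<p. (u i)\<^sup>2)"
      using L by (intro mult_right_mono) (auto intro: sum_nonneg)
    then show ?thesis using min_eigenvalue_le_bform(2)[OF cov inv p, of u] by linarith
  qed
  show "\<bar>A $$ (i, j)\<bar> \<le> B" if "i < p" "j < p" for i j
  proof -
    have eq: "{\<bar>A $$ (i, j)\<bar> | i j. i < dim_row A \<and> j < dim_col A} =
        (\<lambda>(i, j). \<bar>A $$ (i, j)\<bar>) ` ({..<dim_row A} \<times> {..<dim_col A})" by auto
    have "\<bar>A $$ (i, j)\<bar> \<le> max_entry A"
      unfolding max_entry_def eq using that A by (intro Max_ge) auto
    then show ?thesis using B by simp
  qed
  show "real (card {k. k < p \<and> inverse_mat A $$ (k, j) \<noteq> 0}) \<le> s" if "j < p" for j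
  proof -
    have "{i. i < dim_vec (col (inverse_mat A) j) \<and> col (inverse_mat A) j $ i \<noteq> 0} = {k. k < p \<and> inverse_mat A $$ (k, j) \<noteq> 0}"
      using inverse_mat_properties(3)[OF A inv] that by auto
    then show ?thesis using s(2)[OF that] by (simp add: l0norm_def)
  qed
qed (use L s in auto)

text \<open>In matrices, \<Theta> \<Sigma> \<Theta> = \<Theta>: the target variance is the squared
  length, in the form \<open>S\<close>, of the unnormalised shift.\<close>

lemma (in bounded_forms) bform_inverse_image:
  defines "w \<equiv> \<lambda>\<xi> k. \<Sum>l<p. Q k l * \<xi> l"
  shows "bform p S (w \<xi>) (w \<xi>) = bform p Q \<xi> \<xi>"
proof -
  have "(\<Sum>j<p. S i j * w \<xi> j) = \<xi> i" if i: "i < p" for i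
  proof -
    have "(\<Sum>j<p. S i j * w \<xi> j) = (\<Sum>j<p. \<Sum>l<p. S i j * Q j l * \<xi> l)"
      by (simp add: w_def sum_distrib_left mult.assoc)
    also have "\<dots> = (\<Sum>l<p. \<Sum>j<p. S i j * Q j l * \<xi> l)" by (rule sum.swap)
    also have "\<dots> = (\<Sum>l<p. (if i = l then 1 else 0) * \<xi> l)"
      using inverse_pd_formsD(3)[OF forms i] by (simp add: sum_distrib_right[symmetric])
    also have "\<dots> = \<xi> i" using i by (simp add: if_distrib[of "\<lambda>z. z * _"] cong: if_cong)
    finally show ?thesis .
  qed
  then have "bform p S (w \<xi>) (w \<xi>) = (\<Sum>i<p. w \<xi> i * \<xi> i)" by (simp add: bform_mult_vec)
  also have "\<dots> = bform p Q \<xi> \<xi>" by (simp add: bform_mult_vec w_def mult.commute)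
  finally show ?thesis .
qed

lemma (in bounded_forms) bform_Q_bounds: "0 \<le> bform p Q \<xi> \<xi>" "bform p Q \<xi> \<xi> \<le> (\<Sum>k<p. \<bar>\<xi> k\<bar>)\<^sup>2 / \<Lambda>"
proof -
  show "0 \<le> bform p Q \<xi> \<xi>"
    unfolding bform_inverse_image[symmetric] by (rule inverse_pd_formsD(5)[OF forms])
  have "\<bar>\<Sum>k<p. \<Sum>l<p. \<xi> k * \<xi> l * Q k l\<bar> \<le> (\<Sum>k<p. \<bar>\<xi> k\<bar>) * (\<Sum>k<p. \<bar>\<xi> k\<bar>) * (1 / \<Lambda>)"
    using abs_Q_le by (intro abs_double_sum_le) auto
  then show "bform p Q \<xi> \<xi> \<le> (\<Sum>k<p. \<bar>\<xi> k\<bar>)\<^sup>2 / \<Lambda>"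
    by (simp add: bform_def power2_eq_square mult_ac abs_le_iff)
qed

lemma vec_of_index: "v \<in> carrier_vec p \<Longrightarrow> vec p (($) v) = v"
  by (intro eq_vecI) auto

lemma mult_mat_vec_index:
  "A \<in> carrier_mat p p \<Longrightarrow> v \<in> carrier_vec p \<Longrightarrow> k < p \<Longrightarrow> (A *\<^sub>v v) $ k = (\<Sum>l<p. A $$ (k, l) * v $ l)"
  by (simp add: scalar_prod_def atLeast0LessThan)

lemma bigo_one_bound:
  assumes "f \<in> O(\<lambda>_. 1 :: real)"
  shows "\<exists>K>0. \<forall>\<^sub>F n in sequentially. \<bar>f n :: real\<bar> \<le> K"
proof -
  obtain K where "K > 0" "\<forall>\<^sub>F n in sequentially. norm (f n) \<le> K * norm (1 :: real)"
    using landau_o.bigE[OF assms] by blast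
  then show ?thesis by auto
qed

lemma self_in_nbhd:
  assumes "b \<in> sparse_params P C d" "0 \<le> r" "P \<subseteq> carrier_vec p"
  shows "b \<in> nbhd P C d b r"
proof -
  have "b \<in> carrier_vec p" using assms by (auto simp: sparse_params_def)
  then have "b - b = 0\<^sub>v p" by simp
  then show ?thesis using assms by (simp add: nbhd_def l2norm_def)
qed

lemma exp_quotient_tendsto_one: "((\<lambda>x::real. (exp x - 1) / x) \<longlongrightarrow> 1) (at 0)"
  using DERIV_exp[of "0::real"] by (simp add: DERIV_def)

text \<open>The direction \<Theta> xi maximises (xi^T h)^2 for a given value of h^T \<Sigma> h,
  which is where the sharp constant xi^T \<Theta> xi comes from. Unbiasedness is applied at the two
  ends of the shift and determines the change of the mean.\<close>

lemma variance_lower_bound: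
  fixes Sigma0 Theta0 :: "nat \<Rightarrow> real mat" and beta0 xi :: "nat \<Rightarrow> real vec"
  assumes c: "0 < c" and p: "\<And>n. 1 \<le> p n" and P: "\<And>n. P n \<subseteq> carrier_vec (p n)"
    and Sigma0: "\<And>n. covariance_matrix (p n) (Sigma0 n)" "\<And>n. invertible_mat (Sigma0 n)"
    and Theta0: "\<And>n. Theta0 n = inverse_mat (Sigma0 n)"
    and eig: "(\<lambda>n. 1 / min_eigenvalue (Sigma0 n)) \<in> O(\<lambda>_. 1)"
    and beta0: "\<And>n. beta0 n \<in> sparse_params (P n) C (d n)"
    and xi: "\<And>n. xi n \<in> carrier_vec (p n)" "(\<lambda>n. l1norm (xi n)) \<in> O(\<lambda>_. 1)"
    and v: "\<And>n. v n = xi n \<bullet> (Theta0 n *\<^sub>v xi n)"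
    and dir: "\<And>n r. dir n r = beta0 n + (1 / sqrt (v n * r)) \<cdot>\<^sub>v (Theta0 n *\<^sub>v xi n)"
    and T: "strongly_unbiased_rate C c p Sigma0 P d beta0 (\<lambda>n b. xi n \<bullet> b) m T"
    and nb: "\<forall>\<^sub>F n in sequentially. dir n (m n) \<in> nbhd (P n) C (d n) (beta0 n) (c / sqrt (m n))"
  shows "\<exists>r. r \<longlonglongrightarrow> 0 \<and> (\<forall>\<^sub>F n in sequentially. (v n + r n) / real n \<le> var n (p n) (Sigma0 n) (beta0 n) (T n))"
proof -
  have b0: "beta0 n \<in> carrier_vec (p n)" for n
    using beta0[of n] P[of n] by (auto simp: sparse_params_def)
  have m: "0 < m n" and est: "estimator n (p n) (T n)" for n
    using T by (auto simp: strongly_unbiased_rate_def)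
  have fv: "\<forall>\<^sub>F n in sequentially. finite_var n (p n) (Sigma0 n) (beta0 n) (T n)"
    and varO: "(\<lambda>n. var n (p n) (Sigma0 n) (beta0 n) (T n)) \<in> O(\<lambda>n. 1 / real n)"
    and no: "(\<lambda>n. real n) \<in> o(m)"
    and unb: "\<And>b. (\<And>n. b n \<in> nbhd (P n) C (d n) (beta0 n) (c / sqrt (m n))) \<Longrightarrow>
        (\<lambda>n. sqrt (m n) * (expect n (p n) (Sigma0 n) (b n) (T n) - xi n \<bullet> b n)) \<longlonglongrightarrow> 0"
    using T by (auto simp: strongly_unbiased_rate_def)
  define V where "V n = real n * var n (p n) (Sigma0 n) (beta0 n) (T n)" for n
  have self: "beta0 n \<in> nbhd (P n) C (d n) (beta0 n) (c / sqrt (m n))" for n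
    using c m[of n] by (intro self_in_nbhd[OF beta0 _ P]) auto
  \<comment> \<open>Unbiasedness speaks of sequences that lie in the neighbourhood for every index,
    while the shifted vector lies there only eventually; \<open>beta0\<close> is substituted
    elsewhere.\<close>
  define b where "b n = (if dir n (m n) \<in> nbhd (P n) C (d n) (beta0 n) (c / sqrt (m n)) then dir n (m n) else beta0 n)" for n
  define e where "e n = sqrt (m n) * (expect n (p n) (Sigma0 n) (b n) (T n) - xi n \<bullet> b n) -
    sqrt (m n) * (expect n (p n) (Sigma0 n) (beta0 n) (T n) - xi n \<bullet> beta0 n)" for n
  have e: "e \<longlonglongrightarrow> 0"
    unfolding e_def using tendsto_diff[OF unb[of b] unb[of beta0]] self by (simp add: b_def)
  obtain K1 where K1: "K1 > 0" "\<forall>\<^sub>F n in sequentially. \<bar>1 / min_eigenvalue (Sigma0 n)\<bar> \<le> K1"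
    using bigo_one_bound[OF eig] by blast
  obtain K2 where K2: "K2 > 0" "\<forall>\<^sub>F n in sequentially. \<bar>l1norm (xi n)\<bar> \<le> K2"
    using bigo_one_bound[OF xi(2)] by blast
  obtain K3 where K3: "K3 > 0" "\<forall>\<^sub>F n in sequentially. norm (var n (p n) (Sigma0 n) (beta0 n) (T n)) \<le> K3 * norm (1 / real n)"
    using landau_o.bigE[OF varO] by blast
  have nm: "(\<lambda>n. real n / m n) \<longlonglongrightarrow> 0" using smalloD_tendsto[OF no] .
  have im: "(\<lambda>n. 1 / m n) \<longlonglongrightarrow> 0"
  proof (rule tendsto_sandwich[OF _ _ tendsto_const nm])
    show "\<forall>\<^sub>F n in sequentially. 0 \<le> 1 / m n" using m by (simp add: less_imp_le)
    show "\<forall>\<^sub>F n in sequentially. 1 / m n \<le> real n / m n"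
      using eventually_ge_at_top[of 1]
    proof eventually_elim
      case (elim n)
      then show ?case using m[of n] by (intro divide_right_mono) auto
    qed
  qed
  \<comment> \<open>The exponent in \<open>chapman_robbins\<close> for a shift with h^T \<Sigma> h =
    1 / m; it vanishes because n = o(m).\<close>
  define x where "x n = real n * (1 / m n + 4 * (1 / m n)\<^sup>2)" for n
  have x_eq: "x n = real n / m n * (1 + 4 * (1 / m n))" for n
    using m[of n] by (simp add: x_def power2_eq_square field_simps)
  have x0: "x \<longlonglongrightarrow> 0"
    unfolding x_eq using tendsto_mult[OF nm tendsto_add[OF tendsto_const tendsto_mult[OF tendsto_const im]], of 1 4] by simp
  have xpos: "\<forall>\<^sub>F n in sequentially. 0 < x n"
    using eventually_gt_at_top[of 0]
  proof eventually_elim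
    case (elim n)
    then show ?case using m[of n] by (simp add: x_eq add_pos_pos)
  qed
  \<comment> \<open>The factor that multiplies \<open>V n\<close> once the inequality is rescaled by
    \<open>m n\<close>. It tends to one because exp x - 1 behaves like x, and x like n / m.\<close>
  define k where "k n = m n / real n * (exp (x n) - 1)" for n
  have k: "k \<longlonglongrightarrow> 1"
  proof -
    have fl: "filterlim x (at 0) sequentially"
      using x0 xpos by (auto simp: filterlim_at elim: eventually_mono)
    have "(\<lambda>n. (exp (x n) - 1) / x n) \<longlonglongrightarrow> 1"
      by (rule filterlim_compose[OF exp_quotient_tendsto_one fl])
    from tendsto_mult[OF this tendsto_add[OF tendsto_const tendsto_mult[OF tendsto_const im]], of 1 4]
    have "(\<lambda>n. (exp (x n) - 1) / x n * (1 + 4 * (1 / m n))) \<longlonglongrightarrow> 1" by simp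
    moreover have "\<forall>\<^sub>F n in sequentially. (exp (x n) - 1) / x n * (1 + 4 * (1 / m n)) = k n"
      using eventually_gt_at_top[of 0]
    proof eventually_elim
      case (elim n)
      have "1 + 4 * (1 / m n) \<noteq> 0" using m[of n] by (smt (verit) divide_pos_pos)
      then show ?case using elim m[of n] unfolding k_def x_eq[of n] by (simp add: divide_simps)
    qed
    ultimately show ?thesis by (rule Lim_transform_eventually)
  qed
  \<comment> \<open>The first term bounds 2 sqrt v times the error of the means, since v \<le> K2^2
    K1; the second replaces the factor \<open>k n\<close> by one, since \<open>V n\<close> is
    bounded by \<open>K3\<close>.\<close>
  define \<delta> where "\<delta> n = 2 * sqrt (K2\<^sup>2 * K1) * \<bar>e n\<bar> + K3 * \<bar>k n - 1\<bar>" for n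
  have \<delta>: "\<delta> \<longlonglongrightarrow> 0"
  proof -
    have "(\<lambda>n. k n - 1) \<longlonglongrightarrow> 0" using tendsto_diff[OF k tendsto_const[of 1]] by simp
    then have "(\<lambda>n. \<bar>k n - 1\<bar>) \<longlonglongrightarrow> 0" by (rule tendsto_rabs_zero)
    moreover have "(\<lambda>n. \<bar>e n\<bar>) \<longlonglongrightarrow> 0" using e by (rule tendsto_rabs_zero)
    ultimately show ?thesis
      unfolding \<delta>_def by (auto intro!: tendsto_add_zero tendsto_mult_right_zero)
  qed
  have im4: "\<forall>\<^sub>F n in sequentially. 1 / m n < 1 / 4" using im by (rule order_tendstoD) simp
  have main: "\<forall>\<^sub>F n in sequentially. v n - \<delta> n \<le> V n"
    using nb K1(2) K2(2) K3(2) fv im4 eventually_gt_at_top[of 0]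
  proof eventually_elim
    case (elim n)
    let ?A = "Sigma0 n"
    have p0: "0 < p n" using p[of n] by simp
    have A: "?A \<in> carrier_mat (p n) (p n)" using Sigma0(1)[of n] by (simp add: covariance_matrix_def)
    have \<Theta>: "Theta0 n \<in> carrier_mat (p n) (p n)"
      unfolding Theta0 by (rule inverse_mat_properties[OF A Sigma0(2)])
    define \<Lambda> where "\<Lambda> = min_eigenvalue ?A"
    have \<Lambda>: "0 < \<Lambda>" unfolding \<Lambda>_def by (rule min_eigenvalue_le_bform[OF Sigma0 p0])
    have sp: "real (l0norm (col (inverse_mat ?A) j)) \<le> real (p n)" for j
    proof -
      have "card {i. i < dim_vec (col (inverse_mat ?A) j) \<and> col (inverse_mat ?A) j $ i \<noteq> 0} \<le> card {..<p n}"
        using \<Theta> unfolding Theta0 by (intro card_mono) auto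
      then show ?thesis by (simp add: l0norm_def)
    qed
    have p1: "1 \<le> real (p n)" using p[of n] by simp
    have \<Lambda>_le: "\<Lambda> \<le> min_eigenvalue ?A" by (simp add: \<Lambda>_def)
    interpret F: bounded_forms "p n" "\<lambda>i j. ?A $$ (i, j)" "\<lambda>i j. inverse_mat ?A $$ (i, j)" "max_entry ?A" \<Lambda> "real (p n)"
      by (rule bounded_forms_of_matrix[OF Sigma0(1)[of n] Sigma0(2)[of n] p0 \<Lambda> \<Lambda>_le order_refl p1 sp])
    have v_eq: "v n = bform (p n) (\<lambda>i j. inverse_mat ?A $$ (i, j)) (($) (xi n)) (($) (xi n))"
      using scalar_prod_mult_vec_eq_bform[OF \<Theta>, of "($) (xi n)" "($) (xi n)"] xi(1)[of n]
      by (simp add: v vec_of_index Theta0)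
    have v0: "0 \<le> v n" unfolding v_eq by (rule F.bform_Q_bounds)
    have "v n \<le> (l1norm (xi n))\<^sup>2 * (1 / \<Lambda>)"
      using F.bform_Q_bounds(2)[of "($) (xi n)"] xi(1)[of n] by (simp add: v_eq l1norm_def)
    also have "\<dots> \<le> K2\<^sup>2 * K1"
      using elim(2,3) \<Lambda> abs_le_square_iff[of "l1norm (xi n)" K2] K2(1) by (intro mult_mono) (auto simp: \<Lambda>_def)
    finally have vK: "sqrt (v n) \<le> sqrt (K2\<^sup>2 * K1)" by simp
    have var0: "0 \<le> V n" by (simp add: V_def var_def)
    have "norm (var n (p n) (Sigma0 n) (beta0 n) (T n)) \<le> K3 / real n" using elim(4) by simp
    then have VK: "V n \<le> K3"
      using elim(7) by (simp add: V_def field_simps abs_le_iff)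
    have \<delta>0: "0 \<le> \<delta> n" using K1(1) K3(1) by (simp add: \<delta>_def)
    show ?case
    proof (cases "v n = 0")
      \<comment> \<open>The shift cannot be normalised here, but the claim is immediate from the
        nonnegativity of the variance.\<close>
      case True
      then show ?thesis using \<delta>0 var0 by simp
    next
      case False
      then have vpos: "0 < v n" using v0 by simp
      define h where "h = (1 / sqrt (v n * m n)) \<cdot>\<^sub>v (Theta0 n *\<^sub>v xi n)"
      have h: "h \<in> carrier_vec (p n)" using \<Theta> xi(1)[of n] by (simp add: h_def)
      have bn: "b n = beta0 n + h" using elim(1) by (simp add: b_def dir h_def)
      have hk: "h $ k = 1 / sqrt (v n * m n) * (\<Sum>l<p n. inverse_mat ?A $$ (k, l) * xi n $ l)" if "k < p n" for k
        using that \<Theta> xi(1)[of n] mult_mat_vec_index[OF \<Theta> xi(1)[of n] that] by (simp add: h_def Theta0)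
      have vm: "0 < v n * m n" using vpos m[of n] by simp
      have bh: "bform (p n) (\<lambda>i j. ?A $$ (i, j)) (($) h) (($) h) = 1 / m n"
      proof -
        define w where "w k = (\<Sum>l<p n. inverse_mat ?A $$ (k, l) * xi n $ l)" for k
        have bw: "bform (p n) (\<lambda>i j. ?A $$ (i, j)) w w = v n"
          unfolding v_eq F.bform_inverse_image[symmetric] w_def ..
        have "bform (p n) (\<lambda>i j. ?A $$ (i, j)) (($) h) (($) h) =
            bform (p n) (\<lambda>i j. ?A $$ (i, j)) (\<lambda>k. 1 / sqrt (v n * m n) * w k) (\<lambda>k. 1 / sqrt (v n * m n) * w k)"
          by (rule bform_cong) (simp_all only: hk w_def)
        also have "\<dots> = (1 / sqrt (v n * m n)) * ((1 / sqrt (v n * m n)) * v n)"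
          by (simp only: bform_scale_left bform_scale_right bw)
        also have "\<dots> = v n / (sqrt (v n * m n) * sqrt (v n * m n))" by simp
        also have "\<dots> = v n / (v n * m n)" using vm by (simp only: real_sqrt_mult_self abs_of_pos)
        also have "\<dots> = 1 / m n" using vpos by simp
        finally show ?thesis .
      qed
      have xih: "xi n \<bullet> h = sqrt (v n) / sqrt (m n)"
      proof -
        have "xi n \<bullet> h = 1 / sqrt (v n * m n) * v n"
          using xi(1)[of n] \<Theta> by (simp add: h_def v)
        also have "\<dots> = (sqrt (v n) * sqrt (v n)) / (sqrt (v n) * sqrt (m n))"
          using vpos by (simp add: real_sqrt_mult)
        also have "\<dots> = sqrt (v n) / sqrt (m n)"
          using vpos by (intro mult_divide_mult_cancel_left) simp
        finally show ?thesis .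
      qed
      have "xi n \<bullet> b n = xi n \<bullet> beta0 n + xi n \<bullet> h"
        unfolding bn using xi(1)[of n] b0[of n] h by (rule scalar_prod_add_distrib)
      then have "sqrt (m n) * (expect n (p n) ?A (b n) (T n) - expect n (p n) ?A (beta0 n) (T n)) = sqrt (v n) + e n"
        using m[of n] by (simp add: e_def xih algebra_simps)
      then have "(sqrt (v n) + e n)\<^sup>2 = m n * (expect n (p n) ?A (b n) (T n) - expect n (p n) ?A (beta0 n) (T n))\<^sup>2"
        using m[of n] by (simp add: power_mult_distrib flip: \<open>_ = sqrt (v n) + e n\<close>)
      also have "\<dots> \<le> m n * (var n (p n) ?A (beta0 n) (T n) * (exp (real n * (1 / m n + 4 * (1 / m n)\<^sup>2)) - 1))"
        unfolding bn using m[of n] elim(6)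
        by (intro mult_left_mono chapman_robbins[OF Sigma0 est b0 h elim(5) bh]) auto
      also have "\<dots> = V n * k n"
        using elim(7) by (simp add: V_def k_def x_def)
      finally have cr: "(sqrt (v n) + e n)\<^sup>2 \<le> V n * k n" .
      have "v n + 2 * sqrt (v n) * e n \<le> (sqrt (v n) + e n)\<^sup>2"
        using v0 by (simp add: power2_sum)
      moreover have "- (sqrt (K2\<^sup>2 * K1) * \<bar>e n\<bar>) \<le> sqrt (v n) * e n"
      proof -
        have "\<bar>sqrt (v n) * e n\<bar> \<le> sqrt (K2\<^sup>2 * K1) * \<bar>e n\<bar>"
          unfolding abs_mult using vK v0 by (intro mult_right_mono) auto
        then show ?thesis by linarith
      qed
      moreover have "V n * k n \<le> V n + K3 * \<bar>k n - 1\<bar>"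
      proof -
        have "V n * (k n - 1) \<le> V n * \<bar>k n - 1\<bar>" using var0 by (intro mult_left_mono) auto
        also have "\<dots> \<le> K3 * \<bar>k n - 1\<bar>" using VK by (intro mult_right_mono) auto
        finally show ?thesis by (simp add: algebra_simps)
      qed
      ultimately show ?thesis using cr unfolding \<delta>_def by linarith
    qed
  qed
  \<comment> \<open>Only the deficit is recorded, so that \<open>r\<close> vanishes even if
    \<open>V n\<close> stays above \<open>v n\<close>.\<close>
  define r where "r n = min 0 (V n - v n)" for n
  have "r \<longlonglongrightarrow> 0"
  proof (rule tendsto_sandwich)
    show "(\<lambda>n. - \<delta> n) \<longlonglongrightarrow> 0" using tendsto_minus[OF \<delta>] by simp
    have "0 \<le> \<delta> n" for n using K1(1) K3(1) by (simp add: \<delta>_def)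
    then show "\<forall>\<^sub>F n in sequentially. - \<delta> n \<le> r n" using main by (auto simp: r_def elim!: eventually_mono)
    show "\<forall>\<^sub>F n in sequentially. r n \<le> 0" by (simp add: r_def)
  qed simp
  moreover have "\<forall>\<^sub>F n in sequentially. (v n + r n) / real n \<le> var n (p n) (Sigma0 n) (beta0 n) (T n)"
    using eventually_gt_at_top[of 0]
  proof eventually_elim
    case (elim n)
    have "v n + r n \<le> V n" by (simp add: r_def)
    then show ?case using elim by (simp add: V_def field_simps)
  qed
  ultimately show ?thesis by blast
qed

subsection \<open>Moments of the de-sparsified Lasso\<close>

lemma sum_power4_le:
  fixes y :: "nat \<Rightarrow> real"
  shows "(\<Sum>k<m. y k) ^ 4 \<le> real m ^ 3 * (\<Sum>k<m. (y k) ^ 4)"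
proof -
  have *: "(\<Sum>k<m. y k)\<^sup>2 \<le> real m * (\<Sum>k<m. (y k)\<^sup>2)" for y :: "nat \<Rightarrow> real"
    using Cauchy_Schwarz_ineq_sum[of "\<lambda>_. 1" y "{..<m}"] by simp
  have "((\<Sum>k<m. y k)\<^sup>2)\<^sup>2 \<le> (real m * (\<Sum>k<m. (y k)\<^sup>2))\<^sup>2"
    using * by (intro power_mono) auto
  also have "\<dots> = (real m)\<^sup>2 * (\<Sum>k<m. (y k)\<^sup>2)\<^sup>2" by (rule power_mult_distrib)
  also have "\<dots> \<le> (real m)\<^sup>2 * (real m * (\<Sum>k<m. ((y k)\<^sup>2)\<^sup>2))"
    by (intro mult_left_mono *) simp
  finally show ?thesis by (simp add: power2_eq_square power3_eq_cube power4_eq_xxxx mult.assoc)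
qed

lemma add_power4_le: "(a + b) ^ 4 \<le> 8 * (a ^ 4 + b ^ 4)" for a b :: real
proof -
  have *: "(a + b)\<^sup>2 \<le> 2 * (a\<^sup>2 + b\<^sup>2)" for a b :: real
    using sum_squares_bound[of a b] by (simp add: power2_sum)
  have "((a + b)\<^sup>2)\<^sup>2 \<le> (2 * (a\<^sup>2 + b\<^sup>2))\<^sup>2" using * by (intro power_mono) auto
  also have "\<dots> = 4 * (a\<^sup>2 + b\<^sup>2)\<^sup>2" by (simp only: power_mult_distrib) simp
  also have "\<dots> \<le> 4 * (2 * ((a\<^sup>2)\<^sup>2 + (b\<^sup>2)\<^sup>2))" by (intro mult_left_mono *) simp
  finally show ?thesis by (simp flip: power_mult)
qed

context
  fixes n p :: nat and A :: "real mat"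
  assumes cov: "covariance_matrix p A" and inv: "invertible_mat A"
begin

lemma nn_integral_row_form_power8:
  assumes i: "i < n" and s2: "bform p (\<lambda>i j. A $$ (i, j)) a a + b\<^sup>2 \<le> s"
  shows "(\<integral>\<^sup>+w. ennreal ((row_form p a b w i) ^ 8) \<partial>design_noise_law n p A) \<le> ennreal (s ^ 4 * gauss_moment 4)"
proof -
  define v where "v = bform p (\<lambda>i j. A $$ (i, j)) a a + b\<^sup>2"
  have v0: "0 \<le> v" unfolding v_def using inverse_pd_formsD(5)[OF inverse_pd_forms_of_matrix[OF cov inv]] by simp
  define f :: "nat \<Rightarrow> real \<Rightarrow> ennreal" where "f i' z = (if i' = i then ennreal (z ^ 8) else 1)" for i' z
  have [measurable]: "f i' \<in> borel_measurable borel" for i' unfolding f_def by (cases "i' = i") auto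
  have "(\<integral>\<^sup>+w. ennreal ((row_form p a b w i) ^ 8) \<partial>design_noise_law n p A) =
      (\<integral>\<^sup>+w. (\<Prod>i'<n. f i' (row_form p a b w i')) \<partial>design_noise_law n p A)"
    using i by (simp add: f_def prod.If_cases Int_def)
  also have "\<dots> = (\<Prod>i'<n. \<integral>\<^sup>+z. f i' (sqrt v * z) \<partial>std_normal)"
    unfolding v_def by (rule nn_integral_prod_row_form[OF cov inv]) simp
  also have "\<dots> = (\<Prod>i'<n. if i' = i then \<integral>\<^sup>+z. ennreal ((sqrt v * z) ^ 8) \<partial>std_normal else 1)"
    using std_normal.emeasure_space_1 by (intro prod.cong) (auto simp: f_def)
  also have "\<dots> = (\<integral>\<^sup>+z. ennreal ((sqrt v * z) ^ 8) \<partial>std_normal)" using i by simp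
  also have "\<dots> = (\<integral>\<^sup>+z. ennreal (v ^ 4) * ennreal (z ^ (2 * 4)) \<partial>std_normal)"
  proof (rule nn_integral_cong)
    fix z :: real
    have "sqrt v ^ 8 = ((sqrt v)\<^sup>2) ^ 4" by (simp flip: power_mult)
    then have "sqrt v ^ 8 = v ^ 4" using v0 by simp
    then show "ennreal ((sqrt v * z) ^ 8) = ennreal (v ^ 4) * ennreal (z ^ (2 * 4))"
      using v0 by (simp add: power_mult_distrib ennreal_mult')
  qed
  also have "\<dots> = ennreal (v ^ 4 * gauss_moment 4)"
    using v0 nn_integral_std_normal_moment[of 4] by (simp add: nn_integral_cmult ennreal_mult')
  also have "\<dots> \<le> ennreal (s ^ 4 * gauss_moment 4)"
    using s2 v0 by (intro ennreal_leI mult_right_mono power_mono) (auto simp: v_def gauss_moment_def)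
  finally show ?thesis .
qed

text \<open>The factor n is crude; a power of n is harmless against the probability of the bad
  event.\<close>

lemma nn_integral_mean_square_power4:
  assumes s2: "bform p (\<lambda>i j. A $$ (i, j)) a a + b\<^sup>2 \<le> s" and n: "0 < n"
  shows "(\<integral>\<^sup>+w. ennreal (emp n (row_form p a b w) (row_form p a b w) ^ 4) \<partial>design_noise_law n p A) \<le>
    ennreal (real n * (s ^ 4 * gauss_moment 4))"
proof -
  have s0: "0 \<le> s ^ 4 * gauss_moment 4" by (simp add: gauss_moment_def)
  have le: "emp n f f ^ 4 \<le> (\<Sum>i<n. (f i) ^ 8)" for f
  proof -
    have "emp n f f ^ 4 = (\<Sum>i<n. (f i)\<^sup>2) ^ 4 / real n ^ 4"
      by (simp add: emp_def power_divide power2_eq_square)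
    also have "\<dots> \<le> (real n ^ 3 * (\<Sum>i<n. ((f i)\<^sup>2) ^ 4)) / real n ^ 4"
      by (intro divide_right_mono sum_power4_le) simp
    also have "\<dots> = (\<Sum>i<n. (f i) ^ 8) / real n"
      using n by (simp add: field_simps power_numeral_reduce flip: power_mult)
    also have "\<dots> \<le> (\<Sum>i<n. (f i) ^ 8) / 1"
      using n by (intro divide_left_mono sum_nonneg) auto
    finally show ?thesis by simp
  qed
  have "(\<integral>\<^sup>+w. ennreal (emp n (row_form p a b w) (row_form p a b w) ^ 4) \<partial>design_noise_law n p A) \<le>
      (\<integral>\<^sup>+w. (\<Sum>i<n. ennreal ((row_form p a b w i) ^ 8)) \<partial>design_noise_law n p A)"
    using le by (intro nn_integral_mono) (simp add: sum_ennreal ennreal_leI)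
  also have "\<dots> = (\<Sum>i<n. \<integral>\<^sup>+w. ennreal ((row_form p a b w i) ^ 8) \<partial>design_noise_law n p A)"
    by (rule nn_integral_sum) (simp add: measurable_design_noise_law_eq)
  also have "\<dots> \<le> (\<Sum>i<n. ennreal (s ^ 4 * gauss_moment 4))"
    by (intro sum_mono nn_integral_row_form_power8[OF _ s2]) simp
  also have "\<dots> = ennreal (real n * (s ^ 4 * gauss_moment 4))"
    using s0 by (simp add: ennreal_of_nat_eq_real_of_nat ennreal_mult')
  finally show ?thesis .
qed

text \<open>
  A sum of squares dominates each of its first 16 terms, so its inverse fourth power is at most
  the product of the 16 factors \<open>|z\<^sub>i| powr (-1/2)\<close>, which are independent and integrable.
\<close>
lemma nn_integral_inverse_mean_square_power4:
  assumes s2: "s \<le> bform p (\<lambda>i j. A $$ (i, j)) a a + b\<^sup>2" and s: "0 < s" and n: "16 \<le> n"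
  shows "(\<integral>\<^sup>+w. ennreal ((1 / emp n (row_form p a b w) (row_form p a b w)) ^ 4) \<partial>design_noise_law n p A) \<le>
    ennreal (real n ^ 4 * (s powr (- 1/4) * inv_sqrt_moment) ^ 16)"
proof -
  define v where "v = bform p (\<lambda>i j. A $$ (i, j)) a a + b\<^sup>2"
  have v: "0 < v" "s \<le> v" using s2 s by (auto simp: v_def)
  define f :: "nat \<Rightarrow> real \<Rightarrow> ennreal" where "f i z = (if i < 16 then inv_sqrt_abs z else 1)" for i z
  have [measurable]: "f i \<in> borel_measurable borel" for i unfolding f_def by (cases "i < 16") auto
  have le: "ennreal ((1 / emp n z z) ^ 4) \<le> ennreal (real n ^ 4) * (\<Prod>i<n. f i (z i))" for z
  proof (cases "emp n z z = 0")
    \<comment> \<open>By the convention for division by zero the left side is 0.\<close>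
    case True
    then show ?thesis by simp
  next
    case False
    define q where "q = (\<Sum>i<n. (z i)\<^sup>2)"
    have q: "0 < q" using False emp_nonneg[of n z] n by (simp add: q_def emp_def power2_eq_square sum_nonneg order_less_le)
    have fz: "ennreal (q powr (- 1/4)) \<le> inv_sqrt_abs (z i)" if "i < n" for i
    proof (cases "z i = 0")
      case True
      then show ?thesis by (simp add: inv_sqrt_abs_def)
    next
      case z: False
      have "(z i)\<^sup>2 \<le> q" unfolding q_def using that by (intro member_le_sum) auto
      then have "q powr (- 1/4) \<le> ((z i)\<^sup>2) powr (- 1/4)"
        using z by (intro powr_mono2') auto
      also have "((z i)\<^sup>2) powr (- 1/4) = \<bar>z i\<bar> powr (- 1/2)"
      proof -
        have "(z i)\<^sup>2 = \<bar>z i\<bar> powr 2" by simp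
        then have "((z i)\<^sup>2) powr (- 1/4) = \<bar>z i\<bar> powr (2 * (- 1/4))" by (simp only: powr_powr)
        then show ?thesis by simp
      qed
      finally show ?thesis using z by (simp add: inv_sqrt_abs_def ennreal_leI)
    qed
    \<comment> \<open>Sixteen factors distribute the exponent -4 of \<open>q\<close> as -1/4 each,
      which is the exponent -1/2 of a single entry and lies in the integrable range above
      -1.\<close>
    have "ennreal (q powr (- 1/4)) ^ 16 = (\<Prod>i<16::nat. ennreal (q powr (- 1/4)))" by simp
    also have "\<dots> \<le> (\<Prod>i<16::nat. inv_sqrt_abs (z i))"
      using fz n by (intro prod_mono_ennreal) auto
    also have "\<dots> = (\<Prod>i<n. f i (z i))"
      using n by (intro prod.mono_neutral_cong_left) (auto simp: f_def)
    finally have "ennreal (q powr (- 1/4)) ^ 16 \<le> (\<Prod>i<n. f i (z i))" .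
    moreover have "ennreal (q powr (- 1/4)) ^ 16 = ennreal ((1 / q) ^ 4)"
    proof -
      have "(q powr (- 1/4)) ^ 16 = q powr (- 4)"
        using q by (simp add: powr_power)
      also have "\<dots> = (1 / q) ^ 4"
        using q by (simp add: powr_minus powr_numeral power_divide inverse_eq_divide)
      finally show ?thesis by (simp add: ennreal_power)
    qed
    moreover have "(1 / emp n z z) ^ 4 = real n ^ 4 * (1 / q) ^ 4"
      by (simp add: emp_def q_def power_divide power2_eq_square)
    ultimately show ?thesis by (simp add: ennreal_mult' mult_left_mono)
  qed
  have "(\<integral>\<^sup>+w. ennreal ((1 / emp n (row_form p a b w) (row_form p a b w)) ^ 4) \<partial>design_noise_law n p A) \<le>
      (\<integral>\<^sup>+w. ennreal (real n ^ 4) * (\<Prod>i<n. f i (row_form p a b w i)) \<partial>design_noise_law n p A)"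
    by (intro nn_integral_mono le)
  also have "\<dots> = ennreal (real n ^ 4) * (\<integral>\<^sup>+w. (\<Prod>i<n. f i (row_form p a b w i)) \<partial>design_noise_law n p A)"
    by (rule nn_integral_cmult) (unfold measurable_design_noise_law_eq, measurable)
  also have "(\<integral>\<^sup>+w. (\<Prod>i<n. f i (row_form p a b w i)) \<partial>design_noise_law n p A) =
      (\<Prod>i<n. \<integral>\<^sup>+z. f i (sqrt v * z) \<partial>std_normal)"
    unfolding v_def by (rule nn_integral_prod_row_form[OF cov inv]) simp
  also have "\<dots> = (\<Prod>i<16::nat. ennreal (v powr (- 1/4) * inv_sqrt_moment))"
    using n std_normal.emeasure_space_1 nn_integral_inv_sqrt_abs[OF v(1)]
    by (intro prod.mono_neutral_cong_right) (auto simp: f_def)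
  also have "\<dots> = ennreal ((v powr (- 1/4) * inv_sqrt_moment) ^ 16)"
    by (simp add: ennreal_power inv_sqrt_moment_def)
  also have "ennreal (real n ^ 4) * \<dots> \<le> ennreal (real n ^ 4) * ennreal ((s powr (- 1/4) * inv_sqrt_moment) ^ 16)"
    using v s by (intro mult_left_mono ennreal_leI power_mono mult_right_mono powr_mono2') (auto simp: inv_sqrt_moment_def)
  finally show ?thesis by (simp add: ennreal_mult')
qed

end

text \<open>On the bad event X \<le> X^2 / (2 a) + a / 2, so only a second moment of
  \<open>X\<close> and the probability of the event matter. The weight \<open>a\<close> stays free;
  later it is placed between the growth of the moments and the inverse probability.\<close>

lemma (in prob_space) split_on_bad_event:
  fixes f X :: "'a \<Rightarrow> real"
  assumes [measurable]: "f \<in> borel_measurable M" "X \<in> borel_measurable M" "E \<in> events"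
    and bound: "AE w in M. \<bar>f w\<bar> \<le> \<rho> + X w * indicator E w" and \<rho>: "0 \<le> \<rho>"
    and X: "(\<integral>\<^sup>+w. ennreal ((X w)\<^sup>2) \<partial>M) \<le> ennreal K" "0 \<le> K" and E: "prob E \<le> \<pi>" and a: "0 < a"
  shows "integrable M f" "\<bar>expectation f\<bar> \<le> \<rho> + (K / (2 * a) + a * \<pi> / 2)"
proof -
  have X2: "integrable M (\<lambda>w. (X w)\<^sup>2)"
    using X by (intro integrableI_bounded) (auto intro: le_less_trans)
  then have EX: "expectation (\<lambda>w. (X w)\<^sup>2) \<le> K"
    using X nn_integral_eq_integral[OF X2] by simp
  define g where "g w = \<rho> + ((X w)\<^sup>2 / (2 * a) + a / 2 * indicator E w)" for w
  have I: "integrable M (indicator E :: 'a \<Rightarrow> real)" by (simp add: emeasure_eq_measure)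
  have g: "integrable M g" unfolding g_def using X2 I by (intro Bochner_Integration.integrable_add) auto
  have b: "AE w in M. \<bar>f w\<bar> \<le> g w"
    using bound
  proof eventually_elim
    case (elim w)
    have "X w \<le> (X w)\<^sup>2 / (2 * a) + a / 2"
      using zero_le_power2[of "X w - a"] a by (simp add: power2_eq_square field_simps)
    moreover have "0 \<le> (X w)\<^sup>2 / (2 * a)" using a by simp
    ultimately show ?case using elim by (auto simp: g_def indicator_def split: if_splits)
  qed
  show fi: "integrable M f"
    using b by (intro Bochner_Integration.integrable_bound[OF g]) (auto elim!: eventually_mono)
  have "\<bar>expectation f\<bar> \<le> expectation (\<lambda>w. \<bar>f w\<bar>)" by (rule integral_abs_bound)
  also have "\<dots> \<le> expectation g" using fi g b by (intro integral_mono_AE) auto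
  also have "\<dots> = \<rho> + (expectation (\<lambda>w. (X w)\<^sup>2) / (2 * a) + a / 2 * prob E)"
    unfolding g_def using X2 I by (subst Bochner_Integration.integral_add; (subst Bochner_Integration.integral_add)?) (auto simp: prob_space)
  also have "\<dots> \<le> \<rho> + (K / (2 * a) + a / 2 * \<pi>)"
    using EX E a by (intro add_mono divide_right_mono mult_left_mono) auto
  finally show "\<bar>expectation f\<bar> \<le> \<rho> + (K / (2 * a) + a * \<pi> / 2)" by simp
qed

text \<open>With a centred main term \<open>F\<close>, the mean moves only by the mean of the
  remainder, and the variance only by a cross term, bounded by Cauchy--Schwarz, and the variance of
  the remainder.\<close>

lemma (in prob_space) perturbed_mean_variance:
  fixes F R :: "'a \<Rightarrow> real"
  assumes [measurable]: "F \<in> borel_measurable M" "R \<in> borel_measurable M" "W \<in> borel_measurable M"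
    and W: "AE w in M. W w = c + (F w + R w)"
    and F: "integrable M (\<lambda>w. (F w)\<^sup>2)" "expectation F = 0" and R: "integrable M (\<lambda>w. (R w)\<^sup>2)"
    and R2: "expectation (\<lambda>w. (R w)\<^sup>2) \<le> r" and F2: "expectation (\<lambda>w. (F w)\<^sup>2) \<le> a"
  shows "integrable M W" "integrable M (\<lambda>w. (W w)\<^sup>2)" "\<bar>expectation W - c\<bar> \<le> sqrt r"
    "\<bar>expectation (\<lambda>w. (W w - expectation W)\<^sup>2) - expectation (\<lambda>w. (F w)\<^sup>2)\<bar> \<le> 2 * sqrt (a * r) + r"
proof -
  have one: "integrable M f" if "f \<in> borel_measurable M" "integrable M (\<lambda>w. (f w)\<^sup>2)" for f :: "'a \<Rightarrow> real"
    using integral_Cauchy_Schwarz(1)[OF that(1) borel_measurable_const that(2), of 1] by simp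
  have Fi: "integrable M F" and Ri: "integrable M R" using F R by (auto intro: one)
  have FR: "integrable M (\<lambda>w. F w * R w)" by (rule integral_Cauchy_Schwarz(1)) (use F R in auto)
  have W2: "AE w in M. (W w)\<^sup>2 = c\<^sup>2 + 2 * c * F w + 2 * c * R w + (F w)\<^sup>2 + 2 * (F w * R w) + (R w)\<^sup>2"
    using W by eventually_elim (simp add: power2_eq_square algebra_simps)
  show Wi: "integrable M W"
    using W by (subst integrable_cong_AE[where g = "\<lambda>w. c + (F w + R w)"]) (use Fi Ri in auto)
  show W2i: "integrable M (\<lambda>w. (W w)\<^sup>2)"
    using W2 by (subst integrable_cong_AE[where g = "\<lambda>w. c\<^sup>2 + 2 * c * F w + 2 * c * R w + (F w)\<^sup>2 + 2 * (F w * R w) + (R w)\<^sup>2"])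
      (use Fi Ri F R FR in auto)
  define eR where "eR = expectation R"
  have EW: "expectation W = c + eR"
    using W by (subst integral_cong_AE[where g = "\<lambda>w. c + (F w + R w)"]) (use Fi Ri F in \<open>auto simp: eR_def prob_space\<close>)
  have EW2: "expectation (\<lambda>w. (W w)\<^sup>2) = c\<^sup>2 + 2 * c * eR + expectation (\<lambda>w. (F w)\<^sup>2) +
      2 * expectation (\<lambda>w. F w * R w) + expectation (\<lambda>w. (R w)\<^sup>2)"
    using W2 by (subst integral_cong_AE[where g = "\<lambda>w. c\<^sup>2 + 2 * c * F w + 2 * c * R w + (F w)\<^sup>2 + 2 * (F w * R w) + (R w)\<^sup>2"])
      (use Fi Ri F R FR in \<open>auto simp: eR_def prob_space\<close>)
  have eR: "eR\<^sup>2 \<le> expectation (\<lambda>w. (R w)\<^sup>2)"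
    using integral_Cauchy_Schwarz(2)[of R M "\<lambda>_. 1"] R by (simp add: eR_def prob_space)
  then have "eR\<^sup>2 \<le> r" using R2 by simp
  then show "\<bar>expectation W - c\<bar> \<le> sqrt r" unfolding EW by (simp add: real_le_rsqrt)
  have "expectation (\<lambda>w. (W w - expectation W)\<^sup>2) = expectation (\<lambda>w. (W w)\<^sup>2) - (expectation W)\<^sup>2"
    by (rule variance_eq[OF Wi W2i])
  also have "\<dots> = expectation (\<lambda>w. (F w)\<^sup>2) + 2 * expectation (\<lambda>w. F w * R w) + expectation (\<lambda>w. (R w)\<^sup>2) - eR\<^sup>2"
    unfolding EW2 EW by (simp add: power2_eq_square algebra_simps)
  finally have eq: "expectation (\<lambda>w. (W w - expectation W)\<^sup>2) - expectation (\<lambda>w. (F w)\<^sup>2) =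
      2 * expectation (\<lambda>w. F w * R w) + (expectation (\<lambda>w. (R w)\<^sup>2) - eR\<^sup>2)" by simp
  have R0: "0 \<le> expectation (\<lambda>w. (R w)\<^sup>2)" and F0: "0 \<le> expectation (\<lambda>w. (F w)\<^sup>2)" by simp_all
  have "(expectation (\<lambda>w. F w * R w))\<^sup>2 \<le> expectation (\<lambda>w. (F w)\<^sup>2) * expectation (\<lambda>w. (R w)\<^sup>2)"
    by (rule integral_Cauchy_Schwarz(2)) (use F R in auto)
  also have "\<dots> \<le> a * r"
    by (rule mult_mono[OF F2 R2 order_trans[OF F0 F2] R0])
  finally have "\<bar>expectation (\<lambda>w. F w * R w)\<bar> \<le> sqrt (a * r)" by (simp add: real_le_rsqrt)
  then show "\<bar>expectation (\<lambda>w. (W w - expectation W)\<^sup>2) - expectation (\<lambda>w. (F w)\<^sup>2)\<bar> \<le> 2 * sqrt (a * r) + r"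
    unfolding eq using eR R2 zero_le_power2[of eR] by (simp only: abs_le_iff) linarith
qed

lemma bform_identity: "bform n (\<lambda>i j. 1\<^sub>m n $$ (i, j)) u u = (\<Sum>i<n. (u i)\<^sup>2)"
proof -
  have "bform n (\<lambda>i j. 1\<^sub>m n $$ (i, j)) u u = (\<Sum>i<n. \<Sum>j<n. if i = j then u i * u j else 0)"
    unfolding bform_def by (intro sum.cong) auto
  then show ?thesis by (simp add: power2_eq_square)
qed

lemma nn_integral_std_normal_linear:
  fixes n :: nat
  assumes "f \<in> borel_measurable borel"
  shows "(\<integral>\<^sup>+e. f (\<Sum>i<n. u i * e i) \<partial>(\<Pi>\<^sub>M i\<in>{..<n}. std_normal)) = (\<integral>\<^sup>+z. f (sqrt (\<Sum>i<n. (u i)\<^sup>2) * z) \<partial>std_normal)"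
proof -
  have cov: "covariance_matrix n (1\<^sub>m n)"
    by (auto simp: covariance_matrix_def scalar_prod_def intro!: sum_nonneg)
  have inv: "invertible_mat (1\<^sub>m n :: real mat)"
    by (auto simp: invertible_mat_def inverts_mat_def intro!: exI[of _ "1\<^sub>m n"])
  show ?thesis
    using nn_integral_normal_law[OF cov inv assms, of u] by (simp only: normal_law_identity bform_identity)
qed

section \<open>Measurability of the de-sparsified Lasso\<close>

lemma measurable_emp:
  assumes "\<And>i. i < n \<Longrightarrow> (\<lambda>w. f w i) \<in> borel_measurable M" "\<And>i. i < n \<Longrightarrow> (\<lambda>w. g w i) \<in> borel_measurable M"
  shows "(\<lambda>w. emp n (f w) (g w)) \<in> borel_measurable M"
  unfolding emp_def using assms by (intro borel_measurable_divide borel_measurable_sum borel_measurable_times) auto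

lemma nodewise_version_carrier:
  assumes "nodewise_version n p lams ghat" "j < p"
  shows "ghat (design n p x) j \<in> carrier_vec (p - 1)"
  using assms
  by (auto simp: nodewise_version_def is_nodewise_lasso_def is_lasso_def is_arg_min_def remove_col_def design_def)

lemma measurable_node_coef:
  assumes nodewise: "nodewise_version n p lams ghat" and j: "j < p" and k: "k < p"
  shows "(\<lambda>w. node_coef j (ghat (design n p (fst w)) j) k) \<in> borel_measurable (data_space n p)"
proof (cases "k = j")
  case False
  then have "delete_index j k < p - 1" using j k by (auto simp: delete_index_def)
  then have "estimator n p (\<lambda>X Y. ghat X j $ delete_index j k)"
    using nodewise j by (auto simp: nodewise_version_def)
  then have "(\<lambda>w. ghat (design n p (fst w)) j $ delete_index j k) \<in> borel_measurable (data_space n p)"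
    by (simp add: estimator_def case_prod_beta')
  then show ?thesis using False by (simp add: node_coef_def)
qed (simp add: node_coef_def)

lemma measurable_node_residual:
  assumes "nodewise_version n p lams ghat" "j < p" "i < n"
  shows "(\<lambda>w. comb {..<p} (fst w) (node_coef j (ghat (design n p (fst w)) j)) i) \<in> borel_measurable (data_space n p)"
  unfolding comb_def using assms
  by (intro borel_measurable_sum borel_measurable_times measurable_node_coef measurable_design_entry) auto

lemma measurable_tau_sq:
  assumes "nodewise_version n p lams ghat" "j < p"
  shows "(\<lambda>w. tau_sq l (design n p (fst w)) j (ghat (design n p (fst w)) j)) \<in> borel_measurable (data_space n p)"
  unfolding tau_sq_design[OF assms(2) nodewise_version_carrier[OF assms]] using assms
  by (intro borel_measurable_add borel_measurable_times borel_measurable_sum borel_measurable_abs borel_measurable_const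
      measurable_emp measurable_node_residual measurable_node_coef) auto

lemma estimator_debiased_stat:
  assumes lasso: "lasso_version n p lam bhat" and nodewise: "nodewise_version n p lams ghat" and xi: "xi \<in> carrier_vec p"
  shows "estimator n p (debiased_stat xi lams bhat ghat)"
proof -
  have bm: "(\<lambda>w. bhat (design n p (fst w)) (vec n (snd w)) $ k) \<in> borel_measurable (data_space n p)" if "k < p" for k
    using lasso that by (auto simp: lasso_version_def estimator_def case_prod_beta')
  have b: "bhat (design n p x) (vec n y) \<in> carrier_vec p" for x y
    using lasso by (auto simp: lasso_version_def is_lasso_def is_arg_min_def design_def)
  define bh where "bh w = bhat (design n p (fst w)) (vec n (snd w))" for w :: "(nat \<Rightarrow> nat \<Rightarrow> real) \<times> (nat \<Rightarrow> real)"
  have eq: "debiased_stat xi lams bhat ghat (design n p (fst w)) (vec n (snd w)) = (\<Sum>j<p. xi $ j * (bh w $ j +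
      emp n (comb {..<p} (fst w) (node_coef j (ghat (design n p (fst w)) j))) (\<lambda>i. snd w i - comb {..<p} (fst w) (($) (bh w)) i) /
      tau_sq (lams j) (design n p (fst w)) j (ghat (design n p (fst w)) j)))" for w
  proof -
    have "emp n f (\<lambda>i. vec n (snd w) $ i - h i) = emp n f (\<lambda>i. snd w i - h i)" for f h
      by (rule emp_cong) auto
    then show ?thesis
      using debiased_stat_eq[of xi p "vec n (snd w)" n bhat "fst w" lams ghat, OF xi _ b] by (simp add: bh_def)
  qed
  have res: "(\<lambda>w. snd w i - comb {..<p} (fst w) (($) (bh w)) i) \<in> borel_measurable (data_space n p)" if "i < n" for i
    unfolding comb_def bh_def using that
    by (intro borel_measurable_diff borel_measurable_sum borel_measurable_times bm measurable_noise_entry measurable_design_entry) auto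
  have "(\<lambda>w. debiased_stat xi lams bhat ghat (design n p (fst w)) (vec n (snd w))) \<in> borel_measurable (data_space n p)"
    unfolding eq using nodewise bm
    by (intro borel_measurable_sum borel_measurable_add borel_measurable_times borel_measurable_divide
        measurable_emp measurable_node_residual measurable_tau_sq res borel_measurable_const) (auto simp: bh_def)
  then show ?thesis by (simp add: estimator_def case_prod_beta')
qed

text \<open>The situation at one sample size; \<open>lam0\<close> and \<open>lamU\<close> enclose
  all tuning parameters. Sixteen rows are what the inverse fourth moments of the column norms
  require.\<close>

locale desparsified = bounded_forms p "\<lambda>i j. A $$ (i, j)" "\<lambda>i j. inverse_mat A $$ (i, j)" B \<Lambda> s
  for p :: nat and A :: "real mat" and B \<Lambda> s :: real +
  fixes n :: nat and lam lam0 lamU :: real and lams :: "nat \<Rightarrow> real"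
    and bhat :: "real mat \<Rightarrow> real vec \<Rightarrow> real vec" and ghat :: "real mat \<Rightarrow> nat \<Rightarrow> real vec" and xi :: "real vec"
  assumes cov: "covariance_matrix p A" and inv: "invertible_mat A"
    and n16: "16 \<le> n" and p0: "0 < p" and lam0: "0 < lam0" and lam: "lam0 \<le> lam" "lam \<le> lamU"
    and lams: "\<And>j. j < p \<Longrightarrow> lam0 \<le> lams j" "\<And>j. j < p \<Longrightarrow> lams j \<le> lamU"
    and lasso: "lasso_version n p lam bhat" and nodewise: "nodewise_version n p lams ghat"
    and xi: "xi \<in> carrier_vec p"
begin

abbreviation "D \<equiv> design_noise_law n p A"
definition "u x j = node_coef j (ghat (design n p x) j)"
definition "\<tau> x j = tau_sq (lams j) (design n p x) j (ghat (design n p x) j)"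
definition "res x j = comb {..<p} x (u x j)"
text \<open>The weights of the noise term. They depend on the design only, so that given the design
  the noise term is centred normal with variance \<open>q x / n\<close>.\<close>

definition "z x i = (\<Sum>j<p. xi $ j / \<tau> x j * res x j i)"
definition "q x = emp n (z x) (z x)"
definition "noise w = (\<Sum>i<n. z (fst w) i / real n * snd w i)"
definition "N x k = emp n (\<lambda>i. x i k) (\<lambda>i. x i k)"
text \<open>Dominates 1 / \<tau> x j for all \<open>j\<close> as soon as no column vanishes, and
  consists of terms with computable fourth moments.\<close>

definition "H x = (\<Sum>k<p. N x k) + (2 + 2 / lam0\<^sup>2) * (\<Sum>j<p. 1 / N x j)"
definition "v = bform p (\<lambda>i j. inverse_mat A $$ (i, j)) (($) xi) (($) xi)"
definition "x1 = (\<Sum>j<p. \<bar>xi $ j\<bar>)"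
abbreviation "stat \<equiv> debiased_stat xi lams bhat ghat"

lemma n0: "0 < n" using n16 by simp

lemma lamU: "0 < lamU" using lam0 lam by simp

lemma lams0: "j < p \<Longrightarrow> 0 < lams j" using lams(1)[of j] lam0 by simp

lemma design_carrier: "design n p x \<in> carrier_mat n p" by (simp add: design_def)

lemma nodewise_facts:
  assumes j: "j < p"
  shows "nodewise_facts n p x (lams j) j (u x j) (\<tau> x j)"
proof -
  have "is_nodewise_lasso (lams j) (design n p x) j (ghat (design n p x) j)"
    using nodewise j design_carrier by (auto simp: nodewise_version_def)
  then show ?thesis
    unfolding u_def \<tau>_def using lams0[OF j] by (intro nodewise_facts_of_is_nodewise_lasso j) simp_all
qed

lemma measurable_res: "j < p \<Longrightarrow> i < n \<Longrightarrow> (\<lambda>w. res (fst w) j i) \<in> borel_measurable (data_space n p)"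
  unfolding res_def u_def by (rule measurable_node_residual[OF nodewise])

lemma measurable_tau: "j < p \<Longrightarrow> (\<lambda>w. \<tau> (fst w) j) \<in> borel_measurable (data_space n p)"
  unfolding \<tau>_def by (rule measurable_tau_sq[OF nodewise])

lemma measurable_z: "i < n \<Longrightarrow> (\<lambda>w. z (fst w) i) \<in> borel_measurable (data_space n p)"
  unfolding z_def by (intro borel_measurable_sum borel_measurable_times borel_measurable_divide measurable_tau measurable_res) auto

lemma measurable_q [measurable]: "(\<lambda>w. q (fst w)) \<in> borel_measurable (data_space n p)"
  unfolding q_def by (intro measurable_emp measurable_z)

lemma measurable_noise [measurable]: "noise \<in> borel_measurable (data_space n p)"
  unfolding noise_def[abs_def]
  by (intro borel_measurable_sum borel_measurable_times borel_measurable_divide measurable_z measurable_noise_entry) auto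

lemma measurable_N [measurable]: "k < p \<Longrightarrow> (\<lambda>w. N (fst w) k) \<in> borel_measurable (data_space n p)"
  unfolding N_def by (intro measurable_emp measurable_design_entry)

lemma measurable_H [measurable]: "(\<lambda>w. H (fst w)) \<in> borel_measurable (data_space n p)"
  unfolding H_def
  by (intro borel_measurable_add borel_measurable_sum borel_measurable_times borel_measurable_divide measurable_N) auto

lemma measurable_noise_square [measurable]: "(\<lambda>w. emp n (snd w) (snd w)) \<in> borel_measurable (data_space n p)"
  by (intro measurable_emp measurable_noise_entry)

lemma bhat_facts:
  fixes \<beta> :: "real vec" and x :: "nat \<Rightarrow> nat \<Rightarrow> real" and e :: "nat \<Rightarrow> real"
  assumes "\<beta> \<in> carrier_vec p"
  defines "Y \<equiv> design n p x *\<^sub>v \<beta> + vec n e"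
  shows "bhat (design n p x) Y \<in> carrier_vec p" "lasso_kkt {..<p} n x (($) Y) lam (($) (bhat (design n p x) Y))"
    "Y \<in> carrier_vec n" "i < n \<Longrightarrow> Y $ i = comb {..<p} x (($) \<beta>) i + e i"
proof -
  show Y: "Y \<in> carrier_vec n" by (intro carrier_vecI) (simp add: Y_def)
  show "i < n \<Longrightarrow> Y $ i = comb {..<p} x (($) \<beta>) i + e i"
    using assms by (simp add: design_def scalar_prod_def comb_def atLeast0LessThan)
  have "is_lasso lam (design n p x) Y (bhat (design n p x) Y)"
    using lasso Y design_carrier by (auto simp: lasso_version_def)
  then show "bhat (design n p x) Y \<in> carrier_vec p" "lasso_kkt {..<p} n x (($) Y) lam (($) (bhat (design n p x) Y))"
    unfolding design_def using lasso_kkt_of_is_lasso[OF _ Y] lam0 lam by (simp_all add: design_def)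
qed

lemma stat_eq:
  assumes Y: "Y \<in> carrier_vec n" and b: "bhat (design n p x) Y \<in> carrier_vec p"
  shows "stat (design n p x) Y = (\<Sum>j<p. xi $ j * (bhat (design n p x) Y $ j +
      emp n (res x j) (\<lambda>i. Y $ i - comb {..<p} x (($) (bhat (design n p x) Y)) i) / \<tau> x j))"
  unfolding res_def u_def \<tau>_def by (rule debiased_stat_eq[of xi p Y n bhat x lams ghat, OF xi Y b])

lemma estimator_stat: "estimator n p stat"
  by (rule estimator_debiased_stat[OF lasso nodewise xi])

lemma stat_error:
  assumes \<beta>: "\<beta> \<in> carrier_vec p" and pos: "\<And>j. j < p \<Longrightarrow> 0 < \<tau> x j"
    and h: "\<And>j. j < p \<Longrightarrow> lams j / \<tau> x j \<le> h" "0 \<le> h"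
    and b: "(\<Sum>k<p. \<bar>bhat (design n p x) (design n p x *\<^sub>v \<beta> + vec n e) $ k - \<beta> $ k\<bar>) \<le> b1"
  shows "\<bar>under n p \<beta> stat (x, e) - xi \<bullet> \<beta> - noise (x, e)\<bar> \<le> x1 * h * b1"
proof -
  define Y where "Y = design n p x *\<^sub>v \<beta> + vec n e"
  note bf = bhat_facts[where x = x and e = e, OF \<beta>, folded Y_def]
  have "\<bar>(\<Sum>j<p. xi $ j * (bhat (design n p x) Y $ j + emp n (comb {..<p} x (u x j)) (\<lambda>i. Y $ i - comb {..<p} x (($) (bhat (design n p x) Y)) i) / \<tau> x j)) -
      (\<Sum>j<p. xi $ j * \<beta> $ j) - (\<Sum>i<n. (\<Sum>j<p. xi $ j / \<tau> x j * comb {..<p} x (u x j) i) / real n * e i)\<bar>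
    \<le> (\<Sum>j<p. \<bar>xi $ j\<bar>) * h * (\<Sum>k<p. \<bar>bhat (design n p x) Y $ k - \<beta> $ k\<bar>)"
    by (rule debiased_error_decomposition[where lams = lams])
      (use bf(4) nodewise_facts pos h lams0 in \<open>auto intro: less_imp_le\<close>)
  also have "\<dots> \<le> x1 * h * b1"
    unfolding x1_def using b h by (intro mult_left_mono mult_nonneg_nonneg sum_nonneg) (auto simp: Y_def)
  finally have "\<bar>stat (design n p x) Y - xi \<bullet> \<beta> - noise (x, e)\<bar> \<le> x1 * h * b1"
    using \<beta> xi by (simp add: stat_eq[OF bf(3,1)] noise_def z_def res_def scalar_prod_def atLeast0LessThan)
  then show ?thesis by (simp add: under_def Y_def)
qed

lemma inverse_tau_le_H:
  assumes N: "\<And>j. j < p \<Longrightarrow> 0 < N x j" and j: "j < p"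
  shows "0 < \<tau> x j" "1 / \<tau> x j \<le> H x"
proof -
  note it = inverse_tau_le[OF nodewise_facts[OF j, of x] j lams0[OF j]]
  show "0 < \<tau> x j" using it(1) N[OF j] by (simp add: N_def)
  have "2 / (lams j)\<^sup>2 \<le> 2 / lam0\<^sup>2"
    using lams(1)[OF j] lam0 by (intro divide_left_mono power_mono) auto
  then have "(2 + 2 / (lams j)\<^sup>2) * (1 / N x j) \<le> (2 + 2 / lam0\<^sup>2) * (1 / N x j)"
    using N[OF j] by (intro mult_right_mono) auto
  also have "\<dots> \<le> (2 + 2 / lam0\<^sup>2) * (\<Sum>j<p. 1 / N x j)"
    using N j by (intro mult_left_mono member_le_sum) (auto intro: less_imp_le add_nonneg_nonneg)
  finally show "1 / \<tau> x j \<le> H x"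
    using it(2) N[OF j] by (simp add: H_def N_def)
qed

lemma nn_integral_noise:
  assumes f[measurable]: "f \<in> borel_measurable borel"
  shows "(\<integral>\<^sup>+w. f (noise w) \<partial>D) =
    (\<integral>\<^sup>+x. \<integral>\<^sup>+t. f (sqrt (\<Sum>i<n. (z x i / real n)\<^sup>2) * t) \<partial>std_normal \<partial>(\<Pi>\<^sub>M i\<in>{..<n}. normal_law p A))"
proof -
  have "(\<integral>\<^sup>+w. f (noise w) \<partial>D) = (\<integral>\<^sup>+x. \<integral>\<^sup>+e. f (noise (x, e)) \<partial>(\<Pi>\<^sub>M i\<in>{..<n}. std_normal) \<partial>(\<Pi>\<^sub>M i\<in>{..<n}. normal_law p A))"
    by (rule nn_integral_D[OF cov inv]) measurable
  also have "\<dots> = (\<integral>\<^sup>+x. \<integral>\<^sup>+t. f (sqrt (\<Sum>i<n. (z x i / real n)\<^sup>2) * t) \<partial>std_normal \<partial>(\<Pi>\<^sub>M i\<in>{..<n}. normal_law p A))"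
    unfolding noise_def fst_conv snd_conv by (subst nn_integral_std_normal_linear) auto
  finally show ?thesis .
qed

lemma nn_integral_noise_power2: "(\<integral>\<^sup>+w. ennreal ((noise w)\<^sup>2) \<partial>D) = (\<integral>\<^sup>+w. ennreal (q (fst w) / real n) \<partial>D)"
proof -
  interpret E: prob_space "\<Pi>\<^sub>M i\<in>{..<n}. std_normal" by (rule prob_space_PiM[OF prob_space_std_normal])
  have var: "(\<integral>\<^sup>+t. ennreal ((sqrt c * t)\<^sup>2) \<partial>std_normal) = ennreal c" if "0 \<le> c" for c
    using that nn_integral_std_normal_moment[of 1]
    by (simp add: power_mult_distrib ennreal_mult' nn_integral_cmult gauss_moment_def)
  have qz: "(\<Sum>i<n. (z x i / real n)\<^sup>2) = q x / real n" for x
    by (simp add: q_def emp_def power_divide power2_eq_square sum_divide_distrib)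
  have "(\<integral>\<^sup>+w. ennreal ((noise w)\<^sup>2) \<partial>D) = (\<integral>\<^sup>+x. \<integral>\<^sup>+t. ennreal ((sqrt (\<Sum>i<n. (z x i / real n)\<^sup>2) * t)\<^sup>2) \<partial>std_normal \<partial>(\<Pi>\<^sub>M i\<in>{..<n}. normal_law p A))"
    by (rule nn_integral_noise) simp
  also have "\<dots> = (\<integral>\<^sup>+x. ennreal (q x / real n) \<partial>(\<Pi>\<^sub>M i\<in>{..<n}. normal_law p A))"
    unfolding qz by (intro nn_integral_cong var) (simp add: q_def emp_nonneg)
  also have "\<dots> = (\<integral>\<^sup>+w. ennreal (q (fst w) / real n) \<partial>D)"
    using nn_integral_D[OF cov inv, of "\<lambda>w. ennreal (q (fst w) / real n)" n] E.emeasure_space_1 by simp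
  finally show ?thesis .
qed

text \<open>Given the design the law of the noise term is symmetric, so its positive and negative
  parts have the same integral.\<close>

lemma expectation_noise:
  assumes "integrable D noise"
  shows "(\<integral>w. noise w \<partial>D) = 0"
proof -
  have "(\<integral>\<^sup>+w. ennreal (noise w) \<partial>D) = (\<integral>\<^sup>+w. ennreal (- noise w) \<partial>D)"
  proof -
    have "(\<integral>\<^sup>+t. ennreal (c * t) \<partial>std_normal) = (\<integral>\<^sup>+t. ennreal (- (c * t)) \<partial>std_normal)" for c
      using nn_integral_std_normal_abs[of ennreal c] nn_integral_std_normal_abs[of ennreal "- c"] by simp
    then show ?thesis
      using nn_integral_noise[of ennreal] nn_integral_noise[of "\<lambda>t. ennreal (- t)"] by simp
  qed
  then show ?thesis using real_lebesgue_integral_def[OF assms] by simp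
qed

section \<open>Column norms: positivity and moments\<close>

lemma row_form_unit: "k < p \<Longrightarrow> row_form p (\<lambda>i. if i = k then 1 else 0) 0 w i = fst w i k"
  by (simp add: row_form_def if_distrib[of "\<lambda>t. t * _"] cong: if_cong)

lemma bform_unit: "k < p \<Longrightarrow> bform p S (\<lambda>i. if i = k then 1 else 0) (\<lambda>i. if i = k then 1 else 0) = S k k"
  by (simp add: bform_def if_distrib[of "(*) _"] cong: if_cong)

lemma N_row_form: "k < p \<Longrightarrow> N (fst w) k = emp n (row_form p (\<lambda>i. if i = k then 1 else 0) 0 w) (row_form p (\<lambda>i. if i = k then 1 else 0) 0 w)"
  unfolding N_def by (rule emp_cong) (simp_all add: row_form_unit)

text \<open>The first row suffices: each of its entries is a nondegenerate normal variable and hence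
  almost surely nonzero.\<close>

lemma AE_N_pos: "AE w in D. \<forall>j<p. 0 < N (fst w) j"
proof -
  have "AE w in D. fst w 0 j \<noteq> 0" if j: "j < p" for j
  proof -
    define a where "a = (\<lambda>i. if i = j then 1 else 0 :: real)"
    define f :: "nat \<Rightarrow> real \<Rightarrow> ennreal" where "f i t = (if i = 0 then indicator {0} t else 1)" for i t
    have [measurable]: "f i \<in> borel_measurable borel" for i unfolding f_def by (cases "i = 0") auto
    have s: "0 < A $$ (j, j)" using Lam_le_S[OF j] Lam(1) by simp
    have "(\<integral>\<^sup>+w. (\<Prod>i<n. f i (row_form p a 0 w i)) \<partial>D) = (\<Prod>i<n. \<integral>\<^sup>+t. f i (sqrt (A $$ (j, j)) * t) \<partial>std_normal)"
      using nn_integral_prod_row_form[OF cov inv, of f n a 0] bform_unit[OF j, of "\<lambda>i j. A $$ (i, j)"] by (simp add: a_def)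
    also have "\<dots> = 0"
    proof (rule prod_zero[OF finite_lessThan], rule bexI[of _ 0])
      have "(\<integral>\<^sup>+t. f 0 (sqrt (A $$ (j, j)) * t) \<partial>std_normal) = (\<integral>\<^sup>+t. 0 \<partial>std_normal)"
        using AE_std_normal_nonzero s by (intro nn_integral_cong_AE) (auto simp: f_def indicator_def elim!: eventually_mono)
      then show "(\<integral>\<^sup>+t. f 0 (sqrt (A $$ (j, j)) * t) \<partial>std_normal) = 0" by simp
    qed (use n0 in simp)
    finally have "AE w in D. (\<Prod>i<n. f i (row_form p a 0 w i)) = 0"
      by (subst (asm) nn_integral_0_iff_AE) (unfold measurable_design_noise_law_eq, measurable)
    then show ?thesis
    proof eventually_elim
      case (elim w)
      then obtain i where "i < n" "f i (row_form p a 0 w i) = 0" by auto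
      then show ?case using row_form_unit[OF j, of w 0] by (auto simp: f_def a_def split: if_splits)
    qed
  qed
  then have "AE w in D. \<forall>j\<in>{..<p}. fst w 0 j \<noteq> 0" by (intro AE_finite_allI) auto
  then show ?thesis
  proof eventually_elim
    case (elim w)
    have "0 < N (fst w) j" if j: "j < p" for j
    proof -
      have "0 < (fst w 0 j)\<^sup>2" using elim j by simp
      also have "\<dots> \<le> (\<Sum>i<n. (fst w i j)\<^sup>2)" using n0 by (intro member_le_sum) auto
      finally show ?thesis using n0 by (simp add: N_def emp_def power2_eq_square)
    qed
    then show ?case by simp
  qed
qed

text \<open>\<open>CH\<close> and \<open>CB\<close> bound the fourth moments of \<open>H\<close> and
  of the crude l1 error of the Lasso. The factor 8 is that of (a + b)^4 \<le> 8 (a^4 + b^4).\<close>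

definition "CH = 8 * (real p ^ 4 * (real n * (B ^ 4 * gauss_moment 4)) +
  (2 + 2 / lam0\<^sup>2) ^ 4 * (real p ^ 4 * (real n ^ 4 * (\<Lambda> powr (- 1/4) * inv_sqrt_moment) ^ 16)))"

definition "CB b1 = 8 * ((1 / (4 * lam0)) ^ 4 * (real n * gauss_moment 4) + (2 * b1) ^ 4)"

lemma nn_integral_sum_power4:
  assumes f: "\<And>k. k < p \<Longrightarrow> f k \<in> borel_measurable D"
    and le: "\<And>k. k < p \<Longrightarrow> (\<integral>\<^sup>+w. ennreal ((f k w) ^ 4) \<partial>D) \<le> ennreal K" and K: "0 \<le> K"
  shows "(\<integral>\<^sup>+w. ennreal ((\<Sum>k<p. f k w) ^ 4) \<partial>D) \<le> ennreal (real p ^ 4 * K)"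
proof -
  have [measurable]: "k < p \<Longrightarrow> f k \<in> borel_measurable D" for k by (rule f)
  have "(\<integral>\<^sup>+w. ennreal ((\<Sum>k<p. f k w) ^ 4) \<partial>D) \<le> (\<integral>\<^sup>+w. ennreal (real p ^ 3) * (\<Sum>k<p. ennreal ((f k w) ^ 4)) \<partial>D)"
    using sum_power4_le by (intro nn_integral_mono) (simp add: sum_ennreal ennreal_leI flip: ennreal_mult')
  also have "\<dots> = ennreal (real p ^ 3) * (\<Sum>k<p. \<integral>\<^sup>+w. ennreal ((f k w) ^ 4) \<partial>D)"
  proof -
    have "(\<integral>\<^sup>+w. (\<Sum>k<p. ennreal ((f k w) ^ 4)) \<partial>D) = (\<Sum>k<p. \<integral>\<^sup>+w. ennreal ((f k w) ^ 4) \<partial>D)"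
      by (rule nn_integral_sum) simp
    moreover have "(\<lambda>w. \<Sum>k<p. ennreal ((f k w) ^ 4)) \<in> borel_measurable D"
      by (rule borel_measurable_sum) simp
    ultimately show ?thesis by (simp only: nn_integral_cmult)
  qed
  also have "\<dots> \<le> ennreal (real p ^ 3) * (\<Sum>k<p. ennreal K)"
    using le by (intro mult_left_mono sum_mono) auto
  also have "\<dots> = ennreal (real p ^ 4 * K)"
    using K by (simp add: ennreal_of_nat_eq_real_of_nat power4_eq_xxxx power3_eq_cube mult.assoc flip: ennreal_mult')
  finally show ?thesis .
qed

lemma nn_integral_add_power4:
  assumes [measurable]: "f \<in> borel_measurable M" "g \<in> borel_measurable M"
    and "(\<integral>\<^sup>+w. ennreal ((f w) ^ 4) \<partial>M) \<le> ennreal a" "(\<integral>\<^sup>+w. ennreal ((g w) ^ 4) \<partial>M) \<le> ennreal b" "0 \<le> a" "0 \<le> b"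
  shows "(\<integral>\<^sup>+w. ennreal ((f w + g w) ^ 4) \<partial>M) \<le> ennreal (8 * (a + b))"
proof -
  have "(\<integral>\<^sup>+w. ennreal ((f w + g w) ^ 4) \<partial>M) \<le> (\<integral>\<^sup>+w. 8 * (ennreal ((f w) ^ 4) + ennreal ((g w) ^ 4)) \<partial>M)"
  proof (rule nn_integral_mono)
    fix w
    have "ennreal ((f w + g w) ^ 4) \<le> ennreal (8 * ((f w) ^ 4 + (g w) ^ 4))" by (intro ennreal_leI add_power4_le)
    also have "\<dots> = 8 * (ennreal ((f w) ^ 4) + ennreal ((g w) ^ 4))"
      by (simp add: ennreal_mult' ennreal_plus)
    finally show "ennreal ((f w + g w) ^ 4) \<le> 8 * (ennreal ((f w) ^ 4) + ennreal ((g w) ^ 4))" .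
  qed
  also have "\<dots> = 8 * ((\<integral>\<^sup>+w. ennreal ((f w) ^ 4) \<partial>M) + (\<integral>\<^sup>+w. ennreal ((g w) ^ 4) \<partial>M))"
    by (simp add: nn_integral_cmult nn_integral_add)
  also have "\<dots> \<le> 8 * (ennreal a + ennreal b)" using assms by (intro mult_left_mono add_mono) auto
  also have "\<dots> = ennreal (8 * (a + b))" using assms by (simp add: ennreal_mult' ennreal_plus)
  finally show ?thesis .
qed

lemma CH_nonneg: "0 \<le> CH"
  unfolding CH_def by (auto simp: gauss_moment_def inv_sqrt_moment_def intro!: add_nonneg_nonneg mult_nonneg_nonneg)

lemma CB_nonneg: "0 \<le> CB b1"
  unfolding CB_def by (auto simp: gauss_moment_def intro!: add_nonneg_nonneg mult_nonneg_nonneg)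

lemma moment_H: "(\<integral>\<^sup>+w. ennreal ((H (fst w)) ^ 4) \<partial>D) \<le> ennreal CH"
  unfolding H_def CH_def
proof (rule nn_integral_add_power4)
  have mN: "(\<lambda>w. N (fst w) k) \<in> borel_measurable D" if "k < p" for k
    unfolding measurable_design_noise_law_eq using that by measurable
  show "(\<lambda>w. \<Sum>k<p. N (fst w) k) \<in> borel_measurable D" "(\<lambda>w. (2 + 2 / lam0\<^sup>2) * (\<Sum>j<p. 1 / N (fst w) j)) \<in> borel_measurable D"
    using mN by (intro borel_measurable_sum borel_measurable_times borel_measurable_divide; simp)+
  show "(\<integral>\<^sup>+w. ennreal ((\<Sum>k<p. N (fst w) k) ^ 4) \<partial>D) \<le> ennreal (real p ^ 4 * (real n * (B ^ 4 * gauss_moment 4)))"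
  proof (rule nn_integral_sum_power4[OF mN])
    fix k assume k: "k < p"
    have "A $$ (k, k) \<le> B" using B[OF k k] by simp
    then show "(\<integral>\<^sup>+w. ennreal (N (fst w) k ^ 4) \<partial>D) \<le> ennreal (real n * (B ^ 4 * gauss_moment 4))"
      unfolding N_row_form[OF k]
      using nn_integral_mean_square_power4[OF cov inv _ n0, of "\<lambda>i. if i = k then 1 else 0" 0 B] bform_unit[OF k, of "\<lambda>i j. A $$ (i, j)"]
      by simp
  qed (simp_all add: gauss_moment_def)
  have "(\<integral>\<^sup>+w. ennreal ((\<Sum>j<p. 1 / N (fst w) j) ^ 4) \<partial>D) \<le> ennreal (real p ^ 4 * (real n ^ 4 * (\<Lambda> powr (- 1/4) * inv_sqrt_moment) ^ 16))"
  proof (rule nn_integral_sum_power4)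
    show "k < p \<Longrightarrow> (\<lambda>w. 1 / N (fst w) k) \<in> borel_measurable D" for k using mN[of k] by simp
    fix k assume k: "k < p"
    show "(\<integral>\<^sup>+w. ennreal ((1 / N (fst w) k) ^ 4) \<partial>D) \<le> ennreal (real n ^ 4 * (\<Lambda> powr (- 1/4) * inv_sqrt_moment) ^ 16)"
      unfolding N_row_form[OF k]
      using nn_integral_inverse_mean_square_power4[OF cov inv _ Lam(1) n16, of "\<lambda>i. if i = k then 1 else 0" 0]
        bform_unit[OF k, of "\<lambda>i j. A $$ (i, j)"] Lam_le_S[OF k]
      by simp
  qed simp
  then have "ennreal ((2 + 2 / lam0\<^sup>2) ^ 4) * (\<integral>\<^sup>+w. ennreal ((\<Sum>j<p. 1 / N (fst w) j) ^ 4) \<partial>D) \<le>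
      ennreal ((2 + 2 / lam0\<^sup>2) ^ 4) * ennreal (real p ^ 4 * (real n ^ 4 * (\<Lambda> powr (- 1/4) * inv_sqrt_moment) ^ 16))"
    by (intro mult_left_mono) auto
  moreover have "(\<integral>\<^sup>+w. ennreal (((2 + 2 / lam0\<^sup>2) * (\<Sum>j<p. 1 / N (fst w) j)) ^ 4) \<partial>D) =
      ennreal ((2 + 2 / lam0\<^sup>2) ^ 4) * (\<integral>\<^sup>+w. ennreal ((\<Sum>j<p. 1 / N (fst w) j) ^ 4) \<partial>D)"
    using mN by (subst nn_integral_cmult[symmetric]) (auto simp: power_mult_distrib ennreal_mult' intro!: borel_measurable_sum borel_measurable_divide)
  ultimately show "(\<integral>\<^sup>+w. ennreal (((2 + 2 / lam0\<^sup>2) * (\<Sum>j<p. 1 / N (fst w) j)) ^ 4) \<partial>D) \<le>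
      ennreal ((2 + 2 / lam0\<^sup>2) ^ 4 * (real p ^ 4 * (real n ^ 4 * (\<Lambda> powr (- 1/4) * inv_sqrt_moment) ^ 16)))"
    by (simp add: ennreal_mult')
qed (auto simp: gauss_moment_def inv_sqrt_moment_def)

lemma moment_noise: "(\<integral>\<^sup>+w. ennreal ((emp n (snd w) (snd w) / (4 * lam0) + 2 * b1) ^ 4) \<partial>D) \<le> ennreal (CB b1)"
  unfolding CB_def
proof (rule nn_integral_add_power4)
  interpret prob_space D by (rule prob_space_design_noise_law[OF cov inv])
  have m: "(\<lambda>w. emp n (snd w) (snd w)) \<in> borel_measurable D"
    unfolding measurable_design_noise_law_eq by measurable
  show "(\<lambda>w. emp n (snd w) (snd w) / (4 * lam0)) \<in> borel_measurable D" using m by simp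
  have rf: "row_form p (\<lambda>_. 0) 1 w = snd w" for w by (simp add: row_form_def fun_eq_iff)
  have "(\<integral>\<^sup>+w. ennreal (emp n (snd w) (snd w) ^ 4) \<partial>D) \<le> ennreal (real n * gauss_moment 4)"
    using nn_integral_mean_square_power4[OF cov inv _ n0, of "\<lambda>_. 0" 1 1] by (simp add: rf bform_def)
  then have "ennreal ((1 / (4 * lam0)) ^ 4) * (\<integral>\<^sup>+w. ennreal (emp n (snd w) (snd w) ^ 4) \<partial>D) \<le>
      ennreal ((1 / (4 * lam0)) ^ 4) * ennreal (real n * gauss_moment 4)"
    by (intro mult_left_mono) auto
  moreover have "(\<integral>\<^sup>+w. ennreal ((emp n (snd w) (snd w) / (4 * lam0)) ^ 4) \<partial>D) =
      ennreal ((1 / (4 * lam0)) ^ 4) * (\<integral>\<^sup>+w. ennreal (emp n (snd w) (snd w) ^ 4) \<partial>D)"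
    using m by (subst nn_integral_cmult[symmetric]) (auto simp: power_divide simp flip: ennreal_mult')
  ultimately show "(\<integral>\<^sup>+w. ennreal ((emp n (snd w) (snd w) / (4 * lam0)) ^ 4) \<partial>D) \<le>
      ennreal ((1 / (4 * lam0)) ^ 4 * (real n * gauss_moment 4))"
    by (simp add: ennreal_mult')
  show "(\<integral>\<^sup>+w. ennreal ((2 * b1) ^ 4) \<partial>D) \<le> ennreal ((2 * b1) ^ 4)"
    by (simp add: emeasure_space_1)
qed (auto simp: gauss_moment_def)

section \<open>The bad event and its probability\<close>

definition "M = B + 1 / \<Lambda> + 1"

definition "gram_bad j k = {w \<in> space D. \<Lambda> / (32 * s) < \<bar>emp n (\<lambda>i. fst w i j) (\<lambda>i. fst w i k) - A $$ (j, k)\<bar>}"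

definition "inverse_bad \<mu> j k = {w \<in> space D.
  \<mu> < \<bar>emp n (\<lambda>i. fst w i k) (comb {..<p} (fst w) (\<lambda>m. inverse_mat A $$ (m, j))) - (if k = j then 1 else 0)\<bar>}"

definition "noise_bad \<mu> k = {w \<in> space D. \<mu> < \<bar>emp n (\<lambda>i. fst w i k) (snd w)\<bar>}"

definition "bad \<mu> = (\<Union>j<p. \<Union>k<p. gram_bad j k \<union> inverse_bad \<mu> j k) \<union> (\<Union>k<p. noise_bad \<mu> k)"

lemma B_pos: "0 < B" using Lam_le_B[OF p0] Lam(1) by simp

lemma M_ge: "B \<le> M" "1 / \<Lambda> \<le> M" "1 \<le> M" "0 < M"
  using B_pos Lam(1) by (auto simp: M_def add_pos_pos)

lemma measurable_D: "f \<in> borel_measurable (data_space n p) \<Longrightarrow> f \<in> borel_measurable D"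
  by (simp add: measurable_design_noise_law_eq)

lemma bad_events:
  assumes "j < p" "k < p"
  shows "gram_bad j k \<in> sets D" "inverse_bad \<mu> j k \<in> sets D" "noise_bad \<mu> k \<in> sets D"
proof -
  have "(\<lambda>w. emp n (\<lambda>i. fst w i j) (\<lambda>i. fst w i k)) \<in> borel_measurable D"
    "(\<lambda>w. emp n (\<lambda>i. fst w i k) (comb {..<p} (fst w) (\<lambda>m. inverse_mat A $$ (m, j)))) \<in> borel_measurable D"
    "(\<lambda>w. emp n (\<lambda>i. fst w i k) (snd w)) \<in> borel_measurable D"
    using assms by (auto intro!: measurable_D measurable_emp measurable_design_entry measurable_comb measurable_noise_entry)
  note [measurable] = this
  show "gram_bad j k \<in> sets D" "inverse_bad \<mu> j k \<in> sets D" "noise_bad \<mu> k \<in> sets D"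
    unfolding gram_bad_def inverse_bad_def noise_bad_def by measurable
qed

lemma bad_event: "bad \<mu> \<in> sets D"
  unfolding bad_def using bad_events by (intro sets.Un sets.finite_UN) auto

lemma cross_event:
  assumes rf: "\<And>w i. i < n \<Longrightarrow> f w i = row_form p a b w i" "\<And>w i. i < n \<Longrightarrow> g w i = row_form p a' b' w i"
    and s1: "bform p (\<lambda>i j. A $$ (i, j)) a a + b\<^sup>2 \<le> K" and s2: "bform p (\<lambda>i j. A $$ (i, j)) a' a' + b'\<^sup>2 \<le> K"
    and K: "0 < K" and t: "0 \<le> t" "t \<le> 1" and cov': "bform p (\<lambda>i j. A $$ (i, j)) a a' + b * b' = r"
  shows "measure D {w \<in> space D. 2 * t * K < \<bar>emp n (f w) (g w) - r\<bar>} \<le> 4 * exp (- real n * t\<^sup>2 / 16)"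
proof -
  have "{w \<in> space D. 2 * t * K < \<bar>emp n (f w) (g w) - r\<bar>} = {w \<in> space D. 2 * real n * t * K <
      \<bar>(\<Sum>i<n. row_form p a b w i * row_form p a' b' w i) - real n * (bform p (\<lambda>i j. A $$ (i, j)) a a' + b * b')\<bar>}"
  proof -
    have "2 * t * K < \<bar>emp n (f w) (g w) - r\<bar> \<longleftrightarrow> 2 * real n * t * K <
      \<bar>(\<Sum>i<n. row_form p a b w i * row_form p a' b' w i) - real n * (bform p (\<lambda>i j. A $$ (i, j)) a a' + b * b')\<bar>" for w
    proof -
      have "emp n (f w) (g w) = emp n (row_form p a b w) (row_form p a' b' w)"
        by (rule emp_cong) (simp_all add: rf)
      then have "(\<Sum>i<n. row_form p a b w i * row_form p a' b' w i) = real n * emp n (f w) (g w)"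
        using n0 by (simp add: emp_def)
      then have "\<bar>(\<Sum>i<n. row_form p a b w i * row_form p a' b' w i) - real n * (bform p (\<lambda>i j. A $$ (i, j)) a a' + b * b')\<bar> =
          real n * \<bar>emp n (f w) (g w) - r\<bar>"
        by (simp add: cov' abs_mult flip: right_diff_distrib)
      moreover have "2 * real n * t * K = real n * (2 * t * K)" by simp
      ultimately show ?thesis using n0 by (simp only: mult_less_cancel_left_pos of_nat_0_less_iff)
    qed
    then show ?thesis by blast
  qed
  then show ?thesis using cross_product_tail[OF cov inv s1 s2 K t, of n] by simp
qed

text \<open>A union bound. The threshold in \<open>cross_event\<close> is 2 t K: t = \<Lambda> / (64
  s B) with K = B gives the tolerance of \<open>gram_close\<close>, and t = \<mu> / (2 M) with K = M
  gives \<mu>. The p noise events are counted as at most p^2, which explains 8 instead of 4.\<close>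

lemma prob_bad:
  assumes \<mu>: "0 \<le> \<mu>" "\<mu> \<le> 1"
  shows "measure D (bad \<mu>) \<le> 4 * (real p)\<^sup>2 * exp (- real n * (\<Lambda> / (64 * s * B))\<^sup>2 / 16) +
    8 * (real p)\<^sup>2 * exp (- real n * (\<mu> / (2 * M))\<^sup>2 / 16)"
proof -
  interpret D: prob_space D by (rule prob_space_design_noise_law[OF cov inv])
  define e1 where "e1 = 4 * exp (- real n * (\<Lambda> / (64 * s * B))\<^sup>2 / 16)"
  define e2 where "e2 = 4 * exp (- real n * (\<mu> / (2 * M))\<^sup>2 / 16)"
  define unit where "unit k i = (if i = k then 1 else 0 :: real)" for k i :: nat
  have rfu: "fst w i k = row_form p (unit k) 0 w i" if "k < p" for w i k
    using row_form_unit[OF that, of w i] by (simp add: unit_def[abs_def])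
  have bu: "bform p (\<lambda>i j. A $$ (i, j)) (unit k) u = (\<Sum>j<p. A $$ (k, j) * u j)" if "k < p" for k u
    unfolding bform_mult_vec unit_def using that by (simp add: if_distrib[of "\<lambda>t. t * _"] cong: if_cong)
  have buu: "bform p (\<lambda>i j. A $$ (i, j)) (unit k) (unit l) = A $$ (k, l)" if "k < p" "l < p" for k l
    unfolding bu[OF that(1)] unit_def using that by (simp add: if_distrib[of "(*) _"] cong: if_cong)
  have AB: "A $$ (k, k) \<le> B" if "k < p" for k using B[OF that that] by simp
  have g: "measure D (gram_bad j k) \<le> e1" if jk: "j < p" "k < p" for j k
  proof -
    have t: "0 \<le> \<Lambda> / (64 * s * B)" "\<Lambda> / (64 * s * B) \<le> 1"
    proof -
      show "0 \<le> \<Lambda> / (64 * s * B)" using Lam(1) s(1) B_pos by simp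
      have "1 * B \<le> 64 * s * B" using s(1) B_pos by (intro mult_right_mono) auto
      then have "\<Lambda> \<le> 64 * s * B" using Lam_le_B[OF p0] by linarith
      then show "\<Lambda> / (64 * s * B) \<le> 1" using s(1) B_pos by (simp add: divide_le_eq)
    qed
    have "2 * (\<Lambda> / (64 * s * B)) * B = \<Lambda> / (32 * s)" using B_pos by simp
    then show ?thesis
      using cross_event[of "\<lambda>w i. fst w i j" "unit j" 0 "\<lambda>w i. fst w i k" "unit k" 0 B "\<Lambda> / (64 * s * B)" "A $$ (j, k)"]
        rfu jk buu AB t B_pos unfolding gram_bad_def e1_def by simp
  qed
  \<comment> \<open>\<open>M\<close> dominates the variances of the row forms that follow: design
    entries, combinations with columns of the precision matrix, and the noise.\<close>
  have t2: "0 \<le> \<mu> / (2 * M)" "\<mu> / (2 * M) \<le> 1" using \<mu> M_ge by (auto simp: divide_le_eq)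
  have t2M: "2 * (\<mu> / (2 * M)) * M = \<mu>" using M_ge by simp
  have i: "measure D (inverse_bad \<mu> j k) \<le> e2" if jk: "j < p" "k < p" for j k
  proof -
    have r: "comb {..<p} (fst w) (\<lambda>m. inverse_mat A $$ (m, j)) i = row_form p (\<lambda>m. inverse_mat A $$ (m, j)) 0 w i" for w i
      by (simp add: row_form_def comb_def mult.commute)
    have "inverse_mat A $$ (j, j) \<le> M" using Q_diag_bounds(2)[OF jk(1)] M_ge by simp
    moreover have "A $$ (k, k) \<le> M" using AB[OF jk(2)] M_ge by simp
    ultimately show ?thesis
      using cross_event[of "\<lambda>w i. fst w i k" "unit k" 0 "\<lambda>w. comb {..<p} (fst w) (\<lambda>m. inverse_mat A $$ (m, j))" "\<lambda>m. inverse_mat A $$ (m, j)" 0 M "\<mu> / (2 * M)" "unit k j"]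
        rfu[OF jk(2)] r bform_Q_col[OF jk(1)] buu[OF jk(2) jk(2)] t2 M_ge(4)
      unfolding inverse_bad_def e2_def t2M by (simp add: unit_def eq_commute[of j k])
  qed
  have n: "measure D (noise_bad \<mu> k) \<le> e2" if k: "k < p" for k
  proof -
    have r: "snd w i = row_form p (\<lambda>_. 0) 1 w i" for w i by (simp add: row_form_def)
    have "A $$ (k, k) \<le> M" using AB[OF k] M_ge by simp
    then show ?thesis
      using cross_event[of "\<lambda>w i. fst w i k" "unit k" 0 snd "\<lambda>_. 0" 1 M "\<mu> / (2 * M)" 0]
        rfu[OF k] r buu[OF k k] t2 M_ge
      unfolding noise_bad_def e2_def t2M by (simp add: bform_def)
  qed
  have "measure D (bad \<mu>) \<le> measure D (\<Union>j<p. \<Union>k<p. gram_bad j k \<union> inverse_bad \<mu> j k) + measure D (\<Union>k<p. noise_bad \<mu> k)"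
    unfolding bad_def using bad_events by (intro measure_Un_le sets.finite_UN sets.Un) auto
  also have "measure D (\<Union>j<p. \<Union>k<p. gram_bad j k \<union> inverse_bad \<mu> j k) \<le> (\<Sum>j<p. \<Sum>k<p. e1 + e2)"
  proof -
    have "measure D (gram_bad j k \<union> inverse_bad \<mu> j k) \<le> e1 + e2" if "j < p" "k < p" for j k
      using measure_Un_le[OF bad_events(1,2)[OF that]] g[OF that] i[OF that] by (meson add_mono order_trans)
    then have F: "measure D (\<Union>k<p. gram_bad j k \<union> inverse_bad \<mu> j k) \<le> (\<Sum>k<p. e1 + e2)" if "j < p" for j
      using that bad_events by (intro order_trans[OF D.finite_measure_subadditive_finite sum_mono]) auto
    have "measure D (\<Union>j<p. \<Union>k<p. gram_bad j k \<union> inverse_bad \<mu> j k) \<le>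
        (\<Sum>j<p. measure D (\<Union>k<p. gram_bad j k \<union> inverse_bad \<mu> j k))"
      using bad_events by (intro D.finite_measure_subadditive_finite) (auto intro!: sets.finite_UN)
    also have "\<dots> \<le> (\<Sum>j<p. \<Sum>k<p. e1 + e2)" by (intro sum_mono F) simp
    finally show ?thesis .
  qed
  also have "measure D (\<Union>k<p. noise_bad \<mu> k) \<le> (\<Sum>k<p. e2)"
    using n bad_events[OF p0] by (intro order_trans[OF D.finite_measure_subadditive_finite sum_mono]) auto
  also have "(\<Sum>j<p. \<Sum>k<p. e1 + e2) + (\<Sum>k<p. e2) = (real p)\<^sup>2 * e1 + ((real p)\<^sup>2 + real p) * e2"
    by (simp add: power2_eq_square algebra_simps)
  also have "\<dots> \<le> (real p)\<^sup>2 * e1 + (2 * (real p)\<^sup>2) * e2"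
    using p0 by (intro add_left_mono mult_right_mono) (auto simp: power2_eq_square e2_def)
  finally show ?thesis by (simp add: e1_def e2_def)
qed

text \<open>On the good event \<open>\<kappa>\<close> bounds the l1 errors of all Lassos,
  \<open>\<epsilon>0\<close> the errors of the nodewise scales, and \<open>\<epsilon>1\<close> the
  entrywise distance of the normalised Gram matrix of the residuals from the precision
  matrix.\<close>

definition "\<kappa> \<mu> = 32 * s * (lamU + \<mu> * M) / \<Lambda>"
definition "\<epsilon>0 \<mu> = \<mu> * B + 2 * B * \<kappa> \<mu>"
definition "\<epsilon>1 \<mu> = 4 * lamU / \<Lambda>\<^sup>2 * (s * B / \<Lambda> + \<kappa> \<mu>) + 2 * \<kappa> \<mu> / \<Lambda> + 2 * \<epsilon>0 \<mu> / \<Lambda>\<^sup>2"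

text \<open>The bad event is defined by design and noise alone, so one event serves all \<beta>;
  this is the source of the uniformity. The condition on \<open>\<epsilon>0\<close> keeps all
  nodewise scales away from zero.\<close>

lemma good_bounds:
  assumes \<mu>: "0 \<le> \<mu>" and regime: "real p \<le> s \<or> 2 * (\<mu> * M) \<le> lam0" and \<epsilon>: "\<epsilon>0 \<mu> \<le> \<Lambda> / 2"
    and w: "w \<in> space D" "w \<notin> bad \<mu>"
  shows "\<And>j. j < p \<Longrightarrow> \<Lambda> / 2 \<le> \<tau> (fst w) j"
    and "\<bar>q (fst w) - v\<bar> \<le> x1\<^sup>2 * \<epsilon>1 \<mu>"
    and "\<And>\<beta> x e. \<beta> \<in> carrier_vec p \<Longrightarrow> real p \<le> s \<or> real (l0norm \<beta>) \<le> s \<Longrightarrow> w = (x, e) \<Longrightarrow>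
      (\<Sum>k<p. \<bar>bhat (design n p x) (design n p x *\<^sub>v \<beta> + vec n e) $ k - \<beta> $ k\<bar>) \<le> \<kappa> \<mu>"
proof -
  define x where "x = fst w"
  have G: "gram_close n x" and I: "inverse_close n x \<mu>" and E: "\<And>k. k < p \<Longrightarrow> \<bar>emp n (\<lambda>i. x i k) (snd w)\<bar> \<le> \<mu>"
    using w by (auto simp: bad_def gram_bad_def inverse_bad_def noise_bad_def gram_close_def inverse_close_def x_def not_less)
  have mono: "32 * s * (l + \<mu> * c) / \<Lambda> \<le> \<kappa> \<mu>" if "l \<le> lamU" "c \<le> M" for l c
    unfolding \<kappa>_def using that \<mu> s(1) Lam(1)
    by (intro divide_right_mono mult_left_mono add_mono) auto
  have u: "(\<Sum>k<p. \<bar>u x j k - inverse_mat A $$ (k, j) / inverse_mat A $$ (j, j)\<bar>) \<le> \<kappa> \<mu>" if j: "j < p" for j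
  proof -
    have "\<mu> * B \<le> \<mu> * M" using \<mu> M_ge by (intro mult_left_mono) auto
    then have "real p \<le> s \<or> 2 * (\<mu> * B) \<le> lams j" using regime lams(1)[OF j] by auto
    from nodewise_error_good[OF G I \<mu> nodewise_facts[OF j] j lams0[OF j] this]
    show ?thesis using mono[OF lams(2)[OF j] M_ge(1)] by simp
  qed
  have \<tau>e: "\<bar>\<tau> x j - 1 / inverse_mat A $$ (j, j)\<bar> \<le> \<epsilon>0 \<mu>" if j: "j < p" for j
    unfolding \<epsilon>0_def by (rule tau_error_good[OF G I \<mu> nodewise_facts[OF j] j u[OF j]])
  have \<tau>: "\<Lambda> / 2 \<le> \<tau> x j" if j: "j < p" for j
    using \<tau>e[OF j] Q_diag_bounds(4)[OF j] \<epsilon> by (simp add: abs_le_iff)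
  then show "\<And>j. j < p \<Longrightarrow> \<Lambda> / 2 \<le> \<tau> (fst w) j" by (simp add: x_def)
  have gi: "\<bar>emp n (res x j) (res x l) / (\<tau> x j * \<tau> x l) - inverse_mat A $$ (j, l)\<bar> \<le> \<epsilon>1 \<mu>" if "j < p" "l < p" for j l
    unfolding \<epsilon>1_def res_def
    by (rule gram_inverse_error_good[OF that nodewise_facts nodewise_facts lams0 lams(2) u \<tau>e \<tau> \<tau>]) (use that in auto)
  have "q x - v = (\<Sum>j<p. \<Sum>l<p. xi $ j * xi $ l * (emp n (res x j) (res x l) / (\<tau> x j * \<tau> x l) - inverse_mat A $$ (j, l)))"
  proof -
    have "q x = (\<Sum>j<p. \<Sum>l<p. xi $ j * xi $ l * (emp n (res x j) (res x l) / (\<tau> x j * \<tau> x l)))"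
      unfolding q_def z_def[abs_def] by (rule emp_weighted_residuals)
    moreover have "v = (\<Sum>j<p. \<Sum>l<p. xi $ j * xi $ l * inverse_mat A $$ (j, l))"
      by (simp add: v_def bform_def mult_ac)
    ultimately show ?thesis by (simp only: sum_subtractf[symmetric] right_diff_distrib)
  qed
  then have "\<bar>q x - v\<bar> \<le> (\<Sum>j<p. \<bar>xi $ j\<bar>) * (\<Sum>j<p. \<bar>xi $ j\<bar>) * \<epsilon>1 \<mu>"
    by (simp only:) (intro abs_double_sum_le gi; simp)
  then show "\<bar>q (fst w) - v\<bar> \<le> x1\<^sup>2 * \<epsilon>1 \<mu>" by (simp add: x1_def x_def power2_eq_square)
  fix \<beta> x' e
  assume \<beta>: "\<beta> \<in> carrier_vec p" and sp: "real p \<le> s \<or> real (l0norm \<beta>) \<le> s" and w': "w = (x', e)"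
  have x': "x' = x" "e = snd w" using w' by (auto simp: x_def)
  note bf = bhat_facts[where x = x and e = e, OF \<beta>]
  have "\<mu> * 1 \<le> \<mu> * M" using \<mu> M_ge by (intro mult_left_mono) auto
  have "{k. k < p \<and> \<beta> $ k \<noteq> 0} = {i. i < dim_vec \<beta> \<and> \<beta> $ i \<noteq> 0}" using \<beta> by auto
  then have l0: "real (card {k. k < p \<and> \<beta> $ k \<noteq> 0}) = real (l0norm \<beta>)" by (simp add: l0norm_def)
  have "2 * \<mu> \<le> lam" if "2 * (\<mu> * M) \<le> lam0"
    using that \<open>\<mu> * 1 \<le> \<mu> * M\<close> lam(1) by linarith
  then have reg: "real p \<le> s \<or> (real (card {k. k < p \<and> \<beta> $ k \<noteq> 0}) \<le> s \<and> 2 * \<mu> \<le> lam)"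
    unfolding l0 using sp regime by blast
  have "(\<Sum>k<p. \<bar>bhat (design n p x) (design n p x *\<^sub>v \<beta> + vec n e) $ k - \<beta> $ k\<bar>) \<le> 32 * s * (lam + \<mu>) / \<Lambda>"
    by (rule lasso_error_good[OF G bf(2) bf(4) _ \<mu>]) (use E x' reg lam0 lam in auto)
  also have "\<dots> \<le> \<kappa> \<mu>" using mono[OF lam(2) M_ge(3)] by simp
  finally show "(\<Sum>k<p. \<bar>bhat (design n p x') (design n p x' *\<^sub>v \<beta> + vec n e) $ k - \<beta> $ k\<bar>) \<le> \<kappa> \<mu>"
    by (simp add: x')
qed

lemma v_nonneg: "0 \<le> v" unfolding v_def by (rule bform_Q_bounds)

lemma q_le: "q x \<le> x1\<^sup>2 * H x" if "\<And>j. j < p \<Longrightarrow> 0 < N x j"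
  unfolding q_def z_def[abs_def] res_def x1_def
  by (rule emp_weighted_residuals_le[where lams = lams]) (use that nodewise_facts lams0 inverse_tau_le_H in auto)

lemma H_nonneg: "0 \<le> H x"
  unfolding H_def N_def by (auto intro!: add_nonneg_nonneg mult_nonneg_nonneg sum_nonneg divide_nonneg_nonneg emp_nonneg)

text \<open>In both quantities the first summand is the error on the good event; \<open>a\<close> is
  the weight of \<open>split_on_bad_event\<close> and \<open>\<pi>\<close> a bound for the
  probability of the bad event.\<close>

definition "q_err \<mu> a \<pi> = x1\<^sup>2 * \<epsilon>1 \<mu> + ((2 * x1 ^ 4 * (1 + CH) + 2 * v\<^sup>2) / (2 * a) + a * \<pi> / 2)"
definition "r_err \<mu> a \<pi> b1 = (x1 * (2 * lamU / \<Lambda>) * \<kappa> \<mu>)\<^sup>2 + ((x1 * lamU) ^ 4 * (CH * CB b1) / (2 * a) + a * \<pi> / 2)"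

text \<open>\<open>H\<close> depends on the design and the other factor on the noise, so by
  independence the moment factorises and no moment of order eight of either factor is called
  for.\<close>

lemma moment_H_noise:
  "(\<integral>\<^sup>+w. ennreal ((H (fst w) * (emp n (snd w) (snd w) / (4 * lam0) + 2 * b1)) ^ 4) \<partial>D) \<le> ennreal (CH * CB b1)"
proof -
  interpret X: prob_space "\<Pi>\<^sub>M i\<in>{..<n}. normal_law p A"
    by (rule prob_space_PiM[OF prob_space_normal_law[OF cov inv]])
  interpret E: prob_space "\<Pi>\<^sub>M i\<in>{..<n}. std_normal" by (rule prob_space_PiM[OF prob_space_std_normal])
  define g where "g e = ennreal ((emp n e e / (4 * lam0) + 2 * b1) ^ 4)" for e
  have [measurable]: "g \<in> borel_measurable (\<Pi>\<^sub>M i\<in>{..<n}. std_normal)"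
    unfolding g_def emp_def by measurable
  have Hm: "(\<lambda>w. ennreal (H (fst w) ^ 4)) \<in> borel_measurable (data_space n p)" by measurable
  have gm: "(\<lambda>w. g (snd w)) \<in> borel_measurable (data_space n p)" unfolding g_def by measurable
  have eH: "(\<integral>\<^sup>+x. ennreal (H x ^ 4) \<partial>(\<Pi>\<^sub>M i\<in>{..<n}. normal_law p A)) \<le> ennreal CH"
    using moment_H nn_integral_D[OF cov inv Hm] E.emeasure_space_1 by simp
  have eg: "(\<integral>\<^sup>+e. g e \<partial>(\<Pi>\<^sub>M i\<in>{..<n}. std_normal)) \<le> ennreal (CB b1)"
    using moment_noise[of b1] nn_integral_D[OF cov inv gm] X.emeasure_space_1 by (simp add: g_def)
  have "(\<integral>\<^sup>+w. ennreal ((H (fst w) * (emp n (snd w) (snd w) / (4 * lam0) + 2 * b1)) ^ 4) \<partial>D) =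
      (\<integral>\<^sup>+w. ennreal (H (fst w) ^ 4) * g (snd w) \<partial>D)"
    by (simp add: g_def power_mult_distrib ennreal_mult')
  also have "\<dots> = (\<integral>\<^sup>+x. \<integral>\<^sup>+e. ennreal (H x ^ 4) * g e \<partial>(\<Pi>\<^sub>M i\<in>{..<n}. std_normal) \<partial>(\<Pi>\<^sub>M i\<in>{..<n}. normal_law p A))"
    using nn_integral_D[OF cov inv borel_measurable_times_ennreal[OF Hm gm]] by simp
  also have "\<dots> = (\<integral>\<^sup>+x. ennreal (H x ^ 4) * (\<integral>\<^sup>+e. g e \<partial>(\<Pi>\<^sub>M i\<in>{..<n}. std_normal)) \<partial>(\<Pi>\<^sub>M i\<in>{..<n}. normal_law p A))"
    by (simp add: nn_integral_cmult)
  also have "\<dots> \<le> (\<integral>\<^sup>+x. ennreal (CB b1) * ennreal (H x ^ 4) \<partial>(\<Pi>\<^sub>M i\<in>{..<n}. normal_law p A))"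
    by (intro nn_integral_mono) (subst mult.commute, rule mult_right_mono[OF eg], simp)
  also have "\<dots> = ennreal (CB b1) * (\<integral>\<^sup>+x. ennreal (H x ^ 4) \<partial>(\<Pi>\<^sub>M i\<in>{..<n}. normal_law p A))"
  proof (rule nn_integral_cmult)
    have "(\<lambda>x. H (fst (x, \<lambda>i\<in>{..<n}. 0::real))) \<in> borel_measurable (\<Pi>\<^sub>M i\<in>{..<n}. \<Pi>\<^sub>M j\<in>{..<p}. borel)"
      by (rule measurable_compose[OF _ measurable_H]) (rule measurable_Pair2', simp add: space_PiM)
    then show "(\<lambda>x. ennreal (H x ^ 4)) \<in> borel_measurable (\<Pi>\<^sub>M i\<in>{..<n}. normal_law p A)" by simp
  qed
  also have "\<dots> \<le> ennreal (CB b1) * ennreal CH" using eH by (intro mult_left_mono) auto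
  also have "\<dots> = ennreal (CH * CB b1)" using CB_nonneg by (simp add: ennreal_mult' mult.commute)
  finally show ?thesis .
qed

text \<open>The statistic is the target plus the noise term plus a remainder \<open>R\<close>, small
  on the good event and crudely bounded elsewhere. The noise term has variance E q / n, and E q is
  compared with \<open>v\<close> by the same splitting. Fourth moments appear because R^2 is what is
  split, and the splitting squares its bound once more.\<close>

theorem mean_variance_bounds:
  assumes \<mu>: "0 \<le> \<mu>" and regime: "real p \<le> s \<or> 2 * (\<mu> * M) \<le> lam0" and \<epsilon>: "\<epsilon>0 \<mu> \<le> \<Lambda> / 2"
    and bad: "measure D (bad \<mu>) \<le> \<pi>" and a: "0 < a"
    and \<beta>: "\<beta> \<in> carrier_vec p" "real p \<le> s \<or> real (l0norm \<beta>) \<le> s" "(\<Sum>k<p. \<bar>\<beta> $ k\<bar>) \<le> b1"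
  shows "finite_var n p A \<beta> stat"
    and "\<bar>expect n p A \<beta> stat - xi \<bullet> \<beta>\<bar> \<le> sqrt (r_err \<mu> a \<pi> b1)"
    and "\<bar>real n * var n p A \<beta> stat - v\<bar> \<le> q_err \<mu> a \<pi> +
      real n * (2 * sqrt ((v + q_err \<mu> a \<pi>) / real n * r_err \<mu> a \<pi> b1) + r_err \<mu> a \<pi> b1)"
proof -
  interpret D: prob_space D by (rule prob_space_design_noise_law[OF cov inv])
  define W where "W = under n p \<beta> stat"
  define R where "R w = W w - xi \<bullet> \<beta> - noise w" for w
  have W0: "W \<in> borel_measurable (data_space n p)" unfolding W_def by (rule measurable_under[OF estimator_stat \<beta>(1)])
  then have R0: "R \<in> borel_measurable (data_space n p)"
    unfolding R_def by (intro borel_measurable_diff measurable_noise) auto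
  have [measurable]: "W \<in> borel_measurable D" "R \<in> borel_measurable D" "noise \<in> borel_measurable D"
    "(\<lambda>w. q (fst w)) \<in> borel_measurable D" "(\<lambda>w. H (fst w)) \<in> borel_measurable D"
    "(\<lambda>w. emp n (snd w) (snd w)) \<in> borel_measurable D"
    using W0 R0 by (auto intro: measurable_D)
  note [measurable] = bad_event
  have x10: "0 \<le> x1" by (auto simp: x1_def intro: sum_nonneg)
  have lamU0: "0 < lamU" by (rule lamU)
  have \<kappa>0: "0 \<le> \<kappa> \<mu>" unfolding \<kappa>_def using s(1) lamU0 \<mu> M_ge Lam(1) by simp
  have \<epsilon>00: "0 \<le> \<epsilon>0 \<mu>" unfolding \<epsilon>0_def using \<mu> B_pos \<kappa>0 by simp
  have \<epsilon>10: "0 \<le> \<epsilon>1 \<mu>" unfolding \<epsilon>1_def using lamU0 s(1) B_pos Lam(1) \<kappa>0 \<epsilon>00 by simp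
  have b10: "0 \<le> b1" using \<beta>(3) by (meson abs_ge_zero order_trans sum_nonneg)
  define bb where "bb w = emp n (snd w) (snd w) / (4 * lam0) + 2 * b1" for w :: "(nat \<Rightarrow> nat \<Rightarrow> real) \<times> (nat \<Rightarrow> real)"
  have bb0: "0 \<le> bb w" for w unfolding bb_def using emp_nonneg[of n "snd w"] lam0 b10 by simp
  have crude: "\<bar>R w\<bar> \<le> x1 * (lamU * H (fst w)) * bb w" if N: "\<And>j. j < p \<Longrightarrow> 0 < N (fst w) j" for w
  proof -
    obtain x e where w: "w = (x, e)" by (cases w)
    note it = inverse_tau_le_H[of x] N[unfolded w fst_conv]
    note bf = bhat_facts[where x = x and e = e, OF \<beta>(1)]
    have "\<bar>W (x, e) - xi \<bullet> \<beta> - noise (x, e)\<bar> \<le> x1 * (lamU * H x) * bb (x, e)"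
      unfolding W_def
    proof (rule stat_error[OF \<beta>(1)])
      show "j < p \<Longrightarrow> 0 < \<tau> x j" for j using it by blast
      show "lams j / \<tau> x j \<le> lamU * H x" if j: "j < p" for j
      proof -
        have "lams j * (1 / \<tau> x j) \<le> lamU * H x"
          using it(1,2) it(3) j lams(2)[OF j] lams0[OF j] lamU0 H_nonneg
          by (intro mult_mono) (auto intro: less_imp_le)
        then show ?thesis by simp
      qed
      show "0 \<le> lamU * H x" using lamU0 H_nonneg by simp
      have "(\<Sum>k<p. \<bar>bhat (design n p x) (design n p x *\<^sub>v \<beta> + vec n e) $ k - \<beta> $ k\<bar>) \<le>
          emp n e e / (4 * lam) + 2 * (\<Sum>k<p. \<bar>\<beta> $ k\<bar>)"
        by (rule lasso_l1_error_crude[OF bf(2) bf(4)]) (use lam0 lam in auto)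
      also have "\<dots> \<le> bb (x, e)"
        unfolding bb_def snd_conv using \<beta>(3) lam0 lam emp_nonneg[of n e] by (intro add_mono divide_left_mono) auto
      finally show "(\<Sum>k<p. \<bar>bhat (design n p x) (design n p x *\<^sub>v \<beta> + vec n e) $ k - \<beta> $ k\<bar>) \<le> bb (x, e)" .
    qed
    then show ?thesis by (simp add: w R_def)
  qed
  have good: "\<bar>R w\<bar> \<le> x1 * (2 * lamU / \<Lambda>) * \<kappa> \<mu>" if w: "w \<in> space D" "w \<notin> bad \<mu>" for w
  proof -
    obtain x e where we: "w = (x, e)" by (cases w)
    note gb = good_bounds[OF \<mu> regime \<epsilon> w]
    have \<tau>: "\<Lambda> / 2 \<le> \<tau> x j" if "j < p" for j using gb(1)[OF that] by (simp add: we)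
    have "\<bar>W (x, e) - xi \<bullet> \<beta> - noise (x, e)\<bar> \<le> x1 * (2 * lamU / \<Lambda>) * \<kappa> \<mu>"
      unfolding W_def
    proof (rule stat_error[OF \<beta>(1)])
      show "j < p \<Longrightarrow> 0 < \<tau> x j" for j using \<tau>[of j] Lam(1) by simp
      show "lams j / \<tau> x j \<le> 2 * lamU / \<Lambda>" if j: "j < p" for j
      proof -
        have "lams j / \<tau> x j \<le> lamU / (\<Lambda> / 2)"
          using \<tau>[OF j] lams[OF j] lams0[OF j] Lam(1) lamU0 by (intro frac_le) auto
        then show ?thesis by (simp add: mult.commute)
      qed
      show "0 \<le> 2 * lamU / \<Lambda>" using lamU0 Lam(1) by simp
    qed (rule gb(3)[OF \<beta>(1,2) we])
    then show ?thesis by (simp add: we R_def)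
  qed
  define X where "X w = (x1 * lamU)\<^sup>2 * (H (fst w) * bb w)\<^sup>2" for w
  have Xm: "X \<in> borel_measurable D" unfolding X_def bb_def by measurable
  have X2: "(\<integral>\<^sup>+w. ennreal ((X w)\<^sup>2) \<partial>D) \<le> ennreal ((x1 * lamU) ^ 4 * (CH * CB b1))"
  proof -
    have "(X w)\<^sup>2 = (x1 * lamU) ^ 4 * (H (fst w) * bb w) ^ 4" for w
      unfolding X_def by (simp add: power_mult_distrib flip: power_mult)
    then have "(\<integral>\<^sup>+w. ennreal ((X w)\<^sup>2) \<partial>D) = (\<integral>\<^sup>+w. ennreal ((x1 * lamU) ^ 4) * ennreal ((H (fst w) * bb w) ^ 4) \<partial>D)"
      by (simp add: ennreal_mult')
    also have "\<dots> = ennreal ((x1 * lamU) ^ 4) * (\<integral>\<^sup>+w. ennreal ((H (fst w) * bb w) ^ 4) \<partial>D)"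
      unfolding bb_def by (rule nn_integral_cmult) measurable
    also have "\<dots> \<le> ennreal ((x1 * lamU) ^ 4) * ennreal (CH * CB b1)"
      unfolding bb_def by (intro mult_left_mono moment_H_noise) simp
    finally show ?thesis by (simp add: ennreal_mult')
  qed
  have Rb: "AE w in D. \<bar>(R w)\<^sup>2\<bar> \<le> (x1 * (2 * lamU / \<Lambda>) * \<kappa> \<mu>)\<^sup>2 + X w * indicator (bad \<mu>) w"
    using AE_N_pos AE_space
  proof eventually_elim
    case (elim w)
    show ?case
    proof (cases "w \<in> bad \<mu>")
      case True
      have "\<bar>R w\<bar>\<^sup>2 \<le> (x1 * (lamU * H (fst w)) * bb w)\<^sup>2"
        using crude[of w] elim(1) by (intro power_mono) auto
      also have "\<dots> = X w" by (simp add: X_def power_mult_distrib)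
      finally show ?thesis using True by (simp add: add_increasing)
    next
      case False
      have "\<bar>R w\<bar>\<^sup>2 \<le> (x1 * (2 * lamU / \<Lambda>) * \<kappa> \<mu>)\<^sup>2"
        using good[OF elim(2) False] by (intro power_mono) auto
      then show ?thesis using False by simp
    qed
  qed
  note splitR = D.split_on_bad_event[OF _ Xm bad_event Rb zero_le_power2 X2 _ bad a]
  have cn: "0 \<le> (x1 * lamU) ^ 4 * (CH * CB b1)" using CH_nonneg CB_nonneg by simp
  have R2i: "integrable D (\<lambda>w. (R w)\<^sup>2)" by (rule splitR(1)) (use cn in simp_all)
  have R2: "D.expectation (\<lambda>w. (R w)\<^sup>2) \<le> r_err \<mu> a \<pi> b1"
  proof -
    have "\<bar>D.expectation (\<lambda>w. (R w)\<^sup>2)\<bar> \<le> r_err \<mu> a \<pi> b1"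
      unfolding r_err_def by (rule splitR(2)) (use cn in simp_all)
    then show ?thesis by simp
  qed
  define Y where "Y w = x1\<^sup>2 * H (fst w) + v" for w :: "(nat \<Rightarrow> nat \<Rightarrow> real) \<times> (nat \<Rightarrow> real)"
  have Ym: "Y \<in> borel_measurable D" unfolding Y_def by measurable
  have Y2: "(\<integral>\<^sup>+w. ennreal ((Y w)\<^sup>2) \<partial>D) \<le> ennreal (2 * x1 ^ 4 * (1 + CH) + 2 * v\<^sup>2)"
  proof -
    have "(Y w)\<^sup>2 \<le> 2 * x1 ^ 4 * (1 + H (fst w) ^ 4) + 2 * v\<^sup>2" for w
    proof -
      have "(Y w)\<^sup>2 \<le> 2 * (x1\<^sup>2 * H (fst w))\<^sup>2 + 2 * v\<^sup>2"
        using sum_squares_bound[of "x1\<^sup>2 * H (fst w)" v] by (simp add: Y_def power2_sum)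
      also have "(x1\<^sup>2 * H (fst w))\<^sup>2 = x1 ^ 4 * (H (fst w))\<^sup>2" by (simp add: power_mult_distrib flip: power_mult)
      also have "2 * (x1 ^ 4 * (H (fst w))\<^sup>2) \<le> 2 * (x1 ^ 4 * (1 + H (fst w) ^ 4))"
      proof -
        \<comment> \<open>Reduces the second moment of \<open>H\<close> to the fourth, which is
          already bounded.\<close>
        have "t\<^sup>2 \<le> 1 + t ^ 4" for t :: real
        proof -
          have "0 \<le> (t\<^sup>2 - 1 / 2)\<^sup>2" by simp
          also have "\<dots> = t ^ 4 - t\<^sup>2 + 1 / 4"
            by (simp add: power2_eq_square power4_eq_xxxx algebra_simps)
          finally show ?thesis by linarith
        qed
        then show ?thesis by (intro mult_left_mono) auto
      qed
      finally show ?thesis by simp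
    qed
    then have "(\<integral>\<^sup>+w. ennreal ((Y w)\<^sup>2) \<partial>D) \<le> (\<integral>\<^sup>+w. ennreal (2 * x1 ^ 4 + 2 * v\<^sup>2) + ennreal (2 * x1 ^ 4) * ennreal (H (fst w) ^ 4) \<partial>D)"
      by (intro nn_integral_mono) (simp add: algebra_simps ennreal_leI flip: ennreal_mult' ennreal_plus)
    also have "\<dots> = ennreal (2 * x1 ^ 4 + 2 * v\<^sup>2) + ennreal (2 * x1 ^ 4) * (\<integral>\<^sup>+w. ennreal (H (fst w) ^ 4) \<partial>D)"
      by (simp add: nn_integral_add nn_integral_cmult D.emeasure_space_1)
    also have "\<dots> \<le> ennreal (2 * x1 ^ 4 + 2 * v\<^sup>2) + ennreal (2 * x1 ^ 4) * ennreal CH"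
      by (intro add_left_mono mult_left_mono moment_H) simp
    also have "\<dots> = ennreal (2 * x1 ^ 4 * (1 + CH) + 2 * v\<^sup>2)"
      using CH_nonneg by (simp add: algebra_simps flip: ennreal_mult' ennreal_plus)
    finally show ?thesis .
  qed
  have Qb: "AE w in D. \<bar>q (fst w) - v\<bar> \<le> x1\<^sup>2 * \<epsilon>1 \<mu> + Y w * indicator (bad \<mu>) w"
    using AE_N_pos AE_space
  proof eventually_elim
    case (elim w)
    show ?case
    proof (cases "w \<in> bad \<mu>")
      case True
      have "0 \<le> q (fst w)" unfolding q_def by (rule emp_nonneg)
      moreover have "q (fst w) \<le> x1\<^sup>2 * H (fst w)" using elim(1) by (intro q_le) auto
      moreover have "0 \<le> x1\<^sup>2 * \<epsilon>1 \<mu>" "0 \<le> x1\<^sup>2 * H (fst w)" using \<epsilon>10 H_nonneg by simp_all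
      ultimately show ?thesis using True v_nonneg by (simp add: Y_def abs_le_iff)
    next
      case False
      then show ?thesis using good_bounds(2)[OF \<mu> regime \<epsilon> elim(2)] by simp
    qed
  qed
  have dn: "0 \<le> 2 * x1 ^ 4 * (1 + CH) + 2 * v\<^sup>2" using CH_nonneg by simp
  note splitQ = D.split_on_bad_event[OF _ Ym bad_event Qb _ Y2 dn bad a]
  have Qi: "integrable D (\<lambda>w. q (fst w) - v)" by (rule splitQ(1)) (use \<epsilon>10 in simp_all)
  have Qe: "\<bar>D.expectation (\<lambda>w. q (fst w) - v)\<bar> \<le> q_err \<mu> a \<pi>"
    unfolding q_err_def by (rule splitQ(2)) (use \<epsilon>10 in simp_all)
  have "integrable D (\<lambda>w. (q (fst w) - v) + v)" using Qi by (intro Bochner_Integration.integrable_add) auto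
  then have qi: "integrable D (\<lambda>w. q (fst w))" by simp
  have q0: "0 \<le> q x" for x unfolding q_def by (rule emp_nonneg)
  define Eq where "Eq = D.expectation (\<lambda>w. q (fst w))"
  have Eq: "\<bar>Eq - v\<bar> \<le> q_err \<mu> a \<pi>" using Qe qi by (simp add: Eq_def D.prob_space)
  have N2i: "integrable D (\<lambda>w. (noise w)\<^sup>2)"
  proof (rule integrableI_bounded)
    have "(\<integral>\<^sup>+w. ennreal (q (fst w) / real n) \<partial>D) < \<infinity>"
      using qi by (subst nn_integral_eq_integral) (auto simp: q0)
    then show "(\<integral>\<^sup>+w. ennreal (norm ((noise w)\<^sup>2)) \<partial>D) < \<infinity>"
      using nn_integral_noise_power2 by simp
  qed measurable
  have EN2: "D.expectation (\<lambda>w. (noise w)\<^sup>2) = Eq / real n"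
  proof -
    have "D.expectation (\<lambda>w. (noise w)\<^sup>2) = enn2real (\<integral>\<^sup>+w. ennreal ((noise w)\<^sup>2) \<partial>D)"
      by (rule integral_eq_nn_integral) auto
    also have "\<dots> = D.expectation (\<lambda>w. q (fst w) / real n)"
      unfolding nn_integral_noise_power2 by (rule integral_eq_nn_integral[symmetric]) (auto simp: q0)
    finally show ?thesis by (simp add: Eq_def)
  qed
  have Ni: "integrable D noise"
    using integral_Cauchy_Schwarz(1)[OF _ borel_measurable_const N2i, of 1] by simp
  have EN2': "D.expectation (\<lambda>w. (noise w)\<^sup>2) \<le> (v + q_err \<mu> a \<pi>) / real n"
    unfolding EN2 using Eq by (intro divide_right_mono) auto
  have We: "AE w in D. W w = xi \<bullet> \<beta> + (noise w + R w)" by (simp add: R_def)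
  note pm = D.perturbed_mean_variance[OF _ _ _ We N2i expectation_noise[OF Ni] R2i R2 EN2']
  have exp_W: "expect n p A \<beta> stat = D.expectation W" by (simp add: expect_def W_def)
  show "finite_var n p A \<beta> stat"
    unfolding finite_var_def finite_mean_def W_def[symmetric] by (intro conjI pm(1) pm(2)) simp_all
  show "\<bar>expect n p A \<beta> stat - xi \<bullet> \<beta>\<bar> \<le> sqrt (r_err \<mu> a \<pi> b1)"
    unfolding exp_W by (rule pm(3)) simp_all
  have "var n p A \<beta> stat = D.expectation (\<lambda>w. (W w - D.expectation W)\<^sup>2)"
    by (simp add: var_def exp_W[symmetric]) (simp add: W_def)
  then have V: "\<bar>var n p A \<beta> stat - Eq / real n\<bar> \<le> 2 * sqrt ((v + q_err \<mu> a \<pi>) / real n * r_err \<mu> a \<pi> b1) + r_err \<mu> a \<pi> b1"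
    using pm(4) by (simp add: EN2)
  have "real n * var n p A \<beta> stat - v = (Eq - v) + real n * (var n p A \<beta> stat - Eq / real n)"
    using n0 by (simp add: algebra_simps)
  then have "\<bar>real n * var n p A \<beta> stat - v\<bar> \<le> \<bar>Eq - v\<bar> + real n * \<bar>var n p A \<beta> stat - Eq / real n\<bar>"
    by (metis abs_mult abs_of_nat abs_triangle_ineq)
  also have "\<dots> \<le> q_err \<mu> a \<pi> + real n * (2 * sqrt ((v + q_err \<mu> a \<pi>) / real n * r_err \<mu> a \<pi> b1) + r_err \<mu> a \<pi> b1)"
    by (intro add_mono Eq mult_left_mono V) simp
  finally show "\<bar>real n * var n p A \<beta> stat - v\<bar> \<le> q_err \<mu> a \<pi> +
      real n * (2 * sqrt ((v + q_err \<mu> a \<pi>) / real n * r_err \<mu> a \<pi> b1) + r_err \<mu> a \<pi> b1)" .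
qed

end

section \<open>Explicit bounds in powers of n p\<close>

lemma power_quotient: "y \<noteq> 0 \<Longrightarrow> c * y ^ m / y ^ (m + k) = c / y ^ k" for y c :: real
  by (simp add: power_add)

context desparsified
begin

text \<open>A single scale in which moments and probabilities are compared, whichever of n and p is
  the larger.\<close>

definition "np = real n * real p"

lemma np_ge: "1 \<le> np" "real n \<le> np" "real p \<le> np"
proof -
  have "1 \<le> real n" "1 \<le> real p" using n0 p0 by simp_all
  then show "real n \<le> np" "real p \<le> np" "1 \<le> np"
    unfolding np_def using mult_mono[of 1 "real n" 1 "real p"] by (auto intro: mult_left_le mult_right_le_one_le simp: mult_le_cancel_left1 mult_le_cancel_right1)
qed

definition "kH k = 8 * (B ^ 4 * gauss_moment 4 + (2 + 2 * k) ^ 4 * (\<Lambda> powr (- 1/4) * inv_sqrt_moment) ^ 16)"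
definition "kB k C = 8 * (k\<^sup>2 * gauss_moment 4 + 16 * C ^ 4)"

text \<open>The exponent 8 collects n^4 p^4 from the inverse column norms and another n^4 from the
  fourth power of 2 + 2 / lam0^2.\<close>

lemma CH_le:
  assumes k: "1 / lam0\<^sup>2 \<le> k * real n"
  shows "CH \<le> kH k * np ^ 8"
proof -
  define g where "g = gauss_moment 4"
  define c where "c = (\<Lambda> powr (- 1/4) * inv_sqrt_moment) ^ 16"
  have g: "0 \<le> g" by (simp add: g_def gauss_moment_def)
  have c: "0 \<le> c" by (simp add: c_def)
  have n1: "1 \<le> real n" and p1: "1 \<le> real p" using n0 p0 by simp_all
  have "real p ^ 4 * real n \<le> real p ^ 8 * real n ^ 8"
    using n1 p1 power_increasing[of 4 8 "real p"] power_increasing[of 1 8 "real n"] by (intro mult_mono) auto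
  then have 1: "real p ^ 4 * real n \<le> np ^ 8" by (simp add: np_def power_mult_distrib mult.commute)
  have "2 + 2 / lam0\<^sup>2 \<le> (2 + 2 * k) * real n" using k n1 by (simp add: algebra_simps)
  then have "(2 + 2 / lam0\<^sup>2) ^ 4 \<le> ((2 + 2 * k) * real n) ^ 4" using lam0 by (intro power_mono) auto
  then have "(2 + 2 / lam0\<^sup>2) ^ 4 * (real p ^ 4 * real n ^ 4) \<le> ((2 + 2 * k) * real n) ^ 4 * (real p ^ 4 * real n ^ 4)"
    by (intro mult_right_mono) auto
  also have "\<dots> = (2 + 2 * k) ^ 4 * (real p ^ 4 * real n ^ 8)"
    by (simp add: power_mult_distrib flip: power_add)
  also have "\<dots> \<le> (2 + 2 * k) ^ 4 * np ^ 8"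
  proof (rule mult_left_mono)
    have "real p ^ 4 * real n ^ 8 \<le> real p ^ 8 * real n ^ 8"
      using p1 power_increasing[of 4 8 "real p"] by (intro mult_right_mono) auto
    then show "real p ^ 4 * real n ^ 8 \<le> np ^ 8" by (simp add: np_def power_mult_distrib mult.commute)
  qed simp
  finally have 2: "(2 + 2 / lam0\<^sup>2) ^ 4 * (real p ^ 4 * real n ^ 4) \<le> (2 + 2 * k) ^ 4 * np ^ 8" .
  have "CH = 8 * (B ^ 4 * g * (real p ^ 4 * real n) + c * ((2 + 2 / lam0\<^sup>2) ^ 4 * (real p ^ 4 * real n ^ 4)))"
    by (simp add: CH_def g_def c_def mult_ac)
  also have "\<dots> \<le> 8 * (B ^ 4 * g * np ^ 8 + c * ((2 + 2 * k) ^ 4 * np ^ 8))"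
    using 1 2 g c by (intro mult_left_mono add_mono) auto
  also have "\<dots> = kH k * np ^ 8" by (simp add: kH_def g_def c_def algebra_simps)
  finally show ?thesis .
qed

lemma CB_le:
  assumes k: "1 / lam0\<^sup>2 \<le> k * real n" and b1: "0 \<le> b1" "b1 \<le> C * real p"
  shows "CB b1 \<le> kB k C * np ^ 4"
proof -
  define g where "g = gauss_moment 4"
  have g: "0 \<le> g" by (simp add: g_def gauss_moment_def)
  have n1: "1 \<le> real n" and p1: "1 \<le> real p" using n0 p0 by simp_all
  have s1: "1 \<le> np" by (rule np_ge)
  have "(1 / (4 * lam0)) ^ 4 = (1 / lam0\<^sup>2)\<^sup>2 / 256" by (simp add: power_divide power_mult_distrib flip: power_mult)
  also have "\<dots> \<le> (k * real n)\<^sup>2 / 1"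
  proof (rule frac_le)
    show "(1 / lam0\<^sup>2)\<^sup>2 \<le> (k * real n)\<^sup>2" using k by (intro power_mono) auto
  qed auto
  finally have "(1 / (4 * lam0)) ^ 4 * (real n * g) \<le> (k * real n)\<^sup>2 * (real n * g)"
    using g by (intro mult_right_mono) auto
  also have "\<dots> = k\<^sup>2 * g * real n ^ 3" by (simp add: power2_eq_square power3_eq_cube mult_ac)
  also have "\<dots> \<le> k\<^sup>2 * g * np ^ 4"
  proof (rule mult_left_mono)
    have "real n ^ 3 \<le> np ^ 3" using np_ge by (intro power_mono) auto
    also have "\<dots> \<le> np ^ 4" using s1 by (intro power_increasing) auto
    finally show "real n ^ 3 \<le> np ^ 4" .
  qed (use g in simp)
  finally have 1: "(1 / (4 * lam0)) ^ 4 * (real n * g) \<le> k\<^sup>2 * g * np ^ 4" .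
  have C0: "0 \<le> C" using b1 p1 by (smt (verit) mult_neg_pos)
  have "(2 * b1) ^ 4 \<le> (2 * (C * np)) ^ 4"
  proof (rule power_mono)
    have "C * real p \<le> C * np" using C0 np_ge by (intro mult_left_mono) auto
    then show "2 * b1 \<le> 2 * (C * np)" using b1 by simp
  qed (use b1 in simp)
  also have "\<dots> = 16 * C ^ 4 * np ^ 4" by (simp add: power_mult_distrib)
  finally have 2: "(2 * b1) ^ 4 \<le> 16 * C ^ 4 * np ^ 4" .
  have "CB b1 \<le> 8 * (k\<^sup>2 * g * np ^ 4 + 16 * C ^ 4 * np ^ 4)"
    unfolding CB_def g_def[symmetric] by (intro mult_left_mono add_mono 1 2) simp
  also have "\<dots> = kB k C * np ^ 4" by (simp add: kB_def g_def algebra_simps)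
  finally show ?thesis .
qed

lemma constants_nonneg: "0 \<le> kH k" "0 \<le> kB k C"
  by (auto simp: kH_def kB_def gauss_moment_def)

text \<open>Each exponential is at most np^(-24), and the number of events with its constants at
  most np^6, where n \<ge> 12 absorbs the constant 12.\<close>

lemma prob_bad_le:
  assumes \<mu>: "0 \<le> \<mu>" "\<mu> \<le> 1" and n12: "12 \<le> n"
    and e1: "24 * ln np \<le> real n * (\<Lambda> / (64 * s * B))\<^sup>2 / 16" and e2: "24 * ln np \<le> real n * (\<mu> / (2 * M))\<^sup>2 / 16"
  shows "measure D (bad \<mu>) \<le> 1 / np ^ 18"
proof -
  have s1: "1 \<le> np" by (rule np_ge)
  have e: "exp (- x) \<le> 1 / np ^ 24" if "24 * ln np \<le> x" for x
  proof -
    have "exp (- x) \<le> exp (- (24 * ln np))" using that by simp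
    also have "\<dots> = 1 / exp (of_nat 24 * ln np)" by (simp add: exp_minus inverse_eq_divide)
    also have "exp (of_nat 24 * ln np) = np ^ 24" unfolding exp_of_nat_mult using s1 by simp
    finally show ?thesis .
  qed
  have "measure D (bad \<mu>) \<le> 4 * (real p)\<^sup>2 * exp (- real n * (\<Lambda> / (64 * s * B))\<^sup>2 / 16) +
    8 * (real p)\<^sup>2 * exp (- real n * (\<mu> / (2 * M))\<^sup>2 / 16)" by (rule prob_bad[OF \<mu>])
  also have "\<dots> \<le> 4 * (real p)\<^sup>2 * (1 / np ^ 24) + 8 * (real p)\<^sup>2 * (1 / np ^ 24)"
    using e[OF e1] e[OF e2] by (intro add_mono mult_left_mono) auto
  also have "\<dots> = 12 * (real p)\<^sup>2 / np ^ 24" by simp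
  also have "\<dots> \<le> np ^ 6 / np ^ 24"
  proof (rule divide_right_mono)
    have "12 * (real p)\<^sup>2 \<le> np * np\<^sup>2"
      using n12 np_ge by (intro mult_mono power_mono) auto
    also have "\<dots> = np ^ 3" by (simp add: power2_eq_square power3_eq_cube)
    also have "\<dots> \<le> np ^ 6" using s1 by (intro power_increasing) auto
    finally show "12 * (real p)\<^sup>2 \<le> np ^ 6" .
  qed (use s1 in simp)
  also have "\<dots> = 1 / np ^ 18" using power_quotient[of np 1 6 18] s1 by simp
  finally show ?thesis .
qed

lemma x1_nonneg: "0 \<le> x1" by (auto simp: x1_def intro: sum_nonneg)

text \<open>The moment has exponent 14 = 2 + 8 + 4, from the fourth power of \<open>lamU\<close>,
  from \<open>H\<close>, and from the crude error of the Lasso. With weight np^16 and probability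
  np^(-18), both parts of the splitting are of order np^(-2).\<close>

lemma r_err_le:
  assumes k: "1 / lam0\<^sup>2 \<le> k * real n" and b1: "0 \<le> b1" "b1 \<le> C * real p"
    and x: "x1 \<le> K" and U: "lamU\<^sup>2 \<le> U\<^sup>2 * np" and \<mu>: "0 \<le> \<mu>"
  shows "r_err \<mu> (np ^ 16) (1 / np ^ 18) b1 \<le> (K * (2 * lamU / \<Lambda>) * \<kappa> \<mu>)\<^sup>2 +
    (K ^ 4 * U ^ 4 * kH k * kB k C + 1) / (real n)\<^sup>2"
proof -
  have s1: "1 \<le> np" by (rule np_ge)
  have K0: "0 \<le> K" using x x1_nonneg by simp
  have \<kappa>0: "0 \<le> \<kappa> \<mu>" unfolding \<kappa>_def using s(1) lamU \<mu> M_ge Lam(1) by simp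
  have "x1 * (2 * lamU / \<Lambda>) * \<kappa> \<mu> \<le> K * (2 * lamU / \<Lambda>) * \<kappa> \<mu>"
    using x lamU Lam(1) \<kappa>0 by (intro mult_right_mono) auto
  then have 1: "(x1 * (2 * lamU / \<Lambda>) * \<kappa> \<mu>)\<^sup>2 \<le> (K * (2 * lamU / \<Lambda>) * \<kappa> \<mu>)\<^sup>2"
    using x1_nonneg lamU Lam(1) \<kappa>0 by (intro power_mono) auto
  have "(lamU\<^sup>2)\<^sup>2 \<le> (U\<^sup>2 * np)\<^sup>2" using U by (intro power_mono) auto
  then have U4: "lamU ^ 4 \<le> U ^ 4 * np\<^sup>2" by (simp add: power_mult_distrib flip: power_mult)
  have "(x1 * lamU) ^ 4 \<le> K ^ 4 * (U ^ 4 * np\<^sup>2)"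
    unfolding power_mult_distrib using x x1_nonneg U4 K0 lamU by (intro mult_mono power_mono) auto
  then have "(x1 * lamU) ^ 4 * (CH * CB b1) \<le> (K ^ 4 * (U ^ 4 * np\<^sup>2)) * ((kH k * np ^ 8) * (kB k C * np ^ 4))"
    using CH_le[OF k] CB_le[OF k b1] CH_nonneg CB_nonneg K0 constants_nonneg s1 by (intro mult_mono) auto
  also have "\<dots> = K ^ 4 * U ^ 4 * kH k * kB k C * np ^ 14"
  proof -
    have "np ^ 14 = np\<^sup>2 * (np ^ 8 * np ^ 4)" by (simp flip: power_add)
    then show ?thesis by (simp only: mult_ac)
  qed
  finally have 2: "(x1 * lamU) ^ 4 * (CH * CB b1) \<le> K ^ 4 * U ^ 4 * kH k * kB k C * np ^ 14" .
  have "(x1 * lamU) ^ 4 * (CH * CB b1) / (2 * np ^ 16) \<le> K ^ 4 * U ^ 4 * kH k * kB k C * np ^ 14 / (1 * np ^ 16)"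
    using 2 s1 K0 constants_nonneg CH_nonneg CB_nonneg by (intro frac_le mult_right_mono) auto
  also have "\<dots> = K ^ 4 * U ^ 4 * kH k * kB k C / np\<^sup>2"
    using power_quotient[of np "K ^ 4 * U ^ 4 * kH k * kB k C" 14 2] s1 by simp
  finally have 3: "(x1 * lamU) ^ 4 * (CH * CB b1) / (2 * np ^ 16) \<le> K ^ 4 * U ^ 4 * kH k * kB k C / np\<^sup>2" .
  have 4: "np ^ 16 * (1 / np ^ 18) / 2 \<le> 1 / np\<^sup>2" using power_quotient[of np 1 16 2] s1 by (simp add: divide_simps)
  have "r_err \<mu> (np ^ 16) (1 / np ^ 18) b1 \<le> (K * (2 * lamU / \<Lambda>) * \<kappa> \<mu>)\<^sup>2 +
      (K ^ 4 * U ^ 4 * kH k * kB k C / np\<^sup>2 + 1 / np\<^sup>2)"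
    unfolding r_err_def by (intro add_mono 1 3 4)
  also have "K ^ 4 * U ^ 4 * kH k * kB k C / np\<^sup>2 + 1 / np\<^sup>2 = (K ^ 4 * U ^ 4 * kH k * kB k C + 1) / np\<^sup>2"
    by (simp add: add_divide_distrib)
  also have "\<dots> \<le> (K ^ 4 * U ^ 4 * kH k * kB k C + 1) / (real n)\<^sup>2"
  proof (rule divide_left_mono)
    show "(real n)\<^sup>2 \<le> np\<^sup>2" using np_ge by (intro power_mono) auto
    show "0 \<le> K ^ 4 * U ^ 4 * kH k * kB k C + 1" using K0 constants_nonneg by simp
    show "0 < np\<^sup>2 * (real n)\<^sup>2" using s1 n0 by simp
  qed
  finally show ?thesis by simp
qed

lemma v_le: "x1 \<le> K \<Longrightarrow> v \<le> K\<^sup>2 / \<Lambda>"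
  using bform_Q_bounds(2)[of "($) xi"] power_mono[of x1 K 2] x1_nonneg Lam(1)
  unfolding v_def x1_def[symmetric] by (meson divide_right_mono less_imp_le order_trans)

lemma q_err_le:
  assumes k: "1 / lam0\<^sup>2 \<le> k * real n" and x: "x1 \<le> K" and \<mu>: "0 \<le> \<mu>"
  shows "q_err \<mu> (np ^ 16) (1 / np ^ 18) \<le> K\<^sup>2 * \<epsilon>1 \<mu> +
    (K ^ 4 * (1 + kH k) + (K\<^sup>2 / \<Lambda>)\<^sup>2 + 1) / (real n)\<^sup>2"
proof -
  have s1: "1 \<le> np" by (rule np_ge)
  have K0: "0 \<le> K" using x x1_nonneg by simp
  have \<kappa>0: "0 \<le> \<kappa> \<mu>" unfolding \<kappa>_def using s(1) lamU \<mu> M_ge Lam(1) by simp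
  have \<epsilon>00: "0 \<le> \<epsilon>0 \<mu>" unfolding \<epsilon>0_def using \<mu> B_pos \<kappa>0 by simp
  have \<epsilon>10: "0 \<le> \<epsilon>1 \<mu>" unfolding \<epsilon>1_def using lamU s(1) B_pos Lam(1) \<kappa>0 \<epsilon>00 by simp
  have 1: "x1\<^sup>2 * \<epsilon>1 \<mu> \<le> K\<^sup>2 * \<epsilon>1 \<mu>"
    using x x1_nonneg \<epsilon>10 by (intro mult_right_mono power_mono) auto
  have "1 + CH \<le> np ^ 8 + kH k * np ^ 8" using CH_le[OF k] s1 by (intro add_mono) auto
  then have "1 + CH \<le> (1 + kH k) * np ^ 8" by (simp add: algebra_simps)
  then have "x1 ^ 4 * (1 + CH) \<le> K ^ 4 * ((1 + kH k) * np ^ 8)"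
    using x x1_nonneg CH_nonneg K0 by (intro mult_mono power_mono) auto
  moreover have "v\<^sup>2 \<le> (K\<^sup>2 / \<Lambda>)\<^sup>2 * np ^ 8"
  proof -
    have "v\<^sup>2 \<le> (K\<^sup>2 / \<Lambda>)\<^sup>2 * 1" using v_le[OF x] v_nonneg by (simp add: power_mono)
    also have "\<dots> \<le> (K\<^sup>2 / \<Lambda>)\<^sup>2 * np ^ 8" using s1 by (intro mult_left_mono) auto
    finally show ?thesis .
  qed
  ultimately have 2: "2 * x1 ^ 4 * (1 + CH) + 2 * v\<^sup>2 \<le> 2 * ((K ^ 4 * (1 + kH k) + (K\<^sup>2 / \<Lambda>)\<^sup>2) * np ^ 8)"
    by (simp add: algebra_simps)
  define c where "c = K ^ 4 * (1 + kH k) + (K\<^sup>2 / \<Lambda>)\<^sup>2"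
  have c0: "0 \<le> c" unfolding c_def using K0 constants_nonneg by simp
  have "(2 * x1 ^ 4 * (1 + CH) + 2 * v\<^sup>2) / (2 * np ^ 16) \<le> 2 * (c * np ^ 14) / (2 * np ^ 16)"
  proof (rule divide_right_mono)
    have "c * np ^ 8 \<le> c * np ^ 14" using s1 c0 by (intro mult_left_mono power_increasing) auto
    then show "2 * x1 ^ 4 * (1 + CH) + 2 * v\<^sup>2 \<le> 2 * (c * np ^ 14)" using 2 by (simp add: c_def)
  qed (use s1 in simp)
  also have "\<dots> = c / np\<^sup>2" using power_quotient[of np c 14 2] s1 by simp
  finally have 3: "(2 * x1 ^ 4 * (1 + CH) + 2 * v\<^sup>2) / (2 * np ^ 16) \<le> c / np\<^sup>2" .
  have 4: "np ^ 16 * (1 / np ^ 18) / 2 \<le> 1 / np\<^sup>2" using power_quotient[of np 1 16 2] s1 by (simp add: divide_simps)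
  have "q_err \<mu> (np ^ 16) (1 / np ^ 18) \<le> K\<^sup>2 * \<epsilon>1 \<mu> + (c / np\<^sup>2 + 1 / np\<^sup>2)"
    unfolding q_err_def by (intro add_mono 1 3 4)
  also have "c / np\<^sup>2 + 1 / np\<^sup>2 = (c + 1) / np\<^sup>2" by (simp add: add_divide_distrib)
  also have "\<dots> \<le> (c + 1) / (real n)\<^sup>2"
  proof (rule divide_left_mono)
    show "(real n)\<^sup>2 \<le> np\<^sup>2" using np_ge by (intro power_mono) auto
    show "0 < np\<^sup>2 * (real n)\<^sup>2" using s1 n0 by simp
  qed (use c0 in simp)
  finally show ?thesis by (simp add: c_def)
qed

text \<open>
  The tail is cut at the level \<open>np ^ 16\<close>: the fourth moments grow at most like \<open>np ^ 14\<close>, and the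
  bad event is negligible against it.
\<close>
theorem mean_variance_bounds_explicit:
  assumes \<mu>: "0 \<le> \<mu>" "\<mu> \<le> 1" and regime: "real p \<le> s \<or> 2 * (\<mu> * M) \<le> lam0" and \<epsilon>: "\<epsilon>0 \<mu> \<le> \<Lambda> / 2"
    and e1: "24 * ln np \<le> real n * (\<Lambda> / (64 * s * B))\<^sup>2 / 16" and e2: "24 * ln np \<le> real n * (\<mu> / (2 * M))\<^sup>2 / 16"
    and k: "1 / lam0\<^sup>2 \<le> k * real n" and x: "x1 \<le> K" and U: "lamU\<^sup>2 \<le> U\<^sup>2 * np"
    and \<beta>: "\<beta> \<in> carrier_vec p" "real p \<le> s \<or> real (l0norm \<beta>) \<le> s" "(\<Sum>k<p. \<bar>\<beta> $ k\<bar>) \<le> C * real p"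
    and r: "(K * (2 * lamU / \<Lambda>) * \<kappa> \<mu>)\<^sup>2 + (K ^ 4 * U ^ 4 * kH k * kB k C + 1) / (real n)\<^sup>2 \<le> rb"
    and q: "K\<^sup>2 * \<epsilon>1 \<mu> + (K ^ 4 * (1 + kH k) + (K\<^sup>2 / \<Lambda>)\<^sup>2 + 1) / (real n)\<^sup>2 \<le> qb"
  shows "finite_var n p A \<beta> stat"
    and "\<bar>expect n p A \<beta> stat - xi \<bullet> \<beta>\<bar> \<le> sqrt rb"
    and "\<bar>real n * var n p A \<beta> stat - v\<bar> \<le> qb + (2 * sqrt ((K\<^sup>2 / \<Lambda> + qb) * (real n * rb)) + real n * rb)"
proof -
  have s1: "0 < np ^ 16" using np_ge(1) by simp
  have b1: "0 \<le> C * real p" using \<beta>(3) by (meson abs_ge_zero order_trans sum_nonneg)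
  note mv = mean_variance_bounds[OF \<mu>(1) regime \<epsilon> prob_bad_le[OF \<mu> _ e1 e2] s1 \<beta>]
  show "finite_var n p A \<beta> stat" by (rule mv(1)) (use n16 in simp)
  define r' where "r' = r_err \<mu> (np ^ 16) (1 / np ^ 18) (C * real p)"
  define q' where "q' = q_err \<mu> (np ^ 16) (1 / np ^ 18)"
  have r': "r' \<le> rb" unfolding r'_def by (rule order_trans[OF r_err_le[OF k b1 order_refl x U \<mu>(1)] r])
  have q': "q' \<le> qb" unfolding q'_def by (rule order_trans[OF q_err_le[OF k x \<mu>(1)] q])
  have r0: "0 \<le> r'"
  proof -
    have "0 \<le> (x1 * lamU) ^ 4 * (CH * CB (C * real p)) / (2 * np ^ 16)"
      using CH_nonneg CB_nonneg s1 by (intro divide_nonneg_pos mult_nonneg_nonneg) auto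
    moreover have "0 \<le> np ^ 16 * (1 / np ^ 18) / 2" using np_ge(1) by simp
    ultimately show ?thesis unfolding r'_def r_err_def by simp
  qed
  have "\<bar>expect n p A \<beta> stat - xi \<bullet> \<beta>\<bar> \<le> sqrt r'" unfolding r'_def by (rule mv(2)) (use n16 in simp)
  also have "\<dots> \<le> sqrt rb" using r' by simp
  finally show "\<bar>expect n p A \<beta> stat - xi \<bullet> \<beta>\<bar> \<le> sqrt rb" .
  have "\<bar>real n * var n p A \<beta> stat - v\<bar> \<le> q' + real n * (2 * sqrt ((v + q') / real n * r') + r')"
    unfolding r'_def q'_def by (rule mv(3)) (use n16 in simp)
  also have "\<dots> = q' + (2 * (real n * sqrt ((v + q') / real n * r')) + real n * r')" by (simp add: algebra_simps)
  \<comment> \<open>With n drawn under the root, the cross term is seen to vanish as soon as n times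
    the mean square of the remainder does.\<close>
  also have "real n * sqrt ((v + q') / real n * r') = sqrt ((v + q') * (real n * r'))"
  proof -
    have "real n = sqrt ((real n)\<^sup>2)" by simp
    then have "real n * sqrt ((v + q') / real n * r') = sqrt ((real n)\<^sup>2 * ((v + q') / real n * r'))"
      by (simp only: real_sqrt_mult)
    also have "(real n)\<^sup>2 * ((v + q') / real n * r') = (v + q') * (real n * r')"
      using n0 by (simp add: power2_eq_square)
    finally show ?thesis .
  qed
  also have "q' + (2 * sqrt ((v + q') * (real n * r')) + real n * r') \<le>
      qb + (2 * sqrt ((K\<^sup>2 / \<Lambda> + qb) * (real n * rb)) + real n * rb)"
  proof -
    have "v + q' \<le> K\<^sup>2 / \<Lambda> + qb" using v_le[OF x] q' by (rule add_mono)
    moreover have "real n * r' \<le> real n * rb" using r' by (intro mult_left_mono) auto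
    moreover have "0 \<le> qb"
    proof -
      have "0 \<le> \<kappa> \<mu>" unfolding \<kappa>_def using s(1) lamU \<mu> M_ge Lam(1) by simp
      then have "0 \<le> \<epsilon>1 \<mu>" unfolding \<epsilon>1_def \<epsilon>0_def using lamU s(1) B_pos Lam(1) \<mu> by simp
      then have "0 \<le> K\<^sup>2 * \<epsilon>1 \<mu> + (K ^ 4 * (1 + kH k) + (K\<^sup>2 / \<Lambda>)\<^sup>2 + 1) / (real n)\<^sup>2"
        using constants_nonneg by (intro add_nonneg_nonneg mult_nonneg_nonneg divide_nonneg_nonneg) auto
      then show ?thesis using q by linarith
    qed
    ultimately have "(v + q') * (real n * r') \<le> (K\<^sup>2 / \<Lambda> + qb) * (real n * rb)"
      using mult_mono[of "v + q'" "K\<^sup>2 / \<Lambda> + qb" "real n * r'" "real n * rb"] r0 Lam(1) by simp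
    then have "sqrt ((v + q') * (real n * r')) \<le> sqrt ((K\<^sup>2 / \<Lambda> + qb) * (real n * rb))" by simp
    then show ?thesis using q' \<open>real n * r' \<le> real n * rb\<close> by linarith
  qed
  finally show "\<bar>real n * var n p A \<beta> stat - v\<bar> \<le> qb + (2 * sqrt ((K\<^sup>2 / \<Lambda> + qb) * (real n * rb)) + real n * rb)" .
qed

end

subsection \<open>Asymptotics\<close>

text \<open>The inverse has no zero column. This forces the sparsity level \<open>d\<close> to be at
  least one.\<close>

lemma l0norm_col_inverse_ge_one:
  assumes cov: "covariance_matrix p A" and inv: "invertible_mat A" and j: "j < p"
  shows "1 \<le> l0norm (col (inverse_mat A) j)"
proof -
  have A: "A \<in> carrier_mat p p" using cov by (simp add: covariance_matrix_def)
  note B = inverse_mat_properties(3)[OF A inv]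
  have "\<exists>k<p. inverse_mat A $$ (k, j) \<noteq> 0"
  proof (rule ccontr)
    assume "\<not> ?thesis"
    then show False
      using inverse_pd_formsD(3)[OF inverse_pd_forms_of_matrix[OF cov inv] j j] by simp
  qed
  then obtain k where "k < p" "inverse_mat A $$ (k, j) \<noteq> 0" by auto
  then have "{k} \<subseteq> {i. i < dim_vec (col (inverse_mat A) j) \<and> col (inverse_mat A) j $ i \<noteq> 0}"
    using B j by auto
  from card_mono[OF _ this] show ?thesis by (simp add: l0norm_def)
qed

lemma l1_le_of_l2norm_le:
  assumes b: "b \<in> carrier_vec p" and C: "l2norm b \<le> C"
  shows "(\<Sum>k<p. \<bar>b $ k\<bar>) \<le> C * real p"
proof -
  have "\<bar>b $ k\<bar> \<le> C" if k: "k < p" for k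
  proof -
    have "(b $ k)\<^sup>2 \<le> (\<Sum>k<p. (b $ k)\<^sup>2)" using k by (intro member_le_sum) auto
    also have "\<dots> = b \<bullet> b" using b by (simp add: scalar_prod_def atLeast0LessThan power2_eq_square)
    finally have "\<bar>b $ k\<bar> \<le> l2norm b" unfolding l2norm_def by (intro real_le_rsqrt) simp
    then show ?thesis using C by simp
  qed
  then have "(\<Sum>k<p. \<bar>b $ k\<bar>) \<le> (\<Sum>k<p. C)" by (intro sum_mono) auto
  then show ?thesis by (simp add: mult.commute)
qed

text \<open>The rate has to exceed n in order while m \<rho> still vanishes. For w essentially the
  root of n \<rho>, the choice m = (n + 1) / w gives n / m \<le> w and m \<rho> \<le> 2 w; the term
  1 / (n + 1) keeps w positive.\<close>

lemma rate_exists: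
  fixes \<rho> :: "nat \<Rightarrow> real"
  assumes \<rho>: "\<And>n. 0 \<le> \<rho> n" "(\<lambda>n. real n * \<rho> n) \<longlonglongrightarrow> 0"
  shows "\<exists>m. (\<forall>n. 0 < m n) \<and> (\<lambda>n. real n) \<in> o(m) \<and> (\<lambda>n. sqrt (m n) * sqrt (\<rho> n)) \<longlonglongrightarrow> 0"
proof -
  define w where "w n = sqrt (real n * \<rho> n + 1 / real (n + 1))" for n
  define m where "m n = real (n + 1) / w n" for n
  have w: "0 < w n" for n unfolding w_def using \<rho>(1)[of n] by (intro real_sqrt_gt_zero add_nonneg_pos) auto
  have w0: "w \<longlonglongrightarrow> 0"
  proof -
    have "(\<lambda>n. 1 / real (n + 1)) \<longlonglongrightarrow> 0" by real_asymp
    from tendsto_add[OF \<rho>(2) this] have "(\<lambda>n. real n * \<rho> n + 1 / real (n + 1)) \<longlonglongrightarrow> 0" by simp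
    from tendsto_real_sqrt[OF this] show ?thesis by (simp add: w_def[abs_def])
  qed
  have m: "0 < m n" for n unfolding m_def using w[of n] by simp
  have "(\<lambda>n. real n / m n) \<longlonglongrightarrow> 0"
  proof (rule tendsto_sandwich[OF _ _ tendsto_const w0])
    show "\<forall>\<^sub>F n in sequentially. 0 \<le> real n / m n" using m by (simp add: less_imp_le)
    have "real n / m n \<le> w n" for n
    proof -
      have "real n / m n = real n / real (n + 1) * w n" by (simp add: m_def)
      also have "\<dots> \<le> 1 * w n" using w[of n] by (intro mult_right_mono) auto
      finally show ?thesis by simp
    qed
    then show "\<forall>\<^sub>F n in sequentially. real n / m n \<le> w n" by simp
  qed
  then have o: "(\<lambda>n. real n) \<in> o(m)"
    using m by (intro smalloI_tendsto) (auto simp: less_imp_neq[symmetric])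
  have "(\<lambda>n. m n * \<rho> n) \<longlonglongrightarrow> 0"
  proof (rule tendsto_sandwich[OF _ _ tendsto_const])
    show "\<forall>\<^sub>F n in sequentially. 0 \<le> m n * \<rho> n" using m \<rho>(1) by (simp add: less_imp_le)
    show "(\<lambda>n. 2 * w n) \<longlonglongrightarrow> 0" using tendsto_mult[OF tendsto_const w0, of 2] by simp
    show "\<forall>\<^sub>F n in sequentially. m n * \<rho> n \<le> 2 * w n"
      using eventually_ge_at_top[of 1]
    proof eventually_elim
      case (elim n)
      have "(w n)\<^sup>2 = real n * \<rho> n + 1 / real (n + 1)" unfolding w_def using \<rho>(1)[of n] by simp
      then have "real n * \<rho> n \<le> (w n)\<^sup>2" by simp
      moreover have "real (n + 1) * \<rho> n \<le> (2 * real n) * \<rho> n" using elim \<rho>(1)[of n] by (intro mult_right_mono) auto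
      ultimately have "real (n + 1) * \<rho> n \<le> 2 * w n * w n" by (simp add: power2_eq_square)
      then show ?case using w[of n] by (simp add: m_def divide_le_eq)
    qed
  qed
  from tendsto_real_sqrt[OF this] have "(\<lambda>n. sqrt (m n) * sqrt (\<rho> n)) \<longlonglongrightarrow> 0" by (simp add: real_sqrt_mult)
  then show ?thesis using m o by blast
qed

lemma tendsto_zero_sandwich:
  fixes f g :: "nat \<Rightarrow> real"
  assumes "\<forall>\<^sub>F n in sequentially. 0 \<le> f n \<and> f n \<le> g n" "g \<longlonglongrightarrow> 0"
  shows "f \<longlonglongrightarrow> 0"
  by (rule tendsto_sandwich[OF _ _ tendsto_const assms(2)]) (use assms(1) in \<open>auto elim: eventually_mono\<close>)

text \<open>
  Two regimes, chosen separately for every \<open>n\<close>: if \<open>p\<^sup>4 \<le> n\<close> no sparsity is used, and otherwise the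
  tuning parameters dominate the noise outside an event of probability polynomially small in \<open>n p\<close>. The
  constant 90 makes the exponential tail bounds at level \<open>\<mu> n\<close> at most \<open>(n p)\<close> to the power \<open>-24\<close> there,
  and \<open>180 M\<^sup>2\<close> is what the penalty needs to dominate \<open>\<mu> n\<close>.
\<close>
lemma debiased_bounds:
  fixes C :: real and Sigma0 Theta0 :: "nat \<Rightarrow> real mat" and beta0 xi :: "nat \<Rightarrow> real vec"
  assumes p: "\<And>n. 1 \<le> p n" and P: "\<And>n. P n \<subseteq> carrier_vec (p n)"
    and Sigma0: "\<And>n. covariance_matrix (p n) (Sigma0 n)" "\<And>n. invertible_mat (Sigma0 n)"
    and Theta0: "\<And>n. Theta0 n = inverse_mat (Sigma0 n)"
    and d: "d \<in> o(\<lambda>n. sqrt (real n) / ln (real (p n)))"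
    and sp: "\<And>n j. j < p n \<Longrightarrow> real (l0norm (col (Theta0 n) j)) \<le> d n"
    and xi: "\<And>n. xi n \<in> carrier_vec (p n)"
    and v: "\<And>n. v n = xi n \<bullet> (Theta0 n *\<^sub>v xi n)"
    and K1: "0 < K1" "\<forall>\<^sub>F n in sequentially. \<bar>1 / min_eigenvalue (Sigma0 n)\<bar> \<le> K1"
    and K2: "0 < K2" "\<forall>\<^sub>F n in sequentially. \<bar>max_entry (Sigma0 n)\<bar> \<le> K2"
    and K3: "0 < K3" "\<forall>\<^sub>F n in sequentially. \<bar>l1norm (xi n)\<bar> \<le> K3"
    and M: "M = K2 + 1 / (1 / K1) + 1"
    and tune: "tuning_order (180 * M\<^sup>2) p lam lams"
    and lasso: "\<And>n. lasso_version n (p n) (lam n) (bhat n)"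
    and nodewise: "\<And>n. nodewise_version n (p n) (lams n) (ghat n)"
  shows "\<exists>\<rho> \<delta>. (\<forall>n. 0 \<le> \<rho> n) \<and> (\<lambda>n. real n * \<rho> n) \<longlonglongrightarrow> 0 \<and> \<delta> \<longlonglongrightarrow> 0 \<and>
    (\<forall>\<^sub>F n in sequentially. \<bar>v n\<bar> \<le> K3\<^sup>2 / (1 / K1) \<and> (\<forall>\<beta> \<in> sparse_params (P n) C (d n).
      finite_var n (p n) (Sigma0 n) \<beta> (debiased_stat (xi n) (lams n) (bhat n) (ghat n)) \<and>
      \<bar>expect n (p n) (Sigma0 n) \<beta> (debiased_stat (xi n) (lams n) (bhat n) (ghat n)) - xi n \<bullet> \<beta>\<bar> \<le> sqrt (\<rho> n) \<and>
      \<bar>real n * var n (p n) (Sigma0 n) \<beta> (debiased_stat (xi n) (lams n) (bhat n) (ghat n)) - v n\<bar> \<le> \<delta> n))"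
proof -
  define \<Lambda> where "\<Lambda> = 1 / K1"
  define L where "L = 180 * M\<^sup>2"
  have \<Lambda>: "0 < \<Lambda>" using K1(1) by (simp add: \<Lambda>_def)
  have M1: "1 < M" "0 < M" using K1(1) K2(1) by (auto simp: M add_pos_pos)
  have L: "0 < L" using M1 by (simp add: L_def)
  obtain U0 where U0: "\<forall>\<^sub>F n in sequentially.
      lam n \<in> {L * sqrt (ln (real (p n)) / real n) .. U0 * sqrt (ln (real (p n)) / real n)} \<and>
      (\<forall>j<p n. lams n j \<in> {L * sqrt (ln (real (p n)) / real n) .. U0 * sqrt (ln (real (p n)) / real n)})"
    using tune unfolding tuning_order_def L_def[symmetric] by blast
  \<comment> \<open>Positive whatever upper constant the tuning condition provides.\<close>
  define U where "U = max U0 1"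
  have U: "0 < U" "U0 \<le> U" by (auto simp: U_def)
  define ell where "ell n = sqrt (ln (real (p n)) / real n)" for n
  define lam0 where "lam0 n = L * ell n" for n
  define lamU where "lamU n = U * ell n" for n
  define low where "low n \<longleftrightarrow> p n ^ 4 \<le> n" for n
  define s where "s n = (if low n then real (p n) else d n)" for n
  \<comment> \<open>The exponent -3/8 lies between two needs: p \<mu> must vanish for p up to
    n^(1/4), and n \<mu>^2 = n^(1/4) must exceed every multiple of ln n.\<close>
  define \<mu> where "\<mu> n = (if low n then real n powr (- 3/8) else 90 * M * ell n)" for n
  \<comment> \<open>The common scale of the l1 errors: sparsity times penalty plus noise
    level.\<close>
  define z where "z n = s n * (ell n + \<mu> n)" for n
  define dl where "dl n = d n * ln (real (p n)) / sqrt (real n)" for n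
  have dl: "dl \<longlonglongrightarrow> 0" using smalloD_tendsto[OF d] by (simp add: dl_def[abs_def])
  have p0: "0 < p n" for n using p[of n] by simp
  have d1: "1 \<le> d n" for n
    using l0norm_col_inverse_ge_one[OF Sigma0(1)[of n] Sigma0(2) p0] sp[OF p0, of n] by (simp add: Theta0)
  \<comment> \<open>For p = 1 the quotient that bounds \<open>d\<close> has denominator ln 1 = 0 and
    so equals 0 by convention, which contradicts d \<ge> 1.\<close>
  have p2: "\<forall>\<^sub>F n in sequentially. 2 \<le> p n"
    using landau_o.smallD[OF d, of 1, simplified]
  proof eventually_elim
    case (elim n)
    show ?case
    proof (rule ccontr)
      assume "\<not> ?thesis"
      then have "p n = 1" using p[of n] by simp
      then have "ln (real (p n)) = 0" by simp
      then show False using elim d1[of n] by simp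
    qed
  qed
  have ell0: "0 \<le> ell n" for n using p[of n] by (simp add: ell_def)
  have \<mu>0: "0 \<le> \<mu> n" for n using ell0[of n] M1 by (simp add: \<mu>_def)
  have s1: "1 \<le> s n" for n using d1[of n] p[of n] by (simp add: s_def)
  have z0: "0 \<le> z n" for n unfolding z_def using s1[of n] ell0[of n] \<mu>0[of n] by (intro mult_nonneg_nonneg) auto
  \<comment> \<open>\<open>h\<close> serves the regime with sparsity, through d ln p / sqrt n;
    \<open>g1\<close> and \<open>g2\<close> below serve that of small p, through p \<le> n^(1/4) and
    ln p \<le> ln n.\<close>
  define h where "h n = (1 + 90 * M) * \<bar>dl n\<bar>" for n
  have h: "h \<longlonglongrightarrow> 0"
    unfolding h_def using tendsto_mult[OF tendsto_const tendsto_rabs_zero[OF dl], of "1 + 90 * M"] by simp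
  define g1 where "g1 n = real n powr (1/4) * (sqrt (ln (real n) / real n) + real n powr (- 3/8))" for n :: nat
  define g2 where "g2 n = sqrt (ln (real n)) * g1 n" for n :: nat
  have g1: "g1 \<longlonglongrightarrow> 0" unfolding g1_def by real_asymp
  have g2: "g2 \<longlonglongrightarrow> 0" unfolding g2_def g1_def by real_asymp
  have low_facts: "real (p n) \<le> real n powr (1/4)" "(real (p n))\<^sup>2 \<le> sqrt (real n)" "ln (real (p n)) \<le> ln (real n)"
    if "low n" "0 < n" for n
  proof -
    have 4: "real (p n) ^ 4 \<le> real n" using that(1) unfolding low_def by (metis of_nat_le_iff of_nat_power)
    have "real (p n) = (real (p n) powr 4) powr (1/4)" using p0[of n] by (subst powr_powr) simp
    also have "real (p n) powr 4 = real (p n) ^ 4" using p0[of n] by simp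
    also have "(real (p n) ^ 4) powr (1/4) \<le> real n powr (1/4)" using 4 by (intro powr_mono2) auto
    finally show "real (p n) \<le> real n powr (1/4)" .
    show "(real (p n))\<^sup>2 \<le> sqrt (real n)" using 4 by (intro real_le_rsqrt) (simp flip: power_mult)
    have "real (p n) \<le> real (p n) ^ 4" using p[of n] power_increasing[of 1 4 "real (p n)"] by simp
    then show "ln (real (p n)) \<le> ln (real n)" using 4 p0[of n] that(2) by simp
  qed
  \<comment> \<open>The second bound is the decisive one: sqrt n times the bias on the good event is
    of order sqrt (ln p) times \<open>z\<close>.\<close>
  have zb: "\<forall>\<^sub>F n in sequentially. z n \<le> h n / sqrt (ln 2) + g1 n \<and> sqrt (ln (real (p n))) * z n \<le> h n + g2 n"
    using p2 eventually_ge_at_top[of 2]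
  proof eventually_elim
    case (elim n)
    have lp: "ln 2 \<le> ln (real (p n))" "0 < ln (real (p n))" using elim by simp_all
    have lnn: "0 < ln (real n)" using elim by simp
    have h0: "0 \<le> h n" "0 \<le> g1 n" "0 \<le> g2 n" using M1 lnn by (simp_all add: h_def g1_def g2_def)
    show ?case
    proof (cases "low n")
      case False
      have "z n = (1 + 90 * M) * d n * ell n" using False by (simp add: z_def s_def \<mu>_def algebra_simps)
      then have "sqrt (ln (real (p n))) * z n = (1 + 90 * M) * (d n * (sqrt (ln (real (p n))) * sqrt (ln (real (p n)))) / sqrt (real n))"
        by (simp add: ell_def real_sqrt_divide del: real_sqrt_mult_self real_sqrt_abs2)
      also have "\<dots> = (1 + 90 * M) * dl n" using lp by (simp add: dl_def)
      also have "\<dots> \<le> h n" unfolding h_def using M1 by (intro mult_left_mono) auto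
      finally have w: "sqrt (ln (real (p n))) * z n \<le> h n" .
      have "sqrt (ln 2) * z n \<le> sqrt (ln (real (p n))) * z n" using lp z0[of n] by (intro mult_right_mono) auto
      then have "z n \<le> h n / sqrt (ln 2)" using w by (simp add: pos_le_divide_eq mult.commute)
      then show ?thesis using w h0 by simp
    next
      case True
      note lf = low_facts[OF True]
      have "ell n \<le> sqrt (ln (real n) / real n)"
        unfolding ell_def using lf(3) elim by (simp add: divide_right_mono)
      then have "z n \<le> g1 n"
        unfolding z_def g1_def s_def \<mu>_def using True lf(1) elim ell0[of n] by (auto intro!: mult_mono add_mono)
      moreover have "sqrt (ln (real (p n))) * z n \<le> g2 n"
        unfolding g2_def using calculation lf(3) elim lp z0[of n] lnn by (intro mult_mono) auto
      ultimately show ?thesis using h0 by (simp add: add_increasing)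
    qed
  qed
  have z: "z \<longlonglongrightarrow> 0"
  proof (rule tendsto_zero_sandwich)
    show "\<forall>\<^sub>F n in sequentially. 0 \<le> z n \<and> z n \<le> h n / sqrt (ln 2) + g1 n" using zb z0 by (auto elim: eventually_mono)
    show "(\<lambda>n. h n / sqrt (ln 2) + g1 n) \<longlonglongrightarrow> 0"
      using tendsto_add[OF tendsto_divide[OF h tendsto_const[of "sqrt (ln 2)"]] g1] by simp
  qed
  have lz: "(\<lambda>n. sqrt (ln (real (p n))) * z n) \<longlonglongrightarrow> 0"
  proof (rule tendsto_zero_sandwich)
    show "\<forall>\<^sub>F n in sequentially. 0 \<le> sqrt (ln (real (p n))) * z n \<and> sqrt (ln (real (p n))) * z n \<le> h n + g2 n"
      using zb z0 p by (auto elim!: eventually_mono)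
    show "(\<lambda>n. h n + g2 n) \<longlonglongrightarrow> 0" using tendsto_add[OF h g2] by simp
  qed
  have sle: "ell n \<le> z n" "\<mu> n \<le> z n" "s n * ell n \<le> z n" for n
  proof -
    have "1 * (ell n + \<mu> n) \<le> z n"
      unfolding z_def using s1[of n] ell0[of n] \<mu>0[of n] by (intro mult_right_mono) auto
    then show "ell n \<le> z n" "\<mu> n \<le> z n" using ell0[of n] \<mu>0[of n] by auto
    show "s n * ell n \<le> z n" unfolding z_def using s1[of n] \<mu>0[of n] by (intro mult_left_mono) auto
  qed
  have \<mu>: "\<mu> \<longlonglongrightarrow> 0" by (rule tendsto_zero_sandwich[OF _ z]) (use sle \<mu>0 in simp)
  have ell: "ell \<longlonglongrightarrow> 0" by (rule tendsto_zero_sandwich[OF _ z]) (use sle ell0 in simp)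
  have sell: "(\<lambda>n. s n * ell n) \<longlonglongrightarrow> 0"
  proof (rule tendsto_zero_sandwich[OF _ z])
    have "0 \<le> s n * ell n" for n using s1[of n] ell0[of n] by (intro mult_nonneg_nonneg) auto
    then show "\<forall>\<^sub>F n in sequentially. 0 \<le> s n * ell n \<and> s n * ell n \<le> z n" using sle by simp
  qed
  define kap where "kap n = 32 * s n * (lamU n + \<mu> n * M) / \<Lambda>" for n
  define ck where "ck = 32 * (U + M) / \<Lambda>"
  have ck: "0 \<le> ck" using U M1 \<Lambda> by (simp add: ck_def)
  have kap0: "0 \<le> kap n" for n
    unfolding kap_def lamU_def using s1[of n] ell0[of n] \<mu>0[of n] U M1 \<Lambda> by (intro divide_nonneg_pos mult_nonneg_nonneg add_nonneg_nonneg) auto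
  have kapz: "kap n \<le> ck * z n" for n
  proof -
    have "U * ell n + \<mu> n * M \<le> (U + M) * (ell n + \<mu> n)"
      using U M1 ell0[of n] \<mu>0[of n] by (simp add: algebra_simps)
    then have "32 * s n * (U * ell n + \<mu> n * M) \<le> 32 * s n * ((U + M) * (ell n + \<mu> n))"
      using s1[of n] by (intro mult_left_mono) auto
    then have "kap n \<le> 32 * s n * ((U + M) * (ell n + \<mu> n)) / \<Lambda>"
      unfolding kap_def lamU_def using \<Lambda> by (intro divide_right_mono) auto
    also have "32 * s n * ((U + M) * (ell n + \<mu> n)) / \<Lambda> = ck * z n"
      unfolding ck_def z_def by (simp only: times_divide_eq_left times_divide_eq_right mult_ac)
    finally show ?thesis .
  qed
  have ckz: "(\<lambda>n. ck * z n) \<longlonglongrightarrow> 0" using tendsto_mult[OF tendsto_const z, of ck] by simp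
  have kap: "kap \<longlonglongrightarrow> 0" by (rule tendsto_zero_sandwich[OF _ ckz]) (use kapz kap0 in simp)
  have lamU: "lamU \<longlonglongrightarrow> 0" unfolding lamU_def using tendsto_mult[OF tendsto_const ell, of U] by simp
  define eps0 where "eps0 n = \<mu> n * K2 + 2 * K2 * kap n" for n
  define eps1 where "eps1 n = 4 * lamU n / \<Lambda>\<^sup>2 * (s n * K2 / \<Lambda> + kap n) + 2 * kap n / \<Lambda> + 2 * eps0 n / \<Lambda>\<^sup>2" for n
  have eps0: "eps0 \<longlonglongrightarrow> 0"
    unfolding eps0_def using tendsto_add[OF tendsto_mult[OF \<mu> tendsto_const[of K2]] tendsto_mult[OF tendsto_const[of "2 * K2"] kap]] by simp
  have eps1: "eps1 \<longlonglongrightarrow> 0"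
  proof -
    have "(\<lambda>n. 4 * U * K2 / (\<Lambda>\<^sup>2 * \<Lambda>) * (s n * ell n) + 4 / \<Lambda>\<^sup>2 * (lamU n * kap n) + 2 / \<Lambda> * kap n + 2 / \<Lambda>\<^sup>2 * eps0 n) \<longlonglongrightarrow>
        4 * U * K2 / (\<Lambda>\<^sup>2 * \<Lambda>) * 0 + 4 / \<Lambda>\<^sup>2 * (0 * 0) + 2 / \<Lambda> * 0 + 2 / \<Lambda>\<^sup>2 * 0"
      by (intro tendsto_add tendsto_mult tendsto_const sell lamU kap eps0)
    moreover have "eps1 n = 4 * U * K2 / (\<Lambda>\<^sup>2 * \<Lambda>) * (s n * ell n) + 4 / \<Lambda>\<^sup>2 * (lamU n * kap n) + 2 / \<Lambda> * kap n + 2 / \<Lambda>\<^sup>2 * eps0 n" for n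
      using \<Lambda> by (simp add: eps1_def lamU_def field_simps)
    then have "eps1 = (\<lambda>n. 4 * U * K2 / (\<Lambda>\<^sup>2 * \<Lambda>) * (s n * ell n) + 4 / \<Lambda>\<^sup>2 * (lamU n * kap n) + 2 / \<Lambda> * kap n + 2 / \<Lambda>\<^sup>2 * eps0 n)" by (rule ext)
    ultimately show ?thesis by simp
  qed
  \<comment> \<open>From ln p \<ge> ln 2, the inverse square of the smallest penalty is at most
    \<open>k\<close> times n.\<close>
  define k where "k = 1 / (L\<^sup>2 * ln 2)"
  define kH where "kH = 8 * (K2 ^ 4 * gauss_moment 4 + (2 + 2 * k) ^ 4 * (\<Lambda> powr (- 1/4) * inv_sqrt_moment) ^ 16)"
  define kB where "kB = 8 * (k\<^sup>2 * gauss_moment 4 + 16 * C ^ 4)"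
  have kHB: "0 \<le> kH" "0 \<le> kB" by (auto simp: kH_def kB_def gauss_moment_def)
  define c1 where "c1 = K3 ^ 4 * U ^ 4 * kH * kB + 1"
  define c2 where "c2 = K3 ^ 4 * (1 + kH) + (K3\<^sup>2 / \<Lambda>)\<^sup>2 + 1"
  \<comment> \<open>A bound for the mean square of the remainder: the squared bias on the good
    event, and the contribution of the bad event.\<close>
  define \<rho> where "\<rho> n = (K3 * (2 * lamU n / \<Lambda>) * kap n)\<^sup>2 + c1 / (real n)\<^sup>2" for n
  define qb where "qb n = K3\<^sup>2 * eps1 n + c2 / (real n)\<^sup>2" for n
  have c1: "0 \<le> c1" unfolding c1_def using kHB by simp
  have \<rho>0: "0 \<le> \<rho> n" for n unfolding \<rho>_def using c1 by simp
  have n\<rho>: "(\<lambda>n. real n * \<rho> n) \<longlonglongrightarrow> 0"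
  proof -
    have "(\<lambda>n. sqrt (real n) * lamU n * kap n) \<longlonglongrightarrow> 0"
    proof (rule tendsto_zero_sandwich)
      show "\<forall>\<^sub>F n in sequentially. 0 \<le> sqrt (real n) * lamU n * kap n \<and>
          sqrt (real n) * lamU n * kap n \<le> U * ck * (sqrt (ln (real (p n))) * z n)"
        using eventually_gt_at_top[of 0]
      proof eventually_elim
        case (elim n)
        have "sqrt (real n) * lamU n = U * sqrt (ln (real (p n)))"
          using elim by (simp add: lamU_def ell_def real_sqrt_divide)
        moreover have "U * sqrt (ln (real (p n))) * kap n \<le> U * sqrt (ln (real (p n))) * (ck * z n)"
          using U p[of n] kapz by (intro mult_left_mono) auto
        ultimately show ?case using U p[of n] kap0[of n] by (simp add: mult_ac)
      qed
      show "(\<lambda>n. U * ck * (sqrt (ln (real (p n))) * z n)) \<longlonglongrightarrow> 0"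
        using tendsto_mult[OF tendsto_const lz, of "U * ck"] by simp
    qed
    from tendsto_power[OF tendsto_mult[OF tendsto_const this, of "2 * K3 / \<Lambda>"], of 2]
    have "(\<lambda>n. (2 * K3 / \<Lambda> * (sqrt (real n) * lamU n * kap n))\<^sup>2) \<longlonglongrightarrow> 0"
      by (simp only: mult_zero_right zero_power2)
    moreover have "(\<lambda>n. c1 / real n) \<longlonglongrightarrow> 0" by real_asymp
    ultimately have "(\<lambda>n. (2 * K3 / \<Lambda> * (sqrt (real n) * lamU n * kap n))\<^sup>2 + c1 / real n) \<longlonglongrightarrow> 0"
      using tendsto_add by fastforce
    moreover have "\<forall>\<^sub>F n in sequentially. (2 * K3 / \<Lambda> * (sqrt (real n) * lamU n * kap n))\<^sup>2 + c1 / real n = real n * \<rho> n"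
      using eventually_gt_at_top[of 0]
    proof eventually_elim
      case (elim n)
      have "(2 * K3 / \<Lambda> * (sqrt (real n) * lamU n * kap n))\<^sup>2 = real n * (K3 * (2 * lamU n / \<Lambda>) * kap n)\<^sup>2"
        by (simp add: power_mult_distrib power_divide)
      moreover have "c1 / real n = real n * (c1 / (real n)\<^sup>2)" using elim by (simp add: power2_eq_square)
      ultimately show ?case by (simp only: \<rho>_def distrib_left)
    qed
    ultimately show ?thesis by (rule Lim_transform_eventually)
  qed
  have qb: "qb \<longlonglongrightarrow> 0"
  proof -
    have "(\<lambda>n. c2 / (real n)\<^sup>2) \<longlonglongrightarrow> 0" by real_asymp
    from tendsto_add[OF tendsto_mult[OF tendsto_const eps1, of "K3\<^sup>2"] this] show ?thesis by (simp add: qb_def[abs_def])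
  qed
  define \<delta> where "\<delta> n = qb n + (2 * sqrt ((K3\<^sup>2 / \<Lambda> + qb n) * (real n * \<rho> n)) + real n * \<rho> n)" for n
  have \<delta>: "\<delta> \<longlonglongrightarrow> 0"
  proof -
    have "\<delta> \<longlonglongrightarrow> 0 + (2 * sqrt ((K3\<^sup>2 / \<Lambda> + 0) * 0) + 0)"
      unfolding \<delta>_def by (intro tendsto_add tendsto_mult tendsto_const tendsto_real_sqrt qb n\<rho>)
    then show ?thesis by simp
  qed
  \<comment> \<open>The exponent in the tail bound of the Gram matrix is w n / s^2.\<close>
  define w where "w = \<Lambda>\<^sup>2 / (64\<^sup>2 * 16 * K2\<^sup>2)"
  have w: "0 < w" using \<Lambda> K2 by (simp add: w_def)
  \<comment> \<open>The constants 120 and 48 are 24 times 5 and 24 times 2: n p is at most p^5 where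
    n \<le> p^4, and at most n^2 in the other regime.\<close>
  have E1: "\<forall>\<^sub>F n in sequentially. (dl n)\<^sup>2 < w * ln 2 / 120"
  proof (rule order_tendstoD(2))
    show "(\<lambda>n. (dl n)\<^sup>2) \<longlonglongrightarrow> 0" using tendsto_power[OF dl, of 2] by simp
  qed (use w in simp)
  have E2: "\<forall>\<^sub>F n in sequentially. ln (real n) / sqrt (real n) < w / 48"
    by (rule order_tendstoD(2)[of _ 0]) (real_asymp, use w in simp)
  have E3: "\<forall>\<^sub>F n in sequentially. ln (real n) / real n powr (1/4) < 1 / (64 * M\<^sup>2 * 48)"
    by (rule order_tendstoD(2)[of _ 0]) (real_asymp, use M1 in simp)
  have E4: "\<forall>\<^sub>F n in sequentially. \<mu> n < 1" by (rule order_tendstoD(2)[OF \<mu>]) simp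
  have E5: "\<forall>\<^sub>F n in sequentially. eps0 n < \<Lambda> / 2" by (rule order_tendstoD(2)[OF eps0]) (use \<Lambda> in simp)
  have "\<forall>\<^sub>F n in sequentially. \<bar>v n\<bar> \<le> K3\<^sup>2 / \<Lambda> \<and> (\<forall>\<beta> \<in> sparse_params (P n) C (d n).
      finite_var n (p n) (Sigma0 n) \<beta> (debiased_stat (xi n) (lams n) (bhat n) (ghat n)) \<and>
      \<bar>expect n (p n) (Sigma0 n) \<beta> (debiased_stat (xi n) (lams n) (bhat n) (ghat n)) - xi n \<bullet> \<beta>\<bar> \<le> sqrt (\<rho> n) \<and>
      \<bar>real n * var n (p n) (Sigma0 n) \<beta> (debiased_stat (xi n) (lams n) (bhat n) (ghat n)) - v n\<bar> \<le> \<delta> n)"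
    using U0 p2 K1(2) K2(2) K3(2) E1 E2 E3 E4 E5 eventually_ge_at_top[of 16]
  proof eventually_elim
    case (elim n)
    note tn = elim(1) and pn = elim(2) and n16 = elim(11)
    have n0: "0 < real n" using n16 by simp
    have A: "Sigma0 n \<in> carrier_mat (p n) (p n)" using Sigma0(1)[of n] by (simp add: covariance_matrix_def)
    have \<Theta>: "Theta0 n \<in> carrier_mat (p n) (p n)"
      unfolding Theta0 by (rule inverse_mat_properties[OF A Sigma0(2)])
    have me: "0 < min_eigenvalue (Sigma0 n)" by (rule min_eigenvalue_le_bform[OF Sigma0(1)[of n] Sigma0(2)[of n] p0])
    have \<Lambda>le: "\<Lambda> \<le> min_eigenvalue (Sigma0 n)"
    proof -
      have "1 / min_eigenvalue (Sigma0 n) \<le> K1" using elim(3) by (rule abs_le_D1)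
      then show ?thesis using me K1(1) by (simp add: \<Lambda>_def field_simps)
    qed
    have Kle: "max_entry (Sigma0 n) \<le> K2" using elim(4) by simp
    have lp: "0 < ln (real (p n))" "ln 2 \<le> ln (real (p n))" using pn by simp_all
    have ell2: "(ell n)\<^sup>2 = ln (real (p n)) / real n" using lp n0 by (simp add: ell_def)
    have ellpos: "0 < ell n" using lp n0 by (simp add: ell_def)
    have supp: "real (l0norm (col (inverse_mat (Sigma0 n)) j)) \<le> s n" if j: "j < p n" for j
    proof (cases "low n")
      case True
      have "card {i. i < dim_vec (col (Theta0 n) j) \<and> col (Theta0 n) j $ i \<noteq> 0} \<le> card {..<p n}"
        using \<Theta> by (intro card_mono) auto
      then show ?thesis using True by (simp add: l0norm_def s_def Theta0)
    next
      case False
      then show ?thesis using sp[OF j] by (simp add: s_def Theta0)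
    qed
    have bf: "bounded_forms (p n) (\<lambda>i j. Sigma0 n $$ (i, j)) (\<lambda>i j. inverse_mat (Sigma0 n) $$ (i, j)) K2 \<Lambda> (s n)"
      by (rule bounded_forms_of_matrix[OF Sigma0(1)[of n] Sigma0(2)[of n] p0 \<Lambda> \<Lambda>le Kle s1 supp])
    have lamb: "lam0 n \<le> lam n" "lam n \<le> lamU n" "\<And>j. j < p n \<Longrightarrow> lam0 n \<le> lams n j" "\<And>j. j < p n \<Longrightarrow> lams n j \<le> lamU n"
    proof -
      have "U0 * ell n \<le> U * ell n" using U(2) ell0[of n] by (rule mult_right_mono)
      then show "lam0 n \<le> lam n" "lam n \<le> lamU n" "\<And>j. j < p n \<Longrightarrow> lam0 n \<le> lams n j" "\<And>j. j < p n \<Longrightarrow> lams n j \<le> lamU n"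
        using tn unfolding lam0_def lamU_def ell_def by (auto intro: order_trans)
    qed
    have lam0pos: "0 < lam0 n" using L ellpos by (simp add: lam0_def)
    interpret F: desparsified "p n" "Sigma0 n" K2 \<Lambda> "s n" n "lam n" "lam0 n" "lamU n" "lams n" "bhat n" "ghat n" "xi n"
      by (intro desparsified.intro desparsified_axioms.intro bf Sigma0 n16 p0 lam0pos lamb lasso nodewise xi)
    have FM: "F.M = M" using F.M_def by (simp only: M \<Lambda>_def)
    have F\<kappa>: "F.\<kappa> (\<mu> n) = kap n" by (simp add: F.\<kappa>_def FM kap_def)
    have F\<epsilon>0: "F.\<epsilon>0 (\<mu> n) = eps0 n" by (simp add: F.\<epsilon>0_def F\<kappa> eps0_def)
    have F\<epsilon>1: "F.\<epsilon>1 (\<mu> n) = eps1 n" by (simp add: F.\<epsilon>1_def F\<kappa> F\<epsilon>0 eps1_def)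
    have FkH: "F.kH k = kH" "F.kB k C = kB" by (simp_all add: F.kH_def kH_def F.kB_def kB_def)
    have Fv: "F.v = v n"
      using scalar_prod_mult_vec_eq_bform[OF \<Theta>, of "($) (xi n)" "($) (xi n)"] xi[of n]
      by (simp add: F.v_def v vec_of_index Theta0)
    have Fx: "F.x1 \<le> K3" using elim(5) xi[of n] by (simp add: F.x1_def l1norm_def)
    have ln_np: "ln F.np = ln (real n) + ln (real (p n))"
      using n0 p0[of n] by (simp add: F.np_def ln_mult)
    have \<mu>01: "0 \<le> \<mu> n" "\<mu> n \<le> 1" using \<mu>0 elim(9) by simp_all
    have regime: "real (p n) \<le> s n \<or> 2 * (\<mu> n * F.M) \<le> lam0 n"
      by (auto simp: s_def \<mu>_def lam0_def L_def FM power2_eq_square)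
    have \<epsilon>: "F.\<epsilon>0 (\<mu> n) \<le> \<Lambda> / 2" using elim(10) by (simp add: F\<epsilon>0)
    have hi: "24 * ln F.np \<le> 120 * ln (real (p n))" if "\<not> low n"
    proof -
      have "real n \<le> real (p n) ^ 4" using that unfolding low_def by (metis nat_le_linear of_nat_le_iff of_nat_power)
      then have "ln (real n) \<le> ln (real (p n) ^ 4)" using n0 p0[of n] by (subst ln_le_cancel_iff) simp_all
      also have "\<dots> = 4 * ln (real (p n))" using p0[of n] by (simp add: ln_realpow)
      finally show ?thesis by (simp add: ln_np)
    qed
    have lo: "24 * ln F.np \<le> 48 * ln (real n)" if "low n"
      using low_facts(3)[OF that] n16 by (simp add: ln_np)
    have e1: "24 * ln F.np \<le> real n * (\<Lambda> / (64 * s n * K2))\<^sup>2 / 16"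
    proof -
      have eq: "real n * (\<Lambda> / (64 * s n * K2))\<^sup>2 / 16 = w * real n / (s n)\<^sup>2"
        by (simp add: w_def power_divide power_mult_distrib mult_ac)
      have s2: "0 < (s n)\<^sup>2" using s1[of n] by simp
      show ?thesis
      proof (cases "low n")
        case False
        have dln: "(dl n)\<^sup>2 = (d n)\<^sup>2 * (ln (real (p n)))\<^sup>2 / real n"
          by (simp add: dl_def power_divide power_mult_distrib)
        have "(d n)\<^sup>2 * (ln (real (p n)))\<^sup>2 \<le> w * ln 2 / 120 * real n"
          using elim(6) n0 unfolding dln by (simp add: pos_divide_less_eq less_imp_le)
        moreover have "(d n)\<^sup>2 * (ln (real (p n)) * ln 2) \<le> (d n)\<^sup>2 * (ln (real (p n)))\<^sup>2"
          unfolding power2_eq_square[of "ln _"] using lp by (intro mult_left_mono) auto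
        ultimately have "(d n)\<^sup>2 * (ln (real (p n)) * ln 2) \<le> w * ln 2 / 120 * real n" by (rule order_trans[rotated])
        then have "120 * ((d n)\<^sup>2 * (ln (real (p n)) * ln 2)) \<le> 120 * (w * ln 2 / 120 * real n)" by (rule mult_left_mono) simp
        also have "120 * (w * ln 2 / 120 * real n) = (w * real n) * ln 2" by simp
        finally have "(120 * ln (real (p n)) * (d n)\<^sup>2) * ln 2 \<le> (w * real n) * ln 2" by (simp only: mult_ac)
        then have "120 * ln (real (p n)) * (d n)\<^sup>2 \<le> w * real n" by (rule mult_right_le_imp_le) simp
        then have "120 * ln (real (p n)) \<le> w * real n / (s n)\<^sup>2"
          using False s2 by (simp add: s_def pos_le_divide_eq)
        then show ?thesis using hi[OF False] unfolding eq by linarith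
      next
        case True
        have "48 * ln (real n) \<le> w * sqrt (real n)"
          using elim(7) n0 by (simp add: pos_divide_less_eq less_imp_le)
        also have "\<dots> = w * real n / sqrt (real n)" using n0 by (simp add: real_div_sqrt flip: times_divide_eq_right)
        also have "\<dots> \<le> w * real n / (s n)\<^sup>2"
          using True low_facts(2)[OF True] n16 w s2 by (intro divide_left_mono) (auto simp: s_def)
        finally show ?thesis using lo[OF True] unfolding eq by linarith
      qed
    qed
    have e2: "24 * ln F.np \<le> real n * (\<mu> n / (2 * F.M))\<^sup>2 / 16"
    proof -
      have eq: "real n * (\<mu> n / (2 * F.M))\<^sup>2 / 16 = real n * (\<mu> n)\<^sup>2 / (64 * M\<^sup>2)"
        by (simp add: FM power_divide power_mult_distrib)
      show ?thesis
      proof (cases "low n")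
        case False
        \<comment> \<open>8100 = 90^2, and 8100 / 64 exceeds the 120 required by
          \<open>hi\<close>.\<close>
        have "real n * (\<mu> n)\<^sup>2 / (64 * M\<^sup>2) = 8100 / 64 * ln (real (p n))"
          using False ell2 n0 M1 by (simp add: \<mu>_def power_mult_distrib)
        then show ?thesis using hi[OF False] lp unfolding eq by simp
      next
        case True
        have "(real n powr (- 3/8))\<^sup>2 = real n powr (- 3/4)" using n0 by (simp add: powr_power)
        then have "real n * (\<mu> n)\<^sup>2 = real n powr 1 * real n powr (- 3/4)" using True n0 by (simp only: \<mu>_def if_True powr_one)
        also have "\<dots> = real n powr (1 + - 3/4)" by (rule powr_add[symmetric])
        also have "\<dots> = real n powr (1/4)" by simp
        finally have "real n * (\<mu> n)\<^sup>2 = real n powr (1/4)" .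
        moreover have "48 * ln (real n) \<le> real n powr (1/4) / (64 * M\<^sup>2)"
          using elim(8) n0 M1 by (simp add: field_simps)
        ultimately show ?thesis using lo[OF True] unfolding eq by simp
      qed
    qed
    have kn: "1 / (lam0 n)\<^sup>2 \<le> k * real n"
    proof -
      have "(lam0 n)\<^sup>2 = L\<^sup>2 * ln (real (p n)) / real n" by (simp add: lam0_def power_mult_distrib ell2)
      then have "1 / (lam0 n)\<^sup>2 = real n / (L\<^sup>2 * ln (real (p n)))" by simp
      also have "\<dots> \<le> real n / (L\<^sup>2 * ln 2)" using lp L by (intro divide_left_mono mult_left_mono mult_pos_pos) auto
      finally show ?thesis by (simp add: k_def)
    qed
    have Un: "(lamU n)\<^sup>2 \<le> U\<^sup>2 * F.np"
    proof -
      have "ln (real (p n)) / real n \<le> ln (real (p n)) / 1" using lp n16 by (intro divide_left_mono) auto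
      also have "\<dots> \<le> real (p n)" using ln_le_minus_one[of "real (p n)"] p0[of n] by simp
      also have "\<dots> \<le> F.np" by (rule F.np_ge)
      finally have "(ell n)\<^sup>2 \<le> F.np" by (simp add: ell2)
      then show ?thesis by (simp add: lamU_def power_mult_distrib mult_left_mono)
    qed
    have rr: "(K3 * (2 * lamU n / \<Lambda>) * F.\<kappa> (\<mu> n))\<^sup>2 + (K3 ^ 4 * U ^ 4 * F.kH k * F.kB k C + 1) / (real n)\<^sup>2 \<le> \<rho> n"
      by (simp add: \<rho>_def F\<kappa> FkH c1_def)
    have qq: "K3\<^sup>2 * F.\<epsilon>1 (\<mu> n) + (K3 ^ 4 * (1 + F.kH k) + (K3\<^sup>2 / \<Lambda>)\<^sup>2 + 1) / (real n)\<^sup>2 \<le> qb n"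
      by (simp add: qb_def F\<epsilon>1 FkH c2_def)
    have vb: "\<bar>v n\<bar> \<le> K3\<^sup>2 / \<Lambda>" using F.v_le[OF Fx] F.v_nonneg by (simp add: Fv)
    show ?case
    proof (intro conjI ballI vb)
      fix \<beta> assume "\<beta> \<in> sparse_params (P n) C (d n)"
      then have \<beta>: "\<beta> \<in> carrier_vec (p n)" "real (l0norm \<beta>) \<le> d n" "l2norm \<beta> \<le> C"
        using P[of n] by (auto simp: sparse_params_def)
      have sp\<beta>: "real (p n) \<le> s n \<or> real (l0norm \<beta>) \<le> s n" using \<beta>(2) by (simp add: s_def)
      note mv = F.mean_variance_bounds_explicit[OF \<mu>01 regime \<epsilon> e1 e2 kn Fx Un \<beta>(1) sp\<beta> l1_le_of_l2norm_le[OF \<beta>(1,3)] rr qq]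
      show "finite_var n (p n) (Sigma0 n) \<beta> F.stat" by (rule mv(1))
      show "\<bar>expect n (p n) (Sigma0 n) \<beta> F.stat - xi n \<bullet> \<beta>\<bar> \<le> sqrt (\<rho> n)" by (rule mv(2))
      show "\<bar>real n * var n (p n) (Sigma0 n) \<beta> F.stat - v n\<bar> \<le> \<delta> n"
        unfolding \<delta>_def Fv[symmetric] by (rule mv(3))
    qed
  qed
  then show ?thesis using \<rho>0 n\<rho> \<delta> unfolding \<Lambda>_def by blast
qed

text \<open>The bias bound is uniform over the sparse parameters, hence over the neighbourhoods of
  every radius, so a rate can be extracted from \<open>\<rho>\<close> alone.\<close>

lemma debiased_strongly_unbiased:
  fixes C c :: real and Sigma0 Theta0 :: "nat \<Rightarrow> real mat" and beta0 xi :: "nat \<Rightarrow> real vec"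
  assumes \<rho>: "\<And>n. 0 \<le> \<rho> n" "(\<lambda>n. real n * \<rho> n) \<longlonglongrightarrow> 0" and \<delta>: "\<delta> \<longlonglongrightarrow> 0"
    and beta0: "\<And>n. beta0 n \<in> sparse_params (P n) C (d n)"
    and est: "\<And>n. estimator n (p n) (T n)"
    and ev: "\<forall>\<^sub>F n in sequentially. \<bar>v n\<bar> \<le> K \<and> (\<forall>\<beta> \<in> sparse_params (P n) C (d n).
      finite_var n (p n) (Sigma0 n) \<beta> (T n) \<and> \<bar>expect n (p n) (Sigma0 n) \<beta> (T n) - xi n \<bullet> \<beta>\<bar> \<le> sqrt (\<rho> n) \<and>
      \<bar>real n * var n (p n) (Sigma0 n) \<beta> (T n) - v n\<bar> \<le> \<delta> n)"
  shows "(\<exists>m. strongly_unbiased_rate C c p Sigma0 P d beta0 (\<lambda>n b. xi n \<bullet> b) m T) \<and>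
    (\<exists>r. r \<longlonglongrightarrow> 0 \<and> (\<forall>\<^sub>F n in sequentially. var n (p n) (Sigma0 n) (beta0 n) (T n) = (v n + r n) / real n))"
proof
  define V where "V n = var n (p n) (Sigma0 n) (beta0 n) (T n)" for n
  have V: "\<forall>\<^sub>F n in sequentially. \<bar>real n * V n - v n\<bar> \<le> \<delta> n \<and> \<bar>v n\<bar> \<le> K"
    using ev by eventually_elim (use beta0 in \<open>auto simp: V_def\<close>)
  obtain m where m: "\<And>n. 0 < m n" "(\<lambda>n. real n) \<in> o(m)" "(\<lambda>n. sqrt (m n) * sqrt (\<rho> n)) \<longlonglongrightarrow> 0"
    using rate_exists[OF \<rho>] by blast
  have "V \<in> O(\<lambda>n. 1 / real n)"
  proof (rule bigoI[of _ "K + 1"])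
    show "\<forall>\<^sub>F n in sequentially. norm (V n) \<le> (K + 1) * norm (1 / real n)"
      using V eventually_gt_at_top[of 0] order_tendstoD(2)[OF \<delta>, of 1, simplified]
    proof eventually_elim
      case (elim n)
      then have "\<bar>real n * V n\<bar> \<le> K + 1" by linarith
      then show ?case using elim(2) by (simp add: abs_mult pos_le_divide_eq mult.commute)
    qed
  qed
  moreover have "(\<forall>\<^sub>F n in sequentially. finite_mean n (p n) (Sigma0 n) (b n) (T n)) \<and>
      (\<lambda>n. sqrt (m n) * (expect n (p n) (Sigma0 n) (b n) (T n) - xi n \<bullet> b n)) \<longlonglongrightarrow> 0"
    if b: "\<forall>n. b n \<in> nbhd (P n) C (d n) (beta0 n) (c / sqrt (m n))" for b
  proof
    have b': "b n \<in> sparse_params (P n) C (d n)" for n using b by (simp add: nbhd_def)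
    show "\<forall>\<^sub>F n in sequentially. finite_mean n (p n) (Sigma0 n) (b n) (T n)"
      using ev by eventually_elim (use b' in \<open>auto simp: finite_var_def\<close>)
    have "\<forall>\<^sub>F n in sequentially. norm (sqrt (m n) * (expect n (p n) (Sigma0 n) (b n) (T n) - xi n \<bullet> b n)) \<le> sqrt (m n) * sqrt (\<rho> n)"
      using ev
    proof eventually_elim
      case (elim n)
      then have "\<bar>expect n (p n) (Sigma0 n) (b n) (T n) - xi n \<bullet> b n\<bar> \<le> sqrt (\<rho> n)" using b' by blast
      then show ?case using m(1)[of n] by (simp add: abs_mult mult_left_mono)
    qed
    then show "(\<lambda>n. sqrt (m n) * (expect n (p n) (Sigma0 n) (b n) (T n) - xi n \<bullet> b n)) \<longlonglongrightarrow> 0"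
      using m(3) by (rule Lim_null_comparison)
  qed
  moreover have "\<forall>\<^sub>F n in sequentially. finite_var n (p n) (Sigma0 n) (beta0 n) (T n)"
    using ev by eventually_elim (use beta0 in auto)
  ultimately have "strongly_unbiased_rate C c p Sigma0 P d beta0 (\<lambda>n b. xi n \<bullet> b) m T"
    unfolding strongly_unbiased_rate_def V_def[abs_def] using m(1,2) est by blast
  then show "\<exists>m. strongly_unbiased_rate C c p Sigma0 P d beta0 (\<lambda>n b. xi n \<bullet> b) m T" by (rule exI[of _ m])
  show "\<exists>r. r \<longlonglongrightarrow> 0 \<and> (\<forall>\<^sub>F n in sequentially. var n (p n) (Sigma0 n) (beta0 n) (T n) = (v n + r n) / real n)"
  proof (intro exI[of _ "\<lambda>n. real n * V n - v n"] conjI)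
    show "(\<lambda>n. real n * V n - v n) \<longlonglongrightarrow> 0"
      by (rule Lim_null_comparison[OF _ \<delta>]) (use V in \<open>auto elim: eventually_mono\<close>)
    show "\<forall>\<^sub>F n in sequentially. var n (p n) (Sigma0 n) (beta0 n) (T n) = (v n + (real n * V n - v n)) / real n"
      using eventually_gt_at_top[of 0] by eventually_elim (simp add: V_def)
  qed
qed

text \<open>\<open>L\<close> is fixed before the tuning parameters and is chosen from bounds on the
  covariance alone; where sparsity is used, it lets the penalties dominate the noise outside an
  event that is negligible for mean and variance. \<open>dir n r\<close> is the least favourable
  alternative at scale 1 / sqrt r, and the variance bound is derived at r = m, where
  \<open>T\<close> is known to be unbiased to sufficient order.\<close>

theorem theorem3:
  fixes C c :: real
    and p :: "nat \<Rightarrow> nat"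
    and Sigma0 Theta0 :: "nat \<Rightarrow> real mat"
    and P :: "nat \<Rightarrow> real vec set"
    and d :: "nat \<Rightarrow> real"
    and beta0 xi :: "nat \<Rightarrow> real vec"
    and v :: "nat \<Rightarrow> real"
    and dir :: "nat \<Rightarrow> real \<Rightarrow> real vec"
  assumes C: "0 < C" and c: "0 < c"
    and p: "\<And>n. 1 \<le> p n"
    and P: "\<And>n. P n \<subseteq> carrier_vec (p n)"
    and Sigma0: "\<And>n. covariance_matrix (p n) (Sigma0 n)" "\<And>n. invertible_mat (Sigma0 n)"
    and Theta0: "\<And>n. Theta0 n = inverse_mat (Sigma0 n)"
    and eig: "(\<lambda>n. 1 / min_eigenvalue (Sigma0 n)) \<in> O(\<lambda>_. 1)"
    and entries: "(\<lambda>n. max_entry (Sigma0 n)) \<in> O(\<lambda>_. 1)"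
    and beta0: "\<And>n. beta0 n \<in> sparse_params (P n) C (d n)"
    and d: "d \<in> o(\<lambda>n. sqrt (real n) / ln (real (p n)))"
    and s: "\<And>n j. j < p n \<Longrightarrow> real (l0norm (col (Theta0 n) j)) \<le> d n"
    and xi: "\<And>n. xi n \<in> carrier_vec (p n)" "(\<lambda>n. l1norm (xi n)) \<in> O(\<lambda>_. 1)"
    and v: "\<And>n. v n = xi n \<bullet> (Theta0 n *\<^sub>v xi n)"
    and dir: "\<And>n r. dir n r = beta0 n + (1 / sqrt (v n * r)) \<cdot>\<^sub>v (Theta0 n *\<^sub>v xi n)"
  shows
    "(\<exists>L>0. \<forall>lam lams bhat ghat.
        tuning_order L p lam lams \<longrightarrow>
        (\<forall>n. lasso_version n (p n) (lam n) (bhat n)) \<longrightarrow>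
        (\<forall>n. nodewise_version n (p n) (lams n) (ghat n)) \<longrightarrow>
        (\<exists>m. strongly_unbiased_rate C c p Sigma0 P d beta0 (\<lambda>n b. xi n \<bullet> b) m
               (\<lambda>n. debiased_stat (xi n) (lams n) (bhat n) (ghat n))) \<and>
        (\<exists>r. r \<longlonglongrightarrow> 0 \<and> (\<forall>\<^sub>F n in sequentially.
               var n (p n) (Sigma0 n) (beta0 n) (debiased_stat (xi n) (lams n) (bhat n) (ghat n))
                 = (v n + r n) / real n)))
     \<and>
     (\<forall>T m.
        strongly_unbiased_rate C c p Sigma0 P d beta0 (\<lambda>n b. xi n \<bullet> b) m T \<longrightarrow>
        (\<forall>n. dir n (real n) \<in> nbhd (P n) C (d n) (beta0 n) (c / sqrt (real n))) \<longrightarrow>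
        (\<forall>\<^sub>F n in sequentially. dir n (m n) \<in> nbhd (P n) C (d n) (beta0 n) (c / sqrt (m n))) \<longrightarrow>
        (\<exists>r. r \<longlonglongrightarrow> 0 \<and> (\<forall>\<^sub>F n in sequentially.
               (v n + r n) / real n \<le> var n (p n) (Sigma0 n) (beta0 n) (T n))))"
proof -
  obtain K1 where K1: "0 < K1" "\<forall>\<^sub>F n in sequentially. \<bar>1 / min_eigenvalue (Sigma0 n)\<bar> \<le> K1"
    using bigo_one_bound[OF eig] by blast
  obtain K2 where K2: "0 < K2" "\<forall>\<^sub>F n in sequentially. \<bar>max_entry (Sigma0 n)\<bar> \<le> K2"
    using bigo_one_bound[OF entries] by blast
  obtain K3 where K3: "0 < K3" "\<forall>\<^sub>F n in sequentially. \<bar>l1norm (xi n)\<bar> \<le> K3"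
    using bigo_one_bound[OF xi(2)] by blast
  \<comment> \<open>Written as 1 / \<Lambda> with \<Lambda> = 1 / K1, so that it agrees with the
    constant \<open>M\<close> of the locale at each sample size.\<close>
  define M where "M = K2 + 1 / (1 / K1) + 1"
  have L: "0 < 180 * M\<^sup>2" using K1(1) K2(1) by (simp add: M_def add_pos_pos)
  show ?thesis
  proof (intro conjI exI[of _ "180 * M\<^sup>2"] L allI impI)
    fix lam lams bhat ghat
    assume tune: "tuning_order (180 * M\<^sup>2) p lam lams"
      and lasso: "\<forall>n. lasso_version n (p n) (lam n) (bhat n)"
      and nodewise: "\<forall>n. nodewise_version n (p n) (lams n) (ghat n)"
    let ?T = "\<lambda>n. debiased_stat (xi n) (lams n) (bhat n) (ghat n)"
    obtain \<rho> \<delta> where rd: "\<forall>n. 0 \<le> \<rho> n" "(\<lambda>n. real n * \<rho> n) \<longlonglongrightarrow> 0" "\<delta> \<longlonglongrightarrow> 0"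
      "\<forall>\<^sub>F n in sequentially. \<bar>v n\<bar> \<le> K3\<^sup>2 / (1 / K1) \<and> (\<forall>\<beta> \<in> sparse_params (P n) C (d n).
        finite_var n (p n) (Sigma0 n) \<beta> (?T n) \<and> \<bar>expect n (p n) (Sigma0 n) \<beta> (?T n) - xi n \<bullet> \<beta>\<bar> \<le> sqrt (\<rho> n) \<and>
        \<bar>real n * var n (p n) (Sigma0 n) \<beta> (?T n) - v n\<bar> \<le> \<delta> n)"
      using debiased_bounds[where P = P and C = C, OF p P Sigma0 Theta0 d s xi(1) v K1 K2 K3 M_def tune lasso[rule_format] nodewise[rule_format]]
      by blast
    have est: "estimator n (p n) (?T n)" for n
      using lasso nodewise xi(1) by (intro estimator_debiased_stat) auto
    note r = debiased_strongly_unbiased[OF rd(1)[rule_format] rd(2,3) beta0 est rd(4), of c]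
    show "\<exists>m. strongly_unbiased_rate C c p Sigma0 P d beta0 (\<lambda>n b. xi n \<bullet> b) m ?T" by (rule conjunct1[OF r])
    show "\<exists>r. r \<longlonglongrightarrow> 0 \<and> (\<forall>\<^sub>F n in sequentially. var n (p n) (Sigma0 n) (beta0 n) (?T n) = (v n + r n) / real n)"
      by (rule conjunct2[OF r])
  next
    fix T m
    assume "strongly_unbiased_rate C c p Sigma0 P d beta0 (\<lambda>n b. xi n \<bullet> b) m T"
      and "\<forall>\<^sub>F n in sequentially. dir n (m n) \<in> nbhd (P n) C (d n) (beta0 n) (c / sqrt (m n))"
    then show "\<exists>r. r \<longlonglongrightarrow> 0 \<and> (\<forall>\<^sub>F n in sequentially. (v n + r n) / real n \<le> var n (p n) (Sigma0 n) (beta0 n) (T n))"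
      by (rule variance_lower_bound[OF c p P Sigma0 Theta0 eig beta0 xi v dir])
  qed
qed

end
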